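(* Let $\mathcal{V}$ be a variety generated by a two-element algebra $\mathbf{A}$ with universe $\{0,1\}$. Suppose $\mathcal{V}$ is not term-equivalent to any of $\mathcal{J},\mathcal{J}_0,\mathcal{J}_1,\mathcal{J}_{01}$. Then, either - $\mathsf{s}$, $\mathsf{n}$ or $\mathsf{m}$ is a term-operation of $\mathbf{A}$, and $\mathsf{CRT}|_{\mathcal{V}}$ is in $\mathrm{P}$; or - $\mathcal{V}$ is interpretable in $\mathcal{U}$, and $\mathsf{CRT}|_{\mathcal{V}}$ is $\mathrm{coNP}$-complete.
   Context: Problem: the join $\theta\vee\delta$ of two congruences of an algebra is the transitive closure of $\theta\cup\delta$. A tuple $\langle\theta_1,\ldots,\theta_k\rangle$ of congruences of $\mathbf{B}$ is a Chinese Remainder tuple (CR tuple) of $\mathbf{B}$ if for all $b_1,\ldots,b_k\in B$ with $\langle b_i,b_j\rangle\in\theta_i\vee\theta_j$ for all $i,j$ there is $b\in B$ with $\langle b,b_i\rangle\in\theta_i$ for all $i$. $\mathsf{CRT}$: given a finite algebra $\mathbf{B}$ and congruences $\theta_1,\ldots,\theta_k$ of $\mathbf{B}$, decide whether $\langle\theta_1,\ldots,\theta_k\rangle$ is a CR tuple of $\mathbf{B}$. $\mathsf{CRT}|_{\mathcal{V}}$ is its restriction to instances with $\mathbf{B}\in\mathcal{V}$. A fixed reasonable encoding of finite algebras and congruences as strings over a finite alphabet is assumed; completeness is with respect to polynomial-time many-one (Karp) reductions. Operations and varieties: on $2:=\{0,1\}$, with $\neg,\wedge,\vee,+$ the usual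 operations ($+$ is addition modulo 2), put $\mathsf{s}(x,y,z):=x+y+z$, $\mathsf{n}(x,y,z):=(x\wedge y)\vee z$, $\mathsf{m}(x,y,z):=(x\wedge y)\vee(x\wedge z)\vee(y\wedge z)$. $V(\mathbf{B})$ is the variety generated by $\mathbf{B}$. $\mathcal{U}:=V(\langle 2,\neg,0,1\rangle)$, $\mathcal{J}:=V(\langle 2,\vee\rangle)$, $\mathcal{J}_0:=V(\langle 2,\vee,0\rangle)$, $\mathcal{J}_1:=V(\langle 2,\vee,1\rangle)$, $\mathcal{J}_{01}:=V(\langle 2,\vee,0,1\rangle)$. A term-operation of an algebra is the interpretation in it of a term of its language. Interpretations: let $\mathcal{V},\mathcal{V}'$ be varieties in languages $L,L'$. An interpretation of $\mathcal{V}$ in $\mathcal{V}'$ is a map $T$ from $L$ into $L'$-terms such that: if $c\in L$ is a constant symbol, $T(c)$ is a unary $L'$-term with $\mathcal{V}'\vDash T(c)(x)\approx T(c)(y)$; if $f\in L$ is a function symbol of arity $n>0$, $T(f)$ is an $n$-ary $L'$-term; and for every $\mathbf{B}\in\mathcal{V}'$ the algebra $\mathbf{B}^T:=\langle B,T(s)^{\mathbf{B}}\rangle_{s\in L}$ is in $\mathcal{V}$ (for a constant $c\in L$, $T(c)^{\mathbf{B}}$ is taken as the nullary operation given by the value of $T(c)$ in $\mathbf{B}$). $\mathcal{V}$ is interpretable in $\mathcal{V}'$ if such a $T$ exists. $\mathcal{V}$ and $\mathcal{V}'$ are term-equivalent if there are interpretations $T$ of $\mathcal{V}$ in $\mathcal{V}'$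 and $S$ of $\mathcal{V}'$ in $\mathcal{V}$ such that $(\mathbf{B}^T)^S=\mathbf{B}$ for all $\mathbf{B}\in\mathcal{V}'$ and $(\mathbf{B}^S)^T=\mathbf{B}$ for all $\mathbf{B}\in\mathcal{V}$.
   Formalization: In the first alternative, the dual of n, (x∨y)∧z, is also allowed as a term-operation of A beside s, n, m; without it the claim fails for A = ⟨2, x∧(y∨z)⟩, which is not term-equivalent to any excluded variety and satisfies neither alternative. *)

theory Defs
  imports Complex_Main "HOL-Library.Infinite_Typeclass" "HOL-Computational_Algebra.Polynomial"
begin

text \<open>A finite language is given by the list of the arities of its symbols; the symbols are the
  positions of that list, and the constant symbols are the positions of arity 0.
  An operation takes the list of its arguments; only its values at lists of the right length
  with entries in the universe matter.\<close>

type_synonym language = "nat list"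

record 'a algebra =
  univ :: "'a set"
  oper :: "nat \<Rightarrow> 'a list \<Rightarrow> 'a"

definition is_algebra :: "language \<Rightarrow> 'a algebra \<Rightarrow> bool" where
  "is_algebra L B \<longleftrightarrow> univ B \<noteq> {} \<and>
     (\<forall>f < length L. \<forall>xs. length xs = L ! f \<and> set xs \<subseteq> univ B \<longrightarrow> oper B f xs \<in> univ B)"

text \<open>Equality of algebras in the language \<open>L\<close>, ignoring irrelevant values of \<open>oper\<close>.\<close>

definition alg_eq :: "language \<Rightarrow> 'a algebra \<Rightarrow> 'a algebra \<Rightarrow> bool" where
  "alg_eq L B C \<longleftrightarrow> univ B = univ C \<and>
     (\<forall>f < length L. \<forall>xs. length xs = L ! f \<and> set xs \<subseteq> univ B \<longrightarrow> oper B f xs = oper C f xs)"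

definition is_congruence :: "language \<Rightarrow> 'a algebra \<Rightarrow> ('a \<times> 'a) set \<Rightarrow> bool" where
  "is_congruence L B \<theta> \<longleftrightarrow> equiv (univ B) \<theta> \<and>
     (\<forall>f < length L. \<forall>xs ys. length xs = L ! f \<and> list_all2 (\<lambda>x y. (x, y) \<in> \<theta>) xs ys
        \<longrightarrow> (oper B f xs, oper B f ys) \<in> \<theta>)"

datatype trm = Var nat | Fn nat "trm list"

text \<open>\<open>is_term L n t\<close>: \<open>t\<close> is a term of the language \<open>L\<close> in the variables \<open>0, \<dots>, n - 1\<close>.\<close>

fun is_term :: "language \<Rightarrow> nat \<Rightarrow> trm \<Rightarrow> bool" where
  "is_term L n (Var v) \<longleftrightarrow> v < n"
| "is_term L n (Fn f ts) \<longleftrightarrow> f < length L \<and> length ts = L ! f \<and> (\<forall>t \<in> set ts. is_term L n t)"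

fun eval_term :: "'a algebra \<Rightarrow> (nat \<Rightarrow> 'a) \<Rightarrow> trm \<Rightarrow> 'a" where
  "eval_term B \<rho> (Var v) = \<rho> v"
| "eval_term B \<rho> (Fn f ts) = oper B f (map (eval_term B \<rho>) ts)"

definition is_term_operation :: "language \<Rightarrow> 'a algebra \<Rightarrow> nat \<Rightarrow> ('a list \<Rightarrow> 'a) \<Rightarrow> bool" where
  "is_term_operation L B n g \<longleftrightarrow> (\<exists>t. is_term L n t \<and>
     (\<forall>xs. length xs = n \<and> set xs \<subseteq> univ B \<longrightarrow> eval_term B (\<lambda>i. xs ! i) t = g xs))"

definition satisfies :: "'a algebra \<Rightarrow> trm \<Rightarrow> trm \<Rightarrow> bool" where
  "satisfies B s t \<longleftrightarrow> (\<forall>\<rho>. range \<rho> \<subseteq> univ B \<longrightarrow> eval_term B \<rho> s = eval_term B \<rho> t)"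

definition identities :: "language \<Rightarrow> (trm \<times> trm) set" where
  "identities L = {(s, t). \<exists>n. is_term L n s \<and> is_term L n t}"

definition models :: "language \<Rightarrow> (trm \<times> trm) set \<Rightarrow> 'a algebra set" where
  "models L E = {B. is_algebra L B \<and> (\<forall>(s, t) \<in> E. satisfies B s t)}"

text \<open>A variety is the class of models of a set of identities, and the variety generated by \<open>A\<close>
  is the least one containing \<open>A\<close>. A class of algebras is cut down to the algebras whose universe
  is a subset of a type \<open>'b\<close>, which may differ from the type of the elements of \<open>A\<close>.\<close>

definition generated_variety :: "language \<Rightarrow> 'a algebra \<Rightarrow> 'b algebra set" where
  "generated_variety L A = \<Inter> {models L E | E. E \<subseteq> identities L \<and> A \<in> models L E}"

text \<open>The algebra \<open>B\<^sup>T\<close>. A constant symbol is sent to a unary term that takes a single value, so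
  the element at which that term is evaluated is irrelevant.\<close>

definition interpreted :: "language \<Rightarrow> (nat \<Rightarrow> trm) \<Rightarrow> 'a algebra \<Rightarrow> 'a algebra" where
  "interpreted L T B = \<lparr>univ = univ B,
     oper = (\<lambda>f xs. if L ! f = 0 then eval_term B (\<lambda>_. SOME x. x \<in> univ B) (T f)
                    else eval_term B (\<lambda>i. xs ! i) (T f))\<rparr>"

definition is_interpretation ::
  "language \<Rightarrow> 'u algebra set \<Rightarrow> language \<Rightarrow> 'u algebra set \<Rightarrow> (nat \<Rightarrow> trm) \<Rightarrow> bool" where
  "is_interpretation L V L' V' T \<longleftrightarrow>
     (\<forall>f < length L.
        if L ! f = 0
        then is_term L' 1 (T f) \<and>
          (\<forall>B \<in> V'. \<forall>x \<in> univ B. \<forall>y \<in> univ B.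
             eval_term B (\<lambda>_. x) (T f) = eval_term B (\<lambda>_. y) (T f))
        else is_term L' (L ! f) (T f)) \<and>
     (\<forall>B \<in> V'. interpreted L T B \<in> V)"

definition interpretable ::
  "language \<Rightarrow> 'u algebra set \<Rightarrow> language \<Rightarrow> 'u algebra set \<Rightarrow> bool" where
  "interpretable L V L' V' \<longleftrightarrow> (\<exists>T. is_interpretation L V L' V' T)"

definition term_equivalent ::
  "language \<Rightarrow> 'u algebra set \<Rightarrow> language \<Rightarrow> 'u algebra set \<Rightarrow> bool" where
  "term_equivalent L V L' V' \<longleftrightarrow> (\<exists>T S.
     is_interpretation L V L' V' T \<and> is_interpretation L' V' L V S \<and>
     (\<forall>B \<in> V'. alg_eq L' (interpreted L' S (interpreted L T B)) B) \<and>
     (\<forall>B \<in> V. alg_eq L (interpreted L T (interpreted L' S B)) B))"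

text \<open>\<open>False\<close> and \<open>True\<close> play the roles of 0 and 1.\<close>

definition alg2 :: "(bool list \<Rightarrow> bool) list \<Rightarrow> bool algebra" where
  "alg2 fs = \<lparr>univ = UNIV, oper = (\<lambda>f. fs ! f)\<rparr>"

abbreviation op_neg :: "bool list \<Rightarrow> bool" where "op_neg \<equiv> \<lambda>xs. \<not> xs ! 0"
abbreviation op_join :: "bool list \<Rightarrow> bool" where "op_join \<equiv> \<lambda>xs. xs ! 0 \<or> xs ! 1"
abbreviation op_zero :: "bool list \<Rightarrow> bool" where "op_zero \<equiv> \<lambda>xs. False"
abbreviation op_one :: "bool list \<Rightarrow> bool" where "op_one \<equiv> \<lambda>xs. True"

definition op_s :: "bool list \<Rightarrow> bool" where
  "op_s xs \<longleftrightarrow> ((xs ! 0 \<noteq> xs ! 1) \<noteq> xs ! 2)"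

definition op_n :: "bool list \<Rightarrow> bool" where
  "op_n xs \<longleftrightarrow> (xs ! 0 \<and> xs ! 1) \<or> xs ! 2"

definition op_m :: "bool list \<Rightarrow> bool" where
  "op_m xs \<longleftrightarrow> (xs ! 0 \<and> xs ! 1) \<or> (xs ! 0 \<and> xs ! 2) \<or> (xs ! 1 \<and> xs ! 2)"

text \<open>The image of an operation under the exchange of 0 and 1. Both \<open>op_s\<close> and \<open>op_m\<close> are their
  own duals; the dual of \<open>op_n\<close> is \<open>(x \<or> y) \<and> z\<close>. The algebras with the single operation \<open>op_n\<close>,
  respectively its dual, are isomorphic and so generate the same variety, although neither
  operation is a term-operation of the other algebra. Hence a condition on the two-element
  generator of a variety that is meant up to isomorphism has to mention the dual.\<close>

definition dual_op :: "(bool list \<Rightarrow> bool) \<Rightarrow> bool list \<Rightarrow> bool" where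
  "dual_op g xs \<longleftrightarrow> \<not> g (map Not xs)"

abbreviation (input) lang_U :: language where "lang_U \<equiv> [1, 0, 0]"
abbreviation (input) lang_J :: language where "lang_J \<equiv> [2]"
abbreviation (input) lang_J0 :: language where "lang_J0 \<equiv> [2, 0]"
abbreviation (input) lang_J1 :: language where "lang_J1 \<equiv> [2, 0]"
abbreviation (input) lang_J01 :: language where "lang_J01 \<equiv> [2, 0, 0]"

definition var_U :: "'u algebra set" where
  "var_U = generated_variety lang_U (alg2 [op_neg, op_zero, op_one])"
definition var_J :: "'u algebra set" where
  "var_J = generated_variety lang_J (alg2 [op_join])"
definition var_J0 :: "'u algebra set" where
  "var_J0 = generated_variety lang_J0 (alg2 [op_join, op_zero])"
definition var_J1 :: "'u algebra set" where
  "var_J1 = generated_variety lang_J1 (alg2 [op_join, op_one])"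
definition var_J01 :: "'u algebra set" where
  "var_J01 = generated_variety lang_J01 (alg2 [op_join, op_zero, op_one])"

text \<open>Deterministic multi-tape Turing machines with two-way infinite tapes. The tape symbols are
  \<open>0, \<dots>, symbols - 1\<close>: 0 is the blank, 1 and 2 stand for the bits. The machine starts in state 0
  and halts in state \<open>states\<close>. In a state \<open>q < states\<close>, reading the list \<open>ss\<close> of scanned symbols
  (one for each tape), \<open>delta q ss\<close> gives the next state and, for each tape, the symbol to be
  written and the displacement of the head.\<close>

record tm =
  tapes :: nat
  symbols :: nat
  states :: nat
  delta :: "nat \<Rightarrow> nat list \<Rightarrow> nat \<times> (nat \<times> int) list"

definition wf_tm :: "tm \<Rightarrow> bool" where
  "wf_tm M \<longleftrightarrow> tapes M \<ge> 1 \<and> symbols M \<ge> 3 \<and>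
     (\<forall>q < states M. \<forall>ss. length ss = tapes M \<and> set ss \<subseteq> {..<symbols M} \<longrightarrow>
        fst (delta M q ss) \<le> states M \<and>
        length (snd (delta M q ss)) = tapes M \<and>
        set (snd (delta M q ss)) \<subseteq> {..<symbols M} \<times> {-1, 0, 1})"

text \<open>A tape is its contents together with the position of the head.\<close>

type_synonym tape = "(int \<Rightarrow> nat) \<times> int"
type_synonym config = "nat \<times> tape list"

fun act :: "nat \<times> int \<Rightarrow> tape \<Rightarrow> tape" where
  "act (a, d) (c, h) = (c(h := a), h + d)"

fun step :: "tm \<Rightarrow> config \<Rightarrow> config" where
  "step M (q, ts) =
     (if q < states M
      then let (q', as) = delta M q (map (\<lambda>(c, h). c h) ts) in (q', map2 act as ts)
      else (q, ts))"

type_synonym bits = "bool list"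

definition bit_symbol :: "bool \<Rightarrow> nat" where
  "bit_symbol b = (if b then 2 else 1)"

definition input_tape :: "bits \<Rightarrow> int \<Rightarrow> nat" where
  "input_tape w i = (if 0 \<le> i \<and> i < int (length w) then bit_symbol (w ! nat i) else 0)"

definition initial :: "tm \<Rightarrow> bits \<Rightarrow> config" where
  "initial M w = (0, (input_tape w, 0) # replicate (tapes M - 1) (\<lambda>_. 0, 0))"

text \<open>The output is read on the first tape from cell 0 up to the first blank.\<close>

definition output_is :: "config \<Rightarrow> bits \<Rightarrow> bool" where
  "output_is cf v \<longleftrightarrow>
     (let c = fst (hd (snd cf)) in
        (\<forall>i < length v. c (int i) = bit_symbol (v ! i)) \<and> c (int (length v)) = 0)"

definition polytime :: "(bits \<Rightarrow> bits) \<Rightarrow> bool" where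
  "polytime f \<longleftrightarrow> (\<exists>M (p :: nat poly). wf_tm M \<and>
     (\<forall>w. \<exists>k \<le> poly p (length w).
        let cf = (step M ^^ k) (initial M w) in fst cf = states M \<and> output_is cf (f w)))"

definition class_P :: "bits set set" where
  "class_P = {X. polytime (\<lambda>w. [w \<in> X])}"

definition pair_code :: "bits \<Rightarrow> bits \<Rightarrow> bits" where
  "pair_code x u = concat (map (\<lambda>b. [True, b]) x) @ [False] @ u"

definition class_NP :: "bits set set" where
  "class_NP = {X. \<exists>R \<in> class_P. \<exists>p :: nat poly. \<forall>x.
     x \<in> X \<longleftrightarrow> (\<exists>u. length u \<le> poly p (length x) \<and> pair_code x u \<in> R)}"

definition class_coNP :: "bits set set" where
  "class_coNP = {X. - X \<in> class_NP}"

text \<open>A decision problem consists of the codes of its instances and the codes of its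
  yes-instances. It belongs to a class of languages if some member of the class answers all
  instances correctly. Thus an algorithm for a problem restricted to certain instances may rely on
  its input being one of these, while a reduction to the restricted problem must produce them.\<close>

type_synonym problem = "bits set \<times> bits set"

definition in_class :: "problem \<Rightarrow> bits set set \<Rightarrow> bool" where
  "in_class Q C \<longleftrightarrow> (\<exists>X \<in> C. \<forall>w \<in> fst Q. w \<in> X \<longleftrightarrow> w \<in> snd Q)"

definition karp_reducible :: "bits set \<Rightarrow> problem \<Rightarrow> bool" where
  "karp_reducible X Q \<longleftrightarrow>
     (\<exists>f. polytime f \<and> (\<forall>w. f w \<in> fst Q \<and> (w \<in> X \<longleftrightarrow> f w \<in> snd Q)))"

definition coNP_complete :: "problem \<Rightarrow> bool" where
  "coNP_complete Q \<longleftrightarrow> in_class Q class_coNP \<and> (\<forall>X \<in> class_coNP. karp_reducible X Q)"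

definition congruence_join :: "('a \<times> 'a) set \<Rightarrow> ('a \<times> 'a) set \<Rightarrow> ('a \<times> 'a) set" where
  "congruence_join \<theta> \<delta> = (\<theta> \<union> \<delta>)\<^sup>+"

definition CR_tuple :: "'a algebra \<Rightarrow> ('a \<times> 'a) set list \<Rightarrow> bool" where
  "CR_tuple B \<theta>s \<longleftrightarrow>
     (\<forall>bs. length bs = length \<theta>s \<and> set bs \<subseteq> univ B \<and>
        (\<forall>i < length \<theta>s. \<forall>j < length \<theta>s. (bs ! i, bs ! j) \<in> congruence_join (\<theta>s ! i) (\<theta>s ! j))
      \<longrightarrow> (\<exists>b \<in> univ B. \<forall>i < length \<theta>s. (b, bs ! i) \<in> \<theta>s ! i))"

text \<open>The input algebras have universe \<open>{0, \<dots>, n - 1}\<close>, \<open>n \<ge> 1\<close>. An algebra is encoded by \<open>n\<close>, its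
  language and the tables of its operations, a congruence by its 0-1-matrix; numbers are in
  unary.\<close>

type_synonym crt_instance = "language \<times> nat algebra \<times> (nat \<times> nat) set list"

definition CRT_instances :: "crt_instance set" where
  "CRT_instances = {(L, B, \<theta>s). (\<exists>n. univ B = {..<n}) \<and> is_algebra L B \<and>
     (\<forall>\<theta> \<in> set \<theta>s. is_congruence L B \<theta>)}"

definition code_nat :: "nat \<Rightarrow> bits" where
  "code_nat m = replicate m True @ [False]"

definition code_algebra :: "language \<Rightarrow> nat algebra \<Rightarrow> bits" where
  "code_algebra L B =
     (let n = card (univ B) in
        code_nat n @ code_nat (length L) @
        concat (map (\<lambda>f. code_nat (L ! f) @
            concat (map (\<lambda>xs. code_nat (oper B f xs)) (List.n_lists (L ! f) [0..<n])))
          [0..<length L]))"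

definition code_relation :: "nat \<Rightarrow> (nat \<times> nat) set \<Rightarrow> bits" where
  "code_relation n \<theta> = map (\<lambda>xy. xy \<in> \<theta>) (List.product [0..<n] [0..<n])"

fun code_instance :: "crt_instance \<Rightarrow> bits" where
  "code_instance (L, B, \<theta>s) =
     code_algebra L B @ code_nat (length \<theta>s) @ concat (map (code_relation (card (univ B))) \<theta>s)"

definition CRT_restricted :: "language \<Rightarrow> nat algebra set \<Rightarrow> problem" where
  "CRT_restricted L V =
     (code_instance ` {(L', B, \<theta>s) \<in> CRT_instances. L' = L \<and> B \<in> V},
      code_instance ` {(L', B, \<theta>s) \<in> CRT_instances. L' = L \<and> B \<in> V \<and> CR_tuple B \<theta>s})"

end

theory Submission
  imports Defs "HOL-Library.Z2"
begin

text \<open>The operations of the two-element algebra generate a clone of Boolean functions, and the clone decides the complexity. If the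
  clone contains none of the operations \<open>op_s\<close>, \<open>op_n\<close>, \<open>dual_op op_n\<close> and \<open>op_m\<close>, then either it contains \<open>\<or>\<close>
  or \<open>\<and>\<close>, or each of its members is essentially unary. For suppose that a member depends on
  two arguments. Then some function obtained from it by identifying its arguments in three blocks is not essentially
  unary (lemma \<open>essentially_unary\<close>), and a ternary function of this kind yields \<open>\<and>\<close>, \<open>\<or>\<close>, the minority or the majority
  function (\<open>ternary_clone\<close>). In the presence of \<open>\<or>\<close> all
  members are constant or joins of variables, because any other function together with \<open>\<or>\<close> yields \<open>op_n\<close>
  (\<open>join_clone\<close>); then the variety is term-equivalent to one of the four varieties of semilattices that are excluded. The case of \<open>\<and>\<close> is
  reduced to that of \<open>\<or>\<close> by passage to the dual algebra, which generates the same variety. Hence, if none of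
  the four operations is present, all operations are essentially unary, and the variety is interpretable in the variety
  generated by the two-element algebra with the negation and both constants.

  Polynomial time. A tuple of congruences is a CR tuple if and only if every compatible tuple of the form \<open>b, \<dots>, b, c\<close> and of
  any length that extends to a compatible tuple of full length has a solution (\<open>CR_iff_extends\<close>): a shortest
  initial segment without a solution is replaced by one of this form. Whether such a tuple extends is a
  constraint satisfaction problem with binary constraints preserved by the term-operations of the algebra. The operations
  \<open>op_n\<close>, its dual and \<open>op_m\<close> yield a semilattice or a majority operation, and then path consistency decides
  the problem (\<open>semilattice_solution\<close>, \<open>majority_solution\<close>). For \<open>op_s\<close>, the algebra is an elementary abelian 2-group
  for the operation \<open>s(x, 0, y)\<close>, the extension problem is a system of linear equations over the two-element field
  (\<open>extends_iff_solvable\<close>), and Gaussian elimination solves it (\<open>gauss\<close>).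

  The complement is in NP, since a compatible tuple without a solution, together with chains that witness the membership in the joins,
  is a short certificate (\<open>not_CR_iff_certificate\<close>). For the hardness, if all operations are essentially unary, the variety contains
  algebras of every finite size all of whose operations are projections or constant; every equivalence relation on them is a
  congruence. So arbitrary equivalence relations are available, and the computation of a nondeterministic machine,
  written as a constraint satisfaction problem with constraints between the labels of values (\<open>computation_csp\<close>), is
  turned into equivalence relations that fail to be a CR tuple exactly if the problem has a solution (\<open>gadget_CR\<close>).

  All algorithms are expressed by arithmetical expressions with bounded sums and by the iteration of
  parallel updates of bit arrays that are definable by such expressions. These are compiled, by way of a
  structured programming language, to Turing machines with polynomial running time (\<open>code_correct\<close>, \<open>compiles_expr\<close>,
  \<open>polytime_phases\<close>).\<close>

section \<open>A structured programming language for Turing machines\<close>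

text \<open>Tape 0 holds the input and the output and is accessed directly: \<open>Put a d\<close> writes \<open>a\<close> and
  moves by \<open>d\<close>, \<open>Move d\<close> moves without writing. Every other tape is a stack of bits.
  The tests of \<open>If r a\<close> (is \<open>a\<close> scanned on tape \<open>r\<close>?) and \<open>While r\<close> (is a nonblank symbol
  scanned on tape \<open>r\<close>?) apply to all tapes; on a stack, the scanned symbol is the top.\<close>

datatype com = Push nat bool | Pop nat | Put nat int | Move int
  | Seq com com | If nat nat com com | While nat com

type_synonym store = "nat \<Rightarrow> bits"

text \<open>A stack that is empty shows a blank.\<close>

definition scan :: "tape \<Rightarrow> nat" where
  "scan t = fst t (snd t)"

definition top_symbol :: "bits \<Rightarrow> nat" where
  "top_symbol l = (case l of [] \<Rightarrow> 0 | b # _ \<Rightarrow> bit_symbol b)"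

definition scanned :: "tape \<times> store \<Rightarrow> nat \<Rightarrow> nat" where
  "scanned x r = (if r = 0 then scan (fst x) else top_symbol (snd x r))"

text \<open>\<open>exec c x t y\<close>: the program \<open>c\<close> takes the state \<open>x\<close> to the state \<open>y\<close> in \<open>t\<close> steps.\<close>

inductive exec :: "com \<Rightarrow> tape \<times> store \<Rightarrow> nat \<Rightarrow> tape \<times> store \<Rightarrow> bool" where
  Push: "exec (Push r b) (tp, s) 2 (tp, s(r := b # s r))"
| Pop: "exec (Pop r) (tp, s) 1 (tp, s(r := tl (s r)))"
| Put: "exec (Put a d) (tp, s) 1 (act (a, d) tp, s)"
| Move: "exec (Move d) (tp, s) 1 (act (scan tp, d) tp, s)"
| Seq: "exec c1 x t1 y \<Longrightarrow> exec c2 y t2 z \<Longrightarrow> exec (Seq c1 c2) x (t1 + t2) z"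
| IfTrue: "scanned x r = a \<Longrightarrow> exec c1 x t y \<Longrightarrow> exec (If r a c1 c2) x (Suc t) y"
| IfFalse: "scanned x r \<noteq> a \<Longrightarrow> exec c2 x t y \<Longrightarrow> exec (If r a c1 c2) x (Suc t) y"
| WhileFalse: "scanned x r = 0 \<Longrightarrow> exec (While r c) x 1 x"
| WhileTrue: "scanned x r \<noteq> 0 \<Longrightarrow> exec c x t1 y \<Longrightarrow> exec (While r c) y t2 z \<Longrightarrow>
    exec (While r c) x (Suc (t1 + t2)) z"

text \<open>\<open>wf_com K c\<close>: the program \<open>c\<close> uses the tapes below \<open>K\<close>, writes only blanks and bits, and uses
  only the tapes from 1 on as stacks.\<close>

fun wf_com :: "nat \<Rightarrow> com \<Rightarrow> bool" where
  "wf_com K (Push r b) \<longleftrightarrow> 0 < r \<and> r < K"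
| "wf_com K (Pop r) \<longleftrightarrow> 0 < r \<and> r < K"
| "wf_com K (Put a d) \<longleftrightarrow> 0 < K \<and> a < 3 \<and> d \<in> {-1, 0, 1}"
| "wf_com K (Move d) \<longleftrightarrow> 0 < K \<and> d \<in> {-1, 0, 1}"
| "wf_com K (Seq c1 c2) \<longleftrightarrow> wf_com K c1 \<and> wf_com K c2"
| "wf_com K (If r a c1 c2) \<longleftrightarrow> r < K \<and> wf_com K c1 \<and> wf_com K c2"
| "wf_com K (While r c) \<longleftrightarrow> r < K \<and> wf_com K c"

section \<open>Compilation to Turing machines\<close>

text \<open>The number of states of the machine for a program. A push takes two steps, since the head has to be
  moved to the blank cell on the left before the bit is written.\<close>

fun ncode :: "com \<Rightarrow> nat" where
  "ncode (Push r b) = 2"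
| "ncode (Pop r) = 1"
| "ncode (Put a d) = 1"
| "ncode (Move d) = 1"
| "ncode (Seq c1 c2) = ncode c1 + ncode c2"
| "ncode (If r a c1 c2) = 1 + ncode c1 + ncode c2"
| "ncode (While r c) = 1 + ncode c"

definition stay :: "nat list \<Rightarrow> (nat \<times> int) list" where
  "stay ss = map (\<lambda>a. (a, 0)) ss"

text \<open>The program \<open>c\<close> becomes a machine with the states \<open>0, \<dots>, ncode c - 1\<close> that is left by a
  transition to the state \<open>ncode c\<close>.\<close>

fun code :: "com \<Rightarrow> nat \<Rightarrow> nat list \<Rightarrow> nat \<times> (nat \<times> int) list" where
  "code (Push r b) q ss = (if q = 0 then (1, (stay ss)[r := (ss ! r, -1)])
     else (2, (stay ss)[r := (bit_symbol b, 0)]))"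
| "code (Pop r) q ss = (1, if ss ! r = 0 then stay ss else (stay ss)[r := (0, 1)])"
| "code (Put a d) q ss = (1, (stay ss)[0 := (a, d)])"
| "code (Move d) q ss = (1, (stay ss)[0 := (ss ! 0, d)])"
| "code (Seq c1 c2) q ss = (if q < ncode c1 then code c1 q ss
     else (let (q', as) = code c2 (q - ncode c1) ss in (ncode c1 + q', as)))"
| "code (If r a c1 c2) q ss = (if q = 0 then (if ss ! r = a then 1 else 1 + ncode c1, stay ss)
     else if q < 1 + ncode c1
     then (let (q', as) = code c1 (q - 1) ss
           in (if q' = ncode c1 then 1 + ncode c1 + ncode c2 else 1 + q', as))
     else (let (q', as) = code c2 (q - 1 - ncode c1) ss in (1 + ncode c1 + q', as)))"
| "code (While r c) q ss = (if q = 0 then (if ss ! r = 0 then 1 + ncode c else 1, stay ss)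
     else (let (q', as) = code c (q - 1) ss in (if q' = ncode c then 0 else 1 + q', as)))"

lemma ncode_pos: "0 < ncode c"
  by (induction c) auto

text \<open>\<open>runs \<delta> n q ts k ts'\<close>: from the state \<open>q\<close>, the exit state \<open>n\<close> is reached after exactly \<open>k\<close>
  steps within the states below \<open>n\<close>.\<close>

inductive runs :: "(nat \<Rightarrow> nat list \<Rightarrow> nat \<times> (nat \<times> int) list) \<Rightarrow> nat \<Rightarrow> nat \<Rightarrow> tape list \<Rightarrow> nat
    \<Rightarrow> tape list \<Rightarrow> bool" for \<delta> n where
  runs_exit: "runs \<delta> n n ts 0 ts"
| runs_step: "q < n \<Longrightarrow> \<delta> q (map scan ts) = (q', as) \<Longrightarrow> runs \<delta> n q' (map2 act as ts) k ts' \<Longrightarrow>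
    runs \<delta> n q ts (Suc k) ts'"

lemma runs_le: "runs \<delta> n q ts k ts' \<Longrightarrow> q \<le> n"
  by (induction rule: runs.induct) auto

text \<open>A machine embedded into a larger one, at the states from \<open>b\<close> on, with its exit redirected
  to the state \<open>e\<close>.\<close>

lemma runs_embed:
  assumes "runs \<delta> n q ts k ts'"
    and "\<And>q ss q' as. q < n \<Longrightarrow> \<delta> q ss = (q', as) \<Longrightarrow> q' \<le> n \<Longrightarrow>
      \<delta>' (b + q) ss = (if q' = n then e else b + q', as)"
    and "b + n \<le> N" and "runs \<delta>' N e ts' k' ts''"
  shows "runs \<delta>' N (if q = n then e else b + q) ts (k + k') ts''"
  using assms(1,4)
proof (induction rule: runs.induct)
  case (runs_exit ts)
  then show ?case by auto
next
  case (runs_step q ts q' as k ts')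
  have "\<delta>' (b + q) (map scan ts) = (if q' = n then e else b + q', as)"
    using assms(2) runs_step runs_le by blast
  then show ?case using runs_step assms(3) by (auto intro!: runs.runs_step)
qed

text \<open>A stack is written on its tape from the position of the head to the right; all other cells are blank.\<close>

definition is_stack :: "bits \<Rightarrow> tape \<Rightarrow> bool" where
  "is_stack l t \<longleftrightarrow> (\<forall>j. fst t j =
     (if snd t \<le> j \<and> j < snd t + int (length l) then bit_symbol (l ! nat (j - snd t)) else 0))"

definition represents :: "nat \<Rightarrow> tape \<times> store \<Rightarrow> tape list \<Rightarrow> bool" where
  "represents K x ts \<longleftrightarrow> length ts = K \<and> 0 < K \<and> ts ! 0 = fst x \<and>
     (\<forall>r. 0 < r \<and> r < K \<longrightarrow> is_stack (snd x r) (ts ! r))"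

lemma bit_symbol_pos [simp]: "bit_symbol b \<noteq> 0" "0 < bit_symbol b" "bit_symbol b < 3"
  by (auto simp: bit_symbol_def)

lemma is_stack_scan: "is_stack l t \<Longrightarrow> scan t = top_symbol l"
  by (auto simp: is_stack_def scan_def top_symbol_def split: list.splits)

lemma represents_scan: "represents K x ts \<Longrightarrow> r < K \<Longrightarrow> scan (ts ! r) = scanned x r"
  by (auto simp: represents_def scanned_def is_stack_scan)

lemma act_scan [simp]: "act (scan t, 0) t = t"
  by (cases t) (auto simp: scan_def)

lemma map2_act_stay: "map2 act (stay (map scan ts)) ts = ts"
  by (rule nth_equalityI) (auto simp: stay_def)

lemma map2_act_update: "r < length ts \<Longrightarrow>
  map2 act ((stay (map scan ts))[r := p]) ts = ts[r := act p (ts ! r)]"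
  by (rule nth_equalityI)
    (auto simp: stay_def nth_list_update)

lemma represents_update: "represents K (tp, s) ts \<Longrightarrow> 0 < r \<Longrightarrow> r < K \<Longrightarrow> is_stack l t \<Longrightarrow>
  represents K (tp, s(r := l)) (ts[r := t])"
  by (auto simp: represents_def nth_list_update)

lemma represents_update0: "represents K (tp, s) ts \<Longrightarrow> represents K (tp', s) (ts[0 := tp'])"
  by (auto simp: represents_def nth_list_update)

lemma is_stack_push: "is_stack l t \<Longrightarrow> is_stack (b # l) (act (bit_symbol b, 0) (act (scan t, -1) t))"
  by (cases t) (auto simp: is_stack_def scan_def nth_Cons' nat_diff_distrib algebra_simps
    intro!: arg_cong[where f = bit_symbol] arg_cong[where f = "(!) l"])

lemma is_stack_pop: "is_stack (b # l) t \<Longrightarrow> is_stack l (act (0, 1) t)"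
  by (cases t) (auto simp: is_stack_def nth_Cons' algebra_simps
    intro!: arg_cong[where f = bit_symbol] arg_cong[where f = "(!) l"])

text \<open>The machine simulates the program step by step, in exactly the same time.\<close>

theorem code_correct:
  assumes "exec c x t y" "wf_com K c" "represents K x ts"
  shows "\<exists>ts'. runs (code c) (ncode c) 0 ts t ts' \<and> represents K y ts'"
  using assms
proof (induction arbitrary: ts rule: exec.induct)
  case (Push r b tp s)
  let ?t1 = "act (scan (ts ! r), -1) (ts ! r)"
  let ?ts1 = "ts[r := ?t1]"
  let ?ts2 = "ts[r := act (bit_symbol b, 0) ?t1]"
  have r: "r < length ts" "0 < r" "r < K" "is_stack (s r) (ts ! r)"
    using Push by (auto simp: represents_def)
  have "runs (code (Push r b)) 2 2 ?ts2 0 ?ts2" by (rule runs_exit)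
  then have "runs (code (Push r b)) 2 1 ?ts1 1 ?ts2"
    using r map2_act_update[of r ?ts1] by (auto intro!: runs_step)
  then have "runs (code (Push r b)) 2 0 ts 2 ?ts2"
    using r map2_act_update[of r ts]
    runs_step[of 0 2 "code (Push r b)" ts 1 "(stay (map scan ts))[r := (scan (ts ! r), -1)]" 1 ?ts2]
    by (simp add: numeral_2_eq_2)
  then show ?case using represents_update[OF Push(2) r(2,3) is_stack_push[OF r(4)]]
    by (metis ncode.simps(1))
next
  case (Pop r tp s)
  have r: "r < length ts" "0 < r" "r < K" "is_stack (s r) (ts ! r)"
    using Pop by (auto simp: represents_def)
  have sc: "scan (ts ! r) = top_symbol (s r)" using is_stack_scan r by blast
  show ?case
  proof (cases "s r")
    case Nil
    then have "runs (code (Pop r)) 1 0 ts 1 ts" using r sc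
      by (auto intro!: runs_step runs_exit simp: map2_act_stay top_symbol_def)
    moreover have "s(r := tl (s r)) = s" using Nil by auto
    ultimately show ?thesis using Pop(2) by (metis ncode.simps(2))
  next
    case (Cons b l)
    let ?ts1 = "ts[r := act (0, 1) (ts ! r)]"
    have "runs (code (Pop r)) 1 0 ts 1 ?ts1" using r sc Cons map2_act_update[of r ts]
      by (auto intro!: runs_step runs_exit simp: top_symbol_def)
    moreover have "represents K (tp, s(r := tl (s r))) ?ts1"
      using represents_update[OF Pop(2) r(2,3) is_stack_pop] r(4) Cons by auto
    ultimately show ?thesis by (metis ncode.simps(2))
  qed
next
  case (Put a d tp s)
  then have "runs (code (Put a d)) 1 0 ts 1 (ts[0 := act (a, d) tp])"
    using map2_act_update[of 0 ts] by (auto intro!: runs_step runs_exit simp: represents_def)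
  then show ?case using represents_update0[OF Put(2)] by (metis ncode.simps(3))
next
  case (Move d tp s)
  then have "runs (code (Move d)) 1 0 ts 1 (ts[0 := act (scan tp, d) tp])"
    using map2_act_update[of 0 ts] by (auto intro!: runs_step runs_exit simp: represents_def)
  then show ?case using represents_update0[OF Move(2)] by (metis ncode.simps(4))
next
  case (Seq c1 x t1 y c2 t2 z)
  obtain ts1 where 1: "runs (code c1) (ncode c1) 0 ts t1 ts1" "represents K y ts1"
    using Seq by fastforce
  obtain ts2 where 2: "runs (code c2) (ncode c2) 0 ts1 t2 ts2" "represents K z ts2"
    using Seq 1 by fastforce
  let ?\<delta> = "code (Seq c1 c2)" and ?n = "ncode (Seq c1 c2)"
  have "runs ?\<delta> ?n (if 0 = ncode c2 then ?n else ncode c1 + 0) ts1 (t2 + 0) ts2"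
    by (rule runs_embed[OF 2(1)]) (auto intro: runs_exit)
  then have "runs ?\<delta> ?n (ncode c1) ts1 t2 ts2" using ncode_pos[of c2] by auto
  then have "runs ?\<delta> ?n (if 0 = ncode c1 then ncode c1 else 0 + 0) ts (t1 + t2) ts2"
    by (rule runs_embed[OF 1(1), rotated 2]) auto
  then show ?case using ncode_pos[of c1] 2(2) by (metis add_0 less_irrefl)
next
  case (IfTrue x r a c1 t y c2)
  obtain ts1 where 1: "runs (code c1) (ncode c1) 0 ts t ts1" "represents K y ts1"
    using IfTrue by fastforce
  let ?\<delta> = "code (If r a c1 c2)" and ?n = "ncode (If r a c1 c2)"
  have "runs ?\<delta> ?n (if 0 = ncode c1 then ?n else 1 + 0) ts (t + 0) ts1"
    by (rule runs_embed[OF 1(1)]) (auto intro: runs_exit)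
  then have "runs ?\<delta> ?n 1 ts t ts1" using ncode_pos[of c1] by auto
  moreover have "r < length ts" "scan (ts ! r) = a"
    using IfTrue represents_scan[OF IfTrue(5)] by (auto simp: represents_def)
  ultimately have "runs ?\<delta> ?n 0 ts (Suc t) ts1" by (auto intro!: runs_step simp: map2_act_stay)
  then show ?case using 1 by blast
next
  case (IfFalse x r a c2 t y c1)
  obtain ts1 where 1: "runs (code c2) (ncode c2) 0 ts t ts1" "represents K y ts1"
    using IfFalse by fastforce
  let ?\<delta> = "code (If r a c1 c2)" and ?n = "ncode (If r a c1 c2)"
  have "runs ?\<delta> ?n (if 0 = ncode c2 then ?n else (1 + ncode c1) + 0) ts (t + 0) ts1"
    by (rule runs_embed[OF 1(1)]) (auto intro: runs_exit)
  then have "runs ?\<delta> ?n (1 + ncode c1) ts t ts1" using ncode_pos[of c2] by auto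
  moreover have "r < length ts" "scan (ts ! r) \<noteq> a"
    using IfFalse represents_scan[OF IfFalse(5)] by (auto simp: represents_def)
  ultimately have "runs ?\<delta> ?n 0 ts (Suc t) ts1" by (auto intro!: runs_step simp: map2_act_stay)
  then show ?case using 1 by blast
next
  case (WhileFalse x r c)
  have "r < length ts" "scan (ts ! r) = 0"
    using WhileFalse represents_scan[OF WhileFalse(3)] by (auto simp: represents_def)
  then have "runs (code (While r c)) (ncode (While r c)) 0 ts 1 ts"
    using runs_exit[of "code (While r c)" "ncode (While r c)" ts]
    by (auto intro!: runs_step simp: map2_act_stay)
  then show ?case using WhileFalse by blast
next
  case (WhileTrue x r c t1 y t2 z)
  obtain ts1 where 1: "runs (code c) (ncode c) 0 ts t1 ts1" "represents K y ts1"
    using WhileTrue by fastforce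
  let ?\<delta> = "code (While r c)" and ?n = "ncode (While r c)"
  obtain ts2 where 2: "runs ?\<delta> ?n 0 ts1 t2 ts2" "represents K z ts2"
    using WhileTrue 1 by fastforce
  have "runs ?\<delta> ?n (if 0 = ncode c then 0 else 1 + 0) ts (t1 + t2) ts2"
    by (rule runs_embed[OF 1(1) _ _ 2(1)]) auto
  then have "runs ?\<delta> ?n 1 ts (t1 + t2) ts2" using ncode_pos[of c] by auto
  moreover have "r < length ts" "scan (ts ! r) \<noteq> 0"
    using WhileTrue represents_scan[OF WhileTrue(7)] by (auto simp: represents_def)
  ultimately have "runs ?\<delta> ?n 0 ts (Suc (t1 + t2)) ts2"
    by (auto intro!: runs_step simp: map2_act_stay)
  then show ?case using 2 by blast
qed

lemma code_wf:
  assumes "wf_com K c" "q < ncode c" "length ss = K" "set ss \<subseteq> {..<3}"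
  shows "fst (code c q ss) \<le> ncode c \<and> length (snd (code c q ss)) = K \<and>
    set (snd (code c q ss)) \<subseteq> {..<3} \<times> {-1, 0, 1}"
proof -
  have st: "length (stay ss) = K" "set (stay ss) \<subseteq> {..<3} \<times> {-1, 0, 1}"
    using assms by (auto simp: stay_def)
  have up: "set ((stay ss)[r := p]) \<subseteq> {..<3} \<times> {-1, 0, 1}"
    if "p \<in> {..<3} \<times> {-1, 0, 1}" for r p
    using st(2) that set_update_subset_insert[of "stay ss" r p] by blast
  have nth: "ss ! r < 3" if "r < K" for r using assms that nth_mem[of r ss] by blast
  show ?thesis using assms(1,2)
  proof (induction c arbitrary: q)
    case (Push r b)
    then show ?case using up[of "(ss ! r, -1)"] up[of "(bit_symbol b, 0)"] nth st by auto
  next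
    case (Pop r)
    then show ?case using up[of "(0, 1)"] st by (auto simp: st(1))
  next
    case (Put a d)
    then show ?case using up[of "(a, d)"] st by (auto simp: st(1))
  next
    case (Move d)
    then show ?case using up[of "(ss ! 0, d)"] nth[of 0] st by (auto simp: st(1))
  next
    case (Seq c1 c2)
    show ?case
    proof (cases "q < ncode c1")
      case True
      then show ?thesis using Seq.IH(1)[of q] Seq.prems by auto
    next
      case False
      then have "q - ncode c1 < ncode c2" using Seq.prems by auto
      then show ?thesis using False Seq.IH(2)[of "q - ncode c1"] Seq.prems
        by (auto split: prod.splits)
    qed
  next
    case (If r a c1 c2)
    consider "q = 0" | "0 < q" "q < 1 + ncode c1" | "1 + ncode c1 \<le> q" by linarith
    then show ?case
    proof cases
      case 2
      then have "q - 1 < ncode c1" by auto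
      with 2 show ?thesis using If.IH(1)[of "q - 1"] If.prems by (auto split: prod.splits)
    next
      case 3
      then have "q - 1 - ncode c1 < ncode c2" using If.prems by auto
      with 3 show ?thesis using If.IH(2)[of "q - 1 - ncode c1"] If.prems
        by (auto split: prod.splits)
    qed (use st in auto)
  next
    case (While r c)
    show ?case
    proof (cases "q = 0")
      case False
      then have "q - 1 < ncode c" using While.prems by auto
      with False show ?thesis using While.IH[of "q - 1"] While.prems
        by (auto split: prod.splits)
    qed (use st in auto)
  qed
qed

lemma runs_steps:
  assumes "runs (delta M) (states M) q ts k ts'"
  shows "(step M ^^ k) (q, ts) = (states M, ts')"
  using assms
proof (induction rule: runs.induct)
  case (runs_exit ts)
  show ?case by simp
next
  case (runs_step q ts q' as k ts')
  have "map (\<lambda>(c, h). c h) ts = map scan ts"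
    by (auto simp: scan_def split: prod.splits)
  then have "step M (q, ts) = (q', map2 act as ts)" using runs_step
    by (simp del: map_eq_conv)
  then show ?case using runs_step by (simp add: funpow_Suc_right del: funpow.simps)
qed

text \<open>The stacks are empty at the start, and nothing is required of them at the end.\<close>

lemma polytime_exec:
  assumes c: "wf_com K c"
    and run: "\<And>w. \<exists>t \<le> poly p (length w). \<exists>tp s. exec c ((input_tape w, 0), \<lambda>_. []) t (tp, s) \<and>
      (\<forall>i < length (f w). fst tp (int i) = bit_symbol (f w ! i)) \<and> fst tp (int (length (f w))) = 0"
    and K: "0 < K"
  shows "polytime f"
proof -
  define M where "M = \<lparr>tapes = K, symbols = 3, states = ncode c, delta = code c\<rparr>"
  have "wf_tm M" using code_wf[OF c] K by (auto simp: wf_tm_def M_def)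
  moreover have "\<exists>k \<le> poly p (length w).
      let cf = (step M ^^ k) (initial M w) in fst cf = states M \<and> output_is cf (f w)" for w
  proof -
    obtain t tp s where t: "t \<le> poly p (length w)" "exec c ((input_tape w, 0), \<lambda>_. []) t (tp, s)"
      "\<forall>i < length (f w). fst tp (int i) = bit_symbol (f w ! i)" "fst tp (int (length (f w))) = 0"
      using run by blast
    let ?ts = "snd (initial M w)"
    have "represents K ((input_tape w, 0), \<lambda>_. []) ?ts"
      using K by (auto simp: represents_def initial_def M_def is_stack_def nth_Cons')
    from code_correct[OF t(2) c this] obtain ts' where ts':
      "runs (code c) (ncode c) 0 ?ts t ts'" "represents K (tp, s) ts'" by blast
    have "(step M ^^ t) (initial M w) = (states M, ts')"
      using runs_steps[of M 0 ?ts t ts'] ts'(1) by (auto simp: M_def initial_def)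
    moreover have "hd ts' = tp" using ts'(2) by (cases ts') (auto simp: represents_def)
    ultimately show ?thesis using t by (auto simp: output_is_def intro!: exI[of _ t])
  qed
  ultimately show ?thesis unfolding polytime_def by blast
qed

section \<open>Programs on stacks\<close>

text \<open>\<open>takes c x \<tau> y\<close>: the program \<open>c\<close> takes the state \<open>x\<close> to the state \<open>y\<close> in at most \<open>\<tau>\<close> steps.
  \<open>does c s \<tau> s'\<close>: it changes the stacks from \<open>s\<close> to \<open>s'\<close> in at most \<open>\<tau>\<close> steps and leaves tape 0
  alone.\<close>

definition takes :: "com \<Rightarrow> tape \<times> store \<Rightarrow> nat \<Rightarrow> tape \<times> store \<Rightarrow> bool" where
  "takes c x \<tau> y \<longleftrightarrow> (\<exists>t \<le> \<tau>. exec c x t y)"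

definition does :: "com \<Rightarrow> store \<Rightarrow> nat \<Rightarrow> store \<Rightarrow> bool" where
  "does c s \<tau> s' \<longleftrightarrow> (\<forall>tp. takes c (tp, s) \<tau> (tp, s'))"

lemma takes_mono: "takes c x \<tau> y \<Longrightarrow> \<tau> \<le> \<tau>' \<Longrightarrow> takes c x \<tau>' y"
  unfolding takes_def by (meson order_trans)

lemma takes_Seq: "takes c1 x \<tau>1 y \<Longrightarrow> takes c2 y \<tau>2 z \<Longrightarrow> takes (Seq c1 c2) x (\<tau>1 + \<tau>2) z"
  unfolding takes_def by (meson exec.Seq add_mono)

lemma takes_If:
  "(scanned x r = a \<Longrightarrow> takes c1 x \<tau> y) \<Longrightarrow> (scanned x r \<noteq> a \<Longrightarrow> takes c2 x \<tau> y) \<Longrightarrow>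
    takes (If r a c1 c2) x (Suc \<tau>) y"
  unfolding takes_def by (metis IfTrue IfFalse Suc_le_mono)

text \<open>A loop with \<open>m\<close> iterations that passes through the states \<open>I 0, \<dots>, I m\<close>\<close>

lemma takes_While:
  assumes it: "\<And>i. i < m \<Longrightarrow> scanned (I i) r \<noteq> 0 \<and> takes c (I i) \<tau> (I (Suc i))"
    and ex: "scanned (I m) r = 0"
  shows "takes (While r c) (I 0) (m * Suc \<tau> + 1) (I m)"
proof -
  have "takes (While r c) (I j) ((m - j) * Suc \<tau> + 1) (I m)" if "j \<le> m" for j
    using that
  proof (induction rule: inc_induct)
    case base
    show ?case using exec.WhileFalse[of "I m" r c] ex by (auto simp: takes_def)
  next
    case (step j)
    obtain t1 where t1: "t1 \<le> \<tau>" "exec c (I j) t1 (I (Suc j))"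
      using it[OF step(2)] unfolding takes_def by blast
    obtain t2 where t2: "t2 \<le> (m - Suc j) * Suc \<tau> + 1" "exec (While r c) (I (Suc j)) t2 (I m)"
      using step(3) unfolding takes_def by blast
    have "exec (While r c) (I j) (Suc (t1 + t2)) (I m)"
      using it[OF step(2)] t1 t2 by (intro exec.WhileTrue) auto
    moreover have "Suc (t1 + t2) \<le> (m - j) * Suc \<tau> + 1"
    proof -
      have "m - j = Suc (m - Suc j)" using step(2) by auto
      then show ?thesis using t1(1) t2(1) by simp
    qed
    ultimately show ?case unfolding takes_def by blast
  qed
  from this[of 0] show ?thesis by simp
qed

lemma does_mono: "does c s \<tau> s' \<Longrightarrow> \<tau> \<le> \<tau>' \<Longrightarrow> does c s \<tau>' s'"
  unfolding does_def by (meson takes_mono)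

lemma does_Push: "does (Push r b) s 2 (s(r := b # s r))"
  unfolding does_def takes_def by (meson exec.Push order_refl)

lemma does_Pop: "does (Pop r) s 1 (s(r := tl (s r)))"
  unfolding does_def takes_def by (meson exec.Pop order_refl)

lemma does_Pop_empty: "s r = [] \<Longrightarrow> does (Pop r) s 1 s"
  using does_Pop[of r s] by (simp add: fun_upd_idem)

lemma does_Seq: "does c1 s \<tau>1 s' \<Longrightarrow> does c2 s' \<tau>2 s'' \<Longrightarrow> does (Seq c1 c2) s (\<tau>1 + \<tau>2) s''"
  unfolding does_def by (meson takes_Seq)

lemma does_If:
  assumes "0 < r" "top_symbol (s r) = a \<Longrightarrow> does c1 s \<tau> s'" "top_symbol (s r) \<noteq> a \<Longrightarrow> does c2 s \<tau> s'"
  shows "does (If r a c1 c2) s (Suc \<tau>) s'"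
  using assms by (auto simp: does_def scanned_def intro!: takes_If)

lemma top_symbol_0 [simp]: "top_symbol l = 0 \<longleftrightarrow> l = []"
  by (cases l) (auto simp: top_symbol_def)

lemma top_symbol_2 [simp]: "top_symbol l = 2 \<longleftrightarrow> l \<noteq> [] \<and> hd l"
  by (cases l) (auto simp: top_symbol_def bit_symbol_def)

lemma does_While:
  assumes "0 < r" and it: "\<And>i. i < m \<Longrightarrow> I i r \<noteq> [] \<and> does c (I i) \<tau> (I (Suc i))"
    and "I m r = []"
  shows "does (While r c) (I 0) (m * Suc \<tau> + 1) (I m)"
  unfolding does_def
proof
  fix tp
  show "takes (While r c) (tp, I 0) (m * Suc \<tau> + 1) (tp, I m)"
    by (rule takes_While[of m "\<lambda>i. (tp, I i)"]) (cases tp, use assms in \<open>auto simp: does_def scanned_def\<close>)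
qed

lemma does_While':
  assumes "0 < r" and "\<And>i. i < m \<Longrightarrow> I i r \<noteq> [] \<and> does c (I i) \<tau> (I (Suc i))"
    and "I m r = []" and "s = I 0" and "s' = I m" and "m * Suc \<tau> + 1 \<le> \<tau>'"
  shows "does (While r c) s \<tau>' s'"
  using does_mono[OF does_While[OF assms(1-3)]] assms(4-6) by simp

text \<open>Copying the top of \<open>a\<close> to \<open>b\<close>, and moving all of \<open>a\<close> to \<open>b\<close>, which reverses it.\<close>

definition copy_top :: "nat \<Rightarrow> nat \<Rightarrow> com" where
  "copy_top a b = If a 2 (Push b True) (Push b False)"

lemma does_copy_top: "0 < a \<Longrightarrow> s a \<noteq> [] \<Longrightarrow> does (copy_top a b) s 3 (s(b := hd (s a) # s b))"
  using does_If[of a s 2 "Push b True" 2 "s(b := hd (s a) # s b)" "Push b False"]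
    does_Push[of b True s] does_Push[of b False s] by (auto simp: copy_top_def)

definition move_all :: "nat \<Rightarrow> nat \<Rightarrow> com" where
  "move_all a b = While a (Seq (copy_top a b) (Pop a))"

lemma does_move_all:
  assumes "0 < a" "a \<noteq> b" "length (s a) \<le> M"
  shows "does (move_all a b) s (5 * M + 1) (s(a := [], b := rev (s a) @ s b))"
  unfolding move_all_def
proof (rule does_While'[where m = "length (s a)" and \<tau> = 4 and
      I = "\<lambda>i. s(a := drop i (s a), b := rev (take i (s a)) @ s b)"])
  fix i assume i: "i < length (s a)"
  let ?s = "s(a := drop i (s a), b := rev (take i (s a)) @ s b)"
  have "does (Seq (copy_top a b) (Pop a)) ?s (3 + 1)
    ((?s(b := hd (?s a) # ?s b))(a := tl ((?s(b := hd (?s a) # ?s b)) a)))"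
    by (rule does_Seq[OF does_copy_top does_Pop]) (use assms i in auto)
  moreover have "(?s(b := hd (?s a) # ?s b))(a := tl ((?s(b := hd (?s a) # ?s b)) a)) =
      s(a := drop (Suc i) (s a), b := rev (take (Suc i) (s a)) @ s b)"
    using assms i by (auto simp: fun_eq_iff take_Suc_conv_app_nth hd_drop_conv_nth drop_Suc tl_drop)
  ultimately show "?s a \<noteq> [] \<and> does (Seq (copy_top a b) (Pop a)) ?s 4
     (s(a := drop (Suc i) (s a), b := rev (take (Suc i) (s a)) @ s b))"
    using assms i by simp
qed (use assms in auto)

definition clear :: "nat \<Rightarrow> com" where
  "clear a = While a (Pop a)"

lemma does_clear:
  assumes "0 < a" "length (s a) \<le> M"
  shows "does (clear a) s (2 * M + 1) (s(a := []))"
  unfolding clear_def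
proof (rule does_While'[where m = "length (s a)" and \<tau> = 1 and I = "\<lambda>i. s(a := drop i (s a))"])
  fix i assume "i < length (s a)"
  then show "(s(a := drop i (s a))) a \<noteq> [] \<and>
      does (Pop a) (s(a := drop i (s a))) 1 (s(a := drop (Suc i) (s a)))"
    using does_Pop[of a "s(a := drop i (s a))"] by (simp add: drop_Suc tl_drop)
qed (use assms in auto)

text \<open>A counter is a stack whose length is the value. Adding the length of \<open>r\<close> to the counter \<open>g\<close>,
  with the auxiliary stack \<open>k\<close>:\<close>

definition add_length :: "nat \<Rightarrow> nat \<Rightarrow> nat \<Rightarrow> com" where
  "add_length r k g = Seq (While r (Seq (Seq (copy_top r k) (Pop r)) (Push g True))) (move_all k r)"

lemma does_add_length:
  assumes "0 < r" "0 < k" "r \<noteq> k" "r \<noteq> g" "k \<noteq> g" "s k = []" "length (s r) \<le> M"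
  shows "does (add_length r k g) s (12 * M + 2) (s(g := replicate (length (s r)) True @ s g))"
proof -
  let ?I = "\<lambda>i. s(r := drop i (s r), k := rev (take i (s r)), g := replicate i True @ s g)"
  have 1: "does (While r (Seq (Seq (copy_top r k) (Pop r)) (Push g True))) s (7 * M + 1)
      (?I (length (s r)))"
  proof (rule does_While'[where m = "length (s r)" and \<tau> = 6 and I = ?I])
    fix i assume i: "i < length (s r)"
    let ?s = "?I i" let ?s1 = "?s(k := hd (?s r) # ?s k)" let ?s2 = "?s1(r := tl (?s1 r))"
    have "does (Seq (Seq (copy_top r k) (Pop r)) (Push g True)) ?s (3 + 1 + 2) (?s2(g := True # ?s2 g))"
      by (rule does_Seq[OF does_Seq[OF does_copy_top does_Pop] does_Push]) (use assms i in auto)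
    moreover have "?s2(g := True # ?s2 g) = ?I (Suc i)"
      using assms i
      by (auto simp: fun_eq_iff take_Suc_conv_app_nth hd_drop_conv_nth drop_Suc tl_drop)
    ultimately show "?s r \<noteq> [] \<and> does (Seq (Seq (copy_top r k) (Pop r)) (Push g True)) ?s 6 (?I (Suc i))"
      using assms i by simp
  qed (use assms in auto)
  have 2: "does (move_all k r) (?I (length (s r))) (5 * M + 1)
      ((?I (length (s r)))(k := [], r := rev (?I (length (s r)) k) @ ?I (length (s r)) r))"
    by (rule does_move_all) (use assms in auto)
  have "(?I (length (s r)))(k := [], r := rev (?I (length (s r)) k) @ ?I (length (s r)) r) =
      s(g := replicate (length (s r)) True @ s g)"
    using assms by (auto simp: fun_eq_iff)
  then show ?thesis unfolding add_length_def using does_mono[OF does_Seq[OF 1 2]] by simp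
qed

section \<open>Expressions for polynomially bounded arithmetic\<close>

text \<open>Expressions denote natural numbers. They refer to strings by number and to number variables
  by de Bruijn indices: \<open>Sum a b\<close> stands for \<open>\<Sum>v<a. b v\<close> and binds the variable 0 in \<open>b\<close>.
  \<open>Less a b\<close> and \<open>Get r a\<close> (the bit at position \<open>a\<close> of the string \<open>r\<close>) have the values 0 and 1.\<close>

datatype expr = Arg nat | One | Plus expr expr | Less expr expr | Get nat expr | Len nat
  | Sum expr expr

text \<open>Positions beyond the end hold no bit, which counts as 0.\<close>

definition bit_at :: "bits \<Rightarrow> nat \<Rightarrow> bool" where
  "bit_at w i \<longleftrightarrow> i < length w \<and> w ! i"

fun val :: "expr \<Rightarrow> store \<Rightarrow> (nat \<Rightarrow> nat) \<Rightarrow> nat" where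
  "val (Arg i) R \<rho> = \<rho> i"
| "val One R \<rho> = 1"
| "val (Plus a b) R \<rho> = val a R \<rho> + val b R \<rho>"
| "val (Less a b) R \<rho> = of_bool (val a R \<rho> < val b R \<rho>)"
| "val (Get r a) R \<rho> = of_bool (bit_at (R r) (val a R \<rho>))"
| "val (Len r) R \<rho> = length (R r)"
| "val (Sum a b) R \<rho> = (\<Sum>v < val a R \<rho>. val b R (case_nat v \<rho>))"

text \<open>Only the strings \<open>0, \<dots>, S - 1\<close> are referred to.\<close>

fun strings_below :: "nat \<Rightarrow> expr \<Rightarrow> bool" where
  "strings_below S (Plus a b) \<longleftrightarrow> strings_below S a \<and> strings_below S b"
| "strings_below S (Less a b) \<longleftrightarrow> strings_below S a \<and> strings_below S b"
| "strings_below S (Get r a) \<longleftrightarrow> r < S \<and> strings_below S a"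
| "strings_below S (Len r) \<longleftrightarrow> r < S"
| "strings_below S (Sum a b) \<longleftrightarrow> strings_below S a \<and> strings_below S b"
| "strings_below S _ \<longleftrightarrow> True"

text \<open>Bounds for values and running times as polynomials in the maximum of the variables and of the
  lengths of the strings.\<close>

fun val_bound :: "expr \<Rightarrow> nat poly" where
  "val_bound (Arg i) = [:0, 1:]"
| "val_bound One = 1"
| "val_bound (Plus a b) = val_bound a + val_bound b"
| "val_bound (Less a b) = 1"
| "val_bound (Get r a) = 1"
| "val_bound (Len r) = [:0, 1:]"
| "val_bound (Sum a b) = val_bound a * pcompose (val_bound b) ([:0, 1:] + val_bound a)"

fun time_bound :: "expr \<Rightarrow> nat poly" where
  "time_bound (Arg i) = [:2, 12:]"
| "time_bound One = [:2:]"
| "time_bound (Plus a b) = time_bound a + time_bound b"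
| "time_bound (Less a b) = [:6:] + time_bound a + time_bound b + [:3:] * val_bound a + [:2:] * val_bound b"
| "time_bound (Get r a) = [:6, 5:] + time_bound a + [:7:] * val_bound a"
| "time_bound (Len r) = [:2, 12:]"
| "time_bound (Sum a b) = [:2:] + time_bound a
    + val_bound a * ([:6:] + pcompose (time_bound b) ([:0, 1:] + val_bound a))"

lemma poly_mono_nat: "x \<le> y \<Longrightarrow> poly (p :: nat poly) x \<le> poly p y"
  by (induction p) (auto intro!: add_mono mult_mono)

lemma val_le:
  assumes "strings_below S e" "\<And>r. r < S \<Longrightarrow> length (R r) \<le> M" "\<And>i. \<rho> i \<le> M"
  shows "val e R \<rho> \<le> poly (val_bound e) M"
  using assms
proof (induction e arbitrary: \<rho> M)
  case (Plus a b)
  then show ?case by (auto intro!: add_mono)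
next
  case (Sum a b)
  let ?n = "val a R \<rho>" and ?N = "poly (val_bound a) M"
  have n: "?n \<le> ?N" using Sum by auto
  have "val b R (case_nat v \<rho>) \<le> poly (val_bound b) (M + ?N)" if "v < ?n" for v
  proof (rule Sum.IH(2))
    show "length (R r) \<le> M + ?N" if "r < S" for r using Sum that by (meson trans_le_add1)
    show "(case i of 0 \<Rightarrow> v | Suc i \<Rightarrow> \<rho> i) \<le> M + ?N" for i
      using that n Sum.prems(3) by (cases i) (auto intro: trans_le_add1)
  qed (use Sum in auto)
  then have "val (Sum a b) R \<rho> \<le> ?n * poly (val_bound b) (M + ?N)"
    using sum_bounded_above[of "{..<?n}" "\<lambda>v. val b R (case_nat v \<rho>)"] by simp
  also have "\<dots> \<le> ?N * poly (val_bound b) (M + ?N)" using n by (rule mult_right_mono) simp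
  finally show ?case by (simp add: poly_pcompose)
qed auto

text \<open>The compiled expression adds its value to the counter \<open>g\<close>. The string \<open>r\<close> is on the stack
  \<open>Suc r\<close>, the variable \<open>i\<close> is the length of the stack \<open>vs ! i\<close> (and 0 if there is none), and the
  stacks from \<open>k\<close> on are empty before and after. To compare two numbers, their counters are
  emptied simultaneously. To read a bit, the bits before it are moved from the string to an auxiliary stack and back again.\<close>

fun compile :: "expr \<Rightarrow> nat list \<Rightarrow> nat \<Rightarrow> nat \<Rightarrow> com" where
  "compile (Arg i) vs k g = (if i < length vs then add_length (vs ! i) k g else Pop k)"
| "compile One vs k g = Push g True"
| "compile (Plus a b) vs k g = Seq (compile a vs k g) (compile b vs k g)"
| "compile (Less a b) vs k g =
     Seq (Seq (compile a vs (Suc k) k) (compile b vs (Suc (Suc k)) (Suc k)))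
       (Seq (While k (Seq (Pop k) (Pop (Suc k))))
         (While (Suc k) (Seq (Push g True) (clear (Suc k)))))"
| "compile (Get r a) vs k g =
     Seq (Seq (compile a vs (Suc k) k)
         (While k (Seq (Pop k) (If (Suc r) 0 (Pop (Suc r)) (Seq (copy_top (Suc r) (Suc k)) (Pop (Suc r)))))))
       (Seq (If (Suc r) 2 (Push g True) (Pop k)) (move_all (Suc k) (Suc r)))"
| "compile (Len r) vs k g = add_length (Suc r) k g"
| "compile (Sum a b) vs k g =
     Seq (Seq (compile a vs (Suc k) k)
         (While k (Seq (Pop k) (Seq (compile b (Suc k # vs) (Suc (Suc k)) g) (Push (Suc k) True)))))
       (clear (Suc k))"

text \<open>The stores in which compiled expressions run: the strings are on the stacks \<open>1, \<dots>, S\<close>, the variables on stacks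
  strictly between \<open>S\<close> and \<open>k\<close>, and \<open>M\<close> bounds all of them. Variables that are not on a stack are 0.\<close>

definition frame :: "nat \<Rightarrow> store \<Rightarrow> (nat \<Rightarrow> nat) \<Rightarrow> nat \<Rightarrow> nat list \<Rightarrow> nat \<Rightarrow> store \<Rightarrow> bool" where
  "frame S R \<rho> M vs k s \<longleftrightarrow> (\<forall>r<S. s (Suc r) = R r \<and> length (R r) \<le> M) \<and>
     (\<forall>i. \<rho> i \<le> M) \<and> (\<forall>i<length vs. length (s (vs ! i)) = \<rho> i) \<and> (\<forall>i\<ge>length vs. \<rho> i = 0) \<and>
     set vs \<subseteq> {S<..<k} \<and> S < k \<and> (\<forall>r\<ge>k. s r = [])"

lemma frame_update:
  "frame S R \<rho> M vs k s \<Longrightarrow> S < g \<Longrightarrow> g \<notin> set vs \<Longrightarrow> (k \<le> g \<Longrightarrow> l = []) \<Longrightarrow> frame S R \<rho> M vs k (s(g := l))"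
  by (auto simp: frame_def in_set_conv_nth)

lemma frame_Suc: "frame S R \<rho> M vs k s \<Longrightarrow> frame S R \<rho> M vs (Suc k) (s(k := l))"
  by (fastforce simp: frame_def dest: nth_mem)

text \<open>The counter \<open>g\<close> is increased by \<open>n\<close>, and nothing else changes.\<close>

definition adds :: "com \<Rightarrow> store \<Rightarrow> nat \<Rightarrow> nat \<Rightarrow> nat \<Rightarrow> bool" where
  "adds c s \<tau> g n \<longleftrightarrow> does c s \<tau> (s(g := replicate n True @ s g))"

definition compiles :: "nat \<Rightarrow> store \<Rightarrow> expr \<Rightarrow> bool" where
  "compiles S R e \<longleftrightarrow> (\<forall>\<rho> M vs k s g. frame S R \<rho> M vs k s \<and> S < g \<and> g < k \<and> g \<notin> set vs \<longrightarrow>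
     adds (compile e vs k g) s (poly (time_bound e) M) g (val e R \<rho>))"

lemma compilesI:
  assumes "\<And>\<rho> M vs k s g. frame S R \<rho> M vs k s \<Longrightarrow> S < g \<Longrightarrow> g < k \<Longrightarrow> g \<notin> set vs \<Longrightarrow>
     does (compile e vs k g) s (poly (time_bound e) M) (s(g := replicate (val e R \<rho>) True @ s g))"
  shows "compiles S R e"
  using assms by (auto simp: compiles_def adds_def)

lemma compilesD: "compiles S R e \<Longrightarrow> frame S R \<rho> M vs k s \<Longrightarrow> S < g \<Longrightarrow> g < k \<Longrightarrow> g \<notin> set vs \<Longrightarrow>
     does (compile e vs k g) s (poly (time_bound e) M) (s(g := replicate (val e R \<rho>) True @ s g))"
  by (auto simp: compiles_def adds_def)

theorem compiles_expr: "strings_below S e \<Longrightarrow> compiles S R e"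
proof (induction e)
  case (Arg i)
  show ?case
  proof (rule compilesI)
    fix \<rho> M vs k s g assume prems: "frame S R \<rho> M vs k s" "S < g" "g < k" "g \<notin> set vs"
    let ?goal = "does (compile (Arg i) vs k g) s (poly (time_bound (Arg i)) M) (s(g := replicate (val (Arg i) R \<rho>) True @ s g))"
    show ?goal
    proof (cases "i < length vs")
      case True
      then have i: "vs ! i \<in> set vs" by simp
      then have "S < vs ! i" "vs ! i < k" "vs ! i \<noteq> g" "length (s (vs ! i)) \<le> M"
        using prems i True by (auto simp: frame_def subset_iff simp del: nth_mem)
      then have "does (add_length (vs ! i) k g) s (12 * M + 2)
          (s(g := replicate (length (s (vs ! i))) True @ s g))"
        using prems True unfolding frame_def by (intro does_add_length) auto
      moreover have "\<rho> i = length (s (vs ! i))" using prems True by (auto simp: frame_def)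
      ultimately show ?thesis using True by (simp add: mult.commute)
    next
      case False
      then have "\<rho> i = 0" "s k = []" using prems by (auto simp: frame_def)
      then show ?thesis using False does_mono[OF does_Pop_empty[of s k]] by simp
    qed
  qed
next
  case One
  show ?case
  proof (rule compilesI)
    fix \<rho> M vs k s g assume prems: "frame S R \<rho> M vs k s" "S < g" "g < k" "g \<notin> set vs"
    let ?goal = "does (compile One vs k g) s (poly (time_bound One) M) (s(g := replicate (val One R \<rho>) True @ s g))"
    show ?goal using does_Push[of g True s] by simp
  qed
next
  case (Plus a b)
  then have C: "compiles S R a" "compiles S R b" and sb: "strings_below S a" "strings_below S b" by auto
  show ?case
  proof (rule compilesI)
    fix \<rho> M vs k s g assume prems: "frame S R \<rho> M vs k s" "S < g" "g < k" "g \<notin> set vs"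
    let ?goal = "does (compile (Plus a b) vs k g) s (poly (time_bound (Plus a b)) M) (s(g := replicate (val (Plus a b) R \<rho>) True @ s g))"
    let ?s1 = "s(g := replicate (val a R \<rho>) True @ s g)"
    have "does (compile a vs k g) s (poly (time_bound a) M) ?s1"
      by (rule compilesD[OF C(1) prems])
    moreover have "does (compile b vs k g) ?s1 (poly (time_bound b) M)
        (?s1(g := replicate (val b R \<rho>) True @ ?s1 g))"
      using prems by (intro compilesD[OF C(2) frame_update]) auto
    ultimately have "does (Seq (compile a vs k g) (compile b vs k g)) s
        (poly (time_bound a) M + poly (time_bound b) M) (?s1(g := replicate (val b R \<rho>) True @ ?s1 g))"
      by (rule does_Seq)
    moreover have "?s1(g := replicate (val b R \<rho>) True @ ?s1 g) =
        s(g := replicate (val (Plus a b) R \<rho>) True @ s g)"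
      by (simp add: add.commute[of "val a R \<rho>"] replicate_add)
    ultimately show ?goal by simp
  qed
next
  case (Less a b)
  then have C: "compiles S R a" "compiles S R b" and sb: "strings_below S a" "strings_below S b" by auto
  show ?case
  proof (rule compilesI)
    fix \<rho> M vs k s g assume prems: "frame S R \<rho> M vs k s" "S < g" "g < k" "g \<notin> set vs"
    let ?goal = "does (compile (Less a b) vs k g) s (poly (time_bound (Less a b)) M) (s(g := replicate (val (Less a b) R \<rho>) True @ s g))"
    let ?x = "val a R \<rho>" and ?y = "val b R \<rho>"
    let ?s1 = "s(k := replicate ?x True)" let ?s2 = "?s1(Suc k := replicate ?y True)"
    let ?s3 = "s(Suc k := replicate (?y - ?x) True)"
    let ?s4 = "s(g := replicate (of_bool (?x < ?y)) True @ s g)"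
    have k: "S < k" "\<And>r. k \<le> r \<Longrightarrow> s r = []" "set vs \<subseteq> {S<..<k}" using prems by (auto simp: frame_def)
    have kv: "k \<notin> set vs" "Suc k \<notin> set vs" using prems by (auto simp: frame_def)
    have f1: "frame S R \<rho> M vs (Suc k) s" using frame_Suc[OF prems(1), of "s k"] by simp
    have xM: "?x \<le> poly (val_bound a) M" "?y \<le> poly (val_bound b) M"
      using prems sb by (auto intro!: val_le simp: frame_def)
    have 1: "does (compile a vs (Suc k) k) s (poly (time_bound a) M) ?s1"
      using compilesD[OF C(1) f1, of k] prems k kv by auto
    have f2: "frame S R \<rho> M vs (Suc (Suc k)) ?s1"
      using frame_Suc[OF frame_Suc[OF prems(1), of "replicate ?x True"], of "[]"] k(2)[of "Suc k"]
      by (simp add: fun_upd_idem)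
    have 2: "does (compile b vs (Suc (Suc k)) (Suc k)) ?s1 (poly (time_bound b) M) ?s2"
      using compilesD[OF C(2) f2, of "Suc k"] prems k kv by auto
    have 3: "does (While k (Seq (Pop k) (Pop (Suc k)))) ?s2 (poly (val_bound a) M * 3 + 1) ?s3"
    proof (rule does_While'[where m = ?x and \<tau> = 2 and
          I = "\<lambda>i. s(k := replicate (?x - i) True, Suc k := replicate (?y - i) True)"])
      fix i assume i: "i < ?x"
      let ?s = "s(k := replicate (?x - i) True, Suc k := replicate (?y - i) True)"
      let ?t1 = "?s(k := tl (?s k))"
      have "does (Seq (Pop k) (Pop (Suc k))) ?s (1 + 1) (?t1(Suc k := tl (?t1 (Suc k))))"
        by (rule does_Seq[OF does_Pop does_Pop])
      moreover have "?t1(Suc k := tl (?t1 (Suc k))) =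
          s(k := replicate (?x - Suc i) True, Suc k := replicate (?y - Suc i) True)"
        by (auto simp: fun_eq_iff)
      ultimately show "?s k \<noteq> [] \<and> does (Seq (Pop k) (Pop (Suc k))) ?s 2
          (s(k := replicate (?x - Suc i) True, Suc k := replicate (?y - Suc i) True))"
        using i by (simp add: numeral_2_eq_2)
    qed (use k xM in \<open>auto simp: fun_eq_iff\<close>)
    have 4: "does (While (Suc k) (Seq (Push g True) (clear (Suc k)))) ?s3 (2 * poly (val_bound b) M + 5) ?s4"
    proof (cases "?x < ?y")
      case False
      then show ?thesis
        by (intro does_While'[where m = 0 and I = "\<lambda>_. s"]) (use k in \<open>auto simp: fun_eq_iff\<close>)
    next
      case True
      let ?t = "?s3(g := True # ?s3 g)"
      show ?thesis
      proof (rule does_While'[where m = 1 and \<tau> = "2 + (2 * poly (val_bound b) M + 1)" and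
            I = "\<lambda>i. if i = 0 then ?s3 else ?s4"])
        have "does (Seq (Push g True) (clear (Suc k))) ?s3 (2 + (2 * poly (val_bound b) M + 1))
            (?t(Suc k := []))"
          by (rule does_Seq[OF does_Push does_clear]) (use xM prems in auto)
        moreover have "?t(Suc k := []) = ?s4" using True k prems by (auto simp: fun_eq_iff)
        ultimately show "(if i = 0 then ?s3 else ?s4) (Suc k) \<noteq> [] \<and>
            does (Seq (Push g True) (clear (Suc k))) (if i = 0 then ?s3 else ?s4)
             (2 + (2 * poly (val_bound b) M + 1)) (if Suc i = 0 then ?s3 else ?s4)" if "i < 1" for i
          using that True by auto
      qed (use k prems in auto)
    qed
    have "does (compile (Less a b) vs k g) s
      (poly (time_bound a) M + poly (time_bound b) M + (poly (val_bound a) M * 3 + 1 + (2 * poly (val_bound b) M + 5))) ?s4"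
      unfolding compile.simps by (rule does_Seq[OF does_Seq[OF 1 2] does_Seq[OF 3 4]])
    then show ?goal by (simp add: algebra_simps)
  qed
next
  case (Get r a)
  then have C: "compiles S R a" and sb: "strings_below S a" "r < S" by auto
  show ?case
  proof (rule compilesI)
    fix \<rho> M vs k s g assume prems: "frame S R \<rho> M vs k s" "S < g" "g < k" "g \<notin> set vs"
    let ?goal = "does (compile (Get r a) vs k g) s (poly (time_bound (Get r a)) M) (s(g := replicate (val (Get r a) R \<rho>) True @ s g))"
    let ?x = "val a R \<rho>"
    let ?I = "\<lambda>i. s(k := replicate (?x - i) True, Suc r := drop i (R r), Suc k := rev (take i (R r)))"
    have k: "S < k" "\<And>r. k \<le> r \<Longrightarrow> s r = []" "s (Suc r) = R r" "r < S" "length (R r) \<le> M"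
      using prems sb by (auto simp: frame_def)
    have kv: "k \<notin> set vs" "Suc k \<notin> set vs" using prems by (auto simp: frame_def)
    have f1: "frame S R \<rho> M vs (Suc k) s" using frame_Suc[OF prems(1), of "s k"] by simp
    have xM: "?x \<le> poly (val_bound a) M" using prems sb by (auto intro!: val_le simp: frame_def)
    have "set vs \<subseteq> {S<..<k}" using prems by (auto simp: frame_def)
    then have 1: "does (compile a vs (Suc k) k) s (poly (time_bound a) M) (s(k := replicate ?x True))"
      using compilesD[OF C f1, of k] prems k kv by auto
    let ?body = "Seq (Pop k) (If (Suc r) 0 (Pop (Suc r)) (Seq (copy_top (Suc r) (Suc k)) (Pop (Suc r))))"
    have 2: "does (While k ?body) (s(k := replicate ?x True)) (poly (val_bound a) M * 7 + 1) (?I ?x)"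
    proof (rule does_While'[where m = ?x and \<tau> = 6 and I = ?I])
      fix i assume i: "i < ?x"
      let ?s = "?I i" let ?t = "?s(k := tl (?s k))"
      have "does (If (Suc r) 0 (Pop (Suc r)) (Seq (copy_top (Suc r) (Suc k)) (Pop (Suc r)))) ?t
         (Suc 4) (?I (Suc i))"
      proof (rule does_If)
        assume "top_symbol (?t (Suc r)) = 0"
        then have d: "length (R r) \<le> i" using k by auto
        then have "?t = ?I (Suc i)" using k by (auto simp: fun_eq_iff)
        then show "does (Pop (Suc r)) ?t 4 (?I (Suc i))"
          using does_mono[OF does_Pop_empty[of ?t "Suc r"], of 4] d k by simp
      next
        assume "top_symbol (?t (Suc r)) \<noteq> 0"
        then have d: "i < length (R r)" using k by auto
        let ?t1 = "?t(Suc k := hd (?t (Suc r)) # ?t (Suc k))"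
        have "does (Seq (copy_top (Suc r) (Suc k)) (Pop (Suc r))) ?t (3 + 1)
            (?t1(Suc r := tl (?t1 (Suc r))))"
          by (rule does_Seq[OF does_copy_top does_Pop]) (use d k in auto)
        moreover have "?t1(Suc r := tl (?t1 (Suc r))) = ?I (Suc i)"
          using d k by (auto simp: fun_eq_iff take_Suc_conv_app_nth hd_drop_conv_nth drop_Suc tl_drop)
        ultimately show "does (Seq (copy_top (Suc r) (Suc k)) (Pop (Suc r))) ?t 4 (?I (Suc i))"
          by simp
      qed simp
      with does_Seq[OF does_Pop[of k ?s]] have "does ?body ?s (1 + Suc 4) (?I (Suc i))" by blast
      then show "?s k \<noteq> [] \<and> does ?body ?s 6 (?I (Suc i))" using i k by simp
    qed (use k xM in \<open>auto simp: fun_eq_iff\<close>)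
    let ?s4 = "(?I ?x)(g := replicate (of_bool (bit_at (R r) ?x)) True @ s g)"
    have g: "g \<noteq> k" "g \<noteq> Suc k" "g \<noteq> Suc r" using prems k by auto
    have 3: "does (If (Suc r) 2 (Push g True) (Pop k)) (?I ?x) (Suc 2) ?s4"
    proof (rule does_If)
      assume "top_symbol (?I ?x (Suc r)) = 2"
      then have "bit_at (R r) ?x" using k by (auto simp: bit_at_def hd_drop_conv_nth)
      then show "does (Push g True) (?I ?x) 2 ?s4" using does_Push[of g True "?I ?x"] g by simp
    next
      assume "top_symbol (?I ?x (Suc r)) \<noteq> 2"
      then have "\<not> bit_at (R r) ?x" using k by (auto simp: bit_at_def hd_drop_conv_nth)
      then have "?s4 = ?I ?x" using g by (auto simp: fun_eq_iff)
      then show "does (Pop k) (?I ?x) 2 ?s4"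
        using does_mono[OF does_Pop_empty[of "?I ?x" k], of 2] k by simp
    qed simp
    have 4: "does (move_all (Suc k) (Suc r)) ?s4 (5 * M + 1)
        (?s4(Suc k := [], Suc r := rev (?s4 (Suc k)) @ ?s4 (Suc r)))"
      using k g by (intro does_move_all) auto
    have eq: "?s4(Suc k := [], Suc r := rev (?s4 (Suc k)) @ ?s4 (Suc r)) =
        s(g := replicate (val (Get r a) R \<rho>) True @ s g)"
      using k g by (auto simp: fun_eq_iff)
    show ?goal unfolding compile.simps
      by (rule does_mono[OF does_Seq[OF does_Seq[OF 1 2] does_Seq[OF 3 4], unfolded eq]])
        (simp add: algebra_simps)
  qed
next
  case (Len r)
  show ?case
  proof (rule compilesI)
    fix \<rho> M vs k s g assume prems: "frame S R \<rho> M vs k s" "S < g" "g < k" "g \<notin> set vs"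
    let ?goal = "does (compile (Len r) vs k g) s (poly (time_bound (Len r)) M) (s(g := replicate (val (Len r) R \<rho>) True @ s g))"
    have "does (add_length (Suc r) k g) s (12 * M + 2) (s(g := replicate (length (s (Suc r))) True @ s g))"
      using prems Len unfolding frame_def by (intro does_add_length) auto
    moreover have "s (Suc r) = R r" using prems Len by (auto simp: frame_def)
    ultimately show ?goal by (simp add: mult.commute)
  qed
next
  case (Sum a b)
  then have C: "compiles S R a" "compiles S R b" and sb: "strings_below S a" "strings_below S b" by auto
  show ?case
  proof (rule compilesI)
    fix \<rho> M vs k s g assume prems: "frame S R \<rho> M vs k s" "S < g" "g < k" "g \<notin> set vs"
    let ?goal = "does (compile (Sum a b) vs k g) s (poly (time_bound (Sum a b)) M) (s(g := replicate (val (Sum a b) R \<rho>) True @ s g))"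
    let ?x = "val a R \<rho>" and ?N = "M + poly (val_bound a) M"
    let ?I = "\<lambda>i. s(k := replicate (?x - i) True, Suc k := replicate i True,
       g := replicate (\<Sum>v<i. val b R (case_nat v \<rho>)) True @ s g)"
    have k: "S < k" "\<And>r. k \<le> r \<Longrightarrow> s r = []" "set vs \<subseteq> {S<..<k}" using prems by (auto simp: frame_def)
    have g: "g \<noteq> k" "g \<noteq> Suc k" using prems by auto
    have kv: "k \<notin> set vs" "Suc k \<notin> set vs" using prems by (auto simp: frame_def)
    have f1: "frame S R \<rho> M vs (Suc k) s" using frame_Suc[OF prems(1), of "s k"] by simp
    have xM: "?x \<le> poly (val_bound a) M" using prems sb by (auto intro!: val_le simp: frame_def)
    have 1: "does (compile a vs (Suc k) k) s (poly (time_bound a) M) (s(k := replicate ?x True))"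
      using compilesD[OF C(1) f1, of k] prems k kv by auto
    let ?body = "Seq (Pop k) (Seq (compile b (Suc k # vs) (Suc (Suc k)) g) (Push (Suc k) True))"
    have 2: "does (While k ?body) (s(k := replicate ?x True))
        (poly (val_bound a) M * (4 + poly (time_bound b) ?N) + 1) (?I ?x)"
    proof (rule does_While'[where m = ?x and \<tau> = "1 + (poly (time_bound b) ?N + 2)" and I = ?I])
      fix i assume i: "i < ?x"
      let ?s = "?I i" let ?t = "?s(k := tl (?s k))"
      let ?t1 = "?t(g := replicate (val b R (case_nat i \<rho>)) True @ ?t g)"
      have kn: "vs ! x \<noteq> k" "vs ! x \<noteq> Suc k" if "x < length vs" for x
        using kv nth_mem[OF that] by auto
      have "frame S R (case_nat i \<rho>) ?N (Suc k # vs) (Suc (Suc k)) ?t"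
        using prems k g i xM kn
        by (auto simp: frame_def nth_Cons split: nat.splits intro: trans_le_add1)
      then have "does (compile b (Suc k # vs) (Suc (Suc k)) g) ?t (poly (time_bound b) ?N) ?t1"
        using prems k g by (intro compilesD[OF C(2)]) auto
      then have "does ?body ?s (1 + (poly (time_bound b) ?N + 2)) (?t1(Suc k := True # ?t1 (Suc k)))"
        by (rule does_Seq[OF does_Pop does_Seq[OF _ does_Push]])
      moreover have "?t1(Suc k := True # ?t1 (Suc k)) = ?I (Suc i)"
        using g by (auto simp: fun_eq_iff add.commute[of "sum _ _"] replicate_add)
      ultimately show "?s k \<noteq> [] \<and> does ?body ?s (1 + (poly (time_bound b) ?N + 2)) (?I (Suc i))"
        using i g by simp
    next
      have "?x * Suc (1 + (poly (time_bound b) ?N + 2)) + 1 \<le>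
          poly (val_bound a) M * Suc (1 + (poly (time_bound b) ?N + 2)) + 1"
        using xM by (intro add_mono mult_right_mono) auto
      then show "?x * Suc (1 + (poly (time_bound b) ?N + 2)) + 1 \<le>
          poly (val_bound a) M * (4 + poly (time_bound b) ?N) + 1" by (simp add: algebra_simps)
    qed (use k g in \<open>auto simp: fun_eq_iff\<close>)
    have 3: "does (clear (Suc k)) (?I ?x) (2 * poly (val_bound a) M + 1) ((?I ?x)(Suc k := []))"
      using xM g by (intro does_clear) auto
    have eq: "(?I ?x)(Suc k := []) = s(g := replicate (val (Sum a b) R \<rho>) True @ s g)"
      using k g by (auto simp: fun_eq_iff)
    show ?goal unfolding compile.simps
      by (rule does_mono[OF does_Seq[OF does_Seq[OF 1 2] 3, unfolded eq]])
        (simp add: algebra_simps poly_pcompose)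
  qed
qed

lemma wf_com_clear [simp]: "wf_com K (clear a) \<longleftrightarrow> 0 < a \<and> a < K"
  by (auto simp: clear_def)

lemma wf_com_copy_top [simp]: "wf_com K (copy_top a b) \<longleftrightarrow> a < K \<and> 0 < b \<and> b < K"
  by (auto simp: copy_top_def)

lemma wf_com_move_all [simp]: "wf_com K (move_all a b) \<longleftrightarrow> 0 < a \<and> a < K \<and> 0 < b \<and> b < K"
  by (auto simp: move_all_def)

lemma wf_com_add_length [simp]:
  "wf_com K (add_length r k g) \<longleftrightarrow> 0 < r \<and> r < K \<and> 0 < k \<and> k < K \<and> 0 < g \<and> g < K"
  by (auto simp: add_length_def)

text \<open>Compiled programs run on any sufficiently large number of tapes, so that the number needed never has to be computed.\<close>

lemma eventually_wf_compile:
  "strings_below S e \<Longrightarrow> S < k \<Longrightarrow> set vs \<subseteq> {0<..<k} \<Longrightarrow> 0 < g \<Longrightarrow> g < k \<Longrightarrow>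
    eventually (\<lambda>K. wf_com K (compile e vs k g)) sequentially"
proof (induction e arbitrary: vs k g)
  case (Arg i)
  then have "i < length vs \<Longrightarrow> 0 < vs ! i" by (meson greaterThanLessThan_iff nth_mem subsetD)
  with Arg show ?case by (auto simp: eventually_conj_iff)
next
  case (Sum a b)
  then have "eventually (\<lambda>K. wf_com K (compile b (Suc k # vs) (Suc (Suc k)) g)) sequentially"
    by (intro Sum.IH(2)) auto
  moreover have "eventually (\<lambda>K. wf_com K (compile a vs (Suc k) k)) sequentially"
    using Sum by (intro Sum.IH(1)) auto
  ultimately show ?case using Sum.prems by (auto simp: eventually_conj_iff)
next
  case (Less a b)
  have "eventually (\<lambda>K. wf_com K (compile a vs (Suc k) k)) sequentially"
    using Less.prems by (intro Less.IH(1)) auto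
  moreover have "eventually (\<lambda>K. wf_com K (compile b vs (Suc (Suc k)) (Suc k))) sequentially"
    using Less.prems by (intro Less.IH(2)) auto
  ultimately show ?case using Less.prems by (auto simp: eventually_conj_iff)
next
  case (Get r a)
  have "eventually (\<lambda>K. wf_com K (compile a vs (Suc k) k)) sequentially"
    using Get.prems by (intro Get.IH) auto
  then show ?case using Get.prems by (auto simp: eventually_conj_iff)
qed (auto simp: eventually_conj_iff)

section \<open>Programs with output\<close>

text \<open>\<open>Emit a\<close> puts out the bit \<open>0 < a\<close>; \<open>For a p\<close> binds the variable 0 in \<open>p\<close>, which takes the
  values \<open>0, \<dots>, a - 1\<close>.\<close>

datatype prog = Emit expr | Cat prog prog | For expr prog

text \<open>The output, the restriction to strings below a number, and bounds for the length of the output and for the running time\<close>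

fun out :: "prog \<Rightarrow> store \<Rightarrow> (nat \<Rightarrow> nat) \<Rightarrow> bits" where
  "out (Emit a) R \<rho> = [0 < val a R \<rho>]"
| "out (Cat p q) R \<rho> = out p R \<rho> @ out q R \<rho>"
| "out (For a p) R \<rho> = concat (map (\<lambda>v. out p R (case_nat v \<rho>)) [0..<val a R \<rho>])"

fun prog_below :: "nat \<Rightarrow> prog \<Rightarrow> bool" where
  "prog_below S (Emit a) \<longleftrightarrow> strings_below S a"
| "prog_below S (Cat p q) \<longleftrightarrow> prog_below S p \<and> prog_below S q"
| "prog_below S (For a p) \<longleftrightarrow> strings_below S a \<and> prog_below S p"

fun length_bound :: "prog \<Rightarrow> nat poly" where
  "length_bound (Emit a) = 1"
| "length_bound (Cat p q) = length_bound p + length_bound q"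
| "length_bound (For a p) = val_bound a * pcompose (length_bound p) ([:0, 1:] + val_bound a)"

fun prog_time :: "prog \<Rightarrow> nat poly" where
  "prog_time (Emit a) = [:4:] + time_bound a + [:2:] * val_bound a"
| "prog_time (Cat p q) = prog_time p + prog_time q"
| "prog_time (For a p) = [:2:] + time_bound a
    + val_bound a * ([:6:] + pcompose (prog_time p) ([:0, 1:] + val_bound a))"

fun compile_prog :: "prog \<Rightarrow> nat list \<Rightarrow> nat \<Rightarrow> nat \<Rightarrow> com" where
  "compile_prog (Emit a) vs k g =
     Seq (compile a vs (Suc k) k) (Seq (If k 0 (Push g False) (Push g True)) (clear k))"
| "compile_prog (Cat p q) vs k g = Seq (compile_prog p vs k g) (compile_prog q vs k g)"
| "compile_prog (For a p) vs k g =
     Seq (Seq (compile a vs (Suc k) k)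
         (While k (Seq (Pop k) (Seq (compile_prog p (Suc k # vs) (Suc (Suc k)) g) (Push (Suc k) True)))))
       (clear (Suc k))"

lemma length_out_le:
  assumes "prog_below S p" "\<And>r. r < S \<Longrightarrow> length (R r) \<le> M" "\<And>i. \<rho> i \<le> M"
  shows "length (out p R \<rho>) \<le> poly (length_bound p) M"
  using assms
proof (induction p arbitrary: \<rho> M)
  case (Cat p q)
  then show ?case by (auto intro!: add_mono)
next
  case (For a p)
  let ?n = "val a R \<rho>" and ?N = "poly (val_bound a) M"
  have n: "?n \<le> ?N" using For val_le[of S a R M \<rho>] by auto
  have "length (out p R (case_nat v \<rho>)) \<le> poly (length_bound p) (M + ?N)" if "v < ?n" for v
  proof (rule For.IH)
    show "length (R r) \<le> M + ?N" if "r < S" for r using For that by (meson trans_le_add1)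
    show "(case i of 0 \<Rightarrow> v | Suc i \<Rightarrow> \<rho> i) \<le> M + ?N" for i
      using that n For.prems(3) by (cases i) (auto intro: trans_le_add1)
  qed (use For in auto)
  then have "(\<Sum>v<?n. length (out p R (case_nat v \<rho>))) \<le> ?n * poly (length_bound p) (M + ?N)"
    using sum_bounded_above[of "{..<?n}" "\<lambda>v. length (out p R (case_nat v \<rho>))"] by simp
  then have "length (out (For a p) R \<rho>) \<le> ?n * poly (length_bound p) (M + ?N)"
    by (simp add: length_concat comp_def interv_sum_list_conv_sum_set_nat atLeast0LessThan)
  also have "\<dots> \<le> ?N * poly (length_bound p) (M + ?N)" using n by (rule mult_right_mono) simp
  finally show ?case by (simp add: poly_pcompose)
qed auto

text \<open>Being pushed one after the other, the bits put out appear on the stack \<open>g\<close> in reverse order.\<close>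

definition prog_compiles :: "nat \<Rightarrow> store \<Rightarrow> prog \<Rightarrow> bool" where
  "prog_compiles S R p \<longleftrightarrow> (\<forall>\<rho> M vs k s g. frame S R \<rho> M vs k s \<and> S < g \<and> g < k \<and> g \<notin> set vs \<longrightarrow>
     does (compile_prog p vs k g) s (poly (prog_time p) M) (s(g := rev (out p R \<rho>) @ s g)))"

lemma prog_compilesI:
  assumes "\<And>\<rho> M vs k s g. frame S R \<rho> M vs k s \<Longrightarrow> S < g \<Longrightarrow> g < k \<Longrightarrow> g \<notin> set vs \<Longrightarrow>
     does (compile_prog p vs k g) s (poly (prog_time p) M) (s(g := rev (out p R \<rho>) @ s g))"
  shows "prog_compiles S R p"
  using assms by (auto simp: prog_compiles_def)

lemma prog_compilesD: "prog_compiles S R p \<Longrightarrow> frame S R \<rho> M vs k s \<Longrightarrow> S < g \<Longrightarrow> g < k \<Longrightarrow> g \<notin> set vs \<Longrightarrow>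
     does (compile_prog p vs k g) s (poly (prog_time p) M) (s(g := rev (out p R \<rho>) @ s g))"
  by (auto simp: prog_compiles_def)

theorem prog_compiles_below: "prog_below S p \<Longrightarrow> prog_compiles S R p"
proof (induction p)
  case (Emit a)
  then have C: "compiles S R a" and sb: "strings_below S a" using compiles_expr by auto
  show ?case
  proof (rule prog_compilesI)
    fix \<rho> M vs k s g assume prems: "frame S R \<rho> M vs k s" "S < g" "g < k" "g \<notin> set vs"
    let ?x = "val a R \<rho>"
    let ?s1 = "s(k := replicate ?x True)" let ?s2 = "?s1(g := (0 < ?x) # s g)"
    have k: "S < k" "s k = []" "k \<notin> set vs" using prems by (auto simp: frame_def)
    have xM: "?x \<le> poly (val_bound a) M" using prems sb by (auto intro!: val_le simp: frame_def)
    have f1: "frame S R \<rho> M vs (Suc k) s" using frame_Suc[OF prems(1), of "s k"] by simp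
    have 1: "does (compile a vs (Suc k) k) s (poly (time_bound a) M) ?s1"
      using compilesD[OF C f1, of k] k by auto
    have 2: "does (If k 0 (Push g False) (Push g True)) ?s1 (Suc 2) ?s2"
    proof (rule does_If)
      assume "top_symbol (?s1 k) = 0"
      then show "does (Push g False) ?s1 2 ?s2" using does_Push[of g False ?s1] prems by simp
    next
      assume "top_symbol (?s1 k) \<noteq> 0"
      then show "does (Push g True) ?s1 2 ?s2" using does_Push[of g True ?s1] prems by simp
    qed (use k in simp)
    have 3: "does (clear k) ?s2 (2 * poly (val_bound a) M + 1) (?s2(k := []))"
      by (rule does_clear) (use xM k prems in auto)
    have eq: "?s2(k := []) = s(g := rev (out (Emit a) R \<rho>) @ s g)"
      using k prems by (auto simp: fun_eq_iff)
    show "does (compile_prog (Emit a) vs k g) s (poly (prog_time (Emit a)) M)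
        (s(g := rev (out (Emit a) R \<rho>) @ s g))"
      unfolding compile_prog.simps
      by (rule does_mono[OF does_Seq[OF 1 does_Seq[OF 2 3], unfolded eq]]) (simp add: algebra_simps)
  qed
next
  case (Cat p q)
  then have C: "prog_compiles S R p" "prog_compiles S R q" by auto
  show ?case
  proof (rule prog_compilesI)
    fix \<rho> M vs k s g assume prems: "frame S R \<rho> M vs k s" "S < g" "g < k" "g \<notin> set vs"
    let ?s1 = "s(g := rev (out p R \<rho>) @ s g)"
    have "does (compile_prog q vs k g) ?s1 (poly (prog_time q) M) (?s1(g := rev (out q R \<rho>) @ ?s1 g))"
      using prems by (intro prog_compilesD[OF C(2) frame_update]) auto
    from does_Seq[OF prog_compilesD[OF C(1) prems] this]
    show "does (compile_prog (Cat p q) vs k g) s (poly (prog_time (Cat p q)) M)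
        (s(g := rev (out (Cat p q) R \<rho>) @ s g))" by simp
  qed
next
  case (For a p)
  then have C: "compiles S R a" "prog_compiles S R p" and sb: "strings_below S a" using compiles_expr by auto
  show ?case
  proof (rule prog_compilesI)
    fix \<rho> M vs k s g assume prems: "frame S R \<rho> M vs k s" "S < g" "g < k" "g \<notin> set vs"
    let ?x = "val a R \<rho>" and ?N = "M + poly (val_bound a) M"
    let ?I = "\<lambda>i. s(k := replicate (?x - i) True, Suc k := replicate i True,
       g := rev (concat (map (\<lambda>v. out p R (case_nat v \<rho>)) [0..<i])) @ s g)"
    have k: "S < k" "\<And>r. k \<le> r \<Longrightarrow> s r = []" "set vs \<subseteq> {S<..<k}" using prems by (auto simp: frame_def)
    have kv: "k \<notin> set vs" "Suc k \<notin> set vs" using prems by (auto simp: frame_def)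
    have g: "g \<noteq> k" "g \<noteq> Suc k" using prems by auto
    have f1: "frame S R \<rho> M vs (Suc k) s" using frame_Suc[OF prems(1), of "s k"] by simp
    have xM: "?x \<le> poly (val_bound a) M" using prems sb by (auto intro!: val_le simp: frame_def)
    have 1: "does (compile a vs (Suc k) k) s (poly (time_bound a) M) (s(k := replicate ?x True))"
      using compilesD[OF C(1) f1, of k] k kv by auto
    let ?body = "Seq (Pop k) (Seq (compile_prog p (Suc k # vs) (Suc (Suc k)) g) (Push (Suc k) True))"
    have 2: "does (While k ?body) (s(k := replicate ?x True))
        (poly (val_bound a) M * (4 + poly (prog_time p) ?N) + 1) (?I ?x)"
    proof (rule does_While'[where m = ?x and \<tau> = "1 + (poly (prog_time p) ?N + 2)" and I = ?I])
      fix i assume i: "i < ?x"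
      let ?s = "?I i" let ?t = "?s(k := tl (?s k))"
      let ?t1 = "?t(g := rev (out p R (case_nat i \<rho>)) @ ?t g)"
      have kn: "vs ! x \<noteq> k" "vs ! x \<noteq> Suc k" if "x < length vs" for x
        using kv nth_mem[OF that] by auto
      have "frame S R (case_nat i \<rho>) ?N (Suc k # vs) (Suc (Suc k)) ?t"
        using prems k g i xM kn
        by (auto simp: frame_def nth_Cons split: nat.splits intro: trans_le_add1)
      then have "does (compile_prog p (Suc k # vs) (Suc (Suc k)) g) ?t (poly (prog_time p) ?N) ?t1"
        using prems k g by (intro prog_compilesD[OF C(2)]) auto
      then have "does ?body ?s (1 + (poly (prog_time p) ?N + 2)) (?t1(Suc k := True # ?t1 (Suc k)))"
        by (rule does_Seq[OF does_Pop does_Seq[OF _ does_Push]])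
      moreover have "?t1(Suc k := True # ?t1 (Suc k)) = ?I (Suc i)"
        using g by (auto simp: fun_eq_iff)
      ultimately show "?s k \<noteq> [] \<and> does ?body ?s (1 + (poly (prog_time p) ?N + 2)) (?I (Suc i))"
        using i g by simp
    next
      have "?x * Suc (1 + (poly (prog_time p) ?N + 2)) + 1 \<le>
          poly (val_bound a) M * Suc (1 + (poly (prog_time p) ?N + 2)) + 1"
        using xM by (intro add_mono mult_right_mono) auto
      then show "?x * Suc (1 + (poly (prog_time p) ?N + 2)) + 1 \<le>
          poly (val_bound a) M * (4 + poly (prog_time p) ?N) + 1" by (simp add: algebra_simps)
    qed (use k g in \<open>auto simp: fun_eq_iff\<close>)
    have 3: "does (clear (Suc k)) (?I ?x) (2 * poly (val_bound a) M + 1) ((?I ?x)(Suc k := []))"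
      using xM g by (intro does_clear) auto
    have eq: "(?I ?x)(Suc k := []) = s(g := rev (out (For a p) R \<rho>) @ s g)"
      using k g by (auto simp: fun_eq_iff)
    show "does (compile_prog (For a p) vs k g) s (poly (prog_time (For a p)) M)
        (s(g := rev (out (For a p) R \<rho>) @ s g))"
      unfolding compile_prog.simps
      by (rule does_mono[OF does_Seq[OF does_Seq[OF 1 2] 3, unfolded eq]])
        (simp add: algebra_simps poly_pcompose)
  qed
qed

lemma eventually_wf_compile_prog:
  "prog_below S p \<Longrightarrow> S < k \<Longrightarrow> set vs \<subseteq> {0<..<k} \<Longrightarrow> 0 < g \<Longrightarrow> g < k \<Longrightarrow>
    eventually (\<lambda>K. wf_com K (compile_prog p vs k g)) sequentially"
proof (induction p arbitrary: vs k g)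
  case (Emit a)
  have "eventually (\<lambda>K. wf_com K (compile a vs (Suc k) k)) sequentially"
    using Emit by (intro eventually_wf_compile) auto
  then show ?case using Emit by (auto simp: eventually_conj_iff)
next
  case (For a p)
  have "eventually (\<lambda>K. wf_com K (compile_prog p (Suc k # vs) (Suc (Suc k)) g)) sequentially"
    using For.prems by (intro For.IH) auto
  moreover have "eventually (\<lambda>K. wf_com K (compile a vs (Suc k) k)) sequentially"
    using For by (intro eventually_wf_compile) auto
  ultimately show ?case using For.prems by (auto simp: eventually_conj_iff)
qed (auto simp: eventually_conj_iff)

lemma val_cong: "strings_below S e \<Longrightarrow> (\<And>r. r < S \<Longrightarrow> R r = R' r) \<Longrightarrow> val e R \<rho> = val e R' \<rho>"
  by (induction e arbitrary: \<rho>) auto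

lemma out_cong: "prog_below S p \<Longrightarrow> (\<And>r. r < S \<Longrightarrow> R r = R' r) \<Longrightarrow> out p R \<rho> = out p R' \<rho>"
proof (induction p arbitrary: \<rho>)
  case (Emit a)
  then have "val a R \<rho> = val a R' \<rho>" by (intro val_cong) auto
  then show ?case by simp
next
  case (For a p)
  then have "val a R \<rho> = val a R' \<rho>" by (intro val_cong) auto
  moreover have "out p R \<rho>' = out p R' \<rho>'" for \<rho>' using For by auto
  ultimately show ?case by simp
qed simp

section \<open>Running programs in sequence and in loops\<close>

text \<open>The strings \<open>0, \<dots>, S - 1\<close> on the stacks \<open>1, \<dots>, S\<close>\<close>

definition store_of :: "nat \<Rightarrow> store \<Rightarrow> store" where
  "store_of S R = (\<lambda>t. if 0 < t \<and> t \<le> S then R (t - 1) else [])"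

text \<open>The output of \<open>p\<close> becomes the string \<open>r\<close>.\<close>

definition assign :: "nat \<Rightarrow> nat \<Rightarrow> prog \<Rightarrow> com" where
  "assign S r p = Seq (compile_prog p [] (Suc (Suc S)) (Suc S))
     (Seq (clear (Suc r)) (move_all (Suc S) (Suc r)))"

lemma does_assign:
  assumes "prog_below S p" "r < S" "\<And>r. r < S \<Longrightarrow> length (R r) \<le> M" "length (out p R (\<lambda>_. 0)) \<le> M"
  shows "does (assign S r p) (store_of S R) (poly (prog_time p) M + (7 * M + 2))
    (store_of S (R(r := out p R (\<lambda>_. 0))))"
proof -
  let ?s = "store_of S R" and ?o = "out p R (\<lambda>_. 0)"
  let ?s1 = "?s(Suc S := rev ?o)" let ?s2 = "?s1(Suc r := [])"
  have "frame S R (\<lambda>_. 0) M [] (Suc (Suc S)) ?s" using assms by (auto simp: frame_def store_of_def)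
  then have "does (compile_prog p [] (Suc (Suc S)) (Suc S)) ?s (poly (prog_time p) M)
      (?s(Suc S := rev ?o @ ?s (Suc S)))"
    using prog_compilesD[OF prog_compiles_below[OF assms(1)]] by auto
  moreover have "?s (Suc S) = []" by (simp add: store_of_def)
  ultimately have 1: "does (compile_prog p [] (Suc (Suc S)) (Suc S)) ?s (poly (prog_time p) M) ?s1"
    by simp
  have 2: "does (clear (Suc r)) ?s1 (2 * M + 1) ?s2"
    using assms by (intro does_clear) (auto simp: store_of_def)
  have 3: "does (move_all (Suc S) (Suc r)) ?s2 (5 * M + 1)
      (?s2(Suc S := [], Suc r := rev (?s2 (Suc S)) @ ?s2 (Suc r)))"
    using assms by (intro does_move_all) auto
  have eq: "?s2(Suc S := [], Suc r := rev (?s2 (Suc S)) @ ?s2 (Suc r)) = store_of S (R(r := ?o))"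
    using assms by (auto simp: fun_eq_iff store_of_def)
  show ?thesis unfolding assign_def
    by (rule does_mono[OF does_Seq[OF 1 does_Seq[OF 2 3], unfolded eq]]) simp
qed

lemma eventually_wf_assign:
  "prog_below S p \<Longrightarrow> r < S \<Longrightarrow> eventually (\<lambda>K. wf_com K (assign S r p)) sequentially"
  unfolding assign_def using eventually_wf_compile_prog[of S p "Suc (Suc S)" "[]" "Suc S"]
  by (auto simp: eventually_conj_iff)

text \<open>The string \<open>r\<close> is initialized by \<open>i\<close> and then transformed by \<open>p\<close> as often as the initial value of \<open>a\<close>,
  which is kept in unary in the string \<open>c\<close>.\<close>

definition iterate :: "nat \<Rightarrow> nat \<Rightarrow> nat \<Rightarrow> expr \<Rightarrow> prog \<Rightarrow> prog \<Rightarrow> com" where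
  "iterate S r c a i p = Seq (Seq (assign S c (For a (Emit One))) (assign S r i))
     (While (Suc c) (Seq (Pop (Suc c)) (assign S r p)))"

definition iterate_time :: "expr \<Rightarrow> prog \<Rightarrow> prog \<Rightarrow> nat poly" where
  "iterate_time a i p = prog_time (For a (Emit One)) + prog_time i + [:5, 14:]
     + [:0, 1:] * ([:4, 7:] + prog_time p)"

lemma does_iterate:
  assumes "prog_below S p" "prog_below S i" "strings_below S a" "r < S" "c < S" "c \<noteq> r"
    and S: "\<And>r. r < S \<Longrightarrow> length (R r) \<le> M" and a: "val a R (\<lambda>_. 0) = n" "n \<le> M"
    and i: "\<And>l. out i (R(c := l)) (\<lambda>_. 0) = y"
    and p: "\<And>l l'. out p (R(c := l, r := l')) (\<lambda>_. 0) = f l'"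
    and f: "\<And>j. length ((f ^^ j) y) \<le> M"
  shows "does (iterate S r c a i p) (store_of S R) (poly (iterate_time a i p) M)
    (store_of S (R(c := [], r := (f ^^ n) y)))"
proof -
  let ?J = "\<lambda>i. R(c := replicate (n - i) True, r := (f ^^ i) y)"
  let ?I = "\<lambda>i. store_of S (?J i)"
  have o: "out (For a (Emit One)) R (\<lambda>_. 0) = replicate n True"
    using a by (simp add: concat_map_singleton map_replicate_const)
  have 1: "does (assign S c (For a (Emit One))) (store_of S R)
      (poly (prog_time (For a (Emit One))) M + (7 * M + 2)) (store_of S (R(c := replicate n True)))"
    using does_assign[of S "For a (Emit One)" c R M] assms o by simp
  have y: "length y \<le> M" using f[of 0] by simp
  have 2: "does (assign S r i) (store_of S (R(c := replicate n True)))
      (poly (prog_time i) M + (7 * M + 2)) (?I 0)"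
    using does_assign[of S i r "R(c := replicate n True)" M] assms y by simp
  have 3: "does (While (Suc c) (Seq (Pop (Suc c)) (assign S r p))) (?I 0)
      (M * (4 + (poly (prog_time p) M + 7 * M)) + 1) (?I n)"
  proof (rule does_While'[where m = n and \<tau> = "1 + (poly (prog_time p) M + (7 * M + 2))" and I = ?I])
    fix i assume i: "i < n"
    let ?s = "?I i" and ?l = "replicate (n - Suc i) True"
    have "?s(Suc c := tl (?s (Suc c))) = store_of S (R(c := ?l, r := (f ^^ i) y))"
      using assms(5,6) i by (auto simp: fun_eq_iff store_of_def)
    moreover have "does (assign S r p) (store_of S (R(c := ?l, r := (f ^^ i) y)))
        (poly (prog_time p) M + (7 * M + 2)) (store_of S ((R(c := ?l, r := (f ^^ i) y))
           (r := out p (R(c := ?l, r := (f ^^ i) y)) (\<lambda>_. 0))))"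
    proof (rule does_assign)
      show "length (out p (R(c := ?l, r := (f ^^ i) y)) (\<lambda>_. 0)) \<le> M"
        using f[of "Suc i"] by (simp add: p)
      show "length ((R(c := ?l, r := (f ^^ i) y)) r') \<le> M" if "r' < S" for r'
        using S that a f[of i] i by auto
    qed (use assms in auto)
    moreover have "(R(c := ?l, r := (f ^^ i) y))(r := out p (R(c := ?l, r := (f ^^ i) y)) (\<lambda>_. 0)) =
        ?J (Suc i)" by (simp add: p)
    ultimately have "does (Seq (Pop (Suc c)) (assign S r p)) ?s
        (1 + (poly (prog_time p) M + (7 * M + 2))) (?I (Suc i))"
      using does_Seq[OF does_Pop[of "Suc c" ?s]] by metis
    then show "?s (Suc c) \<noteq> [] \<and> does (Seq (Pop (Suc c)) (assign S r p)) ?s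
        (1 + (poly (prog_time p) M + (7 * M + 2))) (?I (Suc i))"
      using i assms(5,6) by (simp add: store_of_def)
  next
    have "n * Suc (1 + (poly (prog_time p) M + (7 * M + 2))) + 1 \<le>
        M * Suc (1 + (poly (prog_time p) M + (7 * M + 2))) + 1"
      using a by (intro add_mono mult_right_mono) auto
    then show "n * Suc (1 + (poly (prog_time p) M + (7 * M + 2))) + 1 \<le>
        M * (4 + (poly (prog_time p) M + 7 * M)) + 1" by (simp add: algebra_simps)
  qed (use assms(5,6) in \<open>auto simp: store_of_def\<close>)
  have eq: "R(c := replicate (n - n) True, r := (f ^^ n) y) = R(c := [], r := (f ^^ n) y)"
    by simp
  show ?thesis unfolding iterate_def
    by (rule does_mono[OF does_Seq[OF does_Seq[OF 1 2] 3, unfolded eq]])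
      (simp add: iterate_time_def algebra_simps)
qed

lemma eventually_wf_iterate:
  "prog_below S p \<Longrightarrow> prog_below S i \<Longrightarrow> strings_below S a \<Longrightarrow> r < S \<Longrightarrow> c < S \<Longrightarrow>
    eventually (\<lambda>K. wf_com K (iterate S r c a i p)) sequentially"
  unfolding iterate_def
  using eventually_wf_assign[of S "For a (Emit One)" c] eventually_wf_assign[of S p r]
    eventually_wf_assign[of S i r]
  by (auto simp: eventually_conj_iff)

section \<open>Input and output\<close>

text \<open>The input is copied to the stack 1, by way of the stack 2; the output is taken from the stack 4.\<close>

definition load :: com where
  "load = Seq (Seq (Seq (While 0 (Seq (If 0 2 (Push 2 True) (Push 2 False)) (Move 1))) (Move (-1)))
     (Seq (While 0 (Move (-1))) (Move 1))) (move_all 2 1)"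

definition unload :: com where
  "unload = Seq (While 4 (Seq (If 4 2 (Put 2 1) (Put 1 1)) (Pop 4))) (Put 0 0)"

lemma act_scan_move: "act (scan tp, d) tp = (fst tp, snd tp + d)"
  by (cases tp) (auto simp: scan_def)

lemma takes_Move: "takes (Move d) ((c, h), s) 1 ((c, h + d), s)"
  using exec.Move[of d "(c, h)" s] unfolding takes_def act_scan_move by auto

lemma takes_Put: "takes (Put a d) (tp, s) 1 (act (a, d) tp, s)"
  using exec.Put[of a d tp s] by (auto simp: takes_def)

lemma input_tape_nat: "input_tape w (int i) = (if i < length w then bit_symbol (w ! i) else 0)"
  by (auto simp: input_tape_def)

lemma takes_load:
  "takes load ((input_tape w, 0), \<lambda>_. []) (12 * length w + 5) ((input_tape w, 0), (\<lambda>_. [])(1 := w))"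
proof -
  let ?n = "length w" and ?s = "(\<lambda>_. [])(2 := rev w) :: store"
  let ?I = "\<lambda>i. ((input_tape w, int i), (\<lambda>_. [])(2 := rev (take i w))) :: tape \<times> store"
  have 1: "takes (While 0 (Seq (If 0 2 (Push 2 True) (Push 2 False)) (Move 1))) (?I 0)
      (?n * Suc (Suc 2 + 1) + 1) (?I ?n)"
  proof (rule takes_While)
    fix i assume i: "i < ?n"
    have sc: "scanned (?I i) 0 = bit_symbol (w ! i)"
      using i by (simp add: scanned_def scan_def input_tape_nat)
    have eq: "rev (take (Suc i) w) = w ! i # rev (take i w)"
      using i by (simp add: take_Suc_conv_app_nth)
    have push: "takes (Push 2 b) (?I i) 2 ((input_tape w, int i), (\<lambda>_. [])(2 := b # rev (take i w)))" for b
      using exec.Push[of 2 b "(input_tape w, int i)" "(\<lambda>_. [])(2 := rev (take i w))"]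
      by (auto simp: takes_def)
    have "takes (If 0 2 (Push 2 True) (Push 2 False)) (?I i) (Suc 2)
        ((input_tape w, int i), (\<lambda>_. [])(2 := rev (take (Suc i) w)))"
      unfolding eq by (rule takes_If; cases "w ! i")
        (use sc push[of True] push[of False] in \<open>auto simp: bit_symbol_def simp del: fun_upd_apply\<close>)
    from takes_Seq[OF this takes_Move[of 1]]
    show "scanned (?I i) 0 \<noteq> 0 \<and>
      takes (Seq (If 0 2 (Push 2 True) (Push 2 False)) (Move 1)) (?I i) (Suc 2 + 1) (?I (Suc i))"
      using sc by (simp add: add.commute)
  qed (simp add: scanned_def scan_def input_tape_nat)
  have 2: "takes (Move (-1)) (?I ?n) 1 ((input_tape w, int ?n - 1), ?s)"
    using takes_Move[of "-1" "input_tape w" "int ?n" ?s] by simp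
  have 3: "takes (While 0 (Move (-1))) ((input_tape w, int ?n - 1), ?s) (?n * Suc 1 + 1)
      ((input_tape w, -1), ?s)"
  proof -
    let ?J = "\<lambda>i. ((input_tape w, int ?n - 1 - int i), ?s)"
    have mv: "takes (Move (-1)) (?J i) 1 (?J (Suc i))" for i
      using takes_Move[of "-1" "input_tape w" "int ?n - 1 - int i" ?s] by (simp add: algebra_simps)
    have sc: "scanned (?J i) 0 \<noteq> 0" if "i < ?n" for i
      using that by (simp add: scanned_def scan_def input_tape_def)
    have "scanned (?J ?n) 0 = 0" by (simp add: scanned_def scan_def input_tape_def)
    then have "takes (While 0 (Move (-1))) (?J 0) (?n * Suc 1 + 1) (?J ?n)"
      using mv sc takes_While[of ?n ?J 0 "Move (-1)" 1] by blast
    then show ?thesis by simp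
  qed
  have 4: "takes (Move 1) ((input_tape w, -1), ?s) 1 ((input_tape w, 0), ?s)"
    using takes_Move[of 1 "input_tape w" "-1" ?s] by simp
  have "does (move_all 2 1) ?s (5 * ?n + 1) (?s(2 := [], 1 := rev (?s 2) @ ?s 1))"
    by (rule does_move_all) auto
  moreover have "?s(2 := [], 1 := rev (?s 2) @ ?s 1) = (\<lambda>_. [])(1 := w)" by (auto simp: fun_eq_iff)
  ultimately have 5: "takes (move_all 2 1) ((input_tape w, 0), ?s) (5 * ?n + 1)
      ((input_tape w, 0), (\<lambda>_. [])(1 := w))" by (auto simp: does_def)
  have start: "?I 0 = ((input_tape w, 0), \<lambda>_. [])" by (auto simp: fun_eq_iff)
  show ?thesis unfolding load_def
    by (rule takes_mono[OF takes_Seq[OF takes_Seq[OF takes_Seq[OF 1[unfolded start] 2] takes_Seq[OF 3 4]] 5]])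
      simp
qed

lemma takes_unload:
  assumes "s 4 = v"
  shows "\<exists>tp s'. takes unload ((c, 0), s) (6 * length v + 2) (tp, s') \<and>
    (\<forall>i < length v. fst tp (int i) = bit_symbol (v ! i)) \<and> fst tp (int (length v)) = 0"
proof -
  let ?n = "length v"
  let ?c = "\<lambda>i j. if 0 \<le> j \<and> j < int i then bit_symbol (v ! nat j) else c j"
  let ?I = "\<lambda>i. ((?c i, int i), s(4 := drop i v)) :: tape \<times> store"
  have 1: "takes (While 4 (Seq (If 4 2 (Put 2 1) (Put 1 1)) (Pop 4))) (?I 0) (?n * Suc (Suc 1 + 1) + 1) (?I ?n)"
  proof (rule takes_While)
    fix i assume i: "i < ?n"
    have sc: "scanned (?I i) 4 = bit_symbol (v ! i)"
      using i by (simp add: scanned_def top_symbol_def Cons_nth_drop_Suc[symmetric])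
    have "act (bit_symbol (v ! i), 1) (?c i, int i) = (?c (Suc i), int (Suc i))"
      by (auto simp: fun_eq_iff)
    then have "takes (If 4 2 (Put 2 1) (Put 1 1)) (?I i) (Suc 1) ((?c (Suc i), int (Suc i)), s(4 := drop i v))"
      using takes_Put[of "bit_symbol (v ! i)" 1 "(?c i, int i)" "s(4 := drop i v)"]
      by (intro takes_If) (use sc in \<open>auto simp: bit_symbol_def simp del: act.simps split: if_splits\<close>)
    moreover have "takes (Pop 4) ((?c (Suc i), int (Suc i)), s(4 := drop i v)) 1 (?I (Suc i))"
      using does_Pop[of 4 "s(4 := drop i v)"] by (auto simp: does_def drop_Suc tl_drop)
    ultimately show "scanned (?I i) 4 \<noteq> 0 \<and>
      takes (Seq (If 4 2 (Put 2 1) (Put 1 1)) (Pop 4)) (?I i) (Suc 1 + 1) (?I (Suc i))"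
      using sc takes_Seq by force
  qed (simp add: scanned_def)
  have start: "?I 0 = ((c, 0), s)" using assms by (auto simp: fun_eq_iff)
  have "takes unload ((c, 0), s) (6 * ?n + 2) (act (0, 0) (?c ?n, int ?n), s(4 := drop ?n v))"
    unfolding unload_def
    by (rule takes_mono[OF takes_Seq[OF 1[unfolded start] takes_Put]]) simp
  then show ?thesis by (intro exI conjI) auto
qed

text \<open>The input is the string 0 and the output is the string 3.\<close>

theorem polytime_does:
  assumes wf: "eventually (\<lambda>K. wf_com K c) sequentially" and S: "4 \<le> S"
    and run: "\<And>w. \<exists>R. does c (store_of S ((\<lambda>_. [])(0 := w))) (poly p (length w)) (store_of S R) \<and>
      R 3 = f w \<and> length (f w) \<le> poly p (length w)"
  shows "polytime f"
proof -
  let ?c = "Seq (Seq load c) unload"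
  obtain K where "wf_com K c" "4 < K"
    using eventually_happens[OF eventually_conj[OF wf eventually_gt_at_top[of 4]]] by auto
  then have K: "wf_com K ?c" "0 < K" by (auto simp: load_def unload_def)
  let ?q = "[:7, 12:] + p + [:6:] * p"
  show ?thesis
  proof (rule polytime_exec[OF K(1) _ K(2), where p = ?q])
    fix w
    obtain R where R: "does c (store_of S ((\<lambda>_. [])(0 := w))) (poly p (length w)) (store_of S R)"
      "R 3 = f w" "length (f w) \<le> poly p (length w)" using run by blast
    have "store_of S ((\<lambda>_. [])(0 := w)) = (\<lambda>_. [])(1 := w)"
      using S by (auto simp: store_of_def fun_eq_iff)
    then have 2: "takes c ((input_tape w, 0), (\<lambda>_. [])(1 := w)) (poly p (length w))
        ((input_tape w, 0), store_of S R)" using R(1) by (auto simp: does_def)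
    have "store_of S R 4 = f w" using S R by (simp add: store_of_def)
    then obtain tp s' where 3: "takes unload ((input_tape w, 0), store_of S R) (6 * length (f w) + 2) (tp, s')"
      "\<forall>i < length (f w). fst tp (int i) = bit_symbol (f w ! i)" "fst tp (int (length (f w))) = 0"
      using takes_unload by blast
    have "takes ?c ((input_tape w, 0), \<lambda>_. []) (poly ?q (length w)) (tp, s')"
      by (rule takes_mono[OF takes_Seq[OF takes_Seq[OF takes_load 2] 3(1)]])
        (use R(3) in \<open>simp add: algebra_simps\<close>)
    then show "\<exists>t \<le> poly ?q (length w). \<exists>tp s. exec ?c ((input_tape w, 0), \<lambda>_. []) t (tp, s) \<and>
      (\<forall>i < length (f w). fst tp (int i) = bit_symbol (f w ! i)) \<and> fst tp (int (length (f w))) = 0"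
      using 3 unfolding takes_def by blast
  qed
qed

section \<open>Definable functions and predicates\<close>

text \<open>A function, a predicate or a bit string that depends on the strings 0, 1, 2 and on number variables is definable
  if it is given by an expression or a program. Definable notions are closed under arithmetic, propositional
  connectives, bounded quantifiers and bounded sums, so that definability is proved by following the syntax.\<close>

definition Def :: "(store \<Rightarrow> (nat \<Rightarrow> nat) \<Rightarrow> nat) \<Rightarrow> bool" where
  "Def f \<longleftrightarrow> (\<exists>e. strings_below 3 e \<and> (\<forall>R \<rho>. f R \<rho> = val e R \<rho>))"

definition DefB :: "(store \<Rightarrow> (nat \<Rightarrow> nat) \<Rightarrow> bool) \<Rightarrow> bool" where
  "DefB P \<longleftrightarrow> Def (\<lambda>R \<rho>. of_bool (P R \<rho>))"

definition DefO :: "(store \<Rightarrow> (nat \<Rightarrow> nat) \<Rightarrow> bits) \<Rightarrow> bool" where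
  "DefO F \<longleftrightarrow> (\<exists>p. prog_below 3 p \<and> (\<forall>R \<rho>. F R \<rho> = out p R \<rho>))"

lemma val_le_const:
  assumes "strings_below S e" "\<And>r. r < S \<Longrightarrow> length (R r) \<le> M"
  shows "val e R (\<lambda>_. 0) \<le> poly (val_bound e) M"
  using val_le[of S e R M "\<lambda>_. 0"] assms by auto

lemma length_out_le_const:
  assumes "prog_below S p" "\<And>r. r < S \<Longrightarrow> length (R r) \<le> M"
  shows "length (out p R (\<lambda>_. 0)) \<le> poly (length_bound p) M"
  using length_out_le[of S p R M "\<lambda>_. 0"] assms by auto

lemma strings_below_mono: "strings_below S e \<Longrightarrow> S \<le> S' \<Longrightarrow> strings_below S' e"
  by (induction e) auto

lemma prog_below_mono: "prog_below S p \<Longrightarrow> S \<le> S' \<Longrightarrow> prog_below S' p"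
  by (induction p) (auto intro: strings_below_mono)

lemma Def_poly_bound:
  assumes "Def f"
  shows "\<exists>p. \<forall>w. f ((\<lambda>_. [])(0 := w)) (\<lambda>_. 0) \<le> poly p (length w)"
proof -
  obtain e where e: "strings_below 3 e" "\<And>R \<rho>. f R \<rho> = val e R \<rho>" using assms by (auto simp: Def_def)
  have "f ((\<lambda>_. [])(0 := w)) (\<lambda>_. 0) \<le> poly (val_bound e) (length w)" for w
    unfolding e(2) by (rule val_le_const[OF e(1)]) auto
  then show ?thesis by blast
qed

text \<open>The general form of the algorithms below: starting from the input \<open>w\<close> in the string 0, the string
  1 is initialized by \<open>I1\<close> and transformed \<open>T1\<close> times by \<open>G1\<close>, then the same is done with the
  string 2, and finally \<open>F\<close> is put out. If the lengths of the strings 1 and 2 stay polynomially bounded, the output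
  is computed in polynomial time.\<close>

definition phase1 :: "(store \<Rightarrow> bits) \<Rightarrow> (store \<Rightarrow> nat) \<Rightarrow> (store \<Rightarrow> bits) \<Rightarrow> bits \<Rightarrow> nat \<Rightarrow> bits" where
  "phase1 I1 T1 G1 w j = (let R0 = (\<lambda>_. [])(0 := w) in ((\<lambda>y. G1 (R0(1 := y))) ^^ j) (I1 R0))"

definition store1 :: "(store \<Rightarrow> bits) \<Rightarrow> (store \<Rightarrow> nat) \<Rightarrow> (store \<Rightarrow> bits) \<Rightarrow> bits \<Rightarrow> store" where
  "store1 I1 T1 G1 w = (\<lambda>_. [])(0 := w, 1 := phase1 I1 T1 G1 w (T1 ((\<lambda>_. [])(0 := w))))"

definition phase2 :: "(store \<Rightarrow> bits) \<Rightarrow> (store \<Rightarrow> nat) \<Rightarrow> (store \<Rightarrow> bits) \<Rightarrow> store \<Rightarrow> nat \<Rightarrow> bits" where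
  "phase2 I2 T2 G2 R1 j = ((\<lambda>y. G2 (R1(2 := y))) ^^ j) (I2 R1)"

theorem polytime_phases:
  fixes I1 I2 G1 G2 F T1 T2
  defines "f \<equiv> \<lambda>w. let R1 = store1 I1 T1 G1 w in F (R1(2 := phase2 I2 T2 G2 R1 (T2 R1)))"
  assumes I1: "DefO (\<lambda>R _. I1 R)" and T1: "Def (\<lambda>R _. T1 R)" and G1: "DefO (\<lambda>R _. G1 R)"
    and I2: "DefO (\<lambda>R _. I2 R)" and T2: "Def (\<lambda>R _. T2 R)" and G2: "DefO (\<lambda>R _. G2 R)"
    and F: "DefO (\<lambda>R _. F R)"
    and b1: "\<And>w j. length (phase1 I1 T1 G1 w j) \<le> poly q (length w)"
    and b2: "\<And>w j. length (phase2 I2 T2 G2 (store1 I1 T1 G1 w) j) \<le> poly q (length w)"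
  shows "polytime f"
proof -
  obtain i1 where i1: "prog_below 3 i1" "\<And>R. I1 R = out i1 R (\<lambda>_. 0)" using I1 by (auto simp: DefO_def)
  obtain g1 where g1: "prog_below 3 g1" "\<And>R. G1 R = out g1 R (\<lambda>_. 0)" using G1 by (auto simp: DefO_def)
  obtain i2 where i2: "prog_below 3 i2" "\<And>R. I2 R = out i2 R (\<lambda>_. 0)" using I2 by (auto simp: DefO_def)
  obtain g2 where g2: "prog_below 3 g2" "\<And>R. G2 R = out g2 R (\<lambda>_. 0)" using G2 by (auto simp: DefO_def)
  obtain o' where o': "prog_below 3 o'" "\<And>R. F R = out o' R (\<lambda>_. 0)" using F by (auto simp: DefO_def)
  obtain t1 where t1: "strings_below 3 t1" "\<And>R. T1 R = val t1 R (\<lambda>_. 0)" using T1 by (auto simp: Def_def)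
  obtain t2 where t2: "strings_below 3 t2" "\<And>R. T2 R = val t2 R (\<lambda>_. 0)" using T2 by (auto simp: Def_def)
  note b5 = i1(1)[THEN prog_below_mono, of 5, simplified] g1(1)[THEN prog_below_mono, of 5, simplified]
    i2(1)[THEN prog_below_mono, of 5, simplified] g2(1)[THEN prog_below_mono, of 5, simplified]
    o'(1)[THEN prog_below_mono, of 5, simplified] t1(1)[THEN strings_below_mono, of 5, simplified]
    t2(1)[THEN strings_below_mono, of 5, simplified]
  let ?c = "Seq (Seq (iterate 5 1 4 t1 i1 g1) (iterate 5 2 4 t2 i2 g2)) (assign 5 3 o')"
  let ?m = "[:0, 1:] + q"
  let ?M = "?m + pcompose (val_bound t1 + val_bound t2 + length_bound o') ?m"
  let ?p = "?M + pcompose (iterate_time t1 i1 g1 + iterate_time t2 i2 g2 + prog_time o' + [:2, 7:]) ?M"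
  show ?thesis
  proof (rule polytime_does[where c = ?c and S = 5 and p = ?p])
    show "eventually (\<lambda>K. wf_com K ?c) sequentially"
      using b5 by (auto simp: eventually_conj_iff intro!: eventually_wf_assign eventually_wf_iterate)
    fix w :: bits
    let ?N = "poly ?m (length w)" and ?L = "poly ?M (length w)"
    define R0 where "R0 = ((\<lambda>_. [])(0 := w) :: store)"
    define R1 where "R1 = store1 I1 T1 G1 w"
    define R2 where "R2 = R1(2 := phase2 I2 T2 G2 R1 (T2 R1))"
    have NL: "?N \<le> ?L" by simp
    have w: "length w \<le> ?N" by simp
    have q: "poly q (length w) \<le> ?N" by simp
    have p1: "((\<lambda>y. G1 (R0(1 := y))) ^^ j) (I1 R0) = phase1 I1 T1 G1 w j" for j
      by (simp add: phase1_def R0_def Let_def)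
    have p2: "((\<lambda>y. G2 (R1(2 := y))) ^^ j) (I2 R1) = phase2 I2 T2 G2 R1 j" for j
      by (simp add: phase2_def)
    have p1N: "length (phase1 I1 T1 G1 w j) \<le> ?N" for j using b1[of w j] q by linarith
    have p2N: "length (phase2 I2 T2 G2 R1 j) \<le> ?N" for j using b2[of w j] q R1_def by simp
    have R1_eq: "R1 = R0(1 := phase1 I1 T1 G1 w (T1 R0))"
      by (simp add: R1_def store1_def R0_def)
    have R0: "length (R0 r) \<le> ?N" for r using w by (simp add: R0_def)
    have R1: "length (R1 r) \<le> ?N" for r using R0 p1N by (simp add: R1_eq)
    have R2: "length (R2 r) \<le> ?N" for r using R1 p2N by (simp add: R2_def)
    have L: "length (R0 r) \<le> ?L" "length (R1 r) \<le> ?L" "length (R2 r) \<le> ?L"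
      "length (phase1 I1 T1 G1 w j) \<le> ?L" "length (phase2 I2 T2 G2 R1 j) \<le> ?L" for r j
      using R0 R1 R2 NL p1N p2N order_trans by blast+
    have "val t1 R0 (\<lambda>_. 0) \<le> poly (val_bound t1) ?N" by (rule val_le_const[OF t1(1)]) (rule R0)
    then have t1L: "T1 R0 \<le> ?L" by (simp add: poly_pcompose t1)
    have "val t2 R1 (\<lambda>_. 0) \<le> poly (val_bound t2) ?N" by (rule val_le_const[OF t2(1)]) (rule R1)
    then have t2L: "T2 R1 \<le> ?L" by (simp add: poly_pcompose t2)
    have "length (out o' R2 (\<lambda>_. 0)) \<le> poly (length_bound o') ?N"
      by (rule length_out_le_const[OF o'(1)]) (rule R2)
    then have oL: "length (out o' R2 (\<lambda>_. 0)) \<le> ?L" by (simp add: poly_pcompose)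
    have R4: "R0(4 := []) = R0" "R1(4 := []) = R1"
      by (auto simp: R1_eq R0_def fun_eq_iff)
    have "does (iterate 5 1 4 t1 i1 g1) (store_of 5 R0) (poly (iterate_time t1 i1 g1) ?L)
        (store_of 5 (R0(4 := [], 1 := ((\<lambda>y. G1 (R0(1 := y))) ^^ T1 R0) (I1 R0))))"
    proof (rule does_iterate)
      show "out i1 (R0(4 := l)) (\<lambda>_. 0) = I1 R0" for l
        unfolding i1(2) by (rule out_cong[OF i1(1)]) auto
      show "out g1 (R0(4 := l, 1 := l')) (\<lambda>_. 0) = G1 (R0(1 := l'))" for l l'
        unfolding g1(2) by (rule out_cong[OF g1(1)]) auto
    qed (use b5 L t1L in \<open>auto simp only: p1 t1\<close>)
    then have 1: "does (iterate 5 1 4 t1 i1 g1) (store_of 5 R0) (poly (iterate_time t1 i1 g1) ?L)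
        (store_of 5 R1)" by (simp only: R4 p1 R1_eq)
    have "does (iterate 5 2 4 t2 i2 g2) (store_of 5 R1) (poly (iterate_time t2 i2 g2) ?L)
        (store_of 5 (R1(4 := [], 2 := ((\<lambda>y. G2 (R1(2 := y))) ^^ T2 R1) (I2 R1))))"
    proof (rule does_iterate)
      show "out i2 (R1(4 := l)) (\<lambda>_. 0) = I2 R1" for l
        unfolding i2(2) by (rule out_cong[OF i2(1)]) auto
      show "out g2 (R1(4 := l, 2 := l')) (\<lambda>_. 0) = G2 (R1(2 := l'))" for l l'
        unfolding g2(2) by (rule out_cong[OF g2(1)]) auto
    qed (use b5 L t2L in \<open>auto simp only: p2 t2\<close>)
    then have 2: "does (iterate 5 2 4 t2 i2 g2) (store_of 5 R1) (poly (iterate_time t2 i2 g2) ?L)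
        (store_of 5 R2)" by (simp only: R4 p2 R2_def)
    have 3: "does (assign 5 3 o') (store_of 5 R2) (poly (prog_time o') ?L + (7 * ?L + 2))
        (store_of 5 (R2(3 := out o' R2 (\<lambda>_. 0))))"
      by (rule does_assign) (use b5 L oL in auto)
    have f: "f w = out o' R2 (\<lambda>_. 0)" by (simp add: f_def R2_def R1_def Let_def o')
    have "does ?c (store_of 5 R0) (poly ?p (length w)) (store_of 5 (R2(3 := f w)))"
      unfolding f by (rule does_mono[OF does_Seq[OF does_Seq[OF 1 2] 3]]) (simp add: poly_pcompose)
    moreover have "length (f w) \<le> poly ?p (length w)" using oL f by simp
    ultimately show "\<exists>R. does ?c (store_of 5 ((\<lambda>_. [])(0 := w))) (poly ?p (length w)) (store_of 5 R) \<and>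
      R 3 = f w \<and> length (f w) \<le> poly ?p (length w)"
      unfolding R0_def by (metis fun_upd_same)
  qed simp
qed

text \<open>Renaming of variables and substitution. Below a \<open>Sum\<close>, the bound variable 0 is kept.\<close>

fun rename :: "(nat \<Rightarrow> nat) \<Rightarrow> expr \<Rightarrow> expr" where
  "rename f (Arg i) = Arg (f i)"
| "rename f One = One"
| "rename f (Plus a b) = Plus (rename f a) (rename f b)"
| "rename f (Less a b) = Less (rename f a) (rename f b)"
| "rename f (Get r a) = Get r (rename f a)"
| "rename f (Len r) = Len r"
| "rename f (Sum a b) = Sum (rename f a) (rename (case_nat 0 (\<lambda>i. Suc (f i))) b)"

lemma val_rename: "val (rename f e) R \<rho> = val e R (\<lambda>i. \<rho> (f i))"
proof (induction e arbitrary: f \<rho>)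
  case (Sum a b)
  have "(\<lambda>i. case case_nat 0 (\<lambda>i. Suc (f i)) i of 0 \<Rightarrow> v | Suc j \<Rightarrow> \<rho> j) = case_nat v (\<lambda>i. \<rho> (f i))" for v
    by (auto simp: fun_eq_iff split: nat.splits)
  then show ?case by (simp add: Sum)
qed auto

lemma strings_below_rename [simp]: "strings_below S (rename f e) = strings_below S e"
  by (induction e arbitrary: f) auto

fun subst :: "(nat \<Rightarrow> expr) \<Rightarrow> expr \<Rightarrow> expr" where
  "subst \<sigma> (Arg i) = \<sigma> i"
| "subst \<sigma> One = One"
| "subst \<sigma> (Plus a b) = Plus (subst \<sigma> a) (subst \<sigma> b)"
| "subst \<sigma> (Less a b) = Less (subst \<sigma> a) (subst \<sigma> b)"
| "subst \<sigma> (Get r a) = Get r (subst \<sigma> a)"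
| "subst \<sigma> (Len r) = Len r"
| "subst \<sigma> (Sum a b) = Sum (subst \<sigma> a) (subst (case_nat (Arg 0) (\<lambda>i. rename Suc (\<sigma> i))) b)"

lemma val_subst: "val (subst \<sigma> e) R \<rho> = val e R (\<lambda>i. val (\<sigma> i) R \<rho>)"
proof (induction e arbitrary: \<sigma> \<rho>)
  case (Sum a b)
  have "(\<lambda>i. val (case i of 0 \<Rightarrow> Arg 0 | Suc j \<Rightarrow> rename Suc (\<sigma> j)) R (case_nat v \<rho>)) =
      case_nat v (\<lambda>i. val (\<sigma> i) R \<rho>)" for v
    by (auto simp: fun_eq_iff val_rename split: nat.splits)
  then show ?case by (simp add: Sum)
qed auto

lemma strings_below_subst: "strings_below S e \<Longrightarrow> (\<And>i. strings_below S (\<sigma> i)) \<Longrightarrow> strings_below S (subst \<sigma> e)"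
  by (induction e arbitrary: \<sigma>) (auto split: nat.splits)

lemma DefI: "strings_below 3 e \<Longrightarrow> (\<And>R \<rho>. f R \<rho> = val e R \<rho>) \<Longrightarrow> Def f"
  unfolding Def_def by blast

lemma DefE: "Def f \<Longrightarrow> (\<And>e. strings_below 3 e \<Longrightarrow> (\<And>R \<rho>. f R \<rho> = val e R \<rho>) \<Longrightarrow> thesis) \<Longrightarrow> thesis"
  unfolding Def_def by blast

lemma Def_subst:
  assumes "Def f" "\<And>i. Def (g i)"
  shows "Def (\<lambda>R \<rho>. f R (\<lambda>i. g i R \<rho>))"
proof -
  obtain e where e: "strings_below 3 e" "\<And>R \<rho>. f R \<rho> = val e R \<rho>" using assms(1) by (auto simp: Def_def)
  obtain \<sigma> where \<sigma>: "\<And>i. strings_below 3 (\<sigma> i)" "\<And>i R \<rho>. g i R \<rho> = val (\<sigma> i) R \<rho>"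
    using assms(2) unfolding Def_def by metis
  show ?thesis unfolding Def_def
    by (rule exI[of _ "subst \<sigma> e"]) (simp add: strings_below_subst e \<sigma> val_subst)
qed

lemma DefB_subst: "DefB P \<Longrightarrow> (\<And>i. Def (g i)) \<Longrightarrow> DefB (\<lambda>R \<rho>. P R (\<lambda>i. g i R \<rho>))"
  unfolding DefB_def by (rule Def_subst[of "\<lambda>R \<rho>. of_bool (P R \<rho>)" g])

lemma Def_var: "Def (\<lambda>R \<rho>. \<rho> i)"
  unfolding Def_def by (rule exI[of _ "Arg i"]) simp

lemma Def_shift: "Def f \<Longrightarrow> Def (\<lambda>R \<rho>. f R (\<lambda>i. \<rho> (Suc i)))"
  using Def_subst[of f "\<lambda>i R \<rho>. \<rho> (Suc i)"] Def_var by blast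

lemma Def_plus: "Def f \<Longrightarrow> Def g \<Longrightarrow> Def (\<lambda>R \<rho>. f R \<rho> + g R \<rho>)"
  by (elim DefE, rule_tac e = "Plus e ea" in DefI) auto

lemma DefB_less: "Def f \<Longrightarrow> Def g \<Longrightarrow> DefB (\<lambda>R \<rho>. f R \<rho> < g R \<rho>)"
  unfolding DefB_def by (elim DefE, rule_tac e = "Less e ea" in DefI) auto

lemma DefB_bit_at: "r < 3 \<Longrightarrow> Def f \<Longrightarrow> DefB (\<lambda>R \<rho>. bit_at (R r) (f R \<rho>))"
  unfolding DefB_def by (elim DefE, rule_tac e = "Get r e" in DefI) auto

lemma Def_length: "r < 3 \<Longrightarrow> Def (\<lambda>R \<rho>. length (R r))"
  unfolding Def_def by (rule exI[of _ "Len r"]) simp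

text \<open>In the premises of the rules for binding operators, the bound variable becomes the variable 0.\<close>

lemma Def_sum:
  assumes "Def a" "Def (\<lambda>R \<rho>. b R (\<lambda>i. \<rho> (Suc i)) (\<rho> 0))"
  shows "Def (\<lambda>R \<rho>. \<Sum>v<a R \<rho>. b R \<rho> v)"
proof -
  obtain e where e: "strings_below 3 e" "\<And>R \<rho>. a R \<rho> = val e R \<rho>" using assms(1) by (auto simp: Def_def)
  obtain e' where e': "strings_below 3 e'" "\<And>R \<rho>. b R (\<lambda>i. \<rho> (Suc i)) (\<rho> 0) = val e' R \<rho>"
    using assms(2) by (auto simp: Def_def)
  have "b R \<rho> v = val e' R (case_nat v \<rho>)" for R \<rho> v using e'(2)[of R "case_nat v \<rho>"] by simp
  then show ?thesis unfolding Def_def by (intro exI[of _ "Sum e e'"]) (simp add: e e')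
qed

lemma Def_of_bool: "DefB P \<Longrightarrow> Def (\<lambda>R \<rho>. of_bool (P R \<rho>))"
  by (simp add: DefB_def)

lemma Def_const: "Def (\<lambda>R \<rho>. n)"
proof (induction n)
  case 0
  have "DefB (\<lambda>R \<rho>. \<rho> 0 < \<rho> 0)" by (intro DefB_less Def_var)
  then show ?case by (simp add: DefB_def)
next
  case (Suc n)
  have "Def (\<lambda>R \<rho>. 1)" unfolding Def_def by (rule exI[of _ One]) simp
  from Def_plus[OF Suc this] show ?case by simp
qed

lemma DefB_const: "DefB (\<lambda>R \<rho>. b)"
  unfolding DefB_def by (rule Def_const)

lemma Def_mult: "Def f \<Longrightarrow> Def g \<Longrightarrow> Def (\<lambda>R \<rho>. f R \<rho> * g R \<rho>)"
  using Def_sum[of f "\<lambda>R \<rho> v. g R \<rho>"] Def_shift[of g] by simp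

lemma DefB_conj:
  assumes "DefB P" "DefB Q"
  shows "DefB (\<lambda>R \<rho>. P R \<rho> \<and> Q R \<rho>)"
proof -
  have "(\<lambda>R \<rho>. of_bool (P R \<rho> \<and> Q R \<rho>) :: nat) = (\<lambda>R \<rho>. of_bool (P R \<rho>) * of_bool (Q R \<rho>))"
    by (simp add: of_bool_conj)
  then show ?thesis using assms Def_mult unfolding DefB_def by simp
qed

lemma DefB_not:
  assumes "DefB P"
  shows "DefB (\<lambda>R \<rho>. \<not> P R \<rho>)"
proof -
  have "DefB (\<lambda>R \<rho>. of_bool (P R \<rho>) < (1 :: nat))"
    using assms by (intro DefB_less Def_of_bool Def_const)
  then show ?thesis by simp
qed

lemma DefB_disj: "DefB P \<Longrightarrow> DefB Q \<Longrightarrow> DefB (\<lambda>R \<rho>. P R \<rho> \<or> Q R \<rho>)"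
  using DefB_not[OF DefB_conj[OF DefB_not DefB_not]] by simp

lemma DefB_imp: "DefB P \<Longrightarrow> DefB Q \<Longrightarrow> DefB (\<lambda>R \<rho>. P R \<rho> \<longrightarrow> Q R \<rho>)"
  using DefB_disj[OF DefB_not, of P Q] by (simp only: imp_conv_disj)

lemma DefB_iff: "DefB P \<Longrightarrow> DefB Q \<Longrightarrow> DefB (\<lambda>R \<rho>. P R \<rho> \<longleftrightarrow> Q R \<rho>)"
  using DefB_conj[OF DefB_imp DefB_imp, of P Q Q P] by (simp only: iff_conv_conj_imp)

lemma DefB_le: "Def f \<Longrightarrow> Def g \<Longrightarrow> DefB (\<lambda>R \<rho>. f R \<rho> \<le> g R \<rho>)"
  using DefB_not[OF DefB_less, of g f] by (simp add: not_less)

lemma DefB_eq: "Def f \<Longrightarrow> Def g \<Longrightarrow> DefB (\<lambda>R \<rho>. f R \<rho> = g R \<rho>)"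
  using DefB_conj[OF DefB_le DefB_le, of f g g f] by (simp only: order.eq_iff)

lemma DefB_ex:
  assumes "Def a" "DefB (\<lambda>R \<rho>. P R (\<lambda>i. \<rho> (Suc i)) (\<rho> 0))"
  shows "DefB (\<lambda>R \<rho>. \<exists>v<a R \<rho>. P R \<rho> v)"
proof -
  have "DefB (\<lambda>R \<rho>. 0 < (\<Sum>v<a R \<rho>. of_bool (P R \<rho> v) :: nat))"
    using assms unfolding DefB_def[of "\<lambda>R \<rho>. P R (\<lambda>i. \<rho> (Suc i)) (\<rho> 0)"] by (intro DefB_less Def_const Def_sum)
  moreover have "(0 < (\<Sum>v<a R \<rho>. of_bool (P R \<rho> v) :: nat)) \<longleftrightarrow> (\<exists>v<a R \<rho>. P R \<rho> v)" for R \<rho>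
    by (auto simp: zero_less_iff_neq_zero)
  ultimately show ?thesis by simp
qed

lemma DefB_all:
  "Def a \<Longrightarrow> DefB (\<lambda>R \<rho>. P R (\<lambda>i. \<rho> (Suc i)) (\<rho> 0)) \<Longrightarrow> DefB (\<lambda>R \<rho>. \<forall>v<a R \<rho>. P R \<rho> v)"
  using DefB_not[OF DefB_ex[of a "\<lambda>R \<rho> v. \<not> P R \<rho> v"]] DefB_not by simp

lemma Def_if:
  assumes "DefB P" "Def f" "Def g"
  shows "Def (\<lambda>R \<rho>. if P R \<rho> then f R \<rho> else g R \<rho>)"
proof -
  have "Def (\<lambda>R \<rho>. of_bool (P R \<rho>) * f R \<rho> + of_bool (\<not> P R \<rho>) * g R \<rho>)"
    using assms by (intro Def_plus Def_mult Def_of_bool DefB_not)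
  moreover have "of_bool (P R \<rho>) * f R \<rho> + of_bool (\<not> P R \<rho>) * g R \<rho> =
      (if P R \<rho> then f R \<rho> else g R \<rho>)" for R \<rho> by simp
  ultimately show ?thesis by simp
qed

lemma DefB_if: "DefB P \<Longrightarrow> DefB Q \<Longrightarrow> DefB Q' \<Longrightarrow> DefB (\<lambda>R \<rho>. if P R \<rho> then Q R \<rho> else Q' R \<rho>)"
  using DefB_conj[OF DefB_imp[of P Q] DefB_imp[OF DefB_not[of P], of Q']] by (simp only: if_bool_eq_conj)

lemma Def_minus:
  assumes "Def f" "Def g"
  shows "Def (\<lambda>R \<rho>. f R \<rho> - g R \<rho>)"
proof -
  have "Def (\<lambda>R \<rho>. \<Sum>v<f R \<rho>. of_bool (g R \<rho> \<le> v))"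
    using assms by (intro Def_sum Def_of_bool DefB_le Def_shift Def_var)
  moreover have "(\<Sum>v<a. of_bool (b \<le> v)) = a - b" for a b :: nat
  proof -
    have "{v. v < a \<and> b \<le> v} = {b..<a}" by auto
    then show ?thesis by (simp add: of_bool_def sum.If_cases lessThan_def Int_def)
  qed
  ultimately show ?thesis by simp
qed

lemma Def_div:
  assumes "Def f" "Def g"
  shows "Def (\<lambda>R \<rho>. f R \<rho> div g R \<rho>)"
proof -
  have "Def (\<lambda>R \<rho>. \<Sum>v<f R \<rho>. of_bool (0 < g R \<rho> \<and> (v + 1) * g R \<rho> \<le> f R \<rho>))"
    using assms by (intro Def_sum Def_of_bool DefB_conj DefB_less DefB_le Def_mult Def_plus Def_const Def_shift Def_var)
  moreover have "(\<Sum>v<a. of_bool (0 < b \<and> (v + 1) * b \<le> a)) = a div b" for a b :: nat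
  proof (cases "b = 0")
    case False
    have "(v + 1) * b \<le> a \<longleftrightarrow> v < a div b" for v
      using False less_eq_div_iff_mult_less_eq[of b "v + 1" a] by (simp add: Suc_le_eq)
    moreover have "a div b \<le> a" by simp
    ultimately have "{v. v < a \<and> (v + 1) * b \<le> a} = {..<a div b}" by (auto intro: less_le_trans)
    then show ?thesis using False by (simp add: of_bool_def sum.If_cases lessThan_def Int_def)
  qed simp
  ultimately show ?thesis by simp
qed

lemma Def_mod: "Def f \<Longrightarrow> Def g \<Longrightarrow> Def (\<lambda>R \<rho>. f R \<rho> mod g R \<rho>)"
  using Def_minus[OF _ Def_mult[OF Def_div], of f f g g] by (simp add: minus_div_mult_eq_mod)

lemma Def_power: "Def f \<Longrightarrow> Def (\<lambda>R \<rho>. f R \<rho> ^ n)"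
  by (induction n) (auto intro: Def_mult Def_const)

lemma Def_poly: "Def f \<Longrightarrow> Def (\<lambda>R \<rho>. poly p (f R \<rho>))"
  by (induction p) (auto intro!: Def_plus Def_mult Def_const)

lemma Def_Suc: "Def f \<Longrightarrow> Def (\<lambda>R \<rho>. Suc (f R \<rho>))"
  using Def_plus[OF _ Def_const[of 1]] by simp

text \<open>A finite table of values\<close>

lemma Def_table:
  assumes "Def f"
  shows "Def (\<lambda>R \<rho>. if f R \<rho> < c then F (f R \<rho>) else 0)"
proof (induction c)
  case 0
  show ?case by (simp add: Def_const)
next
  case (Suc c)
  have "Def (\<lambda>R \<rho>. if f R \<rho> = c then F c else (if f R \<rho> < c then F (f R \<rho>) else 0))"
    by (rule Def_if[OF DefB_eq[OF assms Def_const] Def_const Suc])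
  moreover have "(if x = c then F c else (if x < c then F x else 0)) = (if x < Suc c then F x else 0)" for x
    by auto
  ultimately show ?case by simp
qed

lemma Def_sum_list: "(\<And>x. x \<in> set l \<Longrightarrow> Def (f x)) \<Longrightarrow> Def (\<lambda>R \<rho>. \<Sum>x\<leftarrow>l. f x R \<rho>)"
  by (induction l) (auto intro!: Def_plus Def_const)

lemma DefO_single: "DefB P \<Longrightarrow> DefO (\<lambda>R \<rho>. [P R \<rho>])"
proof -
  assume "DefB P"
  then obtain e where e: "strings_below 3 e" "\<And>R \<rho>. of_bool (P R \<rho>) = val e R \<rho>"
    by (auto simp: DefB_def Def_def)
  have "P R \<rho> \<longleftrightarrow> 0 < val e R \<rho>" for R \<rho> using e(2)[of R \<rho>, symmetric] by simp
  then show ?thesis unfolding DefO_def by (intro exI[of _ "Emit e"]) (simp add: e)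
qed

lemma DefO_append: "DefO F \<Longrightarrow> DefO G \<Longrightarrow> DefO (\<lambda>R \<rho>. F R \<rho> @ G R \<rho>)"
  unfolding DefO_def by (elim exE conjE, rule_tac x = "Cat p pa" in exI) auto

lemma DefO_concat:
  assumes "Def a" "DefO (\<lambda>R \<rho>. F R (\<lambda>i. \<rho> (Suc i)) (\<rho> 0))"
  shows "DefO (\<lambda>R \<rho>. concat (map (\<lambda>v. F R \<rho> v) [0..<a R \<rho>]))"
proof -
  obtain e where e: "strings_below 3 e" "\<And>R \<rho>. a R \<rho> = val e R \<rho>" using assms(1) by (auto simp: Def_def)
  obtain p where p: "prog_below 3 p" "\<And>R \<rho>. F R (\<lambda>i. \<rho> (Suc i)) (\<rho> 0) = out p R \<rho>"
    using assms(2) by (auto simp: DefO_def)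
  have "F R \<rho> v = out p R (case_nat v \<rho>)" for R \<rho> v using p(2)[of R "case_nat v \<rho>"] by simp
  then have "concat (map (\<lambda>v. F R \<rho> v) [0..<a R \<rho>]) = out (For e p) R \<rho>" for R \<rho>
    unfolding out.simps e by (intro arg_cong[where f = concat] map_cong) auto
  then show ?thesis unfolding DefO_def by (intro exI[of _ "For e p"]) (simp add: e p)
qed

lemma DefO_map:
  assumes "Def a" "DefB (\<lambda>R \<rho>. P R (\<lambda>i. \<rho> (Suc i)) (\<rho> 0))"
  shows "DefO (\<lambda>R \<rho>. map (\<lambda>v. P R \<rho> v) [0..<a R \<rho>])"
  using DefO_concat[OF assms(1) DefO_single[OF assms(2)]] by (simp add: concat_map_singleton)

lemma DefO_Nil: "DefO (\<lambda>R \<rho>. [])"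
  using DefO_map[OF Def_const[of 0] DefB_const[of True]] by simp

lemma DefO_concat_list:
  "(\<And>x. x \<in> set l \<Longrightarrow> DefO (F x)) \<Longrightarrow> DefO (\<lambda>R \<rho>. concat (map (\<lambda>x. F x R \<rho>) l))"
  by (induction l) (auto intro!: DefO_append DefO_Nil)

lemma DefO_code_nat: "Def f \<Longrightarrow> DefO (\<lambda>R \<rho>. code_nat (f R \<rho>))"
  using DefO_append[OF DefO_map[of f "\<lambda>_ _ _. True"] DefO_single[OF DefB_const[of False]]] DefB_const[of True]
  by (simp add: code_nat_def map_replicate_const)

lemmas Def_intros = Def_var Def_const Def_plus Def_length Def_sum Def_mult Def_minus Def_div Def_mod
  Def_power Def_poly Def_Suc Def_if Def_of_bool DefB_less DefB_le DefB_eq DefB_const DefB_conj DefB_disj DefB_not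
  DefB_imp DefB_iff DefB_ex DefB_all DefB_if DefB_bit_at

text \<open>Instances of the substitution rule that fix the function into which terms are substituted\<close>

lemma Def_app1: "Def (\<lambda>R \<rho>. f R (\<rho> 0)) \<Longrightarrow> Def a \<Longrightarrow> Def (\<lambda>R \<rho>. f R (a R \<rho>))"
  using Def_subst[of "\<lambda>R \<rho>. f R (\<rho> 0)" "\<lambda>i. a"] by simp

lemma Def_app2: "Def (\<lambda>R \<rho>. f R (\<rho> 0) (\<rho> 1)) \<Longrightarrow> Def a \<Longrightarrow> Def b \<Longrightarrow> Def (\<lambda>R \<rho>. f R (a R \<rho>) (b R \<rho>))"
  using Def_subst[of "\<lambda>R \<rho>. f R (\<rho> 0) (\<rho> 1)" "\<lambda>i. if i = 0 then a else b"] by simp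

lemma DefB_app1: "DefB (\<lambda>R \<rho>. P R (\<rho> 0)) \<Longrightarrow> Def a \<Longrightarrow> DefB (\<lambda>R \<rho>. P R (a R \<rho>))"
  unfolding DefB_def by (rule Def_app1[of "\<lambda>R x. of_bool (P R x)"])

text \<open>An algorithm that computes with two bit arrays, of lengths \<open>N1\<close> and \<open>N2\<close>, by first-order definable
  parallel updates.\<close>

definition array1 :: "(bits \<Rightarrow> nat) \<Rightarrow> (bits \<Rightarrow> nat) \<Rightarrow> (bits \<Rightarrow> nat \<Rightarrow> bool) \<Rightarrow> (bits \<Rightarrow> bits \<Rightarrow> nat \<Rightarrow> bool)
    \<Rightarrow> bits \<Rightarrow> bits" where
  "array1 N T P S w = ((\<lambda>y. map (S w y) [0..<N w]) ^^ T w) (map (P w) [0..<N w])"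

definition array2 :: "(bits \<Rightarrow> nat) \<Rightarrow> (bits \<Rightarrow> nat) \<Rightarrow> (bits \<Rightarrow> bits \<Rightarrow> nat \<Rightarrow> bool)
    \<Rightarrow> (bits \<Rightarrow> bits \<Rightarrow> bits \<Rightarrow> nat \<Rightarrow> bool) \<Rightarrow> bits \<Rightarrow> bits \<Rightarrow> bits" where
  "array2 N T P S w y1 = ((\<lambda>y. map (S w y1 y) [0..<N w]) ^^ T w) (map (P w y1) [0..<N w])"

theorem class_P_arrays:
  assumes N: "Def (\<lambda>R _. N1 (R 0))" "Def (\<lambda>R _. T1 (R 0))" "Def (\<lambda>R _. N2 (R 0))" "Def (\<lambda>R _. T2 (R 0))"
    and D: "DefB (\<lambda>R \<rho>. P1 (R 0) (\<rho> 0))" "DefB (\<lambda>R \<rho>. S1 (R 0) (R 1) (\<rho> 0))"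
      "DefB (\<lambda>R \<rho>. P2 (R 0) (R 1) (\<rho> 0))" "DefB (\<lambda>R \<rho>. S2 (R 0) (R 1) (R 2) (\<rho> 0))"
      "DefB (\<lambda>R _. Q (R 0) (R 1) (R 2))"
  shows "{w. let y1 = array1 N1 T1 P1 S1 w in Q w y1 (array2 N2 T2 P2 S2 w y1)} \<in> class_P"
proof -
  let ?I1 = "\<lambda>R. map (P1 (R 0)) [0..<N1 (R 0)]" and ?G1 = "\<lambda>R. map (S1 (R 0) (R 1)) [0..<N1 (R 0)]"
  let ?I2 = "\<lambda>R. map (P2 (R 0) (R 1)) [0..<N2 (R 0)]" and ?G2 = "\<lambda>R. map (S2 (R 0) (R 1) (R 2)) [0..<N2 (R 0)]"
  let ?T1 = "\<lambda>R. T1 (R 0)" and ?T2 = "\<lambda>R. T2 (R 0)" and ?F = "\<lambda>R. [Q (R 0) (R 1) (R 2)]"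
  obtain p1 where p1: "\<And>w. N1 w \<le> poly p1 (length w)" using Def_poly_bound[OF N(1)] by auto
  obtain p2 where p2: "\<And>w. N2 w \<le> poly p2 (length w)" using Def_poly_bound[OF N(3)] by auto
  have len1: "length (phase1 ?I1 ?T1 ?G1 w j) = N1 w" for w j
    by (cases j) (auto simp: phase1_def)
  have s0: "store1 ?I1 ?T1 ?G1 w 0 = w" for w by (simp only: store1_def) simp
  have len2: "length (phase2 ?I2 ?T2 ?G2 (store1 ?I1 ?T1 ?G1 w) j) = N2 w" for w j
    by (cases j) (auto simp: phase2_def s0 simp del: One_nat_def)
  have "polytime (\<lambda>w. let R1 = store1 ?I1 ?T1 ?G1 w in ?F (R1(2 := phase2 ?I2 ?T2 ?G2 R1 (?T2 R1))))"
  proof (rule polytime_phases[where q = "p1 + p2"])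
    show "length (phase1 ?I1 ?T1 ?G1 w j) \<le> poly (p1 + p2) (length w)" for w j
      using p1[of w] len1 by (simp add: trans_le_add1)
    show "length (phase2 ?I2 ?T2 ?G2 (store1 ?I1 ?T1 ?G1 w) j) \<le> poly (p1 + p2) (length w)" for w j
      using p2[of w] len2 by (simp add: trans_le_add2)
  qed (use N D in \<open>auto intro!: DefO_map DefO_single\<close>)
  moreover have "(let R1 = store1 ?I1 ?T1 ?G1 w in ?F (R1(2 := phase2 ?I2 ?T2 ?G2 R1 (?T2 R1)))) =
      [w \<in> {w. let y1 = array1 N1 T1 P1 S1 w in Q w y1 (array2 N2 T2 P2 S2 w y1)}]" for w
    by (simp add: Let_def store1_def phase1_def phase2_def array1_def array2_def)
  ultimately show ?thesis by (simp add: class_P_def)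
qed

corollary polytime_DefO:
  assumes "DefO (\<lambda>R _. F (R 0))"
  shows "polytime (\<lambda>w. F w)"
proof -
  let ?N = "\<lambda>_. [] :: bits" and ?Z = "\<lambda>_. 0 :: nat"
  have "polytime (\<lambda>w. let R1 = store1 ?N ?Z ?N w in (\<lambda>R. F (R 0)) (R1(2 := phase2 ?N ?Z ?N R1 (?Z R1))))"
  proof (rule polytime_phases[where q = 0])
    show "length (phase1 ?N ?Z ?N w j) \<le> poly 0 (length w)" for w j
      by (cases j) (auto simp: phase1_def)
    show "length (phase2 ?N ?Z ?N (store1 ?N ?Z ?N w) j) \<le> poly 0 (length w)" for w j
      by (cases j) (auto simp: phase2_def)
  qed (use assms in \<open>auto intro!: DefO_Nil Def_const\<close>)
  then show ?thesis by (simp add: Let_def store1_def)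
qed

section \<open>Decoding instances\<close>

text \<open>The number of zeros among the first \<open>p\<close> bits\<close>

definition falses :: "bits \<Rightarrow> nat \<Rightarrow> nat" where
  "falses w p = (\<Sum>i<p. of_bool (\<not> bit_at w i))"

text \<open>The position of the \<open>q\<close>-th zero, counted from 0, and the \<open>m\<close>-th number in a sequence of unary codes\<close>

definition pos :: "bits \<Rightarrow> nat \<Rightarrow> nat" where
  "pos w q = (\<Sum>p<length w. of_bool (falses w (Suc p) \<le> q))"

definition num :: "bits \<Rightarrow> nat \<Rightarrow> nat" where
  "num w m = (if m = 0 then pos w 0 else pos w m - pos w (m - 1) - 1)"

lemma falses_Suc: "falses w (Suc p) = falses w p + of_bool (\<not> bit_at w p)"
  by (simp add: falses_def)

lemma bit_at_code_nat: "bit_at (code_nat m @ w) i \<longleftrightarrow> i < m \<or> m < i \<and> bit_at w (i - m - 1)"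
  by (auto simp: bit_at_def code_nat_def nth_append nth_Cons')

lemma falses_code_nat: "falses (code_nat m @ w) p = (if p \<le> m then 0 else Suc (falses w (p - m - 1)))"
proof (induction p)
  case (Suc p)
  show ?case
  proof (cases "p \<le> m")
    case True
    then show ?thesis using Suc by (auto simp: falses_Suc bit_at_code_nat falses_def[of _ 0])
  next
    case False
    then obtain d where "p = Suc m + d" by (metis add.commute less_imp_Suc_add not_le add_Suc_right)
    then show ?thesis using Suc by (auto simp: falses_Suc bit_at_code_nat)
  qed
qed (simp add: falses_def)

lemma sum_split_lessThan: "(\<Sum>p<a + b. f p) = (\<Sum>p<a. f p) + (\<Sum>p<b. f (a + p))" for f :: "nat \<Rightarrow> nat"
  by (induction b) (auto simp: add.assoc)

lemma length_code_nat [simp]: "length (code_nat m) = Suc m"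
  by (simp add: code_nat_def)

lemma pos_code_nat_0: "pos (code_nat m @ w) 0 = m"
proof -
  have "pos (code_nat m @ w) 0 = (\<Sum>p<m + (1 + length w). of_bool (p < m))"
    unfolding pos_def by (intro sum.cong) (auto simp: falses_code_nat)
  then show ?thesis by (simp add: sum_split_lessThan del: sum.lessThan_Suc add_Suc_right)
qed

lemma pos_code_nat_Suc: "pos (code_nat m @ w) (Suc q) = Suc m + pos w q"
proof -
  have "pos (code_nat m @ w) (Suc q) =
      (\<Sum>p<Suc m + length w. if p \<le> m then 1 else of_bool (falses w (Suc (p - m - 1)) \<le> q))"
    unfolding pos_def
  proof (intro sum.cong)
    fix p assume "p \<in> {..<Suc m + length w}"
    show "(of_bool (falses (code_nat m @ w) (Suc p) \<le> Suc q) :: nat) =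
        (if p \<le> m then 1 else of_bool (falses w (Suc (p - m - 1)) \<le> q))"
      by (cases "p < m"; cases "p = m") (auto simp: falses_code_nat falses_def[of _ 0] Suc_diff_Suc)
  qed auto
  also have "\<dots> = Suc m + pos w q"
    by (simp only: sum_split_lessThan) (simp add: pos_def)
  finally show ?thesis .
qed

lemma num_codes:
  "j < length ms \<Longrightarrow> num (concat (map code_nat ms) @ w) j = ms ! j"
proof (induction ms arbitrary: j)
  case (Cons m ms)
  let ?w = "concat (map code_nat ms) @ w"
  show ?case
  proof (cases j)
    case 0
    then show ?thesis by (simp add: num_def pos_code_nat_0)
  next
    case (Suc i)
    then have "num ?w i = ms ! i" using Cons by auto
    then show ?thesis using Suc by (cases i) (auto simp: num_def pos_code_nat_0 pos_code_nat_Suc)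
  qed
qed simp

lemma pos_codes:
  "ms \<noteq> [] \<Longrightarrow> Suc (pos (concat (map code_nat ms) @ w) (length ms - 1)) = length (concat (map code_nat ms))"
proof (induction ms)
  case (Cons m ms)
  show ?case
  proof (cases ms)
    case Nil
    then show ?thesis using pos_code_nat_0[of m w] by simp
  next
    case (Cons m' ms')
    then show ?thesis using Cons.IH pos_code_nat_Suc[of m "concat (map code_nat ms) @ w" "length ms'"] by simp
  qed
qed simp

lemma concat_nth_uniform:
  "(\<And>x. x \<in> set xss \<Longrightarrow> length x = m) \<Longrightarrow> i < length xss \<Longrightarrow> j < m \<Longrightarrow>
    i * m + j < length (concat xss) \<and> concat xss ! (i * m + j) = xss ! i ! j"
proof (induction xss arbitrary: i)
  case (Cons x xss)
  then have "length x = m" by simp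
  with Cons show ?case by (cases i) (auto simp: nth_append)
qed simp

text \<open>The \<open>q\<close>-th tuple of the table of an \<open>r\<close>-ary operation: the digits of \<open>q\<close> in base \<open>n\<close>, the least
  significant one first.\<close>

lemma n_lists_nth:
  "q < n ^ r \<Longrightarrow> List.n_lists r [0..<n] ! q = map (\<lambda>i. q div n ^ i mod n) [0..<r]"
proof (induction r arbitrary: q)
  case (Suc r)
  have n: "0 < n" using Suc.prems by (cases n) auto
  let ?xss = "map (\<lambda>ys. map (\<lambda>y. y # ys) [0..<n]) (List.n_lists r [0..<n])"
  have q: "q div n < n ^ r" using Suc.prems n by (simp add: less_mult_imp_div_less mult.commute)
  have l: "length (List.n_lists r [0..<n]) = n ^ r" by (simp add: length_n_lists)
  have "List.n_lists (Suc r) [0..<n] ! q = concat ?xss ! (q div n * n + q mod n)" by simp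
  also have "\<dots> = ?xss ! (q div n) ! (q mod n)"
  proof -
    have "length x = n" if "x \<in> set ?xss" for x using that by auto
    from concat_nth_uniform[of ?xss, OF this, of "q div n" "q mod n"] show ?thesis using q l n by simp
  qed
  also have "\<dots> = q mod n # map (\<lambda>i. q div n div n ^ i mod n) [0..<r]"
    using q l n Suc.IH[OF q] by simp
  also have "\<dots> = map (\<lambda>i. q div n ^ i mod n) [0..<Suc r]"
    by (simp add: map_upt_Suc div_mult2_eq mult.commute del: upt_Suc)
  finally show ?case .
qed simp

text \<open>The size of the universe, the index of the number of congruences within the sequence of numbers, this number,
  the congruences and the tables of the operations\<close>

definition code_size :: "bits \<Rightarrow> nat" where
  "code_size w = num w 0"

definition code_index :: "language \<Rightarrow> bits \<Rightarrow> nat" where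
  "code_index L w = 2 + (\<Sum>a\<leftarrow>L. 1 + code_size w ^ a)"

definition code_count :: "language \<Rightarrow> bits \<Rightarrow> nat" where
  "code_count L w = num w (code_index L w)"

definition coded_rel :: "language \<Rightarrow> bits \<Rightarrow> nat \<Rightarrow> nat \<Rightarrow> nat \<Rightarrow> bool" where
  "coded_rel L w i a b \<longleftrightarrow>
     bit_at w (Suc (pos w (code_index L w)) + ((i * code_size w + a) * code_size w + b))"

definition code_oper :: "language \<Rightarrow> bits \<Rightarrow> nat \<Rightarrow> nat \<Rightarrow> nat" where
  "code_oper L w f q = num w (Suc (code_index (take f L) w) + q)"

text \<open>The sequence of the numbers whose unary codes precede the matrices of the congruences\<close>

definition numbers :: "crt_instance \<Rightarrow> nat list" where
  "numbers = (\<lambda>(L, B, \<theta>s). [card (univ B), length L] @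
     concat (map (\<lambda>f. L ! f # map (oper B f) (List.n_lists (L ! f) [0..<card (univ B)])) [0..<length L]) @
     [length \<theta>s])"

lemma code_instance_numbers:
  "code_instance (L, B, \<theta>s) =
     concat (map code_nat (numbers (L, B, \<theta>s))) @ concat (map (code_relation (card (univ B))) \<theta>s)"
proof -
  have "concat (map code_nat (concat (map (\<lambda>f. L ! f # map (oper B f) (F f)) l))) =
      concat (map (\<lambda>f. code_nat (L ! f) @ concat (map (\<lambda>xs. code_nat (oper B f xs)) (F f))) l)" for F l
    by (induction l) (auto simp: comp_def)
  then show ?thesis by (simp add: numbers_def code_algebra_def Let_def)
qed

lemma sum_list_take_nth: "(\<Sum>a\<leftarrow>take f L. g a) = (\<Sum>i\<leftarrow>[0..<f]. g (L ! i))" if "f \<le> length L"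
proof -
  have "take f L = map (\<lambda>i. L ! i) [0..<f]" using that by (intro nth_equalityI) auto
  then show ?thesis by (simp add: comp_def)
qed

lemma decode_instance:
  assumes B: "univ B = {..<n}" and w: "w = code_instance (L, B, \<theta>s)"
  shows "code_size w = n" "code_count L w = length \<theta>s"
    "i < length \<theta>s \<Longrightarrow> a < n \<Longrightarrow> b < n \<Longrightarrow> coded_rel L w i a b \<longleftrightarrow> (a, b) \<in> \<theta>s ! i"
    "f < length L \<Longrightarrow> q < n ^ (L ! f) \<Longrightarrow>
       code_oper L w f q = oper B f (map (\<lambda>i. q div n ^ i mod n) [0..<L ! f])"
proof -
  let ?ms = "numbers (L, B, \<theta>s)" and ?rels = "concat (map (code_relation n) \<theta>s)"
  let ?blk = "\<lambda>f. L ! f # map (oper B f) (List.n_lists (L ! f) [0..<n])"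
  have n: "card (univ B) = n" using B by simp
  have w': "w = concat (map code_nat ?ms) @ ?rels" using code_instance_numbers w n by simp
  have ms: "?ms = [n, length L] @ concat (map ?blk [0..<length L]) @ [length \<theta>s]"
    by (simp add: numbers_def n)
  have lc: "length (concat (map ?blk [0..<f])) = (\<Sum>a\<leftarrow>take f L. 1 + n ^ a)" if "f \<le> length L" for f
    using that by (simp add: sum_list_take_nth length_concat comp_def length_n_lists)
  show sz: "code_size w = n" unfolding code_size_def w' by (subst num_codes) (auto simp: ms)
  have idx: "code_index L w = length ?ms - 1"
    using lc[of "length L"] by (simp add: code_index_def sz ms)
  have ne: "?ms \<noteq> []" by (simp add: ms)
  show "code_count L w = length \<theta>s"
  proof -
    have "num w (length ?ms - 1) = ?ms ! (length ?ms - 1)"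
      using num_codes[of "length ?ms - 1" ?ms ?rels] ne w' by simp
    also have "\<dots> = length \<theta>s" using ne by (simp add: last_conv_nth[symmetric] ms)
    finally show ?thesis by (simp add: code_count_def idx)
  qed
  have p: "Suc (pos w (code_index L w)) = length (concat (map code_nat ?ms))"
    unfolding idx unfolding w' by (rule pos_codes[OF ne])
  show "coded_rel L w i a b \<longleftrightarrow> (a, b) \<in> \<theta>s ! i" if "i < length \<theta>s" "a < n" "b < n"
  proof -
    have ab: "a * n + b < n * n" using that
      by (metis add_less_le_mono less_eq_Suc_le mult_Suc mult_le_mono1 add.commute order_less_le_trans nat_add_left_cancel_less)
    have "(i * n + a) * n + b = i * (n * n) + (a * n + b)" by (simp add: algebra_simps)
    moreover have "i * (n * n) + (a * n + b) < length ?rels \<and>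
        ?rels ! (i * (n * n) + (a * n + b)) = code_relation n (\<theta>s ! i) ! (a * n + b)"
    proof -
      have "length x = n * n" if "x \<in> set (map (code_relation n) \<theta>s)" for x
        using that by (auto simp: code_relation_def)
      from concat_nth_uniform[of "map (code_relation n) \<theta>s", OF this, of i "a * n + b"] show ?thesis using that ab by simp
    qed
    moreover have "code_relation n (\<theta>s ! i) ! (a * n + b) \<longleftrightarrow> (a, b) \<in> \<theta>s ! i"
      using ab that by (simp add: code_relation_def product_nth)
    ultimately show ?thesis unfolding coded_rel_def p sz bit_at_def unfolding w'
      by (simp add: nth_append add.assoc)
  qed
  show "code_oper L w f q = oper B f (map (\<lambda>i. q div n ^ i mod n) [0..<L ! f])"
    if "f < length L" "q < n ^ (L ! f)"
  proof -
    let ?p = "length (concat (map ?blk [0..<f]))"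
    have i: "code_index (take f L) w = 2 + ?p" using lc[of f] that by (simp add: code_index_def sz)
    have "[0..<length L] = [0..<f] @ f # [Suc f..<length L]"
      using that(1) by (metis upt_conv_Cons upt_add_eq_append le_add_diff_inverse less_imp_le_nat zero_le)
    then have ms': "?ms = [n, length L] @ concat (map ?blk [0..<f]) @ ?blk f @
        (concat (map ?blk [Suc f..<length L]) @ [length \<theta>s])" unfolding ms by simp
    have q: "q < length (List.n_lists (L ! f) [0..<n])" using that by (simp add: length_n_lists)
    have "num w (Suc (2 + ?p) + q) = ?ms ! (Suc (2 + ?p) + q)"
      unfolding w' by (rule num_codes) (use q in \<open>simp add: ms'\<close>)
    also have "\<dots> = oper B f (List.n_lists (L ! f) [0..<n] ! q)"
      unfolding ms' using q by (simp add: nth_append)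
    finally show ?thesis unfolding code_oper_def i using n_lists_nth[OF that(2)] by simp
  qed
qed

lemma Def_falses: "r < 3 \<Longrightarrow> Def f \<Longrightarrow> Def (\<lambda>R \<rho>. falses (R r) (f R \<rho>))"
  unfolding falses_def by (intro Def_intros)

lemma Def_pos: "r < 3 \<Longrightarrow> Def f \<Longrightarrow> Def (\<lambda>R \<rho>. pos (R r) (f R \<rho>))"
  unfolding pos_def by (intro Def_intros Def_falses Def_shift)

lemma Def_num: "r < 3 \<Longrightarrow> Def f \<Longrightarrow> Def (\<lambda>R \<rho>. num (R r) (f R \<rho>))"
  unfolding num_def by (intro Def_intros Def_pos)

lemma Def_code_size: "r < 3 \<Longrightarrow> Def (\<lambda>R \<rho>. code_size (R r))"
  unfolding code_size_def by (intro Def_num Def_intros)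

lemma Def_code_index: "r < 3 \<Longrightarrow> Def (\<lambda>R \<rho>. code_index L (R r))"
  unfolding code_index_def by (intro Def_intros Def_sum_list Def_code_size)

lemma Def_code_count: "r < 3 \<Longrightarrow> Def (\<lambda>R \<rho>. code_count L (R r))"
  unfolding code_count_def by (intro Def_num Def_code_index)

lemma DefB_code_rel: "r < 3 \<Longrightarrow> Def f \<Longrightarrow> Def g \<Longrightarrow> Def h \<Longrightarrow>
    DefB (\<lambda>R \<rho>. coded_rel L (R r) (f R \<rho>) (g R \<rho>) (h R \<rho>))"
  unfolding coded_rel_def by (intro Def_intros Def_pos Def_code_index Def_code_size)

lemma Def_code_oper: "r < 3 \<Longrightarrow> Def g \<Longrightarrow> Def (\<lambda>R \<rho>. code_oper L (R r) f (g R \<rho>))"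
  unfolding code_oper_def by (intro Def_intros Def_num Def_code_index)

section \<open>The Chinese remainder property of equivalence relations\<close>

text \<open>For \<open>k\<close> equivalence relations \<open>E 0, \<dots>, E (k - 1)\<close> on \<open>{0, \<dots>, n - 1}\<close>, the join of \<open>E i\<close> and \<open>E j\<close> is the
  transitive closure of \<open>union_rel n E i j\<close>. A tuple is compatible if its entries are related by the
  joins. \<open>CR n k E\<close> says that every compatible tuple has a solution. Only indices below \<open>k\<close> and
  elements below \<open>n\<close> matter.\<close>

definition union_rel :: "nat \<Rightarrow> (nat \<Rightarrow> nat \<Rightarrow> nat \<Rightarrow> bool) \<Rightarrow> nat \<Rightarrow> nat \<Rightarrow> (nat \<times> nat) set" where
  "union_rel n E i j = {(x, y). x < n \<and> y < n \<and> (E i x y \<or> E j x y)}"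

definition compatible :: "nat \<Rightarrow> nat \<Rightarrow> (nat \<Rightarrow> nat \<Rightarrow> nat \<Rightarrow> bool) \<Rightarrow> (nat \<Rightarrow> nat) \<Rightarrow> bool" where
  "compatible n k E c \<longleftrightarrow> (\<forall>i<k. c i < n) \<and> (\<forall>i<k. \<forall>j<k. (c i, c j) \<in> (union_rel n E i j)\<^sup>+)"

definition CR :: "nat \<Rightarrow> nat \<Rightarrow> (nat \<Rightarrow> nat \<Rightarrow> nat \<Rightarrow> bool) \<Rightarrow> bool" where
  "CR n k E \<longleftrightarrow> (\<forall>c. compatible n k E c \<longrightarrow> (\<exists>b<n. \<forall>i<k. E i b (c i)))"

definition equivs :: "nat \<Rightarrow> nat \<Rightarrow> (nat \<Rightarrow> nat \<Rightarrow> nat \<Rightarrow> bool) \<Rightarrow> bool" where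
  "equivs n k E \<longleftrightarrow> (\<forall>i<k. (\<forall>x<n. E i x x) \<and> (\<forall>x<n. \<forall>y<n. E i x y \<longrightarrow> E i y x) \<and>
     (\<forall>x<n. \<forall>y<n. \<forall>z<n. E i x y \<longrightarrow> E i y z \<longrightarrow> E i x z))"

lemma union_rel_cong: "(\<And>a b. a < n \<Longrightarrow> b < n \<Longrightarrow> E i a b = E' i a b) \<Longrightarrow>
    (\<And>a b. a < n \<Longrightarrow> b < n \<Longrightarrow> E j a b = E' j a b) \<Longrightarrow> union_rel n E i j = union_rel n E' i j"
  by (auto simp: union_rel_def)

lemma CR_cong:
  assumes "\<And>i a b. i < k \<Longrightarrow> a < n \<Longrightarrow> b < n \<Longrightarrow> E i a b = E' i a b"
  shows "CR n k E = CR n k E'"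
proof -
  have "union_rel n E i j = union_rel n E' i j" if "i < k" "j < k" for i j
    using assms that by (intro union_rel_cong) auto
  then have c: "compatible n k E c = compatible n k E' c" for c by (auto simp: compatible_def)
  have "(\<exists>b<n. \<forall>i<k. E i b (c i)) = (\<exists>b<n. \<forall>i<k. E' i b (c i))" if "compatible n k E c" for c
    using assms that unfolding compatible_def by blast
  then show ?thesis unfolding CR_def using c by blast
qed

lemma equivs_cong:
  assumes "\<And>i a b. i < k \<Longrightarrow> a < n \<Longrightarrow> b < n \<Longrightarrow> E i a b = E' i a b"
  shows "equivs n k E = equivs n k E'"
  unfolding equivs_def using assms by (intro all_cong arg_cong2[where f = "(\<and>)"]) auto

lemma union_rel_congruences:
  assumes "\<theta> \<subseteq> {..<n} \<times> {..<n}" "\<delta> \<subseteq> {..<n} \<times> {..<n}" "\<theta> = {(a, b). a < n \<and> b < n \<and> E i a b}"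
    "\<delta> = {(a, b). a < n \<and> b < n \<and> E j a b}"
  shows "congruence_join \<theta> \<delta> = (union_rel n E i j)\<^sup>+"
  using assms unfolding congruence_join_def union_rel_def by (intro arg_cong[where f = trancl]) auto

lemma CR_tuple_iff:
  assumes "(L, B, \<theta>s) \<in> CRT_instances" and n: "univ B = {..<n}"
  shows "CR_tuple B \<theta>s \<longleftrightarrow> CR n (length \<theta>s) (\<lambda>i a b. (a, b) \<in> \<theta>s ! i)"
    and "equivs n (length \<theta>s) (\<lambda>i a b. (a, b) \<in> \<theta>s ! i)"
proof -
  let ?k = "length \<theta>s" and ?E = "\<lambda>i a b. (a, b) \<in> \<theta>s ! i"
  have eq: "equiv {..<n} (\<theta>s ! i)" if "i < ?k" for i
    using assms that by (auto simp: CRT_instances_def is_congruence_def)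
  then have sub: "\<theta>s ! i \<subseteq> {..<n} \<times> {..<n}" if "i < ?k" for i
    using that by (simp add: equiv_type)
  have join: "congruence_join (\<theta>s ! i) (\<theta>s ! j) = (union_rel n ?E i j)\<^sup>+" if "i < ?k" "j < ?k" for i j
    using sub that by (intro union_rel_congruences) auto
  show "CR_tuple B \<theta>s \<longleftrightarrow> CR n ?k ?E"
  proof
    assume cr: "CR_tuple B \<theta>s"
    show "CR n ?k ?E" unfolding CR_def
    proof (intro allI impI)
      fix c assume c: "compatible n ?k ?E c"
      let ?bs = "map c [0..<?k]"
      have "length ?bs = ?k \<and> set ?bs \<subseteq> univ B \<and>
          (\<forall>i<?k. \<forall>j<?k. (?bs ! i, ?bs ! j) \<in> congruence_join (\<theta>s ! i) (\<theta>s ! j))"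
        using c join n by (auto simp: compatible_def)
      then obtain b where "b \<in> univ B" "\<forall>i<?k. (b, ?bs ! i) \<in> \<theta>s ! i"
        using cr unfolding CR_tuple_def by blast
      then show "\<exists>b<n. \<forall>i<?k. ?E i b (c i)" using n by auto
    qed
  next
    assume cr: "CR n ?k ?E"
    show "CR_tuple B \<theta>s" unfolding CR_tuple_def
    proof (intro allI impI)
      fix bs assume bs: "length bs = ?k \<and> set bs \<subseteq> univ B \<and>
        (\<forall>i<?k. \<forall>j<?k. (bs ! i, bs ! j) \<in> congruence_join (\<theta>s ! i) (\<theta>s ! j))"
      then have "bs ! i < n" if "i < ?k" for i using n that by (auto simp: subset_iff)
      then have "compatible n ?k ?E (\<lambda>i. bs ! i)" using bs join by (simp add: compatible_def)
      then obtain b where "b < n" "\<forall>i<?k. (b, bs ! i) \<in> \<theta>s ! i" using cr unfolding CR_def by blast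
      then show "\<exists>b\<in>univ B. \<forall>i<?k. (b, bs ! i) \<in> \<theta>s ! i" using n by auto
    qed
  qed
  show "equivs n ?k ?E" unfolding equivs_def
    using eq unfolding equiv_def by (auto simp: refl_on_def dest: symD transD)
qed

text \<open>Whether the code of an instance belongs to a yes-instance can be read off the decoded relations; in particular it
  does not depend on the instance that has this code.\<close>

lemma CRT_restricted_decode:
  assumes "w \<in> fst (CRT_restricted L V)"
  obtains n B \<theta>s where "(L, B, \<theta>s) \<in> CRT_instances" "B \<in> V" "w = code_instance (L, B, \<theta>s)"
    "univ B = {..<n}" "n = code_size w" "0 < n" "code_count L w = length \<theta>s"
    "equivs n (code_count L w) (coded_rel L w)"
    "\<And>i a b. i < code_count L w \<Longrightarrow> a < n \<Longrightarrow> b < n \<Longrightarrow> coded_rel L w i a b \<longleftrightarrow> (a, b) \<in> \<theta>s ! i"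
    "w \<in> snd (CRT_restricted L V) \<longleftrightarrow> CR n (code_count L w) (coded_rel L w)"
proof -
  have gen: "univ B = {..<n} \<Longrightarrow> w = code_instance (L, B, \<theta>s) \<Longrightarrow> (L, B, \<theta>s) \<in> CRT_instances \<Longrightarrow>
      CR_tuple B \<theta>s \<longleftrightarrow> CR (code_size w) (code_count L w) (coded_rel L w)" for B n \<theta>s
    using CR_tuple_iff(1)[of L B \<theta>s n] decode_instance(1,2,3)[of B n w L \<theta>s]
      CR_cong[of "length \<theta>s" n "coded_rel L w" "\<lambda>i a b. (a, b) \<in> \<theta>s ! i"] by simp
  obtain B \<theta>s where B: "(L, B, \<theta>s) \<in> CRT_instances" "B \<in> V" "w = code_instance (L, B, \<theta>s)"
    using assms by (auto simp: CRT_restricted_def)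
  then obtain n where n: "univ B = {..<n}" by (auto simp: CRT_instances_def)
  have pos: "0 < n" using B(1) n by (cases n) (auto simp: CRT_instances_def is_algebra_def)
  note d = decode_instance(1,2,3)[OF n B(3)]
  have e: "equivs n (code_count L w) (coded_rel L w)"
    using CR_tuple_iff(2)[OF B(1) n] d
      equivs_cong[of "length \<theta>s" n "coded_rel L w" "\<lambda>i a b. (a, b) \<in> \<theta>s ! i"] by simp
  have "w \<in> snd (CRT_restricted L V) \<longleftrightarrow> CR n (code_count L w) (coded_rel L w)"
  proof
    assume "w \<in> snd (CRT_restricted L V)"
    then obtain B' \<theta>s' where B': "(L, B', \<theta>s') \<in> CRT_instances" "w = code_instance (L, B', \<theta>s')" "CR_tuple B' \<theta>s'"
      by (auto simp: CRT_restricted_def)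
    then obtain n' where "univ B' = {..<n'}" by (auto simp: CRT_instances_def)
    then show "CR n (code_count L w) (coded_rel L w)" using gen[of B' n' \<theta>s'] B' d(1) by simp
  next
    assume "CR n (code_count L w) (coded_rel L w)"
    then have "CR_tuple B \<theta>s" using gen[of B n \<theta>s] B n d(1) by simp
    then show "w \<in> snd (CRT_restricted L V)" unfolding CRT_restricted_def snd_conv B(3)
      using B by (intro imageI) auto
  qed
  then show ?thesis using that B n d pos e by metis
qed

section \<open>Membership in coNP\<close>

text \<open>Decoding of \<open>pair_code x u\<close>: each bit of \<open>x\<close> is preceded by a 1, and a 0 marks the end of \<open>x\<close>. The length of \<open>x\<close> is the
  number of pairs before this mark.\<close>

definition header :: "bits \<Rightarrow> nat" where
  "header z = (\<Sum>m<length z. of_bool (\<forall>i<Suc m. bit_at z (2 * i)))"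

definition pair_fst :: "bits \<Rightarrow> bits" where
  "pair_fst z = map (\<lambda>i. bit_at z (Suc (2 * i))) [0..<header z]"

definition pair_snd :: "bits \<Rightarrow> bits" where
  "pair_snd z = map (\<lambda>i. bit_at z (Suc (2 * header z) + i)) [0..<length z - Suc (2 * header z)]"

lemma length_pair_code: "length (pair_code x u) = Suc (2 * length x) + length u"
  by (induction x) (auto simp: pair_code_def)

lemma bit_at_pair_code:
  "i < length x \<Longrightarrow> bit_at (pair_code x u) (2 * i)"
  "i < length x \<Longrightarrow> bit_at (pair_code x u) (Suc (2 * i)) = x ! i"
  "\<not> bit_at (pair_code x u) (2 * length x)"
  "i < length u \<Longrightarrow> bit_at (pair_code x u) (Suc (2 * length x) + i) = u ! i"
proof -
  have l: "length (concat (map (\<lambda>b. [True, b]) x)) = length x * 2" by (induction x) auto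
  have c: "i < length x \<Longrightarrow> concat (map (\<lambda>b. [True, b]) x) ! (2 * i)"
    "i < length x \<Longrightarrow> concat (map (\<lambda>b. [True, b]) x) ! Suc (2 * i) = x ! i" for i
  proof -
    have "length y = 2" if "y \<in> set (map (\<lambda>b. [True, b]) x)" for y using that by auto
    note cn = concat_nth_uniform[of "map (\<lambda>b. [True, b]) x", OF this, of i]
    show "i < length x \<Longrightarrow> concat (map (\<lambda>b. [True, b]) x) ! (2 * i)"
      using cn[of 0] by (simp add: mult.commute)
    show "i < length x \<Longrightarrow> concat (map (\<lambda>b. [True, b]) x) ! Suc (2 * i) = x ! i"
      using cn[of 1] by (simp add: mult.commute)
  qed
  show "i < length x \<Longrightarrow> bit_at (pair_code x u) (2 * i)"
    using c l by (auto simp: bit_at_def length_pair_code) (simp add: pair_code_def nth_append l)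
  show "i < length x \<Longrightarrow> bit_at (pair_code x u) (Suc (2 * i)) = x ! i"
    using c l by (auto simp: bit_at_def length_pair_code) (simp_all add: pair_code_def nth_append l)
  show "\<not> bit_at (pair_code x u) (2 * length x)"
    by (simp add: bit_at_def pair_code_def nth_append l mult.commute)
  show "i < length u \<Longrightarrow> bit_at (pair_code x u) (Suc (2 * length x) + i) = u ! i"
    by (simp add: bit_at_def pair_code_def nth_append l mult.commute)
qed

lemma header_pair_code: "header (pair_code x u) = length x"
proof -
  let ?z = "pair_code x u"
  have "(\<forall>i<Suc m. bit_at ?z (2 * i)) \<longleftrightarrow> m < length x" for m
  proof
    assume a: "\<forall>i<Suc m. bit_at ?z (2 * i)"
    show "m < length x"
    proof (rule ccontr)
      assume "\<not> m < length x"
      then have "bit_at ?z (2 * length x)" using a by simp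
      then show False using bit_at_pair_code(3) by blast
    qed
  qed (use bit_at_pair_code(1) in auto)
  then have "header ?z = (\<Sum>m<length x + (Suc (length x) + length u). of_bool (m < length x))"
    unfolding header_def by (intro sum.cong) (auto simp: length_pair_code)
  then show ?thesis by (simp add: sum_split_lessThan del: sum.lessThan_Suc add_Suc_right add_Suc)
qed

lemma pair_fst [simp]: "pair_fst (pair_code x u) = x"
  by (rule nth_equalityI) (auto simp: pair_fst_def header_pair_code bit_at_pair_code)

lemma pair_snd [simp]: "pair_snd (pair_code x u) = u"
  by (rule nth_equalityI) (auto simp: pair_snd_def header_pair_code bit_at_pair_code length_pair_code
      simp del: add_Suc)

lemma Def_header: "r < 3 \<Longrightarrow> Def (\<lambda>R \<rho>. header (R r))"
  unfolding header_def by (intro Def_intros)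

text \<open>A definable relation between instances (the string 1) and certificates of polynomial length (the string 2) defines a set in NP.\<close>

theorem class_NP_DefB:
  assumes Q: "DefB (\<lambda>R _. Q (R 1) (R 2))"
  shows "{x. \<exists>u. length u \<le> poly p (length x) \<and> Q x u} \<in> class_NP"
proof -
  let ?R = "{z. Q (pair_fst z) (pair_snd z)}"
  have "?R = {z. let y1 = array1 header (\<lambda>_. 0) (\<lambda>z i. bit_at z (Suc (2 * i))) (\<lambda>_ _ _. True) z in
      Q y1 (array2 (\<lambda>z. length z - Suc (2 * header z)) (\<lambda>_. 0)
        (\<lambda>z _ i. bit_at z (Suc (2 * header z) + i)) (\<lambda>_ _ _ _. True) z y1)}"
    by (simp add: array1_def array2_def pair_fst_def pair_snd_def Let_def)
  also have "\<dots> \<in> class_P"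
    by (rule class_P_arrays) (use Q in \<open>auto intro!: Def_intros Def_header\<close>)
  finally have "?R \<in> class_P" .
  moreover have "x \<in> {x. \<exists>u. length u \<le> poly p (length x) \<and> Q x u} \<longleftrightarrow>
      (\<exists>u. length u \<le> poly p (length x) \<and> pair_code x u \<in> ?R)" for x by simp
  ultimately show ?thesis unfolding class_NP_def by blast
qed

text \<open>A certificate for the failure of the Chinese remainder property: \<open>el i i 0\<close> is a compatible tuple without a solution, and
  \<open>el i j 0, \<dots>, el i j (n * n)\<close> is a chain from \<open>el i i 0\<close> to \<open>el j j 0\<close>.\<close>

definition certificate :: "nat \<Rightarrow> nat \<Rightarrow> (nat \<Rightarrow> nat \<Rightarrow> nat \<Rightarrow> bool) \<Rightarrow> (nat \<Rightarrow> nat \<Rightarrow> nat \<Rightarrow> nat) \<Rightarrow> bool" where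
  "certificate n k E el \<longleftrightarrow>
     (\<forall>i<k. \<forall>j<k. el i j 0 = el i i 0 \<and> el i j (n * n) = el j j 0 \<and>
       (\<forall>t<Suc (n * n). el i j t < n) \<and>
       (\<forall>t<n * n. E i (el i j t) (el i j (Suc t)) \<or> E j (el i j t) (el i j (Suc t)))) \<and>
     (\<forall>b<n. \<exists>i<k. \<not> E i b (el i i 0))"

lemma certificateI:
  assumes "\<And>i j. i < k \<Longrightarrow> j < k \<Longrightarrow> el i j 0 = el i i 0"
    and "\<And>i j. i < k \<Longrightarrow> j < k \<Longrightarrow> el i j (n * n) = el j j 0"
    and "\<And>i j t. i < k \<Longrightarrow> j < k \<Longrightarrow> t < Suc (n * n) \<Longrightarrow> el i j t < n"
    and "\<And>i j t. i < k \<Longrightarrow> j < k \<Longrightarrow> t < n * n \<Longrightarrow>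
      E i (el i j t) (el i j (Suc t)) \<or> E j (el i j t) (el i j (Suc t))"
    and "\<And>b. b < n \<Longrightarrow> \<exists>i<k. \<not> E i b (el i i 0)"
  shows "certificate n k E el"
  unfolding certificate_def
proof (intro conjI allI impI)
  fix i j assume ij: "i < k" "j < k"
  show "el i j 0 = el i i 0" "el i j (n * n) = el j j 0" using assms(1,2) ij by blast+
  fix t
  show "t < Suc (n * n) \<Longrightarrow> el i j t < n" using assms(3) ij by blast
  show "t < n * n \<Longrightarrow> E i (el i j t) (el i j (Suc t)) \<or> E j (el i j t) (el i j (Suc t))"
    using assms(4) ij by blast
qed (use assms(5) in blast)

lemma certificateD:
  assumes "certificate n k E el"
  shows "i < k \<Longrightarrow> j < k \<Longrightarrow> el i j 0 = el i i 0"
    and "i < k \<Longrightarrow> j < k \<Longrightarrow> el i j (n * n) = el j j 0"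
    and "i < k \<Longrightarrow> j < k \<Longrightarrow> t < Suc (n * n) \<Longrightarrow> el i j t < n"
    and "i < k \<Longrightarrow> j < k \<Longrightarrow> t < n * n \<Longrightarrow>
      E i (el i j t) (el i j (Suc t)) \<or> E j (el i j t) (el i j (Suc t))"
    and "b < n \<Longrightarrow> \<exists>i<k. \<not> E i b (el i i 0)"
  using assms unfolding certificate_def by blast+

lemma certificate_cong:
  assumes "certificate n k E el" "\<And>i j t. i < k \<Longrightarrow> j < k \<Longrightarrow> t < Suc (n * n) \<Longrightarrow> el' i j t = el i j t"
  shows "certificate n k E el'"
proof -
  have "el' i j 0 = el i j 0" "el' i j (n * n) = el i j (n * n)"
    "t < n * n \<Longrightarrow> el' i j t = el i j t \<and> el' i j (Suc t) = el i j (Suc t)" if "i < k" "j < k" for i j t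
    using assms(2) that by simp_all
  note e = this
  note c = certificateD[OF assms(1)]
  show ?thesis
  proof (rule certificateI)
    fix i j assume ij: "i < k" "j < k"
    show "el' i j 0 = el' i i 0" using c(1)[OF ij] e(1)[OF ij] e(1)[OF ij(1,1)] by simp
    show "el' i j (n * n) = el' j j 0" using c(2)[OF ij] e(2)[OF ij] e(1)[OF ij(2,2)] by simp
    show "el' i j t < n" if "t < Suc (n * n)" for t using c(3)[OF ij that] assms(2)[OF ij that] by simp
    show "E i (el' i j t) (el' i j (Suc t)) \<or> E j (el' i j t) (el' i j (Suc t))" if "t < n * n" for t
      using c(4)[OF ij that] e(3)[OF ij that] by simp
  next
    fix b assume "b < n"
    then obtain i where "i < k" "\<not> E i b (el i i 0)" using c(5) by blast
    then show "\<exists>i<k. \<not> E i b (el' i i 0)" using e(1)[of i i] by auto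
  qed
qed

lemma relpow_pad:
  assumes "(a, b) \<in> R ^^ m" "(b, b) \<in> R" "m \<le> N"
  shows "(a, b) \<in> R ^^ N"
  using assms(3)
proof (induction rule: dec_induct)
  case (step N)
  then show ?case using assms(2) by auto
qed (rule assms(1))

text \<open>Since the union of two relations has at most \<open>n * n\<close> pairs, chains of this length are long enough, and
  shorter ones are padded by reflexivity.\<close>

lemma not_CR_iff_certificate:
  assumes n: "0 < n" and E: "equivs n k E"
  shows "\<not> CR n k E \<longleftrightarrow> (\<exists>el. certificate n k E el)"
proof
  assume "\<not> CR n k E"
  then obtain c where c: "compatible n k E c" "\<forall>b<n. \<exists>i<k. \<not> E i b (c i)" by (auto simp: CR_def)
  have "\<exists>f. f 0 = c i \<and> f (n * n) = c j \<and> (\<forall>t<n * n. (f t, f (Suc t)) \<in> union_rel n E i j)"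
    if "i < k" "j < k" for i j
  proof -
    let ?R = "union_rel n E i j"
    have sub: "?R \<subseteq> {..<n} \<times> {..<n}" by (auto simp: union_rel_def)
    have fin: "finite ?R" by (rule finite_subset[OF sub]) simp
    have card: "card ?R \<le> n * n" using card_mono[OF _ sub] by (simp add: card_cartesian_product)
    have "(c i, c j) \<in> ?R\<^sup>+" using c that by (simp add: compatible_def)
    then have "(c i, c j) \<in> ?R\<^sup>*" by (rule trancl_into_rtrancl)
    then obtain m where m: "m \<le> card ?R" "(c i, c j) \<in> ?R ^^ m"
      using rtrancl_finite_eq_relpow[OF fin] by auto
    have "(c j, c j) \<in> ?R" using E c that by (auto simp: union_rel_def equivs_def compatible_def)
    then have "(c i, c j) \<in> ?R ^^ (n * n)" using relpow_pad[OF m(2)] m(1) card by auto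
    then show ?thesis by (simp add: relpow_fun_conv)
  qed
  then obtain f where f: "\<And>i j. i < k \<Longrightarrow> j < k \<Longrightarrow> f i j 0 = c i \<and> f i j (n * n) = c j \<and>
      (\<forall>t<n * n. (f i j t, f i j (Suc t)) \<in> union_rel n E i j)" by metis
  have lt: "f i j t < n" if "i < k" "j < k" "t < Suc (n * n)" for i j t
  proof (cases "t = n * n")
    case True
    then show ?thesis using f[OF that(1,2)] c that by (auto simp: compatible_def)
  next
    case False
    then have "(f i j t, f i j (Suc t)) \<in> union_rel n E i j" using f[OF that(1,2)] that(3) by auto
    then show ?thesis by (simp add: union_rel_def)
  qed
  have "certificate n k E f"
  proof (rule certificateI)
    fix i j assume ij: "i < k" "j < k"
    show "f i j 0 = f i i 0" "f i j (n * n) = f j j 0"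
      using f[OF ij] f[OF ij(1,1)] f[OF ij(2,2)] by simp_all
    show "f i j t < n" if "t < Suc (n * n)" for t using lt[OF ij that] .
    show "E i (f i j t) (f i j (Suc t)) \<or> E j (f i j t) (f i j (Suc t))" if "t < n * n" for t
      using f[OF ij] that unfolding union_rel_def by blast
  next
    fix b assume "b < n"
    then obtain i where "i < k" "\<not> E i b (c i)" using c(2) by blast
    then show "\<exists>i<k. \<not> E i b (f i i 0)" using f[of i i] by auto
  qed
  then show "\<exists>el. certificate n k E el" by blast
next
  assume "\<exists>el. certificate n k E el"
  then obtain el where el: "certificate n k E el" by blast
  have "(el i i 0, el j j 0) \<in> (union_rel n E i j)\<^sup>+" if "i < k" "j < k" for i j
  proof -
    have "(el i i 0, el j j 0) \<in> union_rel n E i j ^^ (n * n)"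
      unfolding relpow_fun_conv
      by (rule exI[of _ "el i j"])
        (use certificateD(1-4)[OF el that] in \<open>auto simp: union_rel_def simp del: mult_Suc_right\<close>)
    then show ?thesis using n trancl_power nat_0_less_mult_iff by blast
  qed
  moreover have "el i i 0 < n" if "i < k" for i using certificateD(3)[OF el that that] by simp
  ultimately have "compatible n k E (\<lambda>i. el i i 0)" by (simp add: compatible_def)
  moreover have "\<not> (\<exists>b<n. \<forall>i<k. E i b (el i i 0))" using certificateD(5)[OF el] by blast
  ultimately show "\<not> CR n k E" unfolding CR_def by blast
qed

text \<open>The entries of a certificate are coded in unary, in blocks of length \<open>n\<close>.\<close>

definition entry :: "nat \<Rightarrow> nat \<Rightarrow> bits \<Rightarrow> nat \<Rightarrow> nat \<Rightarrow> nat \<Rightarrow> nat" where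
  "entry n k u i j t = (\<Sum>a<n. of_bool (bit_at u (((i * k + j) * Suc (n * n) + t) * n + a)))"

lemma mixed_radix_less: "i < m \<Longrightarrow> a < n \<Longrightarrow> i * n + a < m * n" for i a :: nat
  by (metis add.commute add_less_le_mono less_eq_Suc_le mult.commute mult_Suc_right mult_le_mono2
      nat_add_left_cancel_less order_less_le_trans)

lemma entry_surj:
  assumes n: "0 < n" and el: "\<And>i j t. i < k \<Longrightarrow> j < k \<Longrightarrow> t < Suc (n * n) \<Longrightarrow> el i j t < n"
  obtains u where "length u = k * k * Suc (n * n) * n"
    "\<And>i j t. i < k \<Longrightarrow> j < k \<Longrightarrow> t < Suc (n * n) \<Longrightarrow> entry n k u i j t = el i j t"
proof
  let ?N = "Suc (n * n)"
  let ?e = "\<lambda>p. el (p div n div ?N div k) (p div n div ?N mod k) (p div n mod ?N)"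
  let ?u = "map (\<lambda>p. p mod n < ?e p) [0..<k * k * ?N * n]"
  show "length ?u = k * k * ?N * n" by simp
  fix i j t assume ijt: "i < k" "j < k" "t < ?N"
  have "bit_at ?u (((i * k + j) * ?N + t) * n + a) \<longleftrightarrow> a < el i j t" if "a < n" for a
  proof -
    have "((i * k + j) * ?N + t) * n + a < k * k * ?N * n"
      using ijt that by (intro mixed_radix_less) auto
    moreover have "(((i * k + j) * ?N + t) * n + a) div n = (i * k + j) * ?N + t" using that by simp
    moreover have "((i * k + j) * ?N + t) div ?N = i * k + j" "((i * k + j) * ?N + t) mod ?N = t"
      using ijt(3) by (simp_all del: mult_Suc_right add_Suc_right)
    moreover have "(i * k + j) div k = i" "(i * k + j) mod k = j" using ijt by simp_all
    ultimately show ?thesis using that by (simp add: bit_at_def del: mult_Suc_right)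
  qed
  then have "entry n k ?u i j t = (\<Sum>a<n. of_bool (a < el i j t))"
    unfolding entry_def by (intro sum.cong) auto
  also have "\<dots> = (\<Sum>a<el i j t + (n - el i j t). of_bool (a < el i j t))" using el[OF ijt] by simp
  also have "\<dots> = el i j t" by (simp add: sum_split_lessThan)
  finally show "entry n k ?u i j t = el i j t" .
qed

lemma pos_le: "pos w q \<le> length w"
  using sum_bounded_above[of "{..<length w}" "\<lambda>p. of_bool (falses w (Suc p) \<le> q) :: nat" 1]
  by (simp add: pos_def)

lemma num_le: "num w m \<le> length w"
  using pos_le[of w m] by (auto simp: num_def intro: le_trans[OF diff_le_self])

lemma Def_entry:
  assumes "r < 3" "Def n" "Def k" "Def i" "Def j" "Def t"
  shows "Def (\<lambda>R \<rho>. entry (n R \<rho>) (k R \<rho>) (R r) (i R \<rho>) (j R \<rho>) (t R \<rho>))"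
  unfolding entry_def using assms by (intro Def_intros Def_shift)

theorem CRT_in_coNP: "in_class (CRT_restricted L V) class_coNP"
proof -
  let ?p = "[:0, 1:] * [:0, 1:] * [:1, 0, 1:] * [:0, 1:] :: nat poly"
  let ?Q = "\<lambda>x u. certificate (code_size x) (code_count L x) (coded_rel L x)
    (entry (code_size x) (code_count L x) u)"
  let ?X = "{x. \<exists>u. length u \<le> poly ?p (length x) \<and> ?Q x u}"
  have "DefB (\<lambda>R _. ?Q (R 1) (R 2))"
    unfolding certificate_def
    by (intro Def_intros Def_entry Def_code_size Def_code_count DefB_code_rel) simp_all
  then have "?X \<in> class_NP" by (rule class_NP_DefB)
  then have "- ?X \<in> class_coNP" by (simp add: class_coNP_def)
  moreover have "w \<in> - ?X \<longleftrightarrow> w \<in> snd (CRT_restricted L V)" if w: "w \<in> fst (CRT_restricted L V)" for w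
  proof -
    let ?n = "code_size w" and ?k = "code_count L w" and ?E = "coded_rel L w"
    have d: "0 < ?n" "equivs ?n ?k ?E" "w \<in> snd (CRT_restricted L V) \<longleftrightarrow> CR ?n ?k ?E"
      using w by (auto elim: CRT_restricted_decode)
    have "w \<in> ?X \<longleftrightarrow> (\<exists>el. certificate ?n ?k ?E el)"
    proof
      assume "\<exists>el. certificate ?n ?k ?E el"
      then obtain el where el: "certificate ?n ?k ?E el" by blast
      have lt: "el i j t < ?n" if "i < ?k" "j < ?k" "t < Suc (?n * ?n)" for i j t
        using certificateD(3)[OF el] that by blast
      obtain u where u: "length u = ?k * ?k * Suc (?n * ?n) * ?n"
        "\<And>i j t. i < ?k \<Longrightarrow> j < ?k \<Longrightarrow> t < Suc (?n * ?n) \<Longrightarrow> entry ?n ?k u i j t = el i j t"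
        by (rule entry_surj[OF d(1), of ?k el]) (use lt in auto)
      have "?Q w u" using certificate_cong[OF el u(2)] .
      moreover have "length u \<le> poly ?p (length w)"
      proof -
        have "?n \<le> length w" "?k \<le> length w" by (auto simp: code_size_def code_count_def num_le)
        then have "?k * ?k * Suc (?n * ?n) * ?n \<le> length w * length w * Suc (length w * length w) * length w"
          by (intro mult_le_mono Suc_le_mono[THEN iffD2])
        moreover have "poly ?p (length w) = length w * length w * Suc (length w * length w) * length w"
          by (simp add: algebra_simps)
        ultimately show ?thesis by (simp only: u)
      qed
      ultimately show "w \<in> ?X" by blast
    qed blast
    then show ?thesis using not_CR_iff_certificate[OF d(1,2)] d(3) by blast
  qed
  ultimately show ?thesis unfolding in_class_def by blast
qed

section \<open>Functional constraint satisfaction as a failure of the Chinese remainder property\<close>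

text \<open>Consider variables \<open>0, \<dots>, k - 1\<close> with values in \<open>{0, \<dots>, d - 1}\<close>, where \<open>valid i u\<close> says that \<open>u\<close> may be the
  value of \<open>i\<close>, and constraints \<open>lab i j (a i) = lab j i (a j)\<close>. The points of the following set are the quadruples
  \<open>(i, u, j, v)\<close>, written as numbers below \<open>k * d * k * d\<close>. A point is good if \<open>i \<noteq> j\<close> and the values \<open>u\<close> of \<open>i\<close>
  and \<open>v\<close> of \<open>j\<close> are valid and satisfy the constraint between \<open>i\<close> and \<open>j\<close>. For each variable \<open>l\<close>, two points are
  equivalent if they are good and give the same value to \<open>l\<close>; all other classes are singletons.\<close>

definition var1 :: "nat \<Rightarrow> nat \<Rightarrow> nat \<Rightarrow> nat" where "var1 k d b = b div d div k div d"
definition val1 :: "nat \<Rightarrow> nat \<Rightarrow> nat \<Rightarrow> nat" where "val1 k d b = b div d div k mod d"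
definition var2 :: "nat \<Rightarrow> nat \<Rightarrow> nat \<Rightarrow> nat" where "var2 k d b = b div d mod k"
definition val2 :: "nat \<Rightarrow> nat \<Rightarrow> nat \<Rightarrow> nat" where "val2 k d b = b mod d"

definition good :: "nat \<Rightarrow> nat \<Rightarrow> (nat \<Rightarrow> nat \<Rightarrow> bool) \<Rightarrow> (nat \<Rightarrow> nat \<Rightarrow> nat \<Rightarrow> 'l) \<Rightarrow> nat \<Rightarrow> bool" where
  "good k d valid lab b \<longleftrightarrow> var1 k d b \<noteq> var2 k d b \<and>
     valid (var1 k d b) (val1 k d b) \<and> valid (var2 k d b) (val2 k d b) \<and>
     lab (var1 k d b) (var2 k d b) (val1 k d b) = lab (var2 k d b) (var1 k d b) (val2 k d b)"

definition gives :: "nat \<Rightarrow> nat \<Rightarrow> nat \<Rightarrow> nat \<Rightarrow> nat \<Rightarrow> bool" where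
  "gives k d b l u \<longleftrightarrow> l = var1 k d b \<and> u = val1 k d b \<or> l = var2 k d b \<and> u = val2 k d b"

definition gadget :: "nat \<Rightarrow> nat \<Rightarrow> (nat \<Rightarrow> nat \<Rightarrow> bool) \<Rightarrow> (nat \<Rightarrow> nat \<Rightarrow> nat \<Rightarrow> 'l) \<Rightarrow> nat \<Rightarrow> nat \<Rightarrow> nat \<Rightarrow> bool" where
  "gadget k d valid lab l b b' \<longleftrightarrow> b = b' \<or>
     good k d valid lab b \<and> good k d valid lab b' \<and> (\<exists>u<d. gives k d b l u \<and> gives k d b' l u)"

lemma div_mod_mixed: "a < n \<Longrightarrow> (i * n + a) div n = i" "a < n \<Longrightarrow> (i * n + a) mod n = a" for a n i :: nat
  by auto

lemma point_exists:
  assumes "i < k" "u < d" "j < k" "v < d"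
  obtains b where "b < k * d * k * d" "var1 k d b = i" "val1 k d b = u" "var2 k d b = j" "val2 k d b = v"
proof
  let ?b = "((i * d + u) * k + j) * d + v"
  show "?b < k * d * k * d" using assms by (intro mixed_radix_less)
  show "var1 k d ?b = i" "val1 k d ?b = u" "var2 k d ?b = j" "val2 k d ?b = v"
    unfolding var1_def val1_def var2_def val2_def by (simp_all only: div_mod_mixed assms)
qed

lemma gives_unique: "good k d valid lab b \<Longrightarrow> gives k d b l u \<Longrightarrow> gives k d b l v \<Longrightarrow> u = v"
  by (auto simp: good_def gives_def)

lemma equivs_gadget: "equivs n k' (gadget k d valid lab)"
proof -
  have "gadget k d valid lab i x z" if "gadget k d valid lab i x y" "gadget k d valid lab i y z" for i x y z
    using that unfolding gadget_def by (metis gives_unique)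
  moreover have "gadget k d valid lab i y x" if "gadget k d valid lab i x y" for i x y
    using that unfolding gadget_def by blast
  moreover have "gadget k d valid lab i x x" for i x by (simp add: gadget_def)
  ultimately show ?thesis unfolding equivs_def by blast
qed

text \<open>The Chinese remainder property fails if and only if the constraint satisfaction problem has a solution \<open>a\<close>. Given \<open>a\<close>, choose
  for each \<open>i\<close> a good point \<open>c i\<close> that gives the value \<open>a i\<close> to \<open>i\<close>. Any two of these are
  joined by way of the point for \<open>i\<close>, \<open>a i\<close>, \<open>j\<close>, \<open>a j\<close>, but a point gives values to two variables only, so that no point solves
  the tuple. Conversely, let \<open>c\<close> be a compatible tuple without a solution. If every \<open>c i\<close> gives a value to
  \<open>i\<close>, these values solve the problem, because the labels are invariants of the joins. If \<open>c l\<close>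
  gives no value to \<open>l\<close>, then it agrees with \<open>c m\<close> for each \<open>m\<close> to which it gives no value; and if it gives a value to
  \<open>i\<close>, comparison of \<open>c i\<close> with the points \<open>c m\<close> shows that \<open>c i\<close> gives the same value to \<open>i\<close>. Hence \<open>c l\<close> solves the tuple,
  a contradiction. The comparison needs five variables and labels that determine the values.\<close>

theorem gadget_CR:
  fixes lab :: "nat \<Rightarrow> nat \<Rightarrow> nat \<Rightarrow> 'l"
  assumes k: "5 \<le> k"
    and sep: "\<And>i j. i < k \<Longrightarrow> j < k \<Longrightarrow> \<exists>m<k. m \<noteq> i \<and> m \<noteq> j \<and>
      (\<forall>u v. valid i u \<longrightarrow> valid i v \<longrightarrow> lab i m u = lab i m v \<longrightarrow> u = v)"
  shows "\<not> CR (k * d * k * d) k (gadget k d valid lab) \<longleftrightarrow>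
    (\<exists>a. (\<forall>i<k. a i < d \<and> valid i (a i)) \<and> (\<forall>i<k. \<forall>j<k. i \<noteq> j \<longrightarrow> lab i j (a i) = lab j i (a j)))"
    (is "_ \<longleftrightarrow> ?sat")
proof
  let ?n = "k * d * k * d" and ?E = "gadget k d valid lab" and ?good = "good k d valid lab"
  assume ?sat
  then obtain a where a: "\<And>i. i < k \<Longrightarrow> a i < d \<and> valid i (a i)"
    "\<And>i j. i < k \<Longrightarrow> j < k \<Longrightarrow> i \<noteq> j \<Longrightarrow> lab i j (a i) = lab j i (a j)" by blast
  have pt: "\<exists>b<?n. ?good b \<and> gives k d b i (a i) \<and> gives k d b j (a j)" if ij: "i < k" "j < k" "i \<noteq> j" for i j
  proof -
    obtain b where "b < ?n" "var1 k d b = i" "val1 k d b = a i" "var2 k d b = j" "val2 k d b = a j"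
      using point_exists[of i k "a i" d j "a j"] a ij by auto
    then show ?thesis using a ij by (intro exI[of _ b]) (auto simp: good_def gives_def)
  qed
  have "\<exists>b<?n. ?good b \<and> gives k d b i (a i)" if "i < k" for i
  proof -
    let ?j = "if i = 0 then 1 else 0 :: nat"
    have "?j < k" "i \<noteq> ?j" using k by auto
    then show ?thesis using pt[OF that] by blast
  qed
  then obtain c where c: "\<And>i. i < k \<Longrightarrow> c i < ?n \<and> ?good (c i) \<and> gives k d (c i) i (a i)" by metis
  have "(c i, c j) \<in> (union_rel ?n ?E i j)\<^sup>+" if ij: "i < k" "j < k" for i j
  proof (cases "i = j")
    case True
    then show ?thesis using c[OF ij(1)] by (auto simp: union_rel_def gadget_def)
  next
    case False
    then obtain b where b: "b < ?n" "?good b" "gives k d b i (a i)" "gives k d b j (a j)"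
      using pt ij by blast
    have "?E i (c i) b" "?E j b (c j)" using b c ij a unfolding gadget_def by blast+
    then have "(c i, b) \<in> union_rel ?n ?E i j" "(b, c j) \<in> union_rel ?n ?E i j"
      using b c ij by (auto simp: union_rel_def)
    then show ?thesis by (meson trancl.r_into_trancl trancl_trans)
  qed
  then have "compatible ?n k ?E c" using c by (simp add: compatible_def)
  moreover have "\<not> (\<forall>i<k. ?E i b (c i))" for b
  proof
    assume "\<forall>i<k. ?E i b (c i)"
    then have "i = var1 k d b \<or> i = var2 k d b" if "i < k" for i
      using c[OF that] that unfolding gadget_def gives_def by metis
    from this[of 0] this[of 1] this[of 2] k show False by auto
  qed
  ultimately show "\<not> CR ?n k ?E" unfolding CR_def by blast
next
  let ?n = "k * d * k * d" and ?E = "gadget k d valid lab" and ?good = "good k d valid lab"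
  assume "\<not> CR ?n k ?E"
  then obtain c where c: "compatible ?n k ?E c" "\<And>b. b < ?n \<Longrightarrow> \<exists>i<k. \<not> ?E i b (c i)"
    unfolding CR_def by blast
  \<comment> \<open>the value that the good point \<open>b\<close> gives to \<open>l\<close>, if any\<close>
  define def where "def l b \<longleftrightarrow> ?good b \<and> (\<exists>u. gives k d b l u)" for l b
  define cls where "cls l b = (THE u. gives k d b l u)" for l b
  have cls: "gives k d b l u \<longleftrightarrow> u = cls l b" if "def l b" for l b u
  proof -
    have "\<exists>!u. gives k d b l u" using that gives_unique[of k d valid lab b l] by (auto simp: def_def)
    then show ?thesis unfolding cls_def by (metis theI')
  qed
  have clsI: "def l b \<and> cls l b = u" if "?good b" "gives k d b l u" for l b u
  proof -
    have "def l b" using that unfolding def_def by blast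
    then show ?thesis using cls that(2) by auto
  qed
  have E: "?E l b b' \<longleftrightarrow> b = b' \<or> def l b \<and> def l b' \<and> cls l b = cls l b'" if "b < ?n" for l b b'
  proof -
    have d: "0 < d" using that by (cases d) auto
    have lt: "u < d" if "gives k d b l u" for u
      using that d by (auto simp: gives_def val1_def val2_def)
    show ?thesis
    proof
      assume "?E l b b'"
      then show "b = b' \<or> def l b \<and> def l b' \<and> cls l b = cls l b'"
        unfolding gadget_def using clsI by metis
    next
      assume "b = b' \<or> def l b \<and> def l b' \<and> cls l b = cls l b'"
      then show "?E l b b'" unfolding gadget_def using cls lt by (metis def_def)
    qed
  qed
  \<comment> \<open>an invariant of the join of the \<open>i\<close>-th and the \<open>j\<close>-th equivalence for \<open>i \<noteq> j\<close>\<close>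
  define inv where "inv i j b = (if def i b then Inl (lab i j (cls i b))
    else if def j b then Inl (lab j i (cls j b)) else Inr b)" for i j b
  have two: "l = var1 k d b \<or> l = var2 k d b" if "def l b" for l b
    using that by (auto simp: def_def gives_def)
  have both: "lab i j (cls i b) = lab j i (cls j b)" if "def i b" "def j b" "i \<noteq> j" for i j b
  proof -
    have "gives k d b i (cls i b)" "gives k d b j (cls j b)" "?good b"
      using cls that by (auto simp: def_def)
    then show ?thesis using that(3) by (auto simp: good_def gives_def)
  qed
  have inv_step: "inv i j b = inv i j b'" if "(b, b') \<in> union_rel ?n ?E i j" "i \<noteq> j" for i j b b'
    using that E both[of i b j] both[of i b' j] unfolding union_rel_def inv_def by (auto split: if_splits)
  have inv: "inv i j (c i) = inv i j (c j)" if "i < k" "j < k" "i \<noteq> j" for i j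
  proof -
    have "(c i, c j) \<in> (union_rel ?n ?E i j)\<^sup>+" using c(1) that by (simp add: compatible_def)
    then show ?thesis by (induction rule: trancl_induct) (use inv_step that in auto)
  qed
  have cn: "c i < ?n" if "i < k" for i using c(1) that by (simp add: compatible_def)
  have "0 < d" using cn[of 0] k by (cases d) auto
  then have cls_lt: "cls l b < d" if "def l b" for l b
  proof -
    have "gives k d b l (cls l b)" using cls that by auto
    with \<open>0 < d\<close> show ?thesis by (auto simp: gives_def val1_def val2_def)
  qed
  have cls_valid: "valid l (cls l b)" if "def l b" for l b
  proof -
    have "gives k d b l (cls l b)" "?good b" using cls that by (auto simp: def_def)
    then show ?thesis by (auto simp: gives_def good_def)
  qed
  have all_def: "def l (c l)" if l: "l < k" for l
  proof (rule ccontr)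
    assume nd: "\<not> def l (c l)"
    let ?b = "c l"
    have far: "c m = ?b" if m: "m < k" "\<not> def m ?b" for m
    proof (cases "m = l")
      case False
      have "inv l m ?b = Inr ?b" using nd m by (simp add: inv_def)
      then have "inv l m (c m) = Inr ?b" using inv[OF l m(1)] False by simp
      then show ?thesis by (auto simp: inv_def split: if_splits)
    qed simp
    have "?E i ?b (c i)" if i: "i < k" for i
    proof (cases "def i ?b")
      case False
      then show ?thesis using far[OF i] by (simp add: gadget_def)
    next
      case True
      let ?u = "cls i ?b"
      let ?j = "if var1 k d ?b = i then var2 k d ?b else var1 k d ?b"
      have j: "m = i \<or> m = ?j" if "def m ?b" for m
        using two[OF that] two[OF True] by auto
      have invm: "inv i m (c i) = Inl (lab i m ?u)" if m: "m < k" "m \<noteq> i" "m \<noteq> ?j" for m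
      proof -
        have "c m = ?b" using far[OF m(1)] j m by blast
        then show ?thesis using inv[OF i m(1)] m True by (simp add: inv_def)
      qed
      have "def i (c i)"
      proof (rule ccontr)
        assume nd: "\<not> def i (c i)"
        have "def m (c i)" if "m < k" "m \<noteq> i" "m \<noteq> ?j" for m
          using invm[OF that] nd by (auto simp: inv_def split: if_splits)
        then have "m \<in> {i, ?j, var1 k d (c i), var2 k d (c i)}" if "m < k" for m
          using two[of m "c i"] that by blast
        \<comment> \<open>each point gives values to at most two variables, so that four variables are not enough\<close>
        then have "{..<5} \<subseteq> {i, ?j, var1 k d (c i), var2 k d (c i)}"
          using k by (intro subsetI) (simp only: lessThan_iff)
        then have "card {..<5 :: nat} \<le> card {i, ?j, var1 k d (c i), var2 k d (c i)}"
          by (intro card_mono) auto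
        also have "\<dots> \<le> 4" by (simp add: card_insert_if)
        finally show False by simp
      qed
      moreover have "cls i (c i) = ?u"
      proof -
        have kd: "0 < k" using k by simp
        have "?j < k" using cn[OF l] kd
          by (auto simp: var1_def var2_def less_mult_imp_div_less mult.assoc)
        from sep[OF i this] obtain m where m: "m < k" "m \<noteq> i" "m \<noteq> ?j"
          "\<And>u v. valid i u \<Longrightarrow> valid i v \<Longrightarrow> lab i m u = lab i m v \<Longrightarrow> u = v" by blast
        have "lab i m (cls i (c i)) = lab i m ?u"
          using invm[OF m(1-3)] \<open>def i (c i)\<close> by (simp add: inv_def)
        then show ?thesis using m(4) cls_valid \<open>def i (c i)\<close> True by blast
      qed
      ultimately show ?thesis using E[OF cn[OF l]] True by simp
    qed
    then show False using c(2)[OF cn[OF l]] by blast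
  qed
  have "lab i j (cls i (c i)) = lab j i (cls j (c j))" if ij: "i < k" "j < k" "i \<noteq> j" for i j
    using inv[OF ij] all_def[OF ij(1)] all_def[OF ij(2)] both[of i "c j" j] ij
    by (auto simp: inv_def split: if_splits)
  then show ?sat using all_def cls_lt cls_valid by (intro exI[of _ "\<lambda>i. cls i (c i)"]) auto
qed

section \<open>Computations of Turing machines\<close>

text \<open>The next state and the actions, also in the halting state\<close>

definition transition :: "tm \<Rightarrow> nat \<Rightarrow> nat list \<Rightarrow> nat \<times> (nat \<times> int) list" where
  "transition M q ss = (if q < states M then delta M q ss else (q, stay ss))"

text \<open>The configuration after \<open>t\<close> steps, its state, the scanned symbols, and the head position and the contents of the tape \<open>r\<close>\<close>

definition run :: "tm \<Rightarrow> bits \<Rightarrow> nat \<Rightarrow> config" where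
  "run M w t = (step M ^^ t) (initial M w)"

definition state_at :: "tm \<Rightarrow> bits \<Rightarrow> nat \<Rightarrow> nat" where
  "state_at M w t = fst (run M w t)"

definition scan_at :: "tm \<Rightarrow> bits \<Rightarrow> nat \<Rightarrow> nat list" where
  "scan_at M w t = map scan (snd (run M w t))"

definition head_at :: "tm \<Rightarrow> bits \<Rightarrow> nat \<Rightarrow> nat \<Rightarrow> int" where
  "head_at M w t r = snd (snd (run M w t) ! r)"

definition cell_at :: "tm \<Rightarrow> bits \<Rightarrow> nat \<Rightarrow> nat \<Rightarrow> int \<Rightarrow> nat" where
  "cell_at M w t r = fst (snd (run M w t) ! r)"

lemma step_trans: "step M (q, ts) = (let (q', as) = transition M q (map scan ts) in (q', map2 act as ts))"
proof -
  have "map (\<lambda>(c, h). c h) ts = map scan ts" by (auto simp: scan_def split: prod.splits)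
  then show ?thesis by (simp add: transition_def map2_act_stay del: map_eq_conv)
qed

lemma transition_wf:
  assumes M: "wf_tm M" and q: "q \<le> states M" and ss: "length ss = tapes M" "set ss \<subseteq> {..<symbols M}"
  shows "fst (transition M q ss) \<le> states M" "length (snd (transition M q ss)) = tapes M"
    "r < tapes M \<Longrightarrow> fst (snd (transition M q ss) ! r) < symbols M"
    "r < tapes M \<Longrightarrow> snd (snd (transition M q ss) ! r) \<in> {-1, 0, 1}"
proof -
  have *: "fst (transition M q ss) \<le> states M \<and> length (snd (transition M q ss)) = tapes M \<and>
      set (snd (transition M q ss)) \<subseteq> {..<symbols M} \<times> {-1, 0, 1}"
  proof (cases "q < states M")
    case True
    then show ?thesis using M ss unfolding wf_tm_def transition_def by auto
  next
    case False
    then show ?thesis using q ss by (auto simp: transition_def stay_def)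
  qed
  then show "fst (transition M q ss) \<le> states M" "length (snd (transition M q ss)) = tapes M" by auto
  assume r: "r < tapes M"
  have "snd (transition M q ss) ! r \<in> {..<symbols M} \<times> {-1, 0, 1}" using * r by (metis nth_mem subsetD)
  then show "fst (snd (transition M q ss) ! r) < symbols M" "snd (snd (transition M q ss) ! r) \<in> {-1, 0, 1}"
    by (auto simp: mem_Times_iff)
qed

lemma run_invariant:
  assumes M: "wf_tm M"
  shows "state_at M w t \<le> states M \<and> length (snd (run M w t)) = tapes M \<and>
    (\<forall>r<tapes M. \<bar>head_at M w t r\<bar> \<le> int t \<and> (\<forall>s. cell_at M w t r s < symbols M))"
    and "state_at M w (Suc t) = fst (transition M (state_at M w t) (scan_at M w t))"
    and "r < tapes M \<Longrightarrow> head_at M w (Suc t) r =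
      head_at M w t r + snd (snd (transition M (state_at M w t) (scan_at M w t)) ! r)"
    and "r < tapes M \<Longrightarrow> cell_at M w (Suc t) r s = (if s = head_at M w t r
      then fst (snd (transition M (state_at M w t) (scan_at M w t)) ! r) else cell_at M w t r s)"
    and "r < tapes M \<Longrightarrow> scan_at M w t ! r = cell_at M w t r (head_at M w t r)"
    and "set (scan_at M w t) \<subseteq> {..<symbols M}"
proof -
  let ?tr = "\<lambda>t. transition M (state_at M w t) (scan_at M w t)"
  have st: "run M w (Suc t) = (fst (?tr t), map2 act (snd (?tr t)) (snd (run M w t)))" for t
    using step_trans[of M "fst (run M w t)" "snd (run M w t)"]
    by (simp add: run_def state_at_def scan_at_def Let_def split: prod.splits)
  have sc: "scan_at M w t ! r = cell_at M w t r (head_at M w t r)"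
    if "r < tapes M" "length (snd (run M w t)) = tapes M" for r t
    using that by (simp add: scan_at_def cell_at_def head_at_def scan_def)
  have act: "fst (act p tp) s = (if s = snd tp then fst p else fst tp s)" "snd (act p tp) = snd tp + snd p" for p tp s
    by (cases p; cases tp; auto)+
  have sets: "set (scan_at M w t) \<subseteq> {..<symbols M}"
    if "length (snd (run M w t)) = tapes M" "\<forall>r<tapes M. \<forall>s. cell_at M w t r s < symbols M" for t
    using that sc[OF _ that(1)] by (force simp: in_set_conv_nth scan_at_def)
  have hc: "head_at M w (Suc t) r = head_at M w t r + snd (snd (?tr t) ! r)"
    "cell_at M w (Suc t) r s = (if s = head_at M w t r then fst (snd (?tr t) ! r) else cell_at M w t r s)"
    if "r < tapes M" "length (snd (run M w t)) = tapes M" "length (snd (?tr t)) = tapes M" for r t s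
    using that by (simp_all add: head_at_def cell_at_def st act)
  have inv: "state_at M w t \<le> states M \<and> length (snd (run M w t)) = tapes M \<and>
    (\<forall>r<tapes M. \<bar>head_at M w t r\<bar> \<le> int t \<and> (\<forall>s. cell_at M w t r s < symbols M))" for t
  proof (induction t)
    case 0
    have "0 < tapes M" "3 \<le> symbols M" using M by (auto simp: wf_tm_def)
    then show ?case
      by (auto simp: state_at_def head_at_def cell_at_def run_def initial_def nth_Cons' input_tape_def
          intro: less_le_trans[OF bit_symbol_pos(3)])
  next
    case (Suc t)
    have ss: "set (scan_at M w t) \<subseteq> {..<symbols M}" using sets Suc by blast
    have l: "length (scan_at M w t) = tapes M" using Suc by (simp add: scan_at_def)
    have "state_at M w t \<le> states M" using Suc by blast
    note tr = transition_wf[OF M this l ss]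
    have len: "length (snd (run M w t)) = tapes M" using Suc by blast
    have "\<bar>head_at M w (Suc t) r\<bar> \<le> int (Suc t) \<and> cell_at M w (Suc t) r s < symbols M" if r: "r < tapes M" for r s
    proof -
      have "\<bar>head_at M w t r\<bar> \<le> int t" "cell_at M w t r s < symbols M" using Suc r by blast+
      then show ?thesis using tr(3,4)[OF r] by (auto simp: hc[OF r len tr(2)])
    qed
    then show ?case using tr(1,2) len by (simp add: state_at_def[of M w "Suc t"] st)
  qed
  show "state_at M w t \<le> states M \<and> length (snd (run M w t)) = tapes M \<and>
    (\<forall>r<tapes M. \<bar>head_at M w t r\<bar> \<le> int t \<and> (\<forall>s. cell_at M w t r s < symbols M))" by (rule inv)
  show "state_at M w (Suc t) = fst (?tr t)" by (simp add: state_at_def[of M w "Suc t"] st)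
  have len: "length (snd (run M w t)) = tapes M" and ss: "set (scan_at M w t) \<subseteq> {..<symbols M}"
    using inv sets by blast+
  show "set (scan_at M w t) \<subseteq> {..<symbols M}" by (rule ss)
  have l: "length (scan_at M w t) = tapes M" using len by (simp add: scan_at_def)
  have q: "state_at M w t \<le> states M" using inv by blast
  assume r: "r < tapes M"
  note hc' = hc[OF r len transition_wf(2)[OF M q l ss]]
  show "head_at M w (Suc t) r = head_at M w t r + snd (snd (?tr t) ! r)" by (rule hc')
  show "cell_at M w (Suc t) r s = (if s = head_at M w t r then fst (snd (?tr t) ! r) else cell_at M w t r s)"
    by (rule hc')
  show "scan_at M w t ! r = cell_at M w t r (head_at M w t r)" using sc r len by blast
qed

section \<open>Computations as constraint satisfaction\<close>

text \<open>The situations of a machine: a state together with the list of the scanned symbols. The functions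
  of situations are made to vanish outside of their finite domains.\<close>

definition situations :: "tm \<Rightarrow> (nat \<times> nat list) list" where
  "situations M = List.product [0..<Suc (states M)] (List.n_lists (tapes M) [0..<symbols M])"

definition sit_state :: "tm \<Rightarrow> nat \<Rightarrow> nat" where
  "sit_state M j = (if j < length (situations M) then fst (situations M ! j) else 0)"

definition sit_scan :: "tm \<Rightarrow> nat \<Rightarrow> nat \<Rightarrow> nat" where
  "sit_scan M j r = (if j < length (situations M) \<and> r < tapes M then snd (situations M ! j) ! r else 0)"

definition sit_next :: "tm \<Rightarrow> nat \<Rightarrow> nat" where
  "sit_next M j = (if j < length (situations M) then fst (case_prod (transition M) (situations M ! j)) else 0)"

definition sit_write :: "tm \<Rightarrow> nat \<Rightarrow> nat \<Rightarrow> nat" where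
  "sit_write M j r = (if j < length (situations M) \<and> r < tapes M
     then fst (snd (case_prod (transition M) (situations M ! j)) ! r) else 0)"

text \<open>The displacement of the head, plus 1\<close>

definition sit_move :: "tm \<Rightarrow> nat \<Rightarrow> nat \<Rightarrow> nat" where
  "sit_move M j r = (if j < length (situations M) \<and> r < tapes M
     then nat (snd (snd (case_prod (transition M) (situations M ! j)) ! r) + 1) else 0)"

text \<open>The first \<open>T\<close> steps of the machine \<open>M\<close> on the input \<open>pair_code x z\<close>, where \<open>z\<close> is unknown and at most
  \<open>lm\<close> long, are described by variables for the triples of a time \<open>t\<close>, a tape \<open>r\<close> and a position \<open>p\<close>,
  which stands for the cell \<open>p - T\<close>. There are five copies of each of them, so that there are at least five
  variables and each of them has a copy different from any two given variables. The value of a variable consists of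
  the situation at the time \<open>t\<close>, the length of \<open>z\<close>, the position of the head on the tape \<open>r\<close>
  and the content of the cell.\<close>

definition win_pos :: "nat \<Rightarrow> nat \<Rightarrow> nat" where "win_pos T i = i mod Suc (2 * T)"
definition win_tape :: "tm \<Rightarrow> nat \<Rightarrow> nat \<Rightarrow> nat" where "win_tape M T i = i div Suc (2 * T) mod tapes M"
definition win_time :: "tm \<Rightarrow> nat \<Rightarrow> nat \<Rightarrow> nat" where
  "win_time M T i = i div Suc (2 * T) div tapes M mod Suc T"
definition windows :: "tm \<Rightarrow> nat \<Rightarrow> nat" where
  "windows M T = 5 * Suc T * tapes M * Suc (2 * T)"

definition val_cell :: "tm \<Rightarrow> nat \<Rightarrow> nat" where "val_cell M u = u mod symbols M"
definition val_head :: "tm \<Rightarrow> nat \<Rightarrow> nat \<Rightarrow> nat" where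
  "val_head M T u = u div symbols M mod Suc (2 * T)"
definition val_len :: "tm \<Rightarrow> nat \<Rightarrow> nat \<Rightarrow> nat \<Rightarrow> nat" where
  "val_len M T lm u = u div symbols M div Suc (2 * T) mod Suc lm"
definition val_sit :: "tm \<Rightarrow> nat \<Rightarrow> nat \<Rightarrow> nat \<Rightarrow> nat" where
  "val_sit M T lm u = u div symbols M div Suc (2 * T) div Suc lm"
definition win_values :: "tm \<Rightarrow> nat \<Rightarrow> nat \<Rightarrow> nat" where
  "win_values M T lm = length (situations M) * Suc lm * Suc (2 * T) * symbols M"

text \<open>The cell \<open>s\<close> of the input tape may contain \<open>c\<close> initially if \<open>z\<close> has length \<open>l\<close>.\<close>

definition input_cell :: "bits \<Rightarrow> nat \<Rightarrow> nat \<Rightarrow> nat \<Rightarrow> bool" where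
  "input_cell x l s c \<longleftrightarrow>
     (if s < 2 * length x then c = (if even s \<or> bit_at x (s div 2) then 2 else 1)
      else if s = 2 * length x then c = 1
      else if s < Suc (2 * length x) + l then c = 1 \<or> c = 2
      else c = 0)"

text \<open>The conditions on a single value: the scanned cell agrees with the situation, the configuration at the time 0 is initial, and at
  the time \<open>T\<close> the cell 0 of the first tape contains the symbol of an accepting output.\<close>

definition win_valid :: "tm \<Rightarrow> bits \<Rightarrow> nat \<Rightarrow> nat \<Rightarrow> nat \<Rightarrow> nat \<Rightarrow> bool" where
  "win_valid M x T lm i u \<longleftrightarrow>
     (val_head M T u = win_pos T i \<longrightarrow> val_cell M u = sit_scan M (val_sit M T lm u) (win_tape M T i)) \<and>
     (win_time M T i = 0 \<longrightarrow> sit_state M (val_sit M T lm u) = 0 \<and> val_head M T u = T \<and>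
        (if win_tape M T i = 0 \<and> T \<le> win_pos T i
         then input_cell x (val_len M T lm u) (win_pos T i - T) (val_cell M u) else val_cell M u = 0)) \<and>
     (win_time M T i = T \<and> win_tape M T i = 0 \<and> win_pos T i = T \<longrightarrow> val_cell M u = 2)"

text \<open>The labels to be compared for two variables. At the same time, the situations and the lengths must agree, and also the heads if the
  tapes are the same; copies of the same variable must have equal values. At consecutive times, the state, the head
  and the content of the cell at the later time must be those that the situation at the earlier time determines. The later head is
  increased by 1, as the displacement is.\<close>

definition win_label :: "tm \<Rightarrow> nat \<Rightarrow> nat \<Rightarrow> nat \<Rightarrow> nat \<Rightarrow> nat \<Rightarrow> nat \<times> nat \<times> nat" where
  "win_label M T lm i i' u =
     (let t = win_time M T i; t' = win_time M T i'; r = win_tape M T i; j = val_sit M T lm u; h = val_head M T u;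
        same = (r = win_tape M T i'); samepos = (same \<and> win_pos T i = win_pos T i')
      in if t = t' then (if samepos then (u, 0, 0)
           else (j, val_len M T lm u, if same then h else 0))
         else if t' = Suc t then (sit_next M j, if same then h + sit_move M j r else 0,
           if samepos then (if h = win_pos T i then sit_write M j r else val_cell M u) else 0)
         else if t = Suc t' then (sit_state M j, if same then Suc h else 0, if samepos then val_cell M u else 0)
         else (0, 0, 0))"

definition win_index :: "tm \<Rightarrow> nat \<Rightarrow> nat \<Rightarrow> nat \<Rightarrow> nat \<Rightarrow> nat \<Rightarrow> nat" where
  "win_index M T g t r p = ((g * Suc T + t) * tapes M + r) * Suc (2 * T) + p"

lemma win_index:
  assumes "t \<le> T" "r < tapes M" "p \<le> 2 * T"
  shows "win_time M T (win_index M T g t r p) = t" "win_tape M T (win_index M T g t r p) = r"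
    "win_pos T (win_index M T g t r p) = p" "g < 5 \<Longrightarrow> win_index M T g t r p < windows M T"
proof -
  have l: "t < Suc T" "p < Suc (2 * T)" using assms by auto
  show "win_time M T (win_index M T g t r p) = t" "win_tape M T (win_index M T g t r p) = r"
    "win_pos T (win_index M T g t r p) = p"
    unfolding win_time_def win_tape_def win_pos_def win_index_def
    by (simp_all only: div_mod_mixed l assms(2))
  show "win_index M T g t r p < windows M T" if "g < 5"
    unfolding win_index_def windows_def using that l assms(2) by (intro mixed_radix_less)
qed

lemma win_ranges:
  assumes "0 < tapes M"
  shows "win_time M T i \<le> T" "win_tape M T i < tapes M" "win_pos T i \<le> 2 * T"
  using assms mod_less_divisor[of "Suc T" "i div Suc (2 * T) div tapes M"] mod_less_divisor[of "Suc (2 * T)" i]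
  unfolding win_time_def win_tape_def win_pos_def less_Suc_eq_le by simp_all

text \<open>Among three copies of the variable \<open>i\<close>, one differs from \<open>i\<close> and \<open>j\<close>; its label with \<open>i\<close> is the value.\<close>

lemma win_separation:
  assumes M: "0 < tapes M" and i: "i < windows M T" and j: "j < windows M T"
  shows "\<exists>m<windows M T. m \<noteq> i \<and> m \<noteq> j \<and> (\<forall>u v. win_label M T lm i m u = win_label M T lm i m v \<longrightarrow> u = v)"
proof -
  let ?w = "\<lambda>g. win_index M T g (win_time M T i) (win_tape M T i) (win_pos T i)"
  note r = win_ranges[OF M, of T i]
  have inj: "g = g'" if "?w g = ?w g'" for g g'
  proof -
    have "win_time M T i < Suc T" "win_pos T i < Suc (2 * T)" using r by auto
    then have "?w g div Suc (2 * T) div tapes M div Suc T = g" for g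
      unfolding win_index_def by (simp only: div_mod_mixed r(2))
    then show ?thesis using that by metis
  qed
  obtain g where g: "g < 3" "?w g \<noteq> i" "?w g \<noteq> j"
  proof -
    have "\<exists>g\<in>{0, 1, 2}. ?w g \<noteq> i \<and> ?w g \<noteq> j"
      using inj[of 0 1] inj[of 0 2] inj[of 1 2] by auto
    then obtain g where g: "g \<in> {0, 1, 2}" "?w g \<noteq> i" "?w g \<noteq> j" by blast
    from g(1) have "g < 3" by auto
    then show ?thesis using that g(2,3) by blast
  qed
  have "win_label M T lm i (?w g) u = (u, 0, 0)" for u
    using win_index(1-3)[OF r] by (simp add: win_label_def Let_def)
  then show ?thesis using g win_index(4)[OF r, of g] by (intro exI[of _ "?w g"]) auto
qed

text \<open>Encoding of the values\<close>

definition win_value :: "tm \<Rightarrow> nat \<Rightarrow> nat \<Rightarrow> nat \<Rightarrow> nat \<Rightarrow> nat \<Rightarrow> nat \<Rightarrow> nat" where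
  "win_value M T lm j l h c = ((j * Suc lm + l) * Suc (2 * T) + h) * symbols M + c"

lemma win_value:
  assumes "l \<le> lm" "h \<le> 2 * T" "c < symbols M"
  shows "val_sit M T lm (win_value M T lm j l h c) = j" "val_len M T lm (win_value M T lm j l h c) = l"
    "val_head M T (win_value M T lm j l h c) = h" "val_cell M (win_value M T lm j l h c) = c"
    "j < length (situations M) \<Longrightarrow> win_value M T lm j l h c < win_values M T lm"
proof -
  have l: "l < Suc lm" "h < Suc (2 * T)" using assms by auto
  show "val_sit M T lm (win_value M T lm j l h c) = j" "val_len M T lm (win_value M T lm j l h c) = l"
    "val_head M T (win_value M T lm j l h c) = h" "val_cell M (win_value M T lm j l h c) = c"
    unfolding val_sit_def val_len_def val_head_def val_cell_def win_value_def
    by (simp_all only: div_mod_mixed l assms(3))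
  show "win_value M T lm j l h c < win_values M T lm" if "j < length (situations M)"
    unfolding win_value_def win_values_def using that l assms(3) by (intro mixed_radix_less)
qed

lemma situation_exists:
  assumes "q \<le> states M" "length ss = tapes M" "set ss \<subseteq> {..<symbols M}"
  obtains j where "j < length (situations M)" "situations M ! j = (q, ss)"
proof -
  have "(q, ss) \<in> set (situations M)"
    using assms by (auto simp: situations_def set_n_lists)
  then show ?thesis using that by (metis in_set_conv_nth)
qed

lemma situation_length: "j < length (situations M) \<Longrightarrow> length (snd (situations M ! j)) = tapes M"
proof -
  assume "j < length (situations M)"
  then have "situations M ! j \<in> set (situations M)" by simp
  then show ?thesis by (auto simp: situations_def set_n_lists)
qed

lemma input_tape_pair_code:
  assumes "length z = l"
  shows "input_cell x l s (input_tape (pair_code x z) (int s))"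
proof -
  consider (x) "s < 2 * length x" | (e) "s = 2 * length x" | (z) "2 * length x < s" "s < Suc (2 * length x) + l"
    | (b) "Suc (2 * length x) + l \<le> s" by linarith
  then show ?thesis
  proof cases
    case x
    have b: "pair_code x z ! s = (even s \<or> bit_at x (s div 2))"
    proof (cases "even s")
      case True
      then show ?thesis using x bit_at_pair_code(1)[of "s div 2" x z] by (auto simp: bit_at_def)
    next
      case False
      then have "s = Suc (2 * (s div 2))" by simp
      moreover have "s div 2 < length x" using x by simp
      ultimately show ?thesis using False bit_at_pair_code(2)[of "s div 2" x z] x
        by (auto simp: bit_at_def length_pair_code)
    qed
    show ?thesis using x by (simp add: input_cell_def input_tape_nat b length_pair_code bit_symbol_def)
  next
    case e
    have "\<not> pair_code x z ! s" using bit_at_pair_code(3)[of x z] e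
      by (simp add: length_pair_code bit_at_def)
    then have "input_tape (pair_code x z) (int s) = 1"
      using e by (simp only: input_tape_nat) (simp add: length_pair_code bit_symbol_def)
    then show ?thesis using e by (simp add: input_cell_def)
  qed (use assms in \<open>auto simp: input_cell_def input_tape_nat length_pair_code bit_symbol_def\<close>)
qed

text \<open>A solution describes a computation: by induction on the time, its values are those of the configurations on the input
  \<open>pair_code x z\<close>, where the bits of \<open>z\<close> are read off the cells at the time 0.\<close>

theorem computation_csp:
  assumes M: "wf_tm M" and T: "Suc (2 * length x) + lm \<le> T"
  shows "(\<exists>a. (\<forall>i<windows M T. a i < win_values M T lm \<and> win_valid M x T lm i (a i)) \<and>
      (\<forall>i<windows M T. \<forall>j<windows M T. i \<noteq> j \<longrightarrow> win_label M T lm i j (a i) = win_label M T lm j i (a j))) \<longleftrightarrow>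
    (\<exists>z. length z \<le> lm \<and> cell_at M (pair_code x z) T 0 0 = 2)" (is "?sat \<longleftrightarrow> ?acc")
proof
  assume ?acc
  then obtain z where z: "length z \<le> lm" "cell_at M (pair_code x z) T 0 0 = 2" by blast
  let ?w = "pair_code x z" and ?l = "length z"
  have tp: "0 < tapes M" "3 \<le> symbols M" using M by (auto simp: wf_tm_def)
  note inv = run_invariant[OF M, where w = ?w]
  have "\<exists>j<length (situations M). situations M ! j = (state_at M ?w t, scan_at M ?w t)" for t
    using situation_exists[of "state_at M ?w t" M "scan_at M ?w t"] inv(1,6)[of t]
    by (metis length_map scan_at_def)
  then obtain J where J: "\<And>t. J t < length (situations M)"
    "\<And>t. situations M ! J t = (state_at M ?w t, scan_at M ?w t)" by metis
  define hd where "hd t r = nat (head_at M ?w t r + int T)" for t r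
  define a where "a i = (let t = win_time M T i; r = win_tape M T i in
    win_value M T lm (J t) ?l (hd t r) (cell_at M ?w t r (int (win_pos T i) - int T)))" for i
  have hd: "hd t r \<le> 2 * T" "int (hd t r) = head_at M ?w t r + int T" if "t \<le> T" "r < tapes M" for t r
    using inv(1)[of t] that unfolding hd_def by fastforce+
  have a: "val_sit M T lm (a i) = J (win_time M T i)" "val_len M T lm (a i) = ?l"
    "val_head M T (a i) = hd (win_time M T i) (win_tape M T i)"
    "val_cell M (a i) = cell_at M ?w (win_time M T i) (win_tape M T i) (int (win_pos T i) - int T)"
    "a i < win_values M T lm" for i
    using win_value[OF z(1) hd(1)[OF win_ranges(1,2)[OF tp(1), of T i]]] J(1) inv(1) win_ranges[OF tp(1), of T i]
    unfolding a_def Let_def by blast+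
  have valid: "win_valid M x T lm i (a i)" for i
  proof -
    let ?t = "win_time M T i" and ?r = "win_tape M T i" and ?p = "win_pos T i"
    note rg = win_ranges[OF tp(1), of T i]
    have "cell_at M ?w ?t ?r (int ?p - int T) = sit_scan M (J ?t) ?r" if "hd ?t ?r = ?p"
    proof -
      have "int ?p - int T = head_at M ?w ?t ?r" using hd(2)[OF rg(1,2)] that by simp
      then show ?thesis using inv(5)[OF rg(2), of ?t] by (simp add: sit_scan_def J rg)
    qed
    moreover have "sit_state M (J 0) = 0 \<and> hd 0 ?r = T \<and>
        (if ?r = 0 \<and> T \<le> ?p then input_cell x ?l (?p - T) (cell_at M ?w 0 ?r (int ?p - int T))
         else cell_at M ?w 0 ?r (int ?p - int T) = 0)"
    proof (intro conjI)
      show "sit_state M (J 0) = 0" by (simp add: sit_state_def J state_at_def run_def initial_def)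
      have "head_at M ?w 0 ?r = 0" using rg(2) by (simp add: head_at_def run_def initial_def nth_Cons')
      then show "hd 0 ?r = T" by (simp add: hd_def)
      show "if ?r = 0 \<and> T \<le> ?p then input_cell x ?l (?p - T) (cell_at M ?w 0 ?r (int ?p - int T))
         else cell_at M ?w 0 ?r (int ?p - int T) = 0"
        using rg(2) input_tape_pair_code[of z ?l x "?p - T"]
        by (auto simp: cell_at_def run_def initial_def nth_Cons' of_nat_diff) (auto simp: input_tape_def)
    qed
    ultimately show ?thesis unfolding win_valid_def a using z(2) by (auto split: if_splits)
  qed
  have label: "win_label M T lm i j (a i) = win_label M T lm j i (a j)" for i j
  proof -
    let ?t = "win_time M T i" and ?r = "win_tape M T i" and ?p = "win_pos T i"
    let ?t' = "win_time M T j" and ?r' = "win_tape M T j" and ?p' = "win_pos T j"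
    have next_label: "win_label M T lm i j (a i) = win_label M T lm j i (a j)"
      if t: "win_time M T j = Suc (win_time M T i)" for i j
    proof -
      let ?t = "win_time M T i" and ?r = "win_tape M T i" and ?p = "win_pos T i"
      have rg: "Suc ?t \<le> T" "?r < tapes M" "?t \<le> T" using win_ranges[OF tp(1)] t by (metis Suc_leD)+
      let ?tr = "transition M (state_at M ?w ?t) (scan_at M ?w ?t)"
      have l: "length (scan_at M ?w ?t) = tapes M" using inv(1)[of ?t] by (simp add: scan_at_def)
      have q: "state_at M ?w ?t \<le> states M" using inv(1)[of ?t] by blast
      note tr = transition_wf(3,4)[OF M q l inv(6) rg(2)]
      have "sit_next M (J ?t) = sit_state M (J (Suc ?t))"
        by (simp add: sit_next_def sit_state_def J inv(2))
      moreover have "hd ?t ?r + sit_move M (J ?t) ?r = Suc (hd (Suc ?t) ?r)"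
      proof -
        have "int (hd ?t ?r + sit_move M (J ?t) ?r) = int (Suc (hd (Suc ?t) ?r))"
          using hd(2)[OF rg(3,2)] hd(2)[OF rg(1,2)] tr(2) inv(3)[OF rg(2), of ?t]
          by (auto simp: sit_move_def J rg)
        then show ?thesis by (simp only: of_nat_eq_iff)
      qed
      moreover have "cell_at M ?w (Suc ?t) ?r (int ?p - int T) =
          (if hd ?t ?r = ?p then sit_write M (J ?t) ?r else cell_at M ?w ?t ?r (int ?p - int T))"
      proof -
        have "int ?p - int T = head_at M ?w ?t ?r \<longleftrightarrow> hd ?t ?r = ?p" using hd(2)[OF rg(3,2)] by auto
        then show ?thesis using inv(4)[OF rg(2), of ?t "int ?p - int T"] by (simp add: sit_write_def J rg)
      qed
      ultimately show ?thesis by (auto simp: win_label_def Let_def a t)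
    qed
    consider "?t = ?t'" | "?t' = Suc ?t" | "?t = Suc ?t'"
      | "?t \<noteq> ?t'" "?t' \<noteq> Suc ?t" "?t \<noteq> Suc ?t'" by blast
    then show ?thesis
    proof cases
      case 1
      then show ?thesis by (auto simp: win_label_def Let_def a) (simp_all add: a_def Let_def)
    qed (use next_label[of i j] next_label[of j i] in \<open>auto simp: win_label_def Let_def\<close>)
  qed
  show ?sat using a(5) valid label by blast
next
  assume ?sat
  then obtain a where a: "\<And>i. i < windows M T \<Longrightarrow> a i < win_values M T lm \<and> win_valid M x T lm i (a i)"
    "\<And>i j. i < windows M T \<Longrightarrow> j < windows M T \<Longrightarrow> i \<noteq> j \<Longrightarrow> win_label M T lm i j (a i) = win_label M T lm j i (a j)"
    by blast
  have tp: "0 < tapes M" "3 \<le> symbols M" using M by (auto simp: wf_tm_def)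
  define A where "A t r p = a (win_index M T 0 t r p)" for t r p
  let ?sit = "\<lambda>t r p. val_sit M T lm (A t r p)" and ?hd = "\<lambda>t r p. val_head M T (A t r p)"
    and ?c = "\<lambda>t r p. val_cell M (A t r p)"
  have label: "win_label M T lm (win_index M T 0 t r p) (win_index M T 0 t' r' p') (A t r p) =
      win_label M T lm (win_index M T 0 t' r' p') (win_index M T 0 t r p) (A t' r' p')"
    if "t \<le> T" "r < tapes M" "p \<le> 2 * T" "t' \<le> T" "r' < tapes M" "p' \<le> 2 * T" for t r p t' r' p'
    using a(2)[OF win_index(4)[OF that(1-3)] win_index(4)[OF that(4-6)]]
    by (cases "win_index M T 0 t r p = win_index M T 0 t' r' p'") (auto simp: A_def)
  have valid: "win_valid M x T lm (win_index M T 0 t r p) (A t r p)"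
    if "t \<le> T" "r < tapes M" "p \<le> 2 * T" for t r p
    using a(1)[OF win_index(4)[OF that]] by (simp add: A_def)
  have sit_lt: "?sit t r p < length (situations M)" if "t \<le> T" "r < tapes M" "p \<le> 2 * T" for t r p
  proof -
    have "A t r p < win_values M T lm" using a(1)[OF win_index(4)[OF that]] by (simp add: A_def)
    then show ?thesis
      by (auto simp: val_sit_def win_values_def less_mult_imp_div_less mult.assoc simp del: mult_Suc mult_Suc_right)
  qed
  have same_time: "?sit t r p = ?sit t r' p' \<and> val_len M T lm (A t r p) = val_len M T lm (A t r' p')"
    if "t \<le> T" "r < tapes M" "p \<le> 2 * T" "r' < tapes M" "p' \<le> 2 * T" for t r p r' p'
    using label[OF that(1,2,3,1,4,5)] by (auto simp: win_label_def Let_def win_index that split: if_splits)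
  define l where "l = val_len M T lm (A 0 0 0)"
  define z where "z = map (\<lambda>s. ?c 0 0 (T + (Suc (2 * length x) + s)) = 2) [0..<l]"
  let ?w = "pair_code x z"
  have l: "l \<le> lm" using mod_less_divisor[of "Suc lm"] by (auto simp: l_def val_len_def less_Suc_eq_le simp del: mod_less_divisor)
  note inv = run_invariant[OF M, where w = ?w]
  have locate: "situations M ! ?sit t r p = (state_at M ?w t, scan_at M ?w t)"
    if t: "t \<le> T" and st: "\<And>r p. r < tapes M \<Longrightarrow> p \<le> 2 * T \<Longrightarrow> sit_state M (?sit t r p) = state_at M ?w t \<and>
        int (?hd t r p) = head_at M ?w t r + int T \<and> ?c t r p = cell_at M ?w t r (int p - int T)"
      and rp: "r < tapes M" "p \<le> 2 * T" for t r p
  proof -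
    have "snd (situations M ! ?sit t r p) = scan_at M ?w t"
    proof (rule nth_equalityI)
      show len: "length (snd (situations M ! ?sit t r p)) = length (scan_at M ?w t)"
        using situation_length[OF sit_lt[OF t rp]] inv(1)[of t] by (simp add: scan_at_def)
      fix r' assume "r' < length (snd (situations M ! ?sit t r p))"
      then have r': "r' < tapes M" using situation_length[OF sit_lt[OF t rp]] by simp
      let ?p = "nat (head_at M ?w t r' + int T)"
      have hb: "\<bar>head_at M ?w t r'\<bar> \<le> int T" using inv(1)[of t] r' t by fastforce
      then have p: "?p \<le> 2 * T" and ip: "int ?p = head_at M ?w t r' + int T" by auto
      have "int (?hd t r' ?p) = int ?p" using st[OF r' p] ip by simp
      then have "?hd t r' ?p = ?p" by (simp only: of_nat_eq_iff)
      then have "?c t r' ?p = sit_scan M (?sit t r' ?p) r'"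
        using valid[OF t r' p] by (simp add: win_valid_def win_index[OF t r' p])
      moreover have "?sit t r' ?p = ?sit t r p" using same_time[OF t r' p rp] by simp
      moreover have "?c t r' ?p = scan_at M ?w t ! r'"
        using st[OF r' p] ip inv(5)[OF r', of t] by simp
      ultimately show "snd (situations M ! ?sit t r p) ! r' = scan_at M ?w t ! r'"
        using sit_lt[OF t rp] r' by (simp add: sit_scan_def)
    qed
    moreover have "fst (situations M ! ?sit t r p) = state_at M ?w t"
      using st[OF rp] sit_lt[OF t rp] by (simp add: sit_state_def)
    ultimately show ?thesis by (metis prod.collapse)
  qed
  have main: "sit_state M (?sit t r p) = state_at M ?w t \<and> int (?hd t r p) = head_at M ?w t r + int T \<and>
      ?c t r p = cell_at M ?w t r (int p - int T)"
    if "t \<le> T" "r < tapes M" "p \<le> 2 * T" for t r p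
    using that
  proof (induction t arbitrary: r p)
    case (0 r p)
    note v = valid[OF 0, unfolded win_valid_def win_index[OF 0]]
    have "val_len M T lm (A 0 r p) = l" using same_time[OF 0, of 0 0] tp by (simp add: l_def)
    then have cell: "if r = 0 \<and> T \<le> p then input_cell x l (p - T) (?c 0 r p) else ?c 0 r p = 0"
      using v by auto
    have "?c 0 r p = cell_at M ?w 0 r (int p - int T)"
    proof (cases "r = 0 \<and> T \<le> p")
      case True
      have lz: "length z = l" by (simp add: z_def)
      have zc: "z ! (p - T - Suc (2 * length x)) \<longleftrightarrow> ?c 0 r p = 2"
        if "2 * length x < p - T" "p - T < Suc (2 * length x) + l"
        using that True by (auto simp: z_def)
      have "cell_at M ?w 0 r (int p - int T) = input_tape ?w (int (p - T))"
        using True by (simp add: cell_at_def run_def initial_def of_nat_diff)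
      moreover have "input_cell x l (p - T) (input_tape ?w (int (p - T)))"
        by (rule input_tape_pair_code[OF lz])
      moreover have "input_tape ?w (int (p - T)) = bit_symbol (?c 0 r p = 2)"
        if "2 * length x < p - T" "p - T < Suc (2 * length x) + l"
      proof -
        have "p - T = Suc (2 * length x) + (p - T - Suc (2 * length x))" using that by simp
        moreover have "p - T - Suc (2 * length x) < length z" using that lz by simp
        ultimately have "bit_at ?w (p - T) = z ! (p - T - Suc (2 * length x))"
          using bit_at_pair_code(4) by metis
        then show ?thesis unfolding input_tape_nat using zc[OF that] that lz
          by (simp add: length_pair_code bit_at_def)
      qed
      ultimately show ?thesis using cell True
        by (auto simp: input_cell_def bit_symbol_def split: if_splits)
    next
      case False
      then show ?thesis using cell 0
        by (auto simp: cell_at_def run_def initial_def nth_Cons' input_tape_def)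
    qed
    then show ?case using v 0(2)
      by (simp add: state_at_def head_at_def run_def initial_def nth_Cons')
  next
    case (Suc t)
    have t: "t \<le> T" using Suc by simp
    note IH = Suc.IH[OF t]
    have sit: "situations M ! ?sit t r p = (state_at M ?w t, scan_at M ?w t)"
      by (rule locate[OF t IH Suc.prems(2,3)]) auto
    let ?tr = "transition M (state_at M ?w t) (scan_at M ?w t)"
    have len: "length (scan_at M ?w t) = tapes M" using inv(1)[of t] by (simp add: scan_at_def)
    have q: "state_at M ?w t \<le> states M" using inv(1)[of t] by blast
    note tr = transition_wf(3,4)[OF M q len inv(6) Suc.prems(2)]
    note wi = win_index[OF t Suc.prems(2,3)] win_index[OF Suc.prems]
    have "win_label M T lm (win_index M T 0 t r p) (win_index M T 0 (Suc t) r p) (A t r p) =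
        (fst ?tr, ?hd t r p + nat (snd (snd ?tr ! r) + 1), if ?hd t r p = p then fst (snd ?tr ! r) else ?c t r p)"
      using sit_lt[OF t Suc.prems(2,3)] Suc.prems(2)
      by (simp add: win_label_def Let_def wi sit_next_def sit_move_def sit_write_def sit)
    moreover have "win_label M T lm (win_index M T 0 (Suc t) r p) (win_index M T 0 t r p) (A (Suc t) r p) =
        (sit_state M (?sit (Suc t) r p), Suc (?hd (Suc t) r p), ?c (Suc t) r p)"
      by (simp add: win_label_def Let_def wi)
    ultimately have eq: "sit_state M (?sit (Suc t) r p) = fst ?tr"
      "Suc (?hd (Suc t) r p) = ?hd t r p + nat (snd (snd ?tr ! r) + 1)"
      "?c (Suc t) r p = (if ?hd t r p = p then fst (snd ?tr ! r) else ?c t r p)"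
      using label[OF t Suc.prems(2,3) Suc.prems] by auto
    have "int (?hd (Suc t) r p) = head_at M ?w (Suc t) r + int T"
    proof -
      have "int (Suc (?hd (Suc t) r p)) = int (?hd t r p) + (snd (snd ?tr ! r) + 1)"
        using eq(2) tr(2) by auto
      then show ?thesis using IH[OF Suc.prems(2,3)] inv(3)[OF Suc.prems(2), of t] by simp
    qed
    moreover have "?c (Suc t) r p = cell_at M ?w (Suc t) r (int p - int T)"
    proof -
      have "?hd t r p = p \<longleftrightarrow> int p - int T = head_at M ?w t r" using IH[OF Suc.prems(2,3)] by auto
      then show ?thesis using eq(3) IH[OF Suc.prems(2,3)] inv(4)[OF Suc.prems(2), of t "int p - int T"] by simp
    qed
    ultimately show ?case using eq(1) inv(2)[of t] by simp
  qed
  have "?c T 0 T = 2" using valid[of T 0 T] tp win_index[of T T 0 M T 0] by (simp add: win_valid_def)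
  then have "cell_at M ?w T 0 0 = 2" using main[of T 0 T] tp by simp
  then show ?acc using l by (intro exI[of _ z]) (simp add: z_def)
qed

section \<open>Definability of the reduction\<close>

lemma Def_table2:
  assumes "Def f" "Def g"
  shows "Def (\<lambda>R \<rho>. if f R \<rho> < c \<and> g R \<rho> < c' then F (f R \<rho>) (g R \<rho>) else 0)"
proof -
  let ?h = "\<lambda>R \<rho>. f R \<rho> * c' + g R \<rho>"
  have "Def (\<lambda>R \<rho>. if g R \<rho> < c' then (if ?h R \<rho> < c * c' then F (?h R \<rho> div c') (?h R \<rho> mod c') else 0) else 0)"
    using assms by (intro Def_if DefB_less Def_const Def_table[of ?h "c * c'" "\<lambda>m. F (m div c') (m mod c')"]
        Def_plus Def_mult)
  moreover have "(if b < c' then (if a * c' + b < c * c' then F ((a * c' + b) div c') ((a * c' + b) mod c') else 0) else 0) =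
      (if a < c \<and> b < c' then F a b else 0)" for a b
  proof (cases "b < c'")
    case True
    have "a * c' + b < c * c' \<longleftrightarrow> a < c"
    proof
      assume "a * c' + b < c * c'"
      then have "a * c' < c * c'" by linarith
      then show "a < c" by simp
    qed (use True mixed_radix_less in blast)
    then show ?thesis using True by (simp add: div_mod_mixed)
  qed simp
  ultimately show ?thesis by simp
qed

lemma Def_situations1:
  assumes "Def f"
  shows "Def (\<lambda>R \<rho>. sit_state M (f R \<rho>))" "Def (\<lambda>R \<rho>. sit_next M (f R \<rho>))"
  unfolding sit_state_def sit_next_def
  using Def_table[OF assms, of "length (situations M)" "\<lambda>j. fst (situations M ! j)"]
    Def_table[OF assms, of "length (situations M)" "\<lambda>j. fst (case_prod (transition M) (situations M ! j))"]
  by simp_all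

lemma Def_situations2:
  assumes "Def f" "Def g"
  shows "Def (\<lambda>R \<rho>. sit_scan M (f R \<rho>) (g R \<rho>))" "Def (\<lambda>R \<rho>. sit_write M (f R \<rho>) (g R \<rho>))"
    "Def (\<lambda>R \<rho>. sit_move M (f R \<rho>) (g R \<rho>))"
  unfolding sit_scan_def sit_write_def sit_move_def
  using Def_table2[OF assms, of "length (situations M)" "tapes M" "\<lambda>j r. snd (situations M ! j) ! r"]
    Def_table2[OF assms, of "length (situations M)" "tapes M"
      "\<lambda>j r. fst (snd (case_prod (transition M) (situations M ! j)) ! r)"]
    Def_table2[OF assms, of "length (situations M)" "tapes M"
      "\<lambda>j r. nat (snd (snd (case_prod (transition M) (situations M ! j)) ! r) + 1)"]
  by simp_all

lemmas Def_situations = Def_situations1 Def_situations2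

context
  fixes M :: tm and T lm :: "bits \<Rightarrow> nat"
  assumes T: "Def (\<lambda>R _. T (R 0))" and lm: "Def (\<lambda>R _. lm (R 0))"
begin

lemma Def_windows: "Def (\<lambda>R _. windows M (T (R 0)))" "Def (\<lambda>R _. win_values M (T (R 0)) (lm (R 0)))"
  unfolding windows_def win_values_def by (intro Def_intros T lm)+

lemma Def_win:
  assumes "Def i"
  shows "Def (\<lambda>R \<rho>. win_pos (T (R 0)) (i R \<rho>))" "Def (\<lambda>R \<rho>. win_tape M (T (R 0)) (i R \<rho>))"
    "Def (\<lambda>R \<rho>. win_time M (T (R 0)) (i R \<rho>))"
    "Def (\<lambda>R \<rho>. val_cell M (i R \<rho>))" "Def (\<lambda>R \<rho>. val_head M (T (R 0)) (i R \<rho>))"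
    "Def (\<lambda>R \<rho>. val_len M (T (R 0)) (lm (R 0)) (i R \<rho>))" "Def (\<lambda>R \<rho>. val_sit M (T (R 0)) (lm (R 0)) (i R \<rho>))"
  unfolding win_pos_def win_tape_def win_time_def val_cell_def val_head_def val_len_def val_sit_def
  by (intro Def_intros T lm assms)+

lemma DefB_win_valid:
  assumes "Def i" "Def u"
  shows "DefB (\<lambda>R \<rho>. win_valid M (R 0) (T (R 0)) (lm (R 0)) (i R \<rho>) (u R \<rho>))"
  unfolding win_valid_def input_cell_def even_iff_mod_2_eq_zero
  by (intro Def_intros Def_win Def_situations T lm assms) simp_all

lemma DefB_win_label:
  assumes "Def i" "Def j" "Def u" "Def v"
  shows "DefB (\<lambda>R \<rho>. win_label M (T (R 0)) (lm (R 0)) (i R \<rho>) (j R \<rho>) (u R \<rho>) =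
    win_label M (T (R 0)) (lm (R 0)) (j R \<rho>) (i R \<rho>) (v R \<rho>))"
proof -
  have "Def (\<lambda>R \<rho>. fst (win_label M (T (R 0)) (lm (R 0)) (i R \<rho>) (j R \<rho>) (u R \<rho>)))"
    "Def (\<lambda>R \<rho>. fst (snd (win_label M (T (R 0)) (lm (R 0)) (i R \<rho>) (j R \<rho>) (u R \<rho>))))"
    "Def (\<lambda>R \<rho>. snd (snd (win_label M (T (R 0)) (lm (R 0)) (i R \<rho>) (j R \<rho>) (u R \<rho>))))"
    if "Def i" "Def j" "Def u" for i j u
    unfolding win_label_def Let_def if_distrib[of fst] if_distrib[of snd] fst_conv snd_conv
    by (intro Def_intros Def_win Def_situations T lm that)+
  then show ?thesis unfolding prod_eq_iff using assms by (intro DefB_conj DefB_eq)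
qed

lemma Def_points:
  assumes "Def b"
  shows "Def (\<lambda>R \<rho>. var1 (windows M (T (R 0))) (win_values M (T (R 0)) (lm (R 0))) (b R \<rho>))"
    "Def (\<lambda>R \<rho>. val1 (windows M (T (R 0))) (win_values M (T (R 0)) (lm (R 0))) (b R \<rho>))"
    "Def (\<lambda>R \<rho>. var2 (windows M (T (R 0))) (win_values M (T (R 0)) (lm (R 0))) (b R \<rho>))"
    "Def (\<lambda>R \<rho>. val2 (windows M (T (R 0))) (win_values M (T (R 0)) (lm (R 0))) (b R \<rho>))"
  unfolding var1_def val1_def var2_def val2_def by (intro Def_intros Def_windows assms)+

lemma DefB_gadget:
  "DefB (\<lambda>R \<rho>. gadget (windows M (T (R 0))) (win_values M (T (R 0)) (lm (R 0)))
     (win_valid M (R 0) (T (R 0)) (lm (R 0))) (win_label M (T (R 0)) (lm (R 0))) (\<rho> 2) (\<rho> 1) (\<rho> 0))"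
  unfolding gadget_def good_def gives_def
  by (intro Def_intros DefB_win_valid DefB_win_label Def_points Def_windows)

end

section \<open>Algebras all of whose operations are projections or constant\<close>

text \<open>The operation \<open>f\<close> is the projection to the argument \<open>i\<close> if \<open>ch f = Some i\<close>, otherwise it is constant with the value 0.\<close>

definition trivial_algebra :: "(nat \<Rightarrow> nat option) \<Rightarrow> nat \<Rightarrow> nat algebra" where
  "trivial_algebra ch n = \<lparr>univ = {..<n}, oper = (\<lambda>f xs. case ch f of None \<Rightarrow> 0 | Some i \<Rightarrow> xs ! i)\<rparr>"

text \<open>The operation \<open>f\<close> of \<open>A\<close> is constant if \<open>ch f = None\<close>, and it is the argument \<open>i\<close> or its negation if \<open>ch f = Some i\<close>.\<close>

definition unary_choice :: "language \<Rightarrow> bool algebra \<Rightarrow> (nat \<Rightarrow> nat option) \<Rightarrow> bool" where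
  "unary_choice L A ch \<longleftrightarrow> (\<forall>f<length L. case ch f of
     None \<Rightarrow> (\<exists>c. \<forall>xs. length xs = L ! f \<longrightarrow> oper A f xs = c)
   | Some i \<Rightarrow> i < L ! f \<and> (\<exists>c. \<forall>xs. length xs = L ! f \<longrightarrow> oper A f xs = (xs ! i \<noteq> c)))"

text \<open>The variable on which the value of a term depends\<close>

fun chosen :: "(nat \<Rightarrow> nat option) \<Rightarrow> trm \<Rightarrow> nat option" where
  "chosen ch (Var v) = Some v"
| "chosen ch (Fn f ts) = (case ch f of None \<Rightarrow> None | Some i \<Rightarrow> map (chosen ch) ts ! i)"

lemma eval_trivial_algebra:
  "unary_choice L A ch \<Longrightarrow> is_term L m t \<Longrightarrow>
    eval_term (trivial_algebra ch n) \<rho> t = (case chosen ch t of None \<Rightarrow> 0 | Some v \<Rightarrow> \<rho> v)"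
proof (induction t)
  case (Fn f ts)
  show ?case
  proof (cases "ch f")
    case None
    then show ?thesis by (simp add: trivial_algebra_def)
  next
    case (Some i)
    then have "i < length ts" using Fn.prems by (force simp: unary_choice_def)
    then show ?thesis using Some Fn.IH[OF nth_mem] Fn.prems by (simp add: trivial_algebra_def)
  qed
qed simp

lemma eval_unary:
  "unary_choice L A ch \<Longrightarrow> is_term L m t \<Longrightarrow>
    \<exists>c. \<forall>\<rho>. eval_term A \<rho> t = (case chosen ch t of None \<Rightarrow> c | Some v \<Rightarrow> \<rho> v \<noteq> c)"
proof (induction t)
  case (Var v)
  show ?case by (intro exI[of _ False]) simp
next
  case (Fn f ts)
  show ?case
  proof (cases "ch f")
    case None
    then obtain c where "\<And>xs. length xs = L ! f \<Longrightarrow> oper A f xs = c"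
      using Fn.prems by (auto simp: unary_choice_def split: option.splits)
    then show ?thesis using None Fn.prems by (intro exI[of _ c]) simp
  next
    case (Some i)
    then obtain c where i: "i < length ts" "\<And>xs. length xs = L ! f \<Longrightarrow> oper A f xs = (xs ! i \<noteq> c)"
      using Fn.prems by (force simp: unary_choice_def split: option.splits)
    obtain c' where c': "\<And>\<rho>. eval_term A \<rho> (ts ! i) = (case chosen ch (ts ! i) of None \<Rightarrow> c' | Some v \<Rightarrow> \<rho> v \<noteq> c')"
      using Fn.IH[OF nth_mem[OF i(1)]] Fn.prems i(1) by auto
    have ch: "chosen ch (Fn f ts) = chosen ch (ts ! i)" using Some i(1) by simp
    have "eval_term A \<rho> (Fn f ts) = (case chosen ch (Fn f ts) of None \<Rightarrow> c' \<noteq> c | Some v \<Rightarrow> \<rho> v \<noteq> (c' \<noteq> c))" for \<rho>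
    proof -
      have "eval_term A \<rho> (Fn f ts) = (eval_term A \<rho> (ts ! i) \<noteq> c)"
        using i(1) i(2)[of "map (eval_term A \<rho>) ts"] Fn.prems by simp
      then show ?thesis unfolding ch c'[of \<rho>] by (cases "chosen ch (ts ! i)") auto
    qed
    then show ?thesis by blast
  qed
qed

lemma generated_variety_iff:
  assumes "is_algebra L A"
  shows "B \<in> generated_variety L A \<longleftrightarrow> is_algebra L B \<and>
    (\<forall>(s, t) \<in> identities L. satisfies A s t \<longrightarrow> satisfies B s t)"
proof
  assume B: "B \<in> generated_variety L A"
  let ?E = "{(s, t) \<in> identities L. satisfies A s t}"
  have "?E \<subseteq> identities L \<and> A \<in> models L ?E" using assms by (auto simp: models_def)
  then have "models L ?E \<in> {models L E | E. E \<subseteq> identities L \<and> A \<in> models L E}" by blast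
  then have "B \<in> models L ?E" using B unfolding generated_variety_def by (rule InterD[rotated])
  then show "is_algebra L B \<and> (\<forall>(s, t) \<in> identities L. satisfies A s t \<longrightarrow> satisfies B s t)"
    by (auto simp: models_def)
next
  assume "is_algebra L B \<and> (\<forall>(s, t) \<in> identities L. satisfies A s t \<longrightarrow> satisfies B s t)"
  then have "B \<in> models L E" if "E \<subseteq> identities L" "A \<in> models L E" for E
    using that by (fastforce simp: models_def)
  then show "B \<in> generated_variety L A" unfolding generated_variety_def by blast
qed

lemma trivial_algebra:
  assumes ch: "unary_choice L A ch" and n: "0 < n"
  shows "is_algebra L (trivial_algebra ch n)"
    "equiv {..<n} \<theta> \<Longrightarrow> is_congruence L (trivial_algebra ch n) \<theta>"
proof -
  have i: "ch f = Some i \<Longrightarrow> i < L ! f" if "f < length L" for f i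
    using ch that by (force simp: unary_choice_def)
  show "is_algebra L (trivial_algebra ch n)"
    unfolding is_algebra_def
  proof (intro conjI allI impI)
    fix f xs assume f: "f < length L" and xs: "length xs = L ! f \<and> set xs \<subseteq> univ (trivial_algebra ch n)"
    show "oper (trivial_algebra ch n) f xs \<in> univ (trivial_algebra ch n)"
    proof (cases "ch f")
      case (Some j)
      then have "xs ! j \<in> set xs" using i[OF f] xs by simp
      then show ?thesis using Some xs by (auto simp: trivial_algebra_def)
    qed (use n in \<open>simp add: trivial_algebra_def\<close>)
  qed (use n in \<open>auto simp: trivial_algebra_def\<close>)
  assume \<theta>: "equiv {..<n} \<theta>"
  then have "(0, 0) \<in> \<theta>" using n by (simp add: equiv_def refl_on_def)
  moreover have "(xs ! j, ys ! j) \<in> \<theta>"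
    if "f < length L" "ch f = Some j" "length xs = L ! f" "list_all2 (\<lambda>x y. (x, y) \<in> \<theta>) xs ys" for f j xs ys
    using list_all2_nthD[OF that(4), of j] i[OF that(1,2)] that(3) by simp
  ultimately show "is_congruence L (trivial_algebra ch n) \<theta>" using \<theta>
    by (auto simp: is_congruence_def trivial_algebra_def split: option.splits)
qed

text \<open>If two terms agree in \<open>A\<close>, then they depend on the same variable or both are constant.\<close>

lemma trivial_algebra_in_variety:
  assumes A: "is_algebra L A" "univ A = UNIV" and ch: "unary_choice L A ch" and n: "0 < n"
  shows "trivial_algebra ch n \<in> generated_variety L A"
  unfolding generated_variety_iff[OF A(1)]
proof (intro conjI ballI, rule trivial_algebra[OF ch n], clarify)
  fix s t assume "(s, t) \<in> identities L" and sat: "satisfies A s t"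
  then obtain m where st: "is_term L m s" "is_term L m t" by (auto simp: identities_def)
  obtain c where c: "\<And>\<rho>. eval_term A \<rho> s = (case chosen ch s of None \<Rightarrow> c | Some v \<Rightarrow> \<rho> v \<noteq> c)"
    using eval_unary[OF ch st(1)] by blast
  obtain c' where c': "\<And>\<rho>. eval_term A \<rho> t = (case chosen ch t of None \<Rightarrow> c' | Some v \<Rightarrow> \<rho> v \<noteq> c')"
    using eval_unary[OF ch st(2)] by blast
  have eq: "eval_term A \<rho> s = eval_term A \<rho> t" for \<rho> using sat A(2) by (simp add: satisfies_def)
  have "chosen ch s = chosen ch t"
  proof (rule ccontr)
    assume ne: "chosen ch s \<noteq> chosen ch t"
    then consider v where "chosen ch s = Some v" "chosen ch t \<noteq> Some v"
      | v where "chosen ch t = Some v" "chosen ch s \<noteq> Some v" by (cases "chosen ch s"; cases "chosen ch t") auto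
    then show False
    proof cases
      case (1 v)
      then show False using eq[of "\<lambda>_. False"] eq[of "\<lambda>w. w = v"] c c' by (auto split: option.splits)
    next
      case (2 v)
      then show False using eq[of "\<lambda>_. False"] eq[of "\<lambda>w. w = v"] c c' by (auto split: option.splits)
    qed
  qed
  then show "satisfies (trivial_algebra ch n) s t"
    unfolding satisfies_def eval_trivial_algebra[OF ch st(1)] eval_trivial_algebra[OF ch st(2)] by simp
qed

section \<open>Hardness for coNP\<close>

text \<open>The trivial algebra of size \<open>n\<close> with the equivalence relations \<open>E 0, \<dots>, E (k - 1)\<close>\<close>

definition reduct_instance :: "language \<Rightarrow> (nat \<Rightarrow> nat option) \<Rightarrow> nat \<Rightarrow> nat \<Rightarrow> (nat \<Rightarrow> nat \<Rightarrow> nat \<Rightarrow> bool) \<Rightarrow> crt_instance" where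
  "reduct_instance L ch n k E =
     (L, trivial_algebra ch n, map (\<lambda>l. {(a, b). a < n \<and> b < n \<and> E l a b}) [0..<k])"

lemma n_lists_digits: "List.n_lists r [0..<n] = map (\<lambda>q. map (\<lambda>i. q div n ^ i mod n) [0..<r]) [0..<n ^ r]"
  by (rule nth_equalityI) (auto simp: length_n_lists n_lists_nth)

lemma code_reduct_instance:
  assumes ch: "unary_choice L A ch"
  shows "code_instance (reduct_instance L ch n k E) =
    (code_nat n @ code_nat (length L) @
     concat (map (\<lambda>f. code_nat (L ! f) @ concat (map (\<lambda>q. code_nat (case ch f of None \<Rightarrow> 0 | Some i \<Rightarrow> q div n ^ i mod n))
       [0..<n ^ (L ! f)])) [0..<length L])) @
     code_nat k @ concat (map (\<lambda>l. concat (map (\<lambda>a. map (\<lambda>b. E l a b) [0..<n]) [0..<n])) [0..<k])"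
proof -
  have "code_nat (oper (trivial_algebra ch n) f (map (\<lambda>i. q div n ^ i mod n) [0..<L ! f])) =
      code_nat (case ch f of None \<Rightarrow> 0 | Some i \<Rightarrow> q div n ^ i mod n)" if "f < length L" for f q
  proof (cases "ch f")
    case (Some i)
    then have "i < L ! f" using ch that by (force simp: unary_choice_def)
    then show ?thesis using Some by (simp add: trivial_algebra_def)
  qed (simp add: trivial_algebra_def)
  then have tab: "map (\<lambda>f. code_nat (L ! f) @ concat (map (\<lambda>xs. code_nat (oper (trivial_algebra ch n) f xs))
        (List.n_lists (L ! f) [0..<n]))) [0..<length L] =
      map (\<lambda>f. code_nat (L ! f) @ concat (map (\<lambda>q. code_nat (case ch f of None \<Rightarrow> 0 | Some i \<Rightarrow> q div n ^ i mod n))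
       [0..<n ^ (L ! f)])) [0..<length L]"
    by (auto simp: n_lists_digits comp_def)
  have rel: "code_relation n {(a, b). a < n \<and> b < n \<and> E l a b} =
      concat (map (\<lambda>a. map (\<lambda>b. E l a b) [0..<n]) [0..<n])" for l
    by (auto simp: code_relation_def product_concat_map map_concat comp_def intro!: arg_cong[where f = concat])
  have card: "card (univ (trivial_algebra ch n)) = n" by (simp add: trivial_algebra_def)
  show ?thesis by (simp add: reduct_instance_def code_algebra_def Let_def card tab rel comp_def)
qed

lemma DefO_reduct_instance:
  assumes ch: "unary_choice L A ch" and n: "Def (\<lambda>R _. n (R 0))" and k: "Def (\<lambda>R _. k (R 0))"
    and E: "DefB (\<lambda>R \<rho>. E (R 0) (\<rho> 2) (\<rho> 1) (\<rho> 0))"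
  shows "DefO (\<lambda>R _. code_instance (reduct_instance L ch (n (R 0)) (k (R 0)) (E (R 0))))"
proof -
  have D: "Def (\<lambda>R \<rho>. case ch f of None \<Rightarrow> 0 | Some i \<Rightarrow> \<rho> 0 div n (R 0) ^ i mod n (R 0))" for f
    by (cases "ch f") (auto intro!: Def_intros n)
  have "DefO (\<lambda>R (\<rho> :: nat \<Rightarrow> nat). concat (map (\<lambda>f. code_nat (L ! f) @ concat (map (\<lambda>q. code_nat
      (case ch f of None \<Rightarrow> 0 | Some i \<Rightarrow> q div n (R 0) ^ i mod n (R 0))) [0..<n (R 0) ^ (L ! f)])) [0..<length L]))"
    by (intro DefO_concat_list DefO_append DefO_code_nat DefO_concat D Def_const Def_power n)
  moreover have "DefO (\<lambda>R (\<rho> :: nat \<Rightarrow> nat). concat (map (\<lambda>l. concat (map (\<lambda>a. map (\<lambda>b. E (R 0) l a b) [0..<n (R 0)])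
      [0..<n (R 0)])) [0..<k (R 0)]))"
    using E by (intro DefO_concat DefO_map n k) (simp add: numeral_2_eq_2)
  ultimately show ?thesis unfolding code_reduct_instance[OF ch]
    by (intro DefO_append DefO_code_nat n k Def_const)
qed

text \<open>A machine that has halted keeps its configuration.\<close>

lemma accept_cell:
  assumes out: "k \<le> T" "(step M ^^ k) (initial M w) = cf" "fst cf = states M" "output_is cf [b]"
    and M: "wf_tm M"
  shows "cell_at M w T 0 0 = 2 \<longleftrightarrow> b"
proof -
  have "step M cf = cf" using out(3) by (cases cf) simp
  then have "(step M ^^ j) cf = cf" for j by (induction j) auto
  moreover have "run M w T = (step M ^^ (T - k)) cf"
    using out(1,2) funpow_add[of "T - k" k "step M"] by (simp add: run_def)
  ultimately have r: "run M w T = cf" by simp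
  have "length (snd cf) = tapes M" using run_invariant(1)[OF M, of w T] r by simp
  then have "snd cf \<noteq> []" using M by (auto simp: wf_tm_def)
  then have "hd (snd cf) = snd cf ! 0" by (rule hd_conv_nth)
  then have "cell_at M w T 0 0 = bit_symbol b" using out(4) by (simp add: output_is_def cell_at_def r Let_def)
  then show ?thesis by (auto simp: bit_symbol_def)
qed

lemma equivs_equiv:
  assumes "equivs n k E" "l < k"
  shows "equiv {..<n} {(a, b). a < n \<and> b < n \<and> E l a b}"
proof (rule equivI)
  have E: "\<And>x. x < n \<Longrightarrow> E l x x" "\<And>x y. x < n \<Longrightarrow> y < n \<Longrightarrow> E l x y \<Longrightarrow> E l y x"
    "\<And>x y z. x < n \<Longrightarrow> y < n \<Longrightarrow> z < n \<Longrightarrow> E l x y \<Longrightarrow> E l y z \<Longrightarrow> E l x z"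
    using assms unfolding equivs_def by blast+
  show "{(a, b). a < n \<and> b < n \<and> E l a b} \<subseteq> {..<n} \<times> {..<n}" by auto
  show "refl_on {..<n} {(a, b). a < n \<and> b < n \<and> E l a b}" using E(1) by (auto simp: refl_on_def)
  show "sym {(a, b). a < n \<and> b < n \<and> E l a b}" using E(2) by (auto simp: sym_def)
  show "trans {(a, b). a < n \<and> b < n \<and> E l a b}" using E(3) unfolding trans_def by blast
qed

text \<open>The complement of \<open>X\<close> is reduced to the failure of the Chinese remainder property: the verifier for the complement
  accepts \<open>pair_code x z\<close> for some \<open>z\<close> of length at most \<open>lm x\<close>. The time bound \<open>T x\<close> covers the running time on all these inputs.\<close>

theorem CRT_coNP_hard:
  assumes A: "is_algebra L A" "univ A = UNIV" and ch: "unary_choice L A ch" and X: "X \<in> class_coNP"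
  shows "karp_reducible X (CRT_restricted L (generated_variety L A))"
proof -
  obtain Q p where Q: "Q \<in> class_P"
    and p: "\<And>x. x \<notin> X \<longleftrightarrow> (\<exists>u. length u \<le> poly p (length x) \<and> pair_code x u \<in> Q)"
    using X by (auto simp: class_coNP_def class_NP_def)
  obtain M q where M: "wf_tm M" and q: "\<And>w. \<exists>k \<le> poly q (length w).
      let cf = (step M ^^ k) (initial M w) in fst cf = states M \<and> output_is cf [w \<in> Q]"
    using Q by (auto simp: class_P_def polytime_def)
  define lm where "lm x = poly p (length x)" for x :: bits
  define T where "T x = Suc (2 * length x) + lm x + poly q (Suc (2 * length x) + lm x)" for x :: bits
  let ?k = "\<lambda>x. windows M (T x)" and ?d = "\<lambda>x. win_values M (T x) (lm x)"
  let ?n = "\<lambda>x. ?k x * ?d x * ?k x * ?d x"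
  let ?E = "\<lambda>x. gadget (?k x) (?d x) (win_valid M x (T x) (lm x)) (win_label M (T x) (lm x))"
  let ?f = "\<lambda>x. code_instance (reduct_instance L ch (?n x) (?k x) (?E x))"
  have Dlm: "Def (\<lambda>R _. lm (R 0))" unfolding lm_def by (intro Def_intros) simp
  have DT: "Def (\<lambda>R _. T (R 0))" unfolding T_def by (intro Def_intros Dlm) simp_all
  have "polytime ?f"
    by (rule polytime_DefO, rule DefO_reduct_instance[OF ch])
      (intro Def_mult Def_windows[OF DT Dlm] DefB_gadget[OF DT Dlm])+
  moreover have "?f x \<in> fst (CRT_restricted L (generated_variety L A)) \<and>
      (x \<in> X \<longleftrightarrow> ?f x \<in> snd (CRT_restricted L (generated_variety L A)))" for x
  proof -
    have tp: "0 < tapes M" "3 \<le> symbols M" using M by (auto simp: wf_tm_def)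
    have "set (replicate (tapes M) 0) \<subseteq> {..<symbols M}" using tp by auto
    then have "situations M \<noteq> []" using situation_exists[of 0 M "replicate (tapes M) 0"] by fastforce
    then have d: "0 < ?d x" using tp by (simp add: win_values_def)
    have "5 * 1 * 1 * 1 \<le> ?k x" unfolding windows_def using tp by (intro mult_le_mono) auto
    then have k: "5 \<le> ?k x" by simp
    then have n: "0 < ?n x" using d by simp
    let ?B = "trivial_algebra ch (?n x)" and ?\<theta>s = "map (\<lambda>l. {(a, b). a < ?n x \<and> b < ?n x \<and> ?E x l a b}) [0..<?k x]"
    have "equiv {..<?n x} \<theta>" if "\<theta> \<in> set ?\<theta>s" for \<theta>
      using that equivs_equiv[OF equivs_gadget] by auto
    then have inst: "(L, ?B, ?\<theta>s) \<in> CRT_instances"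
      using trivial_algebra[OF ch n] by (auto simp: CRT_instances_def trivial_algebra_def)
    have B: "?B \<in> generated_variety L A" by (rule trivial_algebra_in_variety[OF A ch n])
    have f: "?f x = code_instance (L, ?B, ?\<theta>s)" by (simp add: reduct_instance_def)
    have uB: "univ ?B = {..<?n x}" by (simp add: trivial_algebra_def)
    have fst: "?f x \<in> fst (CRT_restricted L (generated_variety L A))"
      unfolding CRT_restricted_def fst_conv f using inst B by (intro imageI) auto
    note dec = decode_instance(1-3)[OF uB f]
    have "?f x \<in> snd (CRT_restricted L (generated_variety L A)) \<longleftrightarrow>
        CR (code_size (?f x)) (code_count L (?f x)) (coded_rel L (?f x))"
      using CRT_restricted_decode[OF fst] by metis
    also have "\<dots> \<longleftrightarrow> CR (?n x) (?k x) (?E x)"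
      unfolding dec(1,2) length_map length_upt diff_zero
      by (rule CR_cong) (use dec(3) in auto)
    finally have snd: "?f x \<in> snd (CRT_restricted L (generated_variety L A)) \<longleftrightarrow> CR (?n x) (?k x) (?E x)" .
    have "\<not> CR (?n x) (?k x) (?E x) \<longleftrightarrow> (\<exists>a. (\<forall>i<?k x. a i < ?d x \<and> win_valid M x (T x) (lm x) i (a i)) \<and>
      (\<forall>i<?k x. \<forall>j<?k x. i \<noteq> j \<longrightarrow> win_label M (T x) (lm x) i j (a i) = win_label M (T x) (lm x) j i (a j)))"
      using win_separation[OF tp(1)] by (intro gadget_CR[OF k]) blast
    also have "\<dots> \<longleftrightarrow> (\<exists>z. length z \<le> lm x \<and> cell_at M (pair_code x z) (T x) 0 0 = 2)"
      by (rule computation_csp[OF M]) (simp add: T_def)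
    also have "\<dots> \<longleftrightarrow> (\<exists>z. length z \<le> lm x \<and> pair_code x z \<in> Q)"
    proof -
      have "cell_at M (pair_code x z) (T x) 0 0 = 2 \<longleftrightarrow> pair_code x z \<in> Q" if z: "length z \<le> lm x" for z
      proof -
        obtain j where j: "j \<le> poly q (length (pair_code x z))"
          "fst ((step M ^^ j) (initial M (pair_code x z))) = states M"
          "output_is ((step M ^^ j) (initial M (pair_code x z))) [pair_code x z \<in> Q]"
          using q[of "pair_code x z"] by (auto simp: Let_def)
        have "poly q (length (pair_code x z)) \<le> poly q (Suc (2 * length x) + lm x)"
          using z by (intro poly_mono_nat) (simp add: length_pair_code)
        then have "j \<le> T x" using j(1) by (simp add: T_def)
        from accept_cell[OF this refl j(2,3) M] show ?thesis .
      qed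
      then show ?thesis by blast
    qed
    finally show ?thesis using fst snd p[of x] by (auto simp: lm_def)
  qed
  ultimately show ?thesis unfolding karp_reducible_def by blast
qed

section \<open>Reduction to extension problems\<close>

lemma equivsD:
  assumes "equivs n k E" "i < k"
  shows "x < n \<Longrightarrow> E i x x" "x < n \<Longrightarrow> y < n \<Longrightarrow> E i x y \<Longrightarrow> E i y x"
    "x < n \<Longrightarrow> y < n \<Longrightarrow> z < n \<Longrightarrow> E i x y \<Longrightarrow> E i y z \<Longrightarrow> E i x z"
  using assms unfolding equivs_def by blast+

text \<open>\<open>b, \<dots>, b, c\<close> (with \<open>m\<close> times \<open>b\<close>) extends to a compatible tuple.\<close>

definition extends :: "nat \<Rightarrow> nat \<Rightarrow> (nat \<Rightarrow> nat \<Rightarrow> nat \<Rightarrow> bool) \<Rightarrow> nat \<Rightarrow> nat \<Rightarrow> nat \<Rightarrow> bool" where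
  "extends n k E m b c \<longleftrightarrow> (\<exists>x. compatible n k E x \<and> (\<forall>i<m. x i = b) \<and> x m = c)"

text \<open>If some compatible tuple has no solution, consider the first place at which the set of the initial segments of
  compatible tuples differs from that of the solvable ones.\<close>

lemma CR_iff_extends:
  assumes E: "equivs n k E" and n: "0 < n"
  shows "CR n k E \<longleftrightarrow> (\<forall>m<k. \<forall>b<n. \<forall>c<n. extends n k E m b c \<longrightarrow>
    (\<exists>b'<n. (\<forall>i<m. E i b' b) \<and> E m b' c))"
proof
  assume cr: "CR n k E"
  show "\<forall>m<k. \<forall>b<n. \<forall>c<n. extends n k E m b c \<longrightarrow> (\<exists>b'<n. (\<forall>i<m. E i b' b) \<and> E m b' c)"
  proof (intro allI impI)
    fix m b c assume m: "m < k" and "extends n k E m b c"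
    then obtain x where x: "compatible n k E x" "\<forall>i<m. x i = b" "x m = c" by (auto simp: extends_def)
    then obtain b' where "b' < n" "\<forall>i<k. E i b' (x i)" using cr unfolding CR_def by blast
    then show "\<exists>b'<n. (\<forall>i<m. E i b' b) \<and> E m b' c" using x m by (metis order_less_trans)
  qed
next
  assume ext: "\<forall>m<k. \<forall>b<n. \<forall>c<n. extends n k E m b c \<longrightarrow> (\<exists>b'<n. (\<forall>i<m. E i b' b) \<and> E m b' c)"
  show "CR n k E" unfolding CR_def
  proof (intro allI impI)
    fix x assume x: "compatible n k E x"
    have xn: "x i < n" if "i < k" for i using x that by (simp add: compatible_def)
    have "\<exists>b<n. \<forall>i<m. E i b (x i)" if "m \<le> k" for m using that
    proof (induction m)
      case (Suc m)
      then obtain b where b: "b < n" "\<And>i. i < m \<Longrightarrow> E i b (x i)" by auto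
      define x' where "x' i = (if i < m then b else x i)" for i
      have "E i (x' i) (x i) \<and> E i (x i) (x' i) \<and> x' i < n \<and> x i < n" if "i < k" for i
        using equivsD(1,2)[OF E that] b xn[OF that] by (simp add: x'_def)
      then have bx: "(x' i, x i) \<in> union_rel n E i j \<and> (x i, x' i) \<in> union_rel n E j i" if "i < k" "j < k" for i j
        using that by (simp add: union_rel_def)
      have "(x' i, x' j) \<in> (union_rel n E i j)\<^sup>+" if "i < k" "j < k" for i j
      proof -
        have "(x' i, x i) \<in> (union_rel n E i j)\<^sup>+" using bx[OF that] by blast
        moreover have "(x i, x j) \<in> (union_rel n E i j)\<^sup>+" using x that by (simp add: compatible_def)
        moreover have "(x j, x' j) \<in> (union_rel n E i j)\<^sup>+" using bx[OF that(2,1)] by blast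
        ultimately show ?thesis by (meson trancl_trans)
      qed
      then have "compatible n k E x'" using b xn by (simp add: compatible_def x'_def)
      then have "extends n k E m b (x m)" unfolding extends_def
        by (intro exI[of _ x']) (simp add: x'_def)
      then obtain b' where b': "b' < n" "\<forall>i<m. E i b' b" "E m b' (x m)"
        using ext b xn[of m] Suc.prems by (meson Suc_le_lessD)
      have "E i b' (x i)" if "i < Suc m" for i
      proof (cases "i < m")
        case True
        then have "E i b' b" "E i b (x i)" "x i < n" "i < k" using b' b xn Suc.prems by auto
        then show ?thesis using equivsD(3)[OF E] b b' by blast
      next
        case False
        then have "i = m" using that by simp
        then show ?thesis using b' by simp
      qed
      then show ?case using b' by blast
    qed (use n in blast)
    then show "\<exists>b<n. \<forall>i<k. E i b (x i)" by blast
  qed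
qed

text \<open>An operation compatible with all the equivalences is compatible with their joins.\<close>

definition polymorphism :: "nat \<Rightarrow> nat \<Rightarrow> (nat \<Rightarrow> nat \<Rightarrow> nat \<Rightarrow> bool) \<Rightarrow> (nat \<Rightarrow> nat \<Rightarrow> nat \<Rightarrow> nat) \<Rightarrow> bool" where
  "polymorphism n k E g \<longleftrightarrow> (\<forall>x<n. \<forall>y<n. \<forall>z<n. g x y z < n) \<and>
     (\<forall>i<k. \<forall>x<n. \<forall>x'<n. \<forall>y<n. \<forall>y'<n. \<forall>z<n. \<forall>z'<n.
        E i x x' \<longrightarrow> E i y y' \<longrightarrow> E i z z' \<longrightarrow> E i (g x y z) (g x' y' z'))"

lemma union_rel_bounds: "(x, y) \<in> (union_rel n E i j)\<^sup>+ \<Longrightarrow> x < n \<and> y < n"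
  by (induction rule: trancl_induct) (auto simp: union_rel_def)

lemma union_rel_sym:
  assumes "equivs n k E" "i < k" "j < k" "(x, y) \<in> (union_rel n E i j)\<^sup>+"
  shows "(y, x) \<in> (union_rel n E j i)\<^sup>+"
  using assms(4)
proof (induction rule: trancl_induct)
  case (base y)
  then have "(y, x) \<in> union_rel n E j i"
    using equivsD(2)[OF assms(1,2)] equivsD(2)[OF assms(1,3)] by (auto simp: union_rel_def)
  then show ?case by blast
next
  case (step y z)
  then have "(z, y) \<in> union_rel n E j i"
    using equivsD(2)[OF assms(1,2)] equivsD(2)[OF assms(1,3)] by (auto simp: union_rel_def)
  with step(3) show ?case by (meson trancl_into_trancl2)
qed

lemma union_rel_refl: "equivs n k E \<Longrightarrow> i < k \<Longrightarrow> x < n \<Longrightarrow> (x, x) \<in> (union_rel n E i j)\<^sup>+"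
  by (intro r_into_trancl) (simp add: union_rel_def equivsD)

lemma polymorphism_join:
  assumes E: "equivs n k E" and g: "polymorphism n k E g" and ij: "i < k" "j < k"
    and J: "(x, x') \<in> (union_rel n E i j)\<^sup>+" "(y, y') \<in> (union_rel n E i j)\<^sup>+" "(z, z') \<in> (union_rel n E i j)\<^sup>+"
  shows "(g x y z, g x' y' z') \<in> (union_rel n E i j)\<^sup>+"
proof -
  let ?J = "(union_rel n E i j)\<^sup>+"
  have r: "E l x x" if "x < n" "l = i \<or> l = j" for x l
    using equivsD(1)[OF E] ij that by auto
  have gb: "g x y z < n" if "x < n" "y < n" "z < n" for x y z
    using g that by (simp add: polymorphism_def)
  have gE: "E l (g x y z) (g x' y' z')"
    if "E l x x'" "E l y y'" "E l z z'" "l = i \<or> l = j" "x < n" "x' < n" "y < n" "y' < n" "z < n" "z' < n"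
    for l x x' y y' z z'
  proof -
    have "l < k" using ij that(4) by auto
    then show ?thesis using g[unfolded polymorphism_def, THEN conjunct2, rule_format, of l x x' y y' z z'] that
      by blast
  qed
  have 1: "(g a y z, g a' y z) \<in> ?J" if "(a, a') \<in> ?J" "y < n" "z < n" for a a' y z using that(1)
  proof (induction rule: trancl_induct)
    case (base b)
    then have "(g a y z, g b y z) \<in> union_rel n E i j"
      using that(2,3) gb gE r by (auto simp: union_rel_def)
    then show ?case by blast
  next
    case (step b c)
    then have "(g b y z, g c y z) \<in> union_rel n E i j"
      using that(2,3) gb gE r by (auto simp: union_rel_def)
    with step(3) show ?case by (rule trancl_into_trancl)
  qed
  have 2: "(g x a z, g x a' z) \<in> ?J" if "(a, a') \<in> ?J" "x < n" "z < n" for a a' x z using that(1)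
  proof (induction rule: trancl_induct)
    case (base b)
    then have "(g x a z, g x b z) \<in> union_rel n E i j"
      using that(2,3) gb gE r by (auto simp: union_rel_def)
    then show ?case by blast
  next
    case (step b c)
    then have "(g x b z, g x c z) \<in> union_rel n E i j"
      using that(2,3) gb gE r by (auto simp: union_rel_def)
    with step(3) show ?case by (rule trancl_into_trancl)
  qed
  have 3: "(g x y a, g x y a') \<in> ?J" if "(a, a') \<in> ?J" "x < n" "y < n" for a a' x y using that(1)
  proof (induction rule: trancl_induct)
    case (base b)
    then have "(g x y a, g x y b) \<in> union_rel n E i j"
      using that(2,3) gb gE r by (auto simp: union_rel_def)
    then show ?case by blast
  next
    case (step b c)
    then have "(g x y b, g x y c) \<in> union_rel n E i j"
      using that(2,3) gb gE r by (auto simp: union_rel_def)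
    with step(3) show ?case by (rule trancl_into_trancl)
  qed
  have "(g x y z, g x' y z) \<in> ?J" "(g x' y z, g x' y' z) \<in> ?J" "(g x' y' z, g x' y' z') \<in> ?J"
    using 1[OF J(1)] 2[OF J(2)] 3[OF J(3)] J[THEN union_rel_bounds] by blast+
  then show ?thesis by (meson trancl_trans)
qed

section \<open>Path consistency\<close>

text \<open>The constraint between the \<open>i\<close>-th and the \<open>j\<close>-th entry in the extension problem given by \<open>m\<close>, \<open>b\<close>, \<open>c\<close>\<close>

definition fixed :: "nat \<Rightarrow> nat \<Rightarrow> nat \<Rightarrow> nat \<Rightarrow> nat \<Rightarrow> bool" where
  "fixed m b c i a \<longleftrightarrow> (i < m \<longrightarrow> a = b) \<and> (i = m \<longrightarrow> a = c)"

definition constraint :: "nat \<Rightarrow> (nat \<Rightarrow> nat \<Rightarrow> nat \<Rightarrow> bool) \<Rightarrow> nat \<Rightarrow> nat \<Rightarrow> nat \<Rightarrow> nat \<Rightarrow> nat \<Rightarrow> nat \<Rightarrow> nat \<Rightarrow> bool" where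
  "constraint n E m b c i j a a' \<longleftrightarrow> (a, a') \<in> (union_rel n E i j)\<^sup>+ \<and> fixed m b c i a \<and> fixed m b c j a' \<and> (i = j \<longrightarrow> a = a')"

text \<open>One step of path consistency: pairs that do not extend to some third variable are removed.\<close>

definition refine :: "nat \<Rightarrow> nat \<Rightarrow> (nat \<Rightarrow> nat \<Rightarrow> nat \<Rightarrow> nat \<Rightarrow> bool) \<Rightarrow> nat \<Rightarrow> nat \<Rightarrow> nat \<Rightarrow> nat \<Rightarrow> bool" where
  "refine n k D i j a a' \<longleftrightarrow> D i j a a' \<and> (\<forall>l<k. \<exists>d<n. D i l a d \<and> D l j d a')"

text \<open>Path consistent families of relations, closed under an operation\<close>

definition path_consistent :: "nat \<Rightarrow> nat \<Rightarrow> (nat \<Rightarrow> nat \<Rightarrow> nat \<Rightarrow> nat \<Rightarrow> bool) \<Rightarrow> bool" where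
  "path_consistent n k D \<longleftrightarrow> (\<forall>i<k. \<forall>j<k. \<forall>a a'. D i j a a' \<longrightarrow>
     a < n \<and> a' < n \<and> (i = j \<longrightarrow> a = a') \<and> D j i a' a \<and> (\<forall>l<k. \<exists>d. D i l a d \<and> D l j d a'))"

definition closed_family :: "nat \<Rightarrow> (nat \<Rightarrow> nat \<Rightarrow> nat \<Rightarrow> nat) \<Rightarrow> (nat \<Rightarrow> nat \<Rightarrow> nat \<Rightarrow> nat \<Rightarrow> bool) \<Rightarrow> bool" where
  "closed_family k g D \<longleftrightarrow> (\<forall>i<k. \<forall>j<k. \<forall>x x' y y' z z'. D i j x x' \<longrightarrow> D i j y y' \<longrightarrow> D i j z z' \<longrightarrow>
     D i j (g x y z) (g x' y' z'))"

lemma semilattice_top: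
  fixes f :: "'a \<Rightarrow> 'a \<Rightarrow> 'a"
  assumes "finite S" "S \<noteq> {}" "S \<subseteq> U" and cl: "\<And>x y. x \<in> U \<Longrightarrow> y \<in> U \<Longrightarrow> f x y \<in> U"
    and clS: "\<And>x y. x \<in> S \<Longrightarrow> y \<in> S \<Longrightarrow> f x y \<in> S"
    and idem: "\<And>x. x \<in> U \<Longrightarrow> f x x = x" and comm: "\<And>x y. x \<in> U \<Longrightarrow> y \<in> U \<Longrightarrow> f x y = f y x"
    and assoc: "\<And>x y z. x \<in> U \<Longrightarrow> y \<in> U \<Longrightarrow> z \<in> U \<Longrightarrow> f (f x y) z = f x (f y z)"
  shows "\<exists>t\<in>S. \<forall>a\<in>S. f a t = t"
proof -
  have "\<exists>t\<in>S. \<forall>a\<in>F. f a t = t" if "finite F" "F \<noteq> {}" "F \<subseteq> S" for F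
    using that
  proof (induction rule: finite_ne_induct)
    case (singleton x)
    then show ?case using idem assms(3) by auto
  next
    case (insert x F)
    then obtain t where t: "t \<in> S" "\<forall>a\<in>F. f a t = t" by auto
    have U: "x \<in> U" "t \<in> U" using insert.prems t assms(3) by auto
    have "f a (f x t) = f x t" if "a \<in> insert x F" for a
    proof (cases "a = x")
      case True
      then show ?thesis using U idem assoc[of x x t] by simp
    next
      case False
      then have a: "a \<in> U" "f a t = t" using that insert.prems t assms(3) by auto
      have "f a (f x t) = f (f a x) t" using assoc[OF a(1) U] by simp
      also have "\<dots> = f x (f a t)" using comm[OF a(1) U(1)] assoc[OF U(1) a(1) U(2)] by simp
      finally show ?thesis using a by simp
    qed
    moreover have "f x t \<in> S" using insert.prems t clS by auto
    ultimately show ?case by blast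
  qed
  from this[OF assms(1,2)] show ?thesis by blast
qed

text \<open>Each relation of the family, being closed, has a greatest element for the semilattice operation \<open>g x x y\<close>. Its components are the greatest
  elements of the domains, so that the tuple of these is a solution.\<close>

theorem semilattice_solution:
  assumes D: "path_consistent n k D" "closed_family k g D" and k: "0 < k" "D 0 0 a0 a0"
    and gb: "\<And>x y. x < n \<Longrightarrow> y < n \<Longrightarrow> g x x y < n" and idem: "\<And>x. x < n \<Longrightarrow> g x x x = x"
    and comm: "\<And>x y. x < n \<Longrightarrow> y < n \<Longrightarrow> g x x y = g y y x"
    and assoc: "\<And>x y z. x < n \<Longrightarrow> y < n \<Longrightarrow> z < n \<Longrightarrow> g (g x x y) (g x x y) z = g x x (g y y z)"
  shows "\<exists>x. \<forall>i<k. \<forall>j<k. D i j (x i) (x j)"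
proof -
  have PC: "a < n \<and> a' < n \<and> (i = j \<longrightarrow> a = a') \<and> D j i a' a \<and> (\<forall>l<k. \<exists>d. D i l a d \<and> D l j d a')"
    if "D i j a a'" "i < k" "j < k" for i j a a' using D(1) that unfolding path_consistent_def by blast
  have dom: "D i i a a" if "D i j a a'" "i < k" "j < k" for i j a a'
    using PC[OF that] PC that by metis
  have sub: "\<exists>a'. D i j a a'" if "D i i a a" "i < k" "j < k" for i j a using PC[OF that(1,2,2)] that by blast
  have fg: "D i j (g x x y) (g x' x' y')" if "D i j x x'" "D i j y y'" "i < k" "j < k" for i j x x' y y'
    using D(2)[unfolded closed_family_def, rule_format, of i j x x' x x' y y'] that by blast
  define f where "f p q = (g (fst p) (fst p) (fst q), g (snd p) (snd p) (snd q))" for p q :: "nat \<times> nat"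
  have top: "\<exists>t\<in>S. \<forall>p\<in>S. f p t = t" if S: "S = {(a, a'). D i j a a'}" "i < k" "j < k" "S \<noteq> {}" for S i j
  proof (rule semilattice_top[where U = "{..<n} \<times> {..<n}"])
    show sub: "S \<subseteq> {..<n} \<times> {..<n}" using S PC by auto
    show "finite S" by (rule finite_subset[OF sub]) simp
    show "f x y \<in> S" if "x \<in> S" "y \<in> S" for x y using fg that S by (auto simp: f_def)
  qed (use gb idem comm assoc S(4) in \<open>auto simp: f_def\<close>)
  have ne: "{(a, a'). D i j a a'} \<noteq> {}" if ij: "i < k" "j < k" for i j
  proof -
    obtain a where "D 0 i a0 a" using sub[OF k(2) k(1) ij(1)] by blast
    then have "D i i a a" using PC[of 0 i a0 a] dom k(1) ij(1) by blast
    then show ?thesis using sub ij by blast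
  qed
  obtain t where t: "\<And>i. i < k \<Longrightarrow> D i i (t i) (t i)" "\<And>i a. i < k \<Longrightarrow> D i i a a \<Longrightarrow> g a a (t i) = t i"
  proof -
    have "\<exists>t. D i i t t \<and> (\<forall>a. D i i a a \<longrightarrow> g a a t = t)" if i: "i < k" for i
    proof -
      obtain p where p: "D i i (fst p) (snd p)" "\<And>q. D i i (fst q) (snd q) \<Longrightarrow> f q p = p"
        using top[OF refl i i ne[OF i i]] by (auto simp: case_prod_beta)
      have "snd p = fst p" using PC[OF p(1) i i] by simp
      then show ?thesis using p(1) p(2)[of "(a, a)" for a] by (intro exI[of _ "fst p"]) (auto simp: f_def prod_eq_iff)
    qed
    then show ?thesis using that by metis
  qed
  have "D i j (t i) (t j)" if ij: "i < k" "j < k" for i j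
  proof -
    obtain p where p: "D i j (fst p) (snd p)" "\<And>q. D i j (fst q) (snd q) \<Longrightarrow> f q p = p"
      using top[OF refl ij ne[OF ij]] by (auto simp: case_prod_beta)
    have d: "D i i (fst p) (fst p)" "D j j (snd p) (snd p)"
      using dom[OF p(1) ij] dom[of j i "snd p" "fst p"] PC[OF p(1) ij] ij by auto
    obtain a' where a': "D i j (t i) a'" using sub[OF t(1)[OF ij(1)] ij] by blast
    obtain a where "D j i (t j) a" using sub[OF t(1)[OF ij(2)] ij(2,1)] by blast
    then have a: "D i j a (t j)" using PC[of j i "t j" a] ij by blast
    have lt: "t i < n" "t j < n" "fst p < n" "snd p < n" using PC a a' p(1) ij by blast+
    have "g (t i) (t i) (fst p) = fst p" using p(2)[of "(t i, a')"] a' by (simp add: f_def prod_eq_iff)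
    moreover have "g (fst p) (fst p) (t i) = t i" using t(2)[OF ij(1) d(1)] .
    ultimately have 1: "fst p = t i" using comm[of "t i" "fst p"] lt by simp
    have "g (t j) (t j) (snd p) = snd p" using p(2)[of "(a, t j)"] a by (simp add: f_def prod_eq_iff)
    moreover have "g (snd p) (snd p) (t j) = t j" using t(2)[OF ij(2) d(2)] .
    ultimately have "snd p = t j" using comm[of "t j" "snd p"] lt by simp
    with 1 show ?thesis using p(1) by simp
  qed
  then show ?thesis by blast
qed

text \<open>Every partial solution \<open>x\<close> on a set of variables extends to any further variable. For two variables this
  is path consistency. For more than two, omit each of three variables in turn and combine the three values that are obtained by
  the majority operation.\<close>

theorem majority_solution:
  assumes D: "path_consistent n k D" "closed_family k g D" and k: "0 < k" "D 0 0 a0 a0"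
    and maj: "\<And>x y. x < n \<Longrightarrow> y < n \<Longrightarrow> g x x y = x \<and> g x y x = x \<and> g y x x = x"
  shows "\<exists>x. \<forall>i<k. \<forall>j<k. D i j (x i) (x j)"
proof -
  have PC: "a < n \<and> a' < n \<and> (i = j \<longrightarrow> a = a') \<and> D j i a' a \<and> (\<forall>l<k. \<exists>d. D i l a d \<and> D l j d a')"
    if "D i j a a'" "i < k" "j < k" for i j a a' using D(1) that unfolding path_consistent_def by blast
  have dom: "D i i a a" if "D i j a a'" "i < k" "j < k" for i j a a'
    using PC[OF that] PC that by metis
  have sub: "\<exists>a'. D i j a a'" if "D i i a a" "i < k" "j < k" for i j a using PC[OF that(1,2,2)] that by blast
  have cl: "D i j (g x y z) (g x' y' z')" if "D i j x x'" "D i j y y'" "D i j z z'" "i < k" "j < k" for i j x x' y y' z z'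
    using D(2)[unfolded closed_family_def, rule_format, of i j x x' y y' z z'] that by blast
  have ext: "\<exists>c. D l l c c \<and> (\<forall>i\<in>I. D i l (x i) c)"
    if "finite I" "I \<subseteq> {..<k}" "l < k" "\<forall>i\<in>I. \<forall>j\<in>I. D i j (x i) (x j)" for I l x
    using that
  proof (induction "card I" arbitrary: I rule: less_induct)
    case less
    have ik: "i < k" if "i \<in> I" for i using less.prems(2) that by auto
    consider "I = {}" | i where "I = {i}" | i j where "I = {i, j}" "i \<noteq> j"
      | i1 i2 i3 where "i1 \<in> I" "i2 \<in> I" "i3 \<in> I" "i1 \<noteq> i2" "i1 \<noteq> i3" "i2 \<noteq> i3"
    proof -
      consider "I = {}" | i where "i \<in> I" "I - {i} = {}" | i j where "i \<in> I" "j \<in> I - {i}" "I - {i} - {j} = {}"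
        | i j h where "i \<in> I" "j \<in> I - {i}" "h \<in> I - {i} - {j}" by blast
      then show ?thesis
      proof cases
        case (2 i)
        then show ?thesis using that(2)[of i] by blast
      next
        case (3 i j)
        then show ?thesis using that(3)[of i j] by blast
      next
        case (4 i j h)
        then show ?thesis using that(4)[of i j h] by blast
      qed (use that(1) in blast)
    qed
    then show ?case
    proof cases
      case 1
      obtain a where "D 0 l a0 a" using sub[OF k(2) k(1) less.prems(3)] by blast
      then have "D l l a a" using PC[of 0 l a0 a] dom k(1) less.prems(3) by blast
      then show ?thesis using 1 by blast
    next
      case (2 i)
      then have "D i i (x i) (x i)" "i < k" using less.prems(4) ik by auto
      then obtain c where c: "D i l (x i) c" using sub less.prems(3) by blast
      then have "D l l c c" using PC[OF c] dom \<open>i < k\<close> less.prems(3) by blast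
      then show ?thesis using 2 c by blast
    next
      case (3 i j)
      then have d: "D i j (x i) (x j)" "i < k" "j < k" using less.prems(4) ik by auto
      then obtain c where c: "D i l (x i) c" "D l j c (x j)" using PC[OF d] less.prems(3) by blast
      have "D j l (x j) c" "D l l c c" using PC[OF c(2)] dom[OF c(2)] d less.prems(3) by blast+
      then show ?thesis using 3 c by blast
    next
      case (4 i1 i2 i3)
      have "\<exists>c. D l l c c \<and> (\<forall>j\<in>I - {i}. D j l (x j) c)" if "i \<in> I" for i
      proof (rule less.hyps)
        show "card (I - {i}) < card I" using that less.prems(1) by (rule card_Diff1_less[rotated])
      qed (use less.prems in auto)
      then obtain c where c: "\<And>i. i \<in> I \<Longrightarrow> D l l (c i) (c i) \<and> (\<forall>j\<in>I - {i}. D j l (x j) (c i))" by metis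
      let ?c = "g (c i1) (c i2) (c i3)"
      have cn: "c i < n" if "i \<in> I" for i using PC[OF conjunct1[OF c[OF that]] less.prems(3,3)] by blast
      have xn: "x i < n" if "i \<in> I" for i using less.prems(4) PC ik that by blast
      have "D i l (x i) ?c" if i: "i \<in> I" for i
      proof -
        have w: "\<exists>e<n. D i l e (c j)" if j: "j \<in> I" for j
        proof -
          obtain e where "D l i (c j) e" using sub[OF conjunct1[OF c[OF j]] less.prems(3) ik[OF i]] by blast
          then have "e < n \<and> D i l e (c j)" using PC[of l i "c j" e] ik[OF i] less.prems(3) by blast
          then show ?thesis by blast
        qed
        obtain e1 e2 e3 where e: "e1 < n" "D i l e1 (c i1)" "e2 < n" "D i l e2 (c i2)" "e3 < n" "D i l e3 (c i3)"
          using w[OF 4(1)] w[OF 4(2)] w[OF 4(3)] by blast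
        note m = maj[OF xn[OF i]]
        have "i \<noteq> i1 \<and> i \<noteq> i2 \<or> i \<noteq> i1 \<and> i \<noteq> i3 \<or> i \<noteq> i2 \<and> i \<noteq> i3" using 4 by blast
        then show ?thesis
        proof (elim disjE conjE)
          assume "i \<noteq> i1" "i \<noteq> i2"
          then have "D i l (x i) (c i1)" "D i l (x i) (c i2)" using c 4 i by auto
          from cl[OF this e(6) ik[OF i] less.prems(3)] show ?thesis using m[OF e(5)] by simp
        next
          assume "i \<noteq> i1" "i \<noteq> i3"
          then have "D i l (x i) (c i1)" "D i l (x i) (c i3)" using c 4 i by auto
          from cl[OF this(1) e(4) this(2) ik[OF i] less.prems(3)] show ?thesis using m[OF e(3)] by simp
        next
          assume "i \<noteq> i2" "i \<noteq> i3"
          then have "D i l (x i) (c i2)" "D i l (x i) (c i3)" using c 4 i by auto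
          from cl[OF e(2) this ik[OF i] less.prems(3)] show ?thesis using m[OF e(1)] by simp
        qed
      qed
      moreover have "D l l ?c ?c" using c 4 less.prems(3) by (intro cl) auto
      ultimately show ?thesis by blast
    qed
  qed
  have "\<exists>x. \<forall>i<m. \<forall>j<m. D i j (x i) (x j)" if "m \<le> k" for m using that
  proof (induction m)
    case (Suc m)
    then obtain x where x: "\<forall>i<m. \<forall>j<m. D i j (x i) (x j)" by auto
    obtain c where c: "D m m c c" "\<forall>i\<in>{..<m}. D i m (x i) c"
      using ext[of "{..<m}" m x] x Suc.prems by auto
    have c': "D m i c (x i)" if "i < m" for i using PC[of i m "x i" c] c(2) that Suc.prems by auto
    have "\<forall>i<Suc m. \<forall>j<Suc m. D i j ((x(m := c)) i) ((x(m := c)) j)"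
      using x c c' by (auto simp: less_Suc_eq)
    then show ?case by blast
  qed simp
  then show ?thesis by blast
qed

section \<open>Gaussian elimination over the two-element field\<close>

text \<open>The rows \<open>r < N\<close> of the matrix \<open>A\<close> are linear equations in \<open>C\<close> unknowns, with right-hand sides in column \<open>C\<close>.\<close>

definition solvable :: "nat \<Rightarrow> nat \<Rightarrow> (nat \<Rightarrow> nat \<Rightarrow> bool) \<Rightarrow> bool" where
  "solvable N C A \<longleftrightarrow> (\<exists>x :: nat \<Rightarrow> bit. \<forall>r<N. (\<Sum>c<C. of_bool (A r c) * x c) = of_bool (A r C))"

text \<open>The pivot is the first nonzero entry in the first nonzero column \<open>s\<close>; its row \<open>p\<close> is added to all rows
  with a nonzero entry in column \<open>s\<close>, including itself, so that the column \<open>s\<close> vanishes.\<close>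

definition pivot :: "nat \<Rightarrow> (nat \<Rightarrow> nat \<Rightarrow> bool) \<Rightarrow> nat \<Rightarrow> nat \<Rightarrow> bool" where
  "pivot N A s p \<longleftrightarrow> A p s \<and> (\<forall>p'<p. \<not> A p' s) \<and> (\<forall>s'<s. \<forall>r<N. \<not> A r s')"

definition eliminate :: "nat \<Rightarrow> nat \<Rightarrow> (nat \<Rightarrow> nat \<Rightarrow> bool) \<Rightarrow> nat \<Rightarrow> nat \<Rightarrow> bool" where
  "eliminate N C A r c \<longleftrightarrow> A r c \<noteq> (\<exists>s<C. \<exists>p<N. pivot N A s p \<and> A r s \<and> A p c)"

(* Keep sums and products of bits instead of turning them into Boolean combinations. *)
declare add_bit_eq_xor [simp del] mult_bit_eq_and [simp del]

lemma bit_add_self [simp]: "x + x = (0 :: bit)" "x + (x + y) = (y :: bit)"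
  by (cases x; cases y; simp)+

lemma bit_add_eq_0: "x + y = (0 :: bit) \<Longrightarrow> x = y"
  by (cases x; cases y; simp)

lemma of_bool_neq_bit: "of_bool (P \<noteq> Q) = (of_bool P + of_bool Q :: bit)"
  by (cases P; cases Q) auto

lemma pivot_unique: "pivot N A s p \<Longrightarrow> pivot N A s' p' \<Longrightarrow> p < N \<Longrightarrow> p' < N \<Longrightarrow> s' = s \<and> p' = p"
proof -
  assume a: "pivot N A s p" "pivot N A s' p'" "p < N" "p' < N"
  have "\<not> s < s'" "\<not> s' < s" using a unfolding pivot_def by blast+
  then have s: "s' = s" by simp
  then have "\<not> p < p'" "\<not> p' < p" using a unfolding pivot_def by blast+
  with s show ?thesis by simp
qed

lemma pivot_exists:
  assumes "\<exists>s<C. \<exists>r<N. A r s"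
  obtains s p where "s < C" "p < N" "pivot N A s p"
proof -
  define s where "s = (LEAST s. \<exists>r<N. A r s)"
  have s: "\<exists>r<N. A r s" "\<And>s'. s' < s \<Longrightarrow> \<not> (\<exists>r<N. A r s')"
  proof -
    have "\<exists>s. \<exists>r<N. A r s" using assms by blast
    then show "\<exists>r<N. A r s" unfolding s_def by (rule LeastI_ex)
  qed (use not_less_Least s_def in blast)
  have "s < C"
  proof (rule ccontr)
    assume "\<not> s < C"
    then have "\<not> (\<exists>r<N. A r s')" if "s' < C" for s' using that s(2)[of s'] by simp
    then show False using assms by blast
  qed
  define p where "p = (LEAST p. A p s)"
  obtain r where r: "r < N" "A r s" using s(1) by blast
  have "A p s" "\<And>p'. p' < p \<Longrightarrow> \<not> A p' s" "p \<le> r"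
    unfolding p_def by (rule LeastI[of "\<lambda>p. A p s", OF r(2)], rule not_less_Least, assumption,
        rule Least_le[of "\<lambda>p. A p s", OF r(2)])
  then have "pivot N A s p" "p < N" using s r unfolding pivot_def by auto
  then show ?thesis using that \<open>s < C\<close> by blast
qed

lemma eliminate_pivot:
  assumes "s < C" "p < N" "pivot N A s p"
  shows "eliminate N C A r c \<longleftrightarrow> A r c \<noteq> (A r s \<and> A p c)"
proof -
  have "(\<exists>s'<C. \<exists>p'<N. pivot N A s' p' \<and> A r s' \<and> A p' c) \<longleftrightarrow> A r s \<and> A p c"
    using assms pivot_unique[OF assms(3) _ assms(2)] by blast
  then show ?thesis by (simp add: eliminate_def)
qed

lemma eliminate_zero: "\<not> (\<exists>s<C. \<exists>r<N. A r s) \<Longrightarrow> eliminate N C A = A"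
  by (auto simp: eliminate_def pivot_def fun_eq_iff)

lemma eliminate_solvable: "solvable N C (eliminate N C A) \<longleftrightarrow> solvable N C A"
proof (cases "\<exists>s<C. \<exists>r<N. A r s")
  case False
  then show ?thesis using eliminate_zero by metis
next
  case True
  then obtain s p where sp: "s < C" "p < N" "pivot N A s p" by (rule pivot_exists)
  let ?a = "\<lambda>r c. of_bool (A r c) :: bit"
  let ?S = "\<lambda>x r. \<Sum>c<C. ?a r c * x c"
  have el: "of_bool (eliminate N C A r c) = ?a r c + ?a r s * ?a p c" for r c
    unfolding eliminate_pivot[OF sp] of_bool_neq_bit of_bool_conj ..
  have sum: "(\<Sum>c<C. of_bool (eliminate N C A r c) * x c) = ?S x r + ?a r s * ?S x p" for x r
    unfolding el by (simp add: distrib_right sum.distrib sum_distrib_left mult.assoc)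
  show ?thesis
  proof
    assume "solvable N C A"
    then obtain x where x: "\<And>r. r < N \<Longrightarrow> ?S x r = ?a r C" unfolding solvable_def by blast
    have "(\<Sum>c<C. of_bool (eliminate N C A r c) * x c) = of_bool (eliminate N C A r C)" if "r < N" for r
      unfolding sum unfolding el x[OF that] x[OF sp(2)] ..
    then show "solvable N C (eliminate N C A)" unfolding solvable_def by blast
  next
    assume "solvable N C (eliminate N C A)"
    then obtain x where x: "\<And>r. r < N \<Longrightarrow> ?S x r + ?a r s * ?S x p = ?a r C + ?a r s * ?a p C"
      unfolding solvable_def sum unfolding el by (elim exE) (rule that, drule spec, erule mp)
    let ?x = "x(s := x s + (?S x p + ?a p C))"
    have "?S ?x r = ?a r C" if "r < N" for r
    proof -
      have "?S ?x r = (\<Sum>c<C. ?a r c * x c + (if c = s then ?a r s * (?S x p + ?a p C) else 0))"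
        by (intro sum.cong) (auto simp: distrib_left)
      also have "\<dots> = ?S x r + ?a r s * (?S x p + ?a p C)"
        using sp(1) by (simp add: sum.distrib)
      also have "\<dots> = (?S x r + ?a r s * ?S x p) + ?a r s * ?a p C" by (simp add: distrib_left add.assoc)
      also have "\<dots> = ?a r C" unfolding x[OF that] by (simp add: add.assoc)
      finally show ?thesis .
    qed
    then show "solvable N C A" unfolding solvable_def by blast
  qed
qed

lemma eliminate_columns:
  assumes "\<And>c r. c < j \<Longrightarrow> c < C \<Longrightarrow> r < N \<Longrightarrow> \<not> A r c" "c < Suc j" "c < C" "r < N"
  shows "\<not> eliminate N C A r c"
proof (cases "\<exists>s<C. \<exists>r<N. A r s")
  case False
  then show ?thesis using assms(3,4) eliminate_zero by metis
next
  case True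
  then obtain s p where sp: "s < C" "p < N" "pivot N A s p" by (rule pivot_exists)
  have "j \<le> s" using assms(1) sp unfolding pivot_def by (meson not_le)
  have "A r c \<longleftrightarrow> A r s \<and> A p c"
  proof (cases "c = s")
    case True
    then show ?thesis using sp by (simp add: pivot_def)
  next
    case False
    then have "c < s" using assms(2) \<open>j \<le> s\<close> by linarith
    then show ?thesis using sp assms(4) by (auto simp: pivot_def)
  qed
  then show ?thesis unfolding eliminate_pivot[OF sp] by simp
qed

text \<open>Each step of the elimination clears one more column, so that after \<open>C\<close> steps only the right-hand sides are left.\<close>

theorem gauss:
  "solvable N C A \<longleftrightarrow> (\<forall>r<N. \<not> (eliminate N C ^^ C) A r C)"
proof -
  let ?B = "\<lambda>j. (eliminate N C ^^ j) A"
  have "\<not> ?B j r c" if "c < j" "c < C" "r < N" for j c r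
    using that
  proof (induction j arbitrary: c r)
    case (Suc j)
    then show ?case using eliminate_columns[of j C N "?B j" c r] by simp
  qed simp
  then have zero: "\<not> ?B C r c" if "c < C" "r < N" for r c using that by blast
  have "solvable N C A \<longleftrightarrow> solvable N C (?B j)" for j
    by (induction j) (simp_all add: eliminate_solvable)
  then have "solvable N C A \<longleftrightarrow> solvable N C (?B C)" .
  also have "\<dots> \<longleftrightarrow> (\<forall>r<N. \<not> ?B C r C)"
    using zero by (auto simp: solvable_def)
  finally show ?thesis .
qed

section \<open>Extension problems as linear equations\<close>

text \<open>In the presence of a compatible operation that is \<open>x + y + z\<close> in an elementary abelian 2-group, an element of the group is
  described by a formal sum of elements, that is, by a function to the two-element field. The formal sums
  \<open>a + a' + add a a'\<close> describe 0. The unknowns are formal sums \<open>X i\<close> of elements (columns of the type 0)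
  and, for each pair \<open>i\<close>, \<open>j\<close>, the coefficients in an expression of \<open>X i + X j\<close> as a combination of
  formal sums \<open>a + a' + add a a'\<close> (type 1) and elements equivalent to 0 (type 2).\<close>

definition coef :: "(nat \<Rightarrow> nat \<Rightarrow> nat \<Rightarrow> bool) \<Rightarrow> (nat \<Rightarrow> nat \<Rightarrow> nat) \<Rightarrow> nat \<Rightarrow> nat \<Rightarrow> nat \<Rightarrow> nat \<Rightarrow> nat
    \<Rightarrow> nat \<Rightarrow> nat \<Rightarrow> nat \<Rightarrow> nat \<Rightarrow> nat \<Rightarrow> bool" where
  "coef E add m ty i j e ty' i' j' a a' \<longleftrightarrow>
     (if ty = 0
      then (if ty' = 0 then j' = 0 \<and> a = e \<and> a' = 0 \<and> (i' = i) \<noteq> (i' = j)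
        else if ty' = 1 then i' = i \<and> j' = j \<and> ((e = a) \<noteq> (e = a')) \<noteq> (e = add a a')
        else i' = i \<and> j' = j \<and> a = e \<and> a' = 0 \<and> (E i a 0 \<or> E j a 0))
      else ty' = 0 \<and> i' = i \<and> j' = 0 \<and> a = e \<and> a' = 0 \<and> i \<le> m \<and> j = 0)"

definition sys_rows :: "nat \<Rightarrow> nat \<Rightarrow> nat" where "sys_rows n k = 2 * k * k * n"
definition sys_cols :: "nat \<Rightarrow> nat \<Rightarrow> nat" where "sys_cols n k = 3 * k * k * n * n"

definition sys :: "nat \<Rightarrow> nat \<Rightarrow> (nat \<Rightarrow> nat \<Rightarrow> nat \<Rightarrow> bool) \<Rightarrow> (nat \<Rightarrow> nat \<Rightarrow> nat) \<Rightarrow> nat \<Rightarrow> nat \<Rightarrow> nat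
    \<Rightarrow> nat \<Rightarrow> nat \<Rightarrow> bool" where
  "sys n k E add m b c r col \<longleftrightarrow>
     (let e = r mod n; j = r div n mod k; i = r div n div k mod k; ty = r div n div k div k
      in if col = sys_cols n k then ty = 1 \<and> i \<le> m \<and> j = 0 \<and> e = (if i < m then b else c)
         else coef E add m ty i j e (col div n div n div k div k) (col div n div n div k mod k) (col div n div n mod k)
           (col div n mod n) (col mod n))"

lemma sum_mixed: "(\<Sum>c<m * n. f c) = (\<Sum>i<m. \<Sum>a<n. f (i * n + a))" for f :: "nat \<Rightarrow> bit"
proof (induction m)
  case (Suc m)
  have "(\<Sum>c<m * n + l. f c) = (\<Sum>c<m * n. f c) + (\<Sum>a<l. f (m * n + a))" for l
    by (induction l) (auto simp: add.assoc)
  from this[of n] show ?case using Suc by (simp add: add.commute)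
qed simp

lemma sum_single: "(\<And>i'. i' \<noteq> i \<Longrightarrow> f i' = 0) \<Longrightarrow> i < k \<Longrightarrow> (\<Sum>i'<k. f i') = f i"
  for f :: "nat \<Rightarrow> bit" and k :: nat
  by (subst sum.remove[of _ i]) (auto intro!: sum.neutral)

text \<open>The numbers of columns and rows. In a column of type 0, \<open>j\<close> and \<open>a'\<close> are 0; in a column of type 2, \<open>a'\<close> is 0. The rows of type 0
  express that \<open>X i + X j\<close> is a combination, those of type 1 (with \<open>j = 0\<close> and \<open>i \<le> m\<close>) that \<open>X i\<close> is the prescribed element. Other rows
  and columns vanish.\<close>

definition col :: "nat \<Rightarrow> nat \<Rightarrow> nat \<Rightarrow> nat \<Rightarrow> nat \<Rightarrow> nat \<Rightarrow> nat \<Rightarrow> nat" where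
  "col n k ty i j a a' = (((ty * k + i) * k + j) * n + a) * n + a'"

definition row :: "nat \<Rightarrow> nat \<Rightarrow> nat \<Rightarrow> nat \<Rightarrow> nat \<Rightarrow> nat \<Rightarrow> nat" where
  "row n k ty i j e = ((ty * k + i) * k + j) * n + e"

text \<open>The element described by the formal sum \<open>f\<close> of the elements below \<open>m\<close>\<close>

fun gsum :: "(nat \<Rightarrow> nat \<Rightarrow> nat) \<Rightarrow> nat \<Rightarrow> (nat \<Rightarrow> bit) \<Rightarrow> nat" where
  "gsum add 0 f = 0"
| "gsum add (Suc m) f = (if f m = 1 then add (gsum add m f) m else gsum add m f)"

context
  fixes n k :: nat and E :: "nat \<Rightarrow> nat \<Rightarrow> nat \<Rightarrow> bool" and t :: "nat \<Rightarrow> nat \<Rightarrow> nat \<Rightarrow> nat" and add :: "nat \<Rightarrow> nat \<Rightarrow> nat"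
  assumes n: "0 < n" and E: "equivs n k E" and t: "polymorphism n k E t"
    and add: "\<And>x y. x < n \<Longrightarrow> y < n \<Longrightarrow> add x y = t x 0 y"
    and comm: "\<And>x y. x < n \<Longrightarrow> y < n \<Longrightarrow> add x y = add y x"
    and assoc: "\<And>x y z. x < n \<Longrightarrow> y < n \<Longrightarrow> z < n \<Longrightarrow> add (add x y) z = add x (add y z)"
    and zero: "\<And>x. x < n \<Longrightarrow> add x 0 = x" and self: "\<And>x. x < n \<Longrightarrow> add x x = 0"
begin

lemma add_lt: "x < n \<Longrightarrow> y < n \<Longrightarrow> add x y < n"
  using t n by (simp add: add polymorphism_def)

lemma zero': "x < n \<Longrightarrow> add 0 x = x"
  using comm[OF n] zero by simp

lemma cancel: "x < n \<Longrightarrow> y < n \<Longrightarrow> add (add x y) y = x"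
  using assoc[of x y y] self zero by simp

lemma add_E:
  assumes "i < k" "x < n" "x' < n" "y < n" "y' < n" "E i x x'" "E i y y'"
  shows "E i (add x y) (add x' y')"
proof -
  have "E i 0 0" using equivsD(1)[OF E assms(1) n] .
  then show ?thesis
    using t[unfolded polymorphism_def, THEN conjunct2, rule_format, of i x x' 0 0 y y'] assms n by (simp add: add)
qed

lemma add_J:
  assumes "i < k" "j < k" "(x, x') \<in> (union_rel n E i j)\<^sup>+" "(y, y') \<in> (union_rel n E i j)\<^sup>+"
  shows "(add x y, add x' y') \<in> (union_rel n E i j)\<^sup>+"
  using polymorphism_join[OF E t assms(1,2,3) union_rel_refl[OF E assms(1) n] assms(4)]
    assms(3,4)[THEN union_rel_bounds] by (simp add: add)

lemma gsum_lt: "m \<le> n \<Longrightarrow> gsum add m f < n"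
  by (induction m) (auto simp: n add_lt)

lemma gsum_add: "m \<le> n \<Longrightarrow> gsum add m (\<lambda>e. f e + g e) = add (gsum add m f) (gsum add m g)"
proof (induction m)
  case 0
  then show ?case by (simp add: zero n)
next
  case (Suc m)
  let ?F = "gsum add m f" and ?G = "gsum add m g"
  have lt: "?F < n" "?G < n" "m < n" "add ?F ?G < n" using gsum_lt[of m] Suc.prems add_lt by auto
  consider "f m = 0" "g m = 0" | "f m = 1" "g m = 0" | "f m = 0" "g m = 1" | "f m = 1" "g m = 1"
    by (metis bit_not_one_iff)
  then show ?case
  proof cases
    case 2
    have "add (add ?F ?G) m = add ?F (add m ?G)" using assoc[OF lt(1-3)] comm[OF lt(2,3)] by simp
    then show ?thesis using 2 Suc assoc[OF lt(1,3,2)] by simp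
  next
    case 3
    then show ?thesis using Suc assoc[OF lt(1-3)] by simp
  next
    case 4
    have "add (add ?F m) (add ?G m) = add ?F (add m (add ?G m))" using assoc lt add_lt by simp
    also have "add m (add ?G m) = ?G" using comm[OF lt(3) add_lt[OF lt(2,3)]] cancel[OF lt(2,3)] by simp
    finally show ?thesis using 4 Suc by simp
  qed (use Suc in simp)
qed

lemma gsum_zero: "gsum add m (\<lambda>e. 0) = 0"
  by (induction m) auto

lemma gsum_delta: "m \<le> n \<Longrightarrow> a < n \<Longrightarrow> gsum add m (\<lambda>e. of_bool (e = a)) = (if a < m then a else 0)"
proof (induction m)
  case (Suc m)
  then show ?case by (auto simp: less_Suc_eq zero' of_bool_def)
qed simp

lemma gsum_cong: "(\<And>e. e < m \<Longrightarrow> f e = g e) \<Longrightarrow> gsum add m f = gsum add m g"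
  by (induction m) auto

lemma gsum_sum: "(\<And>c. c < (l :: nat) \<Longrightarrow> gsum add n (g c) = 0) \<Longrightarrow> gsum add n (\<lambda>e. \<Sum>c<l. g c e) = 0"
proof (induction l)
  case (Suc l)
  then show ?case using gsum_add[of n "\<lambda>e. \<Sum>c<l. g c e" "g l"] zero[OF n] by simp
qed (simp add: gsum_zero)

text \<open>The formal sum \<open>a + a' + add a a'\<close>, and the combinations of these sums and of elements equivalent to 0\<close>

definition relator :: "nat \<Rightarrow> nat \<Rightarrow> nat \<Rightarrow> bit" where
  "relator a a' e = of_bool (((e = a) \<noteq> (e = a')) \<noteq> (e = add a a'))"

definition in_span :: "nat \<Rightarrow> nat \<Rightarrow> (nat \<Rightarrow> bit) \<Rightarrow> (nat \<Rightarrow> nat \<Rightarrow> bit) \<Rightarrow> (nat \<Rightarrow> bit) \<Rightarrow> bool" where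
  "in_span i j f y z \<longleftrightarrow> (\<forall>e<n. f e = (\<Sum>a<n. \<Sum>a'<n. relator a a' e * y a a') + of_bool (E i e 0 \<or> E j e 0) * z e)"

lemma gsum_relator: "a < n \<Longrightarrow> a' < n \<Longrightarrow> gsum add n (relator a a') = 0"
proof -
  assume a: "a < n" "a' < n"
  have "gsum add n (relator a a') = gsum add n (\<lambda>e. of_bool (e = a) + of_bool (e = a') + of_bool (e = add a a'))"
    unfolding relator_def of_bool_neq_bit ..
  also have "\<dots> = add (add a a') (add a a')"
    using a add_lt by (simp add: gsum_add gsum_delta)
  finally show ?thesis using self add_lt a by simp
qed

text \<open>Combinations describe elements related to 0, and conversely, related elements differ by a combination.\<close>

lemma span_join:
  assumes ij: "i < k" "j < k" and s: "in_span i j f y z"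
  shows "(gsum add n f, 0) \<in> (union_rel n E i j)\<^sup>+"
proof -
  let ?w = "\<lambda>e. of_bool (E i e 0 \<or> E j e 0) * z e"
  have w: "(gsum add m ?w, 0) \<in> (union_rel n E i j)\<^sup>+" if "m \<le> n" for m
    using that
  proof (induction m)
    case 0
    then show ?case using union_rel_refl[OF E ij(1) n] by simp
  next
    case (Suc m)
    have "(add (gsum add m ?w) m, add 0 0) \<in> (union_rel n E i j)\<^sup>+" if "?w m = 1"
    proof (rule add_J[OF ij])
      have "E i m 0 \<or> E j m 0" using that by (auto simp: of_bool_def split: if_splits)
      then show "(m, 0) \<in> (union_rel n E i j)\<^sup>+" using Suc.prems n by (auto simp: union_rel_def)
    qed (use Suc in simp)
    then show ?case using Suc zero[OF n] by auto
  qed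
  have "gsum add n f = gsum add n (\<lambda>e. (\<Sum>a<n. \<Sum>a'<n. relator a a' e * y a a') + ?w e)"
    using s unfolding in_span_def by (intro gsum_cong) auto
  also have "\<dots> = add (gsum add n (\<lambda>e. \<Sum>a<n. \<Sum>a'<n. relator a a' e * y a a')) (gsum add n ?w)"
    by (simp add: gsum_add)
  also have "gsum add n (\<lambda>e. \<Sum>a<n. \<Sum>a'<n. relator a a' e * y a a') = 0"
  proof (intro gsum_sum)
    fix a a' assume a: "a < n" "a' < n"
    show "gsum add n (\<lambda>e. relator a a' e * y a a') = 0"
      using gsum_relator[OF a] gsum_zero by (cases "y a a'") simp_all
  qed
  finally show ?thesis using w[of n] gsum_lt[of n ?w] zero' by simp
qed

lemma span_add: "in_span i j f y z \<Longrightarrow> in_span i j f' y' z' \<Longrightarrow>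
  in_span i j (\<lambda>e. f e + f' e) (\<lambda>a a'. y a a' + y' a a') (\<lambda>e. z e + z' e)"
  by (simp add: in_span_def distrib_left sum.distrib algebra_simps)

lemma span_step:
  assumes "i < k" "j < k" "(c, c') \<in> union_rel n E i j"
  shows "\<exists>y z. in_span i j (\<lambda>e. of_bool (e = c) + of_bool (e = c')) y z"
proof -
  have c: "c < n" "c' < n" "E i c c' \<or> E j c c'" using assms by (auto simp: union_rel_def)
  let ?d = "add c c'"
  have E0: "E l ?d 0" if "E l c c'" "l < k" for l
    using add_E[OF that(2) c(1,2,2,2) that(1) equivsD(1)[OF E that(2) c(2)]] self[OF c(2)] by simp
  then have d: "E i ?d 0 \<or> E j ?d 0" using c(3) assms by blast
  have "in_span i j (\<lambda>e. of_bool (e = c) + of_bool (e = c'))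
      (\<lambda>a a'. of_bool (a = c \<and> a' = c')) (\<lambda>e. of_bool (e = ?d))"
    unfolding in_span_def
  proof (intro allI impI)
    fix e assume e: "e < n"
    have "(\<Sum>a<n. \<Sum>a'<n. relator a a' e * of_bool (a = c \<and> a' = c')) =
        (\<Sum>a'<n. relator c a' e * of_bool (c = c \<and> a' = c'))"
      by (rule sum_single[OF _ c(1)]) simp
    also have "\<dots> = relator c c' e * of_bool (c = c \<and> c' = c')" by (rule sum_single[OF _ c(2)]) simp
    finally have "(\<Sum>a<n. \<Sum>a'<n. relator a a' e * of_bool (a = c \<and> a' = c')) =
        of_bool (e = c) + of_bool (e = c') + of_bool (e = ?d)"
      by (simp add: relator_def of_bool_neq_bit del: of_bool_not_iff)
    moreover have "of_bool (E i e 0 \<or> E j e 0) * of_bool (e = ?d) = (of_bool (e = ?d) :: bit)" using d by auto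
    ultimately show "of_bool (e = c) + of_bool (e = c') =
        (\<Sum>a<n. \<Sum>a'<n. relator a a' e * of_bool (a = c \<and> a' = c')) + of_bool (E i e 0 \<or> E j e 0) * (of_bool (e = ?d) :: bit)"
      by (simp only:) (simp add: add.assoc)
  qed
  then show ?thesis by blast
qed

lemma join_span:
  assumes "i < k" "j < k" "(u, v) \<in> (union_rel n E i j)\<^sup>+"
  shows "\<exists>y z. in_span i j (\<lambda>e. of_bool (e = u) + of_bool (e = v)) y z"
  using assms(3)
proof (induction rule: trancl_induct)
  case (base v)
  then show ?case by (rule span_step[OF assms(1,2)])
next
  case (step v w)
  obtain y z y' z' where "in_span i j (\<lambda>e. of_bool (e = u) + of_bool (e = v)) y z"
    "in_span i j (\<lambda>e. of_bool (e = v) + of_bool (e = w)) y' z'"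
    using step(3) span_step[OF assms(1,2) step(2)] by blast
  from span_add[OF this]
  have "in_span i j (\<lambda>e. of_bool (e = u) + of_bool (e = w)) (\<lambda>a a'. y a a' + y' a a') (\<lambda>e. z e + z' e)"
    by (simp add: add.assoc)
  then show ?case by blast
qed

lemma sum_col: "(\<Sum>c<sys_cols n k. f c) = (\<Sum>ty<3. \<Sum>i<k. \<Sum>j<k. \<Sum>a<n. \<Sum>a'<n. f (col n k ty i j a a'))"
  for f :: "nat \<Rightarrow> bit"
  unfolding sys_cols_def col_def sum_mixed ..

lemma sys_row_sum:
  fixes x :: "nat \<Rightarrow> bit"
  assumes r: "i < k" "j < k" "e < n"
  shows "(\<Sum>c'<sys_cols n k. of_bool (sys n k E add m b c (row n k ty i j e) c') * x c') =
    (\<Sum>ty'<3. \<Sum>i'<k. \<Sum>j'<k. \<Sum>a<n. \<Sum>a'<n. of_bool (coef E add m ty i j e ty' i' j' a a') * x (col n k ty' i' j' a a'))"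
proof -
  have "of_bool (sys n k E add m b c (row n k ty i j e) (col n k ty' i' j' a a')) =
      (of_bool (coef E add m ty i j e ty' i' j' a a') :: bit)"
    if "ty' \<in> {..<3}" "i' \<in> {..<k}" "j' \<in> {..<k}" "a \<in> {..<n}" "a' \<in> {..<n}" for ty' i' j' a a'
  proof -
    have "col n k ty' i' j' a a' < sys_cols n k"
      unfolding col_def sys_cols_def using that[unfolded lessThan_iff] by (intro mixed_radix_less)
    then show ?thesis unfolding sys_def Let_def using that by (simp add: row_def col_def div_mod_mixed r)
  qed
  then show ?thesis unfolding sum_col by (intro sum.cong refl arg_cong2[where f = "(*)"]) blast+
qed

lemma sys_rhs:
  assumes r: "i < k" "j < k" "e < n"
  shows "sys n k E add m b c (row n k ty i j e) (sys_cols n k) \<longleftrightarrow>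
    ty = 1 \<and> i \<le> m \<and> j = 0 \<and> e = (if i < m then b else c)"
  unfolding sys_def Let_def by (simp add: row_def div_mod_mixed r)

lemma sum_coef_pair:
  fixes x :: "nat \<Rightarrow> bit"
  assumes r: "i < k" "j < k" "e < n"
  shows "(\<Sum>ty'<3. \<Sum>i'<k. \<Sum>j'<k. \<Sum>a<n. \<Sum>a'<n. of_bool (coef E add m 0 i j e ty' i' j' a a') * x (col n k ty' i' j' a a')) =
    (x (col n k 0 i 0 e 0) + x (col n k 0 j 0 e 0)) + ((\<Sum>a<n. \<Sum>a'<n. relator a a' e * x (col n k 1 i j a a')) +
      of_bool (E i e 0 \<or> E j e 0) * x (col n k 2 i j e 0))"
proof -
  let ?T = "\<lambda>ty'. \<Sum>i'<k. \<Sum>j'<k. \<Sum>a<n. \<Sum>a'<n. of_bool (coef E add m 0 i j e ty' i' j' a a') * x (col n k ty' i' j' a a')"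
  have k0: "0 < k" using r by simp
  have inner: "(\<Sum>j'<k. \<Sum>a<n. \<Sum>a'<n. of_bool (coef E add m 0 i j e 0 i' j' a a') * x (col n k 0 i' j' a a')) =
      of_bool ((i' = i) \<noteq> (i' = j)) * x (col n k 0 i' 0 e 0)" for i'
    by (rule trans[OF sum_single[OF _ k0]], simp add: coef_def, rule trans[OF sum_single[OF _ r(3)]], simp add: coef_def,
        rule trans[OF sum_single[OF _ n]]) (simp_all add: coef_def)
  have "?T 0 = (\<Sum>i'<k. of_bool (i' = i) * x (col n k 0 i' 0 e 0)) + (\<Sum>i'<k. of_bool (i' = j) * x (col n k 0 i' 0 e 0))"
    unfolding inner of_bool_neq_bit distrib_right sum.distrib ..
  also have "(\<Sum>i'<k. of_bool (i' = i) * x (col n k 0 i' 0 e 0)) = x (col n k 0 i 0 e 0)"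
    by (rule trans[OF sum_single[OF _ r(1)]]) auto
  also have "(\<Sum>i'<k. of_bool (i' = j) * x (col n k 0 i' 0 e 0)) = x (col n k 0 j 0 e 0)"
    by (rule trans[OF sum_single[OF _ r(2)]]) auto
  finally have T0: "?T 0 = x (col n k 0 i 0 e 0) + x (col n k 0 j 0 e 0)" .
  have T1: "?T 1 = (\<Sum>a<n. \<Sum>a'<n. relator a a' e * x (col n k 1 i j a a'))"
    by (rule trans[OF sum_single[OF _ r(1)]], simp add: coef_def, rule trans[OF sum_single[OF _ r(2)]])
      (simp_all add: coef_def relator_def)
  have T2: "?T 2 = of_bool (E i e 0 \<or> E j e 0) * x (col n k 2 i j e 0)"
    by (rule trans[OF sum_single[OF _ r(1)]], simp add: coef_def, rule trans[OF sum_single[OF _ r(2)]], simp add: coef_def,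
        rule trans[OF sum_single[OF _ r(3)]], simp add: coef_def, rule trans[OF sum_single[OF _ n]]) (simp_all add: coef_def)
  have "(\<Sum>ty'<3. f ty') = f 0 + (f 1 + f 2)" for f :: "nat \<Rightarrow> bit"
    by (simp add: numeral_3_eq_3 numeral_2_eq_2 add.assoc)
  then show ?thesis unfolding T0[symmetric] T1[symmetric] T2[symmetric] .
qed

lemma sum_coef_fix:
  fixes x :: "nat \<Rightarrow> bit"
  assumes r: "i < k" "e < n" "i \<le> m"
  shows "(\<Sum>ty'<3. \<Sum>i'<k. \<Sum>j'<k. \<Sum>a<n. \<Sum>a'<n. of_bool (coef E add m 1 i 0 e ty' i' j' a a') * x (col n k ty' i' j' a a')) =
    x (col n k 0 i 0 e 0)"
proof -
  have k0: "0 < k" using r by simp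
  have t3: "(0 :: nat) < 3" by simp
  let ?g = "\<lambda>ty' i' j' a a'. of_bool (coef E add m 1 i 0 e ty' i' j' a a') * x (col n k ty' i' j' a a')"
  have "(\<Sum>ty'<3. \<Sum>i'<k. \<Sum>j'<k. \<Sum>a<n. \<Sum>a'<n. ?g ty' i' j' a a') = (\<Sum>i'<k. \<Sum>j'<k. \<Sum>a<n. \<Sum>a'<n. ?g 0 i' j' a a')"
    by (rule sum_single[OF _ t3]) (simp add: coef_def)
  also have "\<dots> = (\<Sum>j'<k. \<Sum>a<n. \<Sum>a'<n. ?g 0 i j' a a')" by (rule sum_single[OF _ r(1)]) (simp add: coef_def)
  also have "\<dots> = (\<Sum>a<n. \<Sum>a'<n. ?g 0 i 0 a a')" by (rule sum_single[OF _ k0]) (simp add: coef_def)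
  also have "\<dots> = (\<Sum>a'<n. ?g 0 i 0 e a')" by (rule sum_single[OF _ r(2)]) (simp add: coef_def)
  also have "\<dots> = ?g 0 i 0 e 0" by (rule sum_single[OF _ n]) (simp add: coef_def)
  finally show ?thesis using r by (simp add: coef_def)
qed

theorem extends_iff_solvable:
  assumes m: "m < k" and bc: "b < n" "c < n"
  shows "extends n k E m b c \<longleftrightarrow> solvable (sys_rows n k) (sys_cols n k) (sys n k E add m b c)"
proof
  assume "extends n k E m b c"
  then obtain u where u: "compatible n k E u" "\<forall>i<m. u i = b" "u m = c" by (auto simp: extends_def)
  have "\<exists>y z. in_span i j (\<lambda>e. of_bool (e = u i) + of_bool (e = u j)) y z" if "i < k" "j < k" for i j
    using u(1) that by (intro join_span) (auto simp: compatible_def)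
  then obtain y z where yz: "\<And>i j. i < k \<Longrightarrow> j < k \<Longrightarrow>
      in_span i j (\<lambda>e. of_bool (e = u i) + of_bool (e = u j)) (y i j) (z i j)" by metis
  \<comment> \<open>the formal sum for \<open>i\<close> consists of the single element \<open>u i\<close>\<close>
  define x where "x p = (let ty = p div n div n div k div k; i = p div n div n div k mod k; j = p div n div n mod k;
    a = p div n mod n; a' = p mod n
    in if ty = 0 then of_bool (a = u i) else if ty = 1 then y i j a a' else z i j a)" for p
  have x: "x (col n k ty i j a a') = (if ty = 0 then of_bool (a = u i) else if ty = 1 then y i j a a' else z i j a)"
    if "i < k" "j < k" "a < n" "a' < n" for ty i j a a'
    unfolding x_def Let_def by (simp add: col_def div_mod_mixed that)
  show "solvable (sys_rows n k) (sys_cols n k) (sys n k E add m b c)" unfolding solvable_def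
  proof (intro exI[of _ x] allI impI)
    fix r assume r: "r < sys_rows n k"
    have k0: "0 < k" using m by simp
    define ty i j e where "ty = r div n div k div k" and "i = r div n div k mod k" and "j = r div n mod k" and "e = r mod n"
    have lt: "i < k" "j < k" "e < n" using k0 n by (simp_all add: i_def j_def e_def)
    have req: "r = row n k ty i j e" by (simp add: row_def ty_def i_def j_def e_def)
    have ty: "ty < 2"
      using r by (auto simp: ty_def sys_rows_def less_mult_imp_div_less mult.assoc)
    show "(\<Sum>c'<sys_cols n k. of_bool (sys n k E add m b c r c') * x c') = of_bool (sys n k E add m b c r (sys_cols n k))"
    proof (cases "ty = 0")
      case True
      have "in_span i j (\<lambda>e. of_bool (e = u i) + of_bool (e = u j)) (y i j) (z i j)" using yz lt by blast
      then have "of_bool (e = u i) + of_bool (e = u j) =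
          (\<Sum>a<n. \<Sum>a'<n. relator a a' e * y i j a a') + of_bool (E i e 0 \<or> E j e 0) * z i j e"
        using lt by (simp add: in_span_def)
      moreover have "(\<Sum>a<n. \<Sum>a'<n. relator a a' e * x (col n k 1 i j a a')) = (\<Sum>a<n. \<Sum>a'<n. relator a a' e * y i j a a')"
        by (intro sum.cong refl) (simp add: x lt)
      ultimately show ?thesis unfolding req sys_row_sum[OF lt] sys_rhs[OF lt]
        by (simp only: True sum_coef_pair[OF lt]) (simp add: x lt n k0)
    next
      case False
      then have ty1: "ty = 1" using ty by auto
      show ?thesis
      proof (cases "i \<le> m \<and> j = 0")
        case True
        then have "u i = (if i < m then b else c)" using u by auto
        then show ?thesis unfolding req sys_row_sum[OF lt] sys_rhs[OF lt] ty1
          using True sum_coef_fix[OF lt(1,3), of m x] by (simp add: x lt n k0)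
      next
        case False
        then have "\<not> coef E add m 1 i j e ty' i' j' a a'" for ty' i' j' a a' by (auto simp: coef_def)
        then show ?thesis unfolding req sys_row_sum[OF lt] sys_rhs[OF lt] ty1 using False by auto
      qed
    qed
  qed
next
  assume "solvable (sys_rows n k) (sys_cols n k) (sys n k E add m b c)"
  then obtain x :: "nat \<Rightarrow> bit" where x: "\<And>r. r < sys_rows n k \<Longrightarrow>
      (\<Sum>c'<sys_cols n k. of_bool (sys n k E add m b c r c') * x c') = of_bool (sys n k E add m b c r (sys_cols n k))"
    unfolding solvable_def by blast
  have rl: "row n k ty i j e < sys_rows n k" if "ty < 2" "i < k" "j < k" "e < n" for ty i j e
    unfolding row_def sys_rows_def using that by (intro mixed_radix_less)
  define X where "X i e = x (col n k 0 i 0 e 0)" for i e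
  \<comment> \<open>the elements described by the formal sums\<close>
  define u where "u i = gsum add n (X i)" for i
  have un: "u i < n" for i by (simp add: u_def gsum_lt)
  have "(u i, u j) \<in> (union_rel n E i j)\<^sup>+" if ij: "i < k" "j < k" for i j
  proof -
    have "in_span i j (\<lambda>e. X i e + X j e) (\<lambda>a a'. x (col n k 1 i j a a')) (\<lambda>e. x (col n k 2 i j e 0))"
      unfolding in_span_def
    proof (intro allI impI)
      fix e assume e: "e < n"
      let ?s = "(\<Sum>a<n. \<Sum>a'<n. relator a a' e * x (col n k 1 i j a a')) + of_bool (E i e 0 \<or> E j e 0) * x (col n k 2 i j e 0)"
      have "(X i e + X j e) + ?s = 0"
        using x[OF rl[OF _ ij e, of 0]] unfolding sys_row_sum[OF ij e] sys_rhs[OF ij e] sum_coef_pair[OF ij e] X_def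
        by simp
      then show "X i e + X j e = ?s" by (rule bit_add_eq_0)
    qed
    from span_join[OF ij this] have "(add (u i) (u j), 0) \<in> (union_rel n E i j)\<^sup>+"
      by (simp add: gsum_add u_def)
    from add_J[OF ij this union_rel_refl[OF E ij(1) un[of j]]] show ?thesis
      by (simp add: cancel un zero')
  qed
  then have "compatible n k E u" using un by (simp add: compatible_def)
  moreover have fixu: "u i = (if i < m then b else c)" if "i \<le> m" for i
  proof -
    have i: "i < k" "0 < k" using that m by auto
    have "X i e = of_bool (e = (if i < m then b else c))" if e: "e < n" for e
      using x[OF rl[OF _ i e, of 1]] \<open>i \<le> m\<close>
      unfolding sys_row_sum[OF i e] sys_rhs[OF i e] sum_coef_fix[OF i(1) e \<open>i \<le> m\<close>] X_def by simp
    then have "u i = gsum add n (\<lambda>e. of_bool (e = (if i < m then b else c)))"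
      unfolding u_def by (rule gsum_cong)
    then show ?thesis using gsum_delta[of n "if i < m then b else c"] bc by simp
  qed
  ultimately show "extends n k E m b c" unfolding extends_def
    by (intro exI[of _ u]) (simp add: fixu)
qed

end

section \<open>Path consistency in polynomial time\<close>

lemma refine_cong:
  assumes "\<And>i j a a'. i < k \<Longrightarrow> j < k \<Longrightarrow> a < n \<Longrightarrow> a' < n \<Longrightarrow> D i j a a' = D' i j a a'"
    and "i < k" "j < k" "a < n" "a' < n"
  shows "refine n k D i j a a' = refine n k D' i j a a'"
proof -
  have "(D i l a d \<and> D l j d a') = (D' i l a d \<and> D' l j d a')" if "l < k" "d < n" for l d
    using assms that by simp
  then have "(\<forall>l<k. \<exists>d<n. D i l a d \<and> D l j d a') = (\<forall>l<k. \<exists>d<n. D' i l a d \<and> D' l j d a')" by blast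
  then show ?thesis unfolding refine_def using assms by simp
qed

lemma refine_Suc: "(refine n k ^^ Suc t) D i j a a' \<longleftrightarrow> (refine n k ^^ t) D i j a a' \<and>
    (\<forall>l<k. \<exists>d<n. (refine n k ^^ t) D i l a d \<and> (refine n k ^^ t) D l j d a')"
  by (simp only: funpow.simps comp_def refine_def)

text \<open>If the refinement is stationary after \<open>T\<close> steps, the extension problem has a solution if and only if the domain of the first variable has not become empty. The refined
  relations contain all solutions, are symmetric and closed under \<open>g\<close>; for the restriction of the first entries to constants,
  this requires \<open>g\<close> to be idempotent.\<close>

lemma path_consistency:
  fixes E :: "nat \<Rightarrow> nat \<Rightarrow> nat \<Rightarrow> bool" and n k T m b c :: nat
  defines "D \<equiv> (refine n k ^^ T) (constraint n E m b c)"
  assumes E: "equivs n k E" and m: "m < k" and g: "polymorphism n k E g" and idem: "\<And>x. x < n \<Longrightarrow> g x x x = x"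
    and sol: "\<And>D a0. path_consistent n k D \<Longrightarrow> closed_family k g D \<Longrightarrow> D 0 0 a0 a0 \<Longrightarrow> \<exists>x. \<forall>i<k. \<forall>j<k. D i j (x i) (x j)"
    and fp: "\<And>i j a a'. i < k \<Longrightarrow> j < k \<Longrightarrow> a < n \<Longrightarrow> a' < n \<Longrightarrow> D i j a a' \<Longrightarrow> refine n k D i j a a'"
    and bc: "b < n" "c < n"
  shows "extends n k E m b c \<longleftrightarrow> (\<exists>a<n. D 0 0 a a)"
proof -
  let ?C = "constraint n E m b c" and ?D = "\<lambda>t. (refine n k ^^ t) (constraint n E m b c)"
  have le: "?D t i j a a' \<Longrightarrow> ?C i j a a'" for t i j a a'
    by (induction t arbitrary: i j a a') (auto simp: refine_Suc simp del: funpow.simps(2))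
  have bound: "a < n \<and> a' < n" if "?D t i j a a'" for t i j a a'
    using le[OF that] union_rel_bounds by (auto simp: constraint_def)
  show ?thesis
  proof
    assume "extends n k E m b c"
    then obtain x where x: "compatible n k E x" "\<forall>i<m. x i = b" "x m = c" by (auto simp: extends_def)
    have xn: "x i < n" if "i < k" for i using x that by (simp add: compatible_def)
    have "?D t i j (x i) (x j)" if "i < k" "j < k" for t i j using that
    proof (induction t arbitrary: i j)
      case 0
      then show ?case using x by (auto simp: constraint_def fixed_def compatible_def)
    next
      case (Suc t)
      then show ?case using xn by (auto simp: refine_Suc simp del: funpow.simps(2))
    qed
    then have "D 0 0 (x 0) (x 0)" "x 0 < n" using m xn unfolding D_def by (blast intro: gr_implies_not0 zero_less_iff_neq_zero[THEN iffD2])+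
    then show "\<exists>a<n. D 0 0 a a" by blast
  next
    assume "\<exists>a<n. D 0 0 a a"
    then obtain a0 where a0: "D 0 0 a0 a0" by blast
    have sym: "?D t j i a' a" if "?D t i j a a'" "i < k" "j < k" for t i j a a' using that
    proof (induction t arbitrary: i j a a')
      case 0
      then show ?case using union_rel_sym[OF E] by (auto simp: constraint_def)
    next
      case (Suc t)
      have "\<exists>d<n. ?D t j l a' d \<and> ?D t l i d a" if l: "l < k" for l
      proof -
        obtain d where d: "d < n" "?D t i l a d" "?D t l j d a'" using Suc.prems(1) l by (auto simp: refine_Suc simp del: funpow.simps(2))
        then show ?thesis using Suc.IH[OF d(2) Suc.prems(2) l] Suc.IH[OF d(3) l Suc.prems(3)] by blast
      qed
      moreover have "?D t j i a' a" using Suc by (auto simp: refine_Suc simp del: funpow.simps(2))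
      ultimately show ?case by (simp add: refine_Suc del: funpow.simps(2))
    qed
    have closed: "?D t i j (g x y z) (g x' y' z')"
      if "?D t i j x x'" "?D t i j y y'" "?D t i j z z'" "i < k" "j < k" for t i j x x' y y' z z'
      using that
    proof (induction t arbitrary: i j x x' y y' z z')
      case 0
      then have "fixed m b c i (g x y z)" "fixed m b c j (g x' y' z')"
        using idem bc by (auto simp: constraint_def fixed_def)
      moreover have "i = j \<longrightarrow> g x y z = g x' y' z'" using 0 by (auto simp: constraint_def)
      ultimately show ?case
        using 0 polymorphism_join[OF E g 0(4,5), of x x' y y' z z'] by (simp add: constraint_def)
    next
      case (Suc t)
      have "\<exists>d<n. ?D t i l (g x y z) d \<and> ?D t l j d (g x' y' z')" if l: "l < k" for l
      proof -
        obtain d1 d2 d3 where "?D t i l x d1" "?D t l j d1 x'" "?D t i l y d2" "?D t l j d2 y'"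
          "?D t i l z d3" "?D t l j d3 z'" using Suc.prems l by (fastforce simp: refine_Suc simp del: funpow.simps(2))
        then have "?D t i l (g x y z) (g d1 d2 d3)" "?D t l j (g d1 d2 d3) (g x' y' z')"
          using Suc.IH Suc.prems(4,5) l by blast+
        then show ?thesis using bound by blast
      qed
      moreover have "?D t i j (g x y z) (g x' y' z')" using Suc by (simp add: refine_Suc del: funpow.simps(2))
      ultimately show ?case by (simp add: refine_Suc del: funpow.simps(2))
    qed
    have pc: "path_consistent n k D" unfolding path_consistent_def
    proof (intro allI impI)
      fix i j a a' assume ij: "i < k" "j < k" and d: "D i j a a'"
      have "refine n k D i j a a'" using fp ij d bound unfolding D_def by blast
      then have "\<forall>l<k. \<exists>d. D i l a d \<and> D l j d a'" unfolding refine_def by blast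
      moreover have "i = j \<longrightarrow> a = a'" using le d unfolding D_def constraint_def by blast
      ultimately show "a < n \<and> a' < n \<and> (i = j \<longrightarrow> a = a') \<and> D j i a' a \<and> (\<forall>l<k. \<exists>d. D i l a d \<and> D l j d a')"
        using bound d sym ij unfolding D_def by blast
    qed
    have cl: "closed_family k g D" unfolding closed_family_def D_def using closed by blast
    obtain x where x: "\<And>i j. i < k \<Longrightarrow> j < k \<Longrightarrow> D i j (x i) (x j)" using sol[of D a0, OF pc cl a0] by blast
    then have C: "?C i j (x i) (x j)" if "i < k" "j < k" for i j using that le unfolding D_def by blast
    have "x i < n" if "i < k" for i using x[OF that that] bound unfolding D_def by blast
    then have "compatible n k E x" using C by (simp add: compatible_def constraint_def)
    moreover have "\<forall>i<m. x i = b" using C m unfolding constraint_def fixed_def by (meson order_less_trans)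
    moreover have "x m = c" using C[OF m m] by (simp add: constraint_def fixed_def)
    ultimately show "extends n k E m b c" unfolding extends_def by blast
  qed
qed

text \<open>A parallel update that never changes bits equal to \<open>d\<close> is stationary after as many steps as there are bits.\<close>

lemma monotone_fixpoint:
  fixes F :: "bits \<Rightarrow> bits"
  assumes len: "\<And>y. length y = N \<Longrightarrow> length (F y) = N" and y0: "length y0 = N"
    and mono: "\<And>y p. length y = N \<Longrightarrow> p < N \<Longrightarrow> y ! p = d \<Longrightarrow> F y ! p = d"
  shows "F ((F ^^ N) y0) = (F ^^ N) y0"
proof -
  let ?y = "\<lambda>t. (F ^^ t) y0" and ?c = "\<lambda>y. card {p. p < N \<and> y ! p = d}"
  have ly: "length (?y t) = N" for t by (induction t) (auto simp: y0 len)
  have step: "F (?y t) = ?y t \<or> ?c (?y t) < ?c (?y (Suc t))" for t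
  proof (cases "F (?y t) = ?y t")
    case False
    then have "\<exists>p<N. F (?y t) ! p \<noteq> ?y t ! p"
      using ly[of t] len[OF ly[of t]] by (auto simp: list_eq_iff_nth_eq)
    then obtain p where p: "p < N" "F (?y t) ! p \<noteq> ?y t ! p" by blast
    then have "F (?y t) ! p = d \<and> ?y t ! p \<noteq> d" using mono[OF ly[of t] p(1)] by auto
    then have "{p. p < N \<and> ?y t ! p = d} \<subset> {p. p < N \<and> ?y (Suc t) ! p = d}"
      using mono[OF ly[of t]] p(1) by auto
    then have "?c (?y t) < ?c (?y (Suc t))" by (intro psubset_card_mono) auto
    then show ?thesis by blast
  qed blast
  have "F (?y t) = ?y t \<or> t \<le> ?c (?y t)" for t
  proof (induction t)
    case (Suc t)
    then show ?case using step[of t] by auto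
  qed simp
  then consider "F (?y N) = ?y N" | "N \<le> ?c (?y N)" by blast
  then show ?thesis
  proof cases
    case 2
    have "{p. p < N \<and> ?y N ! p = d} = {..<N}"
      by (rule card_subset_eq) (use 2 card_mono[of "{..<N}" "{p. p < N \<and> ?y N ! p = d}"] in auto)
    then have "?y N ! p = d" if "p < N" for p using that by blast
    then show ?thesis using mono[OF ly] ly len by (intro nth_equalityI) auto
  qed
qed

text \<open>Arrays with the five indices \<open>q < Q\<close>, \<open>i, j < k\<close> and \<open>a, a' < n\<close>\<close>

text \<open>\<open>table n k F\<close> is the content of the array with the entries \<open>F q i j a a'\<close>, and \<open>look\<close> retrieves the entries.\<close>

definition table :: "nat \<Rightarrow> nat \<Rightarrow> (nat \<Rightarrow> nat \<Rightarrow> nat \<Rightarrow> nat \<Rightarrow> nat \<Rightarrow> bool) \<Rightarrow> nat \<Rightarrow> bool" where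
  "table n k F p = F (p div n div n div k div k) (p div n div n div k mod k) (p div n div n mod k) (p div n mod n) (p mod n)"

definition look :: "nat \<Rightarrow> nat \<Rightarrow> bits \<Rightarrow> nat \<Rightarrow> nat \<Rightarrow> nat \<Rightarrow> nat \<Rightarrow> nat \<Rightarrow> bool" where
  "look n k y q i j a a' = bit_at y (col n k q i j a a')"

lemma col_less: "q < Q \<Longrightarrow> i < k \<Longrightarrow> j < k \<Longrightarrow> a < n \<Longrightarrow> a' < n \<Longrightarrow> col n k q i j a a' < Q * k * k * n * n"
  unfolding col_def by (intro mixed_radix_less)

lemma table_col: "i < k \<Longrightarrow> j < k \<Longrightarrow> a < n \<Longrightarrow> a' < n \<Longrightarrow> table n k F (col n k q i j a a') = F q i j a a'"
  by (simp add: table_def col_def div_mod_mixed)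

lemma look_table: "q < Q \<Longrightarrow> i < k \<Longrightarrow> j < k \<Longrightarrow> a < n \<Longrightarrow> a' < n \<Longrightarrow>
    look n k (map (table n k F) [0..<Q * k * k * n * n]) q i j a a' = F q i j a a'"
  using col_less[of q Q i k j a n a'] by (simp add: look_def bit_at_def table_col)

lemma table_look:
  assumes "p < Q * k * k * n * n"
  shows "table n k (look n k y) p = bit_at y p"
proof -
  have "col n k (p div n div n div k div k) (p div n div n div k mod k) (p div n div n mod k) (p div n mod n) (p mod n) = p"
    by (simp add: col_def)
  then show ?thesis by (simp add: table_def look_def)
qed

lemma table_fixpoint:
  assumes mono: "\<And>y q i j a a'. look n k y q i j a a' = d \<Longrightarrow> G y q i j a a' = d"
    and F: "F = (\<lambda>y. map (table n k (G y)) [0..<Q * k * k * n * n])"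
    and y0: "length y0 = Q * k * k * n * n"
    and x: "q < Q" "i < k" "j < k" "a < n" "a' < n"
  shows "look n k ((F ^^ (Q * k * k * n * n)) y0) q i j a a' = G ((F ^^ (Q * k * k * n * n)) y0) q i j a a'"
proof -
  let ?N = "Q * k * k * n * n" and ?y = "(F ^^ (Q * k * k * n * n)) y0"
  have "F ?y = ?y"
  proof (rule monotone_fixpoint)
    show "F y ! p = d" if "length y = ?N" "p < ?N" "y ! p = d" for y p
    proof -
      have "table n k (look n k y) p = d" using that table_look[OF that(2)] by (simp add: bit_at_def)
      then have "table n k (G y) p = d" unfolding table_def by (rule mono)
      then show ?thesis using that by (simp add: F)
    qed
  qed (simp_all add: F y0)
  then have "look n k ?y q i j a a' = look n k (F ?y) q i j a a'" by simp
  also have "\<dots> = G ?y q i j a a'" unfolding F using look_table[OF x] by blast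
  finally show ?thesis .
qed

text \<open>A step of the computation of transitive closures\<close>

definition join_step :: "nat \<Rightarrow> (nat \<Rightarrow> nat \<Rightarrow> nat \<Rightarrow> nat \<Rightarrow> nat \<Rightarrow> bool) \<Rightarrow> nat \<Rightarrow> nat \<Rightarrow> nat \<Rightarrow> nat \<Rightarrow> nat \<Rightarrow> bool" where
  "join_step n D q i j a b \<longleftrightarrow> D q i j a b \<or> (\<exists>c<n. D q i j a c \<and> D q i j c b)"

lemma join_fixpoint:
  fixes E :: "nat \<Rightarrow> nat \<Rightarrow> nat \<Rightarrow> bool" and n k :: nat
  defines "F \<equiv> \<lambda>y. map (table n k (join_step n (look n k y))) [0..<1 * k * k * n * n]"
  defines "y0 \<equiv> map (table n k (\<lambda>q i j a b. E i a b \<or> E j a b)) [0..<1 * k * k * n * n]"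
  assumes ij: "i < k" "j < k" "a < n" "b < n"
  shows "look n k ((F ^^ (1 * k * k * n * n)) y0) 0 i j a b \<longleftrightarrow> (a, b) \<in> (union_rel n E i j)\<^sup>+"
proof -
  let ?y = "\<lambda>t. (F ^^ t) y0" and ?z = "(F ^^ (1 * k * k * n * n)) y0"
  have lF: "look n k (F y) 0 i j a b = join_step n (look n k y) 0 i j a b" if "a < n" "b < n" for y a b
    unfolding F_def using look_table[of 0 1 i k j a n b] ij that by simp
  have l0: "look n k y0 0 i j a b \<longleftrightarrow> E i a b \<or> E j a b" if "a < n" "b < n" for a b
    unfolding y0_def using look_table[of 0 1 i k j a n b] ij that by simp
  have sub: "look n k (?y t) 0 i j a b \<Longrightarrow> (a, b) \<in> (union_rel n E i j)\<^sup>+" if "a < n" "b < n" for t a b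
    using that
  proof (induction t arbitrary: a b)
    case 0
    then show ?case by (auto simp: l0 union_rel_def)
  next
    case (Suc t)
    have "join_step n (look n k (?y t)) 0 i j a b" using Suc.prems lF[OF Suc.prems(2,3), of "?y t"] by simp
    then show ?case using Suc.IH Suc.prems(2,3) unfolding join_step_def by (meson trancl_trans)
  qed
  have sup0: "look n k (?y t) 0 i j a b" if "(a, b) \<in> union_rel n E i j" for t a b
  proof -
    have "a < n" "b < n" "E i a b \<or> E j a b" using that by (auto simp: union_rel_def)
    then show ?thesis
    proof (induction t)
      case (Suc t)
      then show ?case using lF[of a b "?y t"] by (simp add: join_step_def)
    qed (simp add: l0)
  qed
  have fp: "look n k ?z 0 i j a b = join_step n (look n k ?z) 0 i j a b" if "a < n" "b < n" for a b
    by (rule table_fixpoint[where d = True and G = "\<lambda>y. join_step n (look n k y)"])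
      (use ij that in \<open>auto simp: join_step_def F_def y0_def\<close>)
  have "look n k ?z 0 i j a b" if "(a, b) \<in> (union_rel n E i j)\<^sup>+" for a b using that
  proof (induction rule: trancl_induct)
    case (base b)
    then show ?case by (rule sup0)
  next
    case (step b c)
    have "a < n" "b < n" "c < n" using union_rel_bounds[OF step(1)] step(2) by (auto simp: union_rel_def)
    then show ?case using fp[of a c] step(3) sup0[OF step(2)] by (auto simp: join_step_def)
  qed
  then show ?thesis using sub ij by blast
qed

lemma DefB_table:
  assumes "Def n" "Def k" "DefB (\<lambda>R \<rho>. F R (\<rho> 0) (\<rho> 1) (\<rho> 2) (\<rho> 3) (\<rho> 4))" "Def p"
  shows "DefB (\<lambda>R \<rho>. table (n R \<rho>) (k R \<rho>) (F R) (p R \<rho>))"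
proof -
  define g where "g i = [\<lambda>R \<rho>. p R \<rho> div n R \<rho> div n R \<rho> div k R \<rho> div k R \<rho>,
    \<lambda>R \<rho>. p R \<rho> div n R \<rho> div n R \<rho> div k R \<rho> mod k R \<rho>, \<lambda>R \<rho>. p R \<rho> div n R \<rho> div n R \<rho> mod k R \<rho>,
    \<lambda>R \<rho>. p R \<rho> div n R \<rho> mod n R \<rho>, \<lambda>R \<rho>. p R \<rho> mod n R \<rho>] ! min i 4" for i
  have "Def (g i)" for i
  proof -
    have "min i 4 = 0 \<or> min i 4 = 1 \<or> min i 4 = 2 \<or> min i 4 = 3 \<or> min i 4 = 4" by linarith
    then show ?thesis unfolding g_def using assms(1,2,4) by (elim disjE) (auto intro!: Def_intros)
  qed
  from DefB_subst[OF assms(3), of g, OF this] show ?thesis unfolding table_def by (simp add: g_def)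
qed

lemma DefB_look: "r < 3 \<Longrightarrow> Def n \<Longrightarrow> Def k \<Longrightarrow> Def q \<Longrightarrow> Def i \<Longrightarrow> Def j \<Longrightarrow> Def a \<Longrightarrow> Def a' \<Longrightarrow>
    DefB (\<lambda>R \<rho>. look (n R \<rho>) (k R \<rho>) (R r) (q R \<rho>) (i R \<rho>) (j R \<rho>) (a R \<rho>) (a' R \<rho>))"
  unfolding look_def col_def by (intro Def_intros)

text \<open>The final step: every solvable extension problem that comes from a tuple \<open>b, \<dots>, b, c\<close> must have a solution
  among the elements.\<close>

definition verdict :: "nat \<Rightarrow> nat \<Rightarrow> (nat \<Rightarrow> nat \<Rightarrow> nat \<Rightarrow> bool) \<Rightarrow> (nat \<Rightarrow> bool) \<Rightarrow> bool" where
  "verdict n k E X \<longleftrightarrow> (\<forall>m<k. \<forall>b<n. \<forall>c<n. X ((m * n + b) * n + c) \<longrightarrow> (\<exists>b'<n. (\<forall>i<m. E i b' b) \<and> E m b' c))"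

lemma verdict_CR:
  assumes "equivs n k E" "0 < n"
    and "\<And>m b c. m < k \<Longrightarrow> b < n \<Longrightarrow> c < n \<Longrightarrow> X ((m * n + b) * n + c) \<longleftrightarrow> extends n k E m b c"
  shows "verdict n k E X \<longleftrightarrow> CR n k E"
  unfolding CR_iff_extends[OF assms(1,2)] verdict_def using assms(3) by auto

lemma DefB_verdict:
  assumes "DefB (\<lambda>R \<rho>. X R (\<rho> 0))"
  shows "DefB (\<lambda>R _. verdict (code_size (R 0)) (code_count L (R 0)) (coded_rel L (R 0)) (X R))"
  unfolding verdict_def
  by (intro Def_intros Def_code_size Def_code_count DefB_code_rel DefB_app1[where P = X, OF assms]) simp_all

text \<open>All extension problems are treated in parallel; the one for \<open>m\<close>, \<open>b\<close>, \<open>c\<close> has the index \<open>q = (m * n + b) * n + c\<close>. The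
  first array computes the joins, the second one refines the constraints.\<close>

theorem CRT_path_consistency_in_P:
  assumes "\<And>w n k E. w \<in> fst (CRT_restricted L V) \<Longrightarrow> n = code_size w \<Longrightarrow> k = code_count L w \<Longrightarrow> E = coded_rel L w \<Longrightarrow> 0 < k \<Longrightarrow>
    \<exists>g. polymorphism n k E g \<and> (\<forall>x<n. g x x x = x) \<and>
      (\<forall>D a0. path_consistent n k D \<longrightarrow> closed_family k g D \<longrightarrow> D 0 0 a0 a0 \<longrightarrow> (\<exists>x. \<forall>i<k. \<forall>j<k. D i j (x i) (x j)))"
  shows "in_class (CRT_restricted L V) class_P"
proof -
  let ?n = code_size and ?k = "code_count L" and ?E = "coded_rel L"
  let ?N1 = "\<lambda>w. 1 * ?k w * ?k w * ?n w * ?n w" and ?N2 = "\<lambda>w. (?k w * ?n w * ?n w) * ?k w * ?k w * ?n w * ?n w"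
  let ?P1 = "\<lambda>w. table (?n w) (?k w) (\<lambda>q i j a b. ?E w i a b \<or> ?E w j a b)"
  let ?S1 = "\<lambda>w y. table (?n w) (?k w) (join_step (?n w) (look (?n w) (?k w) y))"
  let ?C = "\<lambda>w y q i j a a'. look (?n w) (?k w) y 0 i j a a' \<and>
    fixed (q div ?n w div ?n w) (q div ?n w mod ?n w) (q mod ?n w) i a \<and>
    fixed (q div ?n w div ?n w) (q div ?n w mod ?n w) (q mod ?n w) j a' \<and> (i = j \<longrightarrow> a = a')"
  let ?P2 = "\<lambda>w y. table (?n w) (?k w) (?C w y)"
  let ?S2 = "\<lambda>w y1 y. table (?n w) (?k w) (\<lambda>q. refine (?n w) (?k w) (look (?n w) (?k w) y q))"
  let ?Q = "\<lambda>w y1 y. verdict (?n w) (?k w) (?E w) (\<lambda>q. \<exists>a<?n w. look (?n w) (?k w) y q 0 0 a a)"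
  let ?X = "{w. let y1 = array1 ?N1 ?N1 ?P1 ?S1 w in ?Q w y1 (array2 ?N2 ?N2 ?P2 ?S2 w y1)}"
  note D = Def_intros Def_code_size Def_code_count DefB_code_rel DefB_look
  have "?X \<in> class_P"
  proof (rule class_P_arrays)
    show "DefB (\<lambda>R \<rho>. ?P1 (R 0) (\<rho> 0))" by (intro DefB_table D) simp_all
    show "DefB (\<lambda>R \<rho>. ?S1 (R 0) (R 1) (\<rho> 0))" unfolding join_step_def by (intro DefB_table D) simp_all
    show "DefB (\<lambda>R \<rho>. ?P2 (R 0) (R 1) (\<rho> 0))" unfolding fixed_def by (intro DefB_table D) simp_all
    show "DefB (\<lambda>R \<rho>. ?S2 (R 0) (R 1) (R 2) (\<rho> 0))" unfolding refine_def by (intro DefB_table D) simp_all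
    show "DefB (\<lambda>R _. ?Q (R 0) (R 1) (R 2))" by (intro DefB_verdict D) simp_all
  qed (intro D; simp)+
  moreover have "w \<in> ?X \<longleftrightarrow> w \<in> snd (CRT_restricted L V)" if w: "w \<in> fst (CRT_restricted L V)" for w
  proof -
    define n k E where "n = ?n w" and "k = ?k w" and "E = ?E w"
    have d: "0 < n" "equivs n k E" "w \<in> snd (CRT_restricted L V) \<longleftrightarrow> CR n k E"
      using w unfolding n_def k_def E_def by (auto elim: CRT_restricted_decode)
    define y1 where "y1 = array1 ?N1 ?N1 ?P1 ?S1 w"
    define y2 where "y2 = array2 ?N2 ?N2 ?P2 ?S2 w y1"
    have y1: "look n k y1 0 i j a b \<longleftrightarrow> (a, b) \<in> (union_rel n E i j)\<^sup>+" if "i < k" "j < k" "a < n" "b < n" for i j a b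
      using join_fixpoint[OF that, of E] unfolding y1_def array1_def n_def k_def E_def .
    let ?Q = "k * n * n"
    let ?G = "\<lambda>y q. refine n k (look n k y q)"
    define F where "F = (\<lambda>y. map (table n k (?G y)) [0..<?Q * k * k * n * n])"
    define y0 where "y0 = map (table n k (?C w y1)) [0..<?Q * k * k * n * n]"
    have y2: "y2 = (F ^^ (?Q * k * k * n * n)) y0"
      unfolding y2_def array2_def F_def y0_def n_def k_def E_def ..
    have "(\<exists>a<n. look n k y2 ((m * n + b) * n + c) 0 0 a a) \<longleftrightarrow> extends n k E m b c" if m: "m < k" "b < n" "c < n" for m b c
    proof -
      let ?q = "(m * n + b) * n + c"
      have q: "?q < ?Q" using m by (intro mixed_radix_less)
      have k0: "0 < k" using m by simp
      have t: "look n k ((F ^^ t) y0) ?q i j a a' = (refine n k ^^ t) (constraint n E m b c) i j a a'"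
        if "i < k" "j < k" "a < n" "a' < n" for t i j a a' using that
      proof (induction t arbitrary: i j a a')
        case 0
        then show ?case using y1 look_table[OF q 0] m
          by (simp add: y0_def constraint_def div_mod_mixed n_def[symmetric] k_def[symmetric])
      next
        case (Suc t)
        have "look n k ((F ^^ Suc t) y0) ?q i j a a' = refine n k (look n k ((F ^^ t) y0) ?q) i j a a'"
          using look_table[OF q Suc.prems, of "?G ((F ^^ t) y0)"] by (simp add: F_def)
        also have "\<dots> = refine n k ((refine n k ^^ t) (constraint n E m b c)) i j a a'"
          by (rule refine_cong[OF Suc.IH Suc.prems])
        finally show ?case by simp
      qed
      have fp: "look n k y2 ?q i j a a' = refine n k (look n k y2 ?q) i j a a'"
        if "i < k" "j < k" "a < n" "a' < n" for i j a a'
        unfolding y2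
        by (rule table_fixpoint[where d = False and G = ?G])
          (use q that in \<open>auto simp: refine_def F_def y0_def\<close>)
      obtain g where g: "polymorphism n k E g" "\<And>x. x < n \<Longrightarrow> g x x x = x"
        "\<And>D a0. path_consistent n k D \<Longrightarrow> closed_family k g D \<Longrightarrow> D 0 0 a0 a0 \<Longrightarrow> \<exists>x. \<forall>i<k. \<forall>j<k. D i j (x i) (x j)"
        using assms[OF w n_def k_def E_def k0] by blast
      let ?D = "(refine n k ^^ (?Q * k * k * n * n)) (constraint n E m b c)"
      have "extends n k E m b c \<longleftrightarrow> (\<exists>a<n. ?D 0 0 a a)"
      proof (rule path_consistency[OF d(2) m(1) g(1,2,3) _ m(2,3)])
        fix i j a a' assume ij: "i < k" "j < k" "a < n" "a' < n" and "?D i j a a'"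
        then have "refine n k (look n k y2 ?q) i j a a'" using t[OF ij] fp[OF ij] unfolding y2 by blast
        then show "refine n k ?D i j a a'" unfolding y2
            using refine_cong[of k n "look n k ((F ^^ (?Q * k * k * n * n)) y0) ?q" ?D i j a a', OF t ij] by blast
      qed
      then show ?thesis unfolding y2 using t k0 by auto
    qed
    then have "verdict n k E (\<lambda>q. \<exists>a<n. look n k y2 q 0 0 a a) \<longleftrightarrow> CR n k E"
      by (rule verdict_CR[OF d(2,1)])
    then show ?thesis using d(3) by (simp add: Let_def y1_def y2_def n_def k_def E_def)
  qed
  ultimately show ?thesis unfolding in_class_def by blast
qed

section \<open>Gaussian elimination in polynomial time\<close>

lemma pivot_cong:
  assumes "\<And>r c. r < N \<Longrightarrow> c \<le> C \<Longrightarrow> A r c = A' r c" "s < C" "p < N"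
  shows "pivot N A s p = pivot N A' s p"
  unfolding pivot_def using assms by auto

lemma eliminate_cong:
  assumes "\<And>r c. r < N \<Longrightarrow> c \<le> C \<Longrightarrow> A r c = A' r c" "r < N" "c \<le> C"
  shows "eliminate N C A r c = eliminate N C A' r c"
proof -
  have "(pivot N A s p \<and> A r s \<and> A p c) = (pivot N A' s p \<and> A' r s \<and> A' p c)" if "s < C" "p < N" for s p
    using assms that pivot_cong[of N C A A' s p] by simp
  then have "(\<exists>s<C. \<exists>p<N. pivot N A s p \<and> A r s \<and> A p c) = (\<exists>s<C. \<exists>p<N. pivot N A' s p \<and> A' r s \<and> A' p c)" by blast
  then show ?thesis unfolding eliminate_def using assms by simp
qed

text \<open>The systems of linear equations for all extension problems are eliminated in parallel; \<open>add w\<close> computes the addition from the code \<open>w\<close>.\<close>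

theorem CRT_affine_in_P:
  assumes add_def: "Def (\<lambda>R \<rho>. add (R 0) (\<rho> 0) (\<rho> 1))"
    and aff: "\<And>w n k E. w \<in> fst (CRT_restricted L V) \<Longrightarrow> n = code_size w \<Longrightarrow> k = code_count L w \<Longrightarrow> E = coded_rel L w \<Longrightarrow>
      \<exists>t. polymorphism n k E t \<and> (\<forall>x<n. \<forall>y<n. add w x y = t x 0 y \<and> t x 0 y = t y 0 x \<and> t x 0 0 = x \<and> t x 0 x = 0 \<and>
        (\<forall>z<n. t (t x 0 y) 0 z = t x 0 (t y 0 z)))"
  shows "in_class (CRT_restricted L V) class_P"
proof -
  let ?n = code_size and ?k = "code_count L" and ?E = "coded_rel L"
  let ?R = "\<lambda>w. sys_rows (?n w) (?k w)" and ?C = "\<lambda>w. sys_cols (?n w) (?k w)"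
  let ?look = "\<lambda>w y q r c. bit_at y ((q * ?R w + r) * Suc (?C w) + c)"
  let ?N = "\<lambda>w. ?k w * ?n w * ?n w * ?R w * Suc (?C w)"
  let ?q = "\<lambda>w p. p div Suc (?C w) div ?R w" and ?r = "\<lambda>w p. p div Suc (?C w) mod ?R w" and ?c = "\<lambda>w p. p mod Suc (?C w)"
  let ?P = "\<lambda>w y p. sys (?n w) (?k w) (?E w) (add w) (?q w p div ?n w div ?n w) (?q w p div ?n w mod ?n w) (?q w p mod ?n w) (?r w p) (?c w p)"
  let ?S = "\<lambda>w y1 y p. eliminate (?R w) (?C w) (?look w y (?q w p)) (?r w p) (?c w p)"
  let ?Q = "\<lambda>w y1 y. verdict (?n w) (?k w) (?E w) (\<lambda>q. \<forall>r<?R w. \<not> ?look w y q r (?C w))"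
  let ?X = "{w. let y1 = array1 (\<lambda>_. 0) (\<lambda>_. 0) (\<lambda>_ _. True) (\<lambda>_ _ _. True) w in ?Q w y1 (array2 ?N ?C ?P ?S w y1)}"
  have D1: "Def (\<lambda>R \<rho>. ?R (R 0))" "Def (\<lambda>R \<rho>. ?C (R 0))"
    unfolding sys_rows_def sys_cols_def by (intro Def_intros Def_code_size Def_code_count; simp)+
  note D = Def_intros D1 Def_code_size Def_code_count DefB_code_rel
  have "?X \<in> class_P"
  proof (rule class_P_arrays)
    show "DefB (\<lambda>R \<rho>. ?P (R 0) (R 1) (\<rho> 0))" unfolding sys_def coef_def Let_def
      by (intro D Def_app2[where f = "\<lambda>R. add (R 0)", OF add_def]) simp_all
    show "DefB (\<lambda>R \<rho>. ?S (R 0) (R 1) (R 2) (\<rho> 0))" unfolding eliminate_def pivot_def by (intro D) simp_all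
    show "DefB (\<lambda>R _. ?Q (R 0) (R 1) (R 2))" by (intro DefB_verdict D) simp_all
  qed (intro D; simp)+
  moreover have "w \<in> ?X \<longleftrightarrow> w \<in> snd (CRT_restricted L V)" if w: "w \<in> fst (CRT_restricted L V)" for w
  proof -
    define n k E where "n = ?n w" and "k = ?k w" and "E = ?E w"
    have d: "0 < n" "equivs n k E" "w \<in> snd (CRT_restricted L V) \<longleftrightarrow> CR n k E"
      using w unfolding n_def k_def E_def by (auto elim: CRT_restricted_decode)
    define R C where "R = sys_rows n k" and "C = sys_cols n k"
    define look3 where "look3 y q r c = bit_at y ((q * R + r) * Suc C + c)" for y q r c
    let ?Qn = "k * n * n"
    define tab where "tab G = map (\<lambda>p. G (p div Suc C div R) (p div Suc C mod R) (p mod Suc C)) [0..<?Qn * R * Suc C]"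
      for G :: "nat \<Rightarrow> nat \<Rightarrow> nat \<Rightarrow> bool"
    have look3: "look3 (tab G) q r c = G q r c" if "q < ?Qn" "r < R" "c \<le> C" for G q r c
    proof -
      have "(q * R + r) * Suc C + c < ?Qn * R * Suc C" using that by (intro mixed_radix_less) auto
      moreover have "((q * R + r) * Suc C + c) div Suc C = q * R + r" "((q * R + r) * Suc C + c) mod Suc C = c"
        using that by (simp_all only: div_mod_mixed less_Suc_eq_le)
      ultimately show ?thesis using that unfolding look3_def tab_def bit_at_def
        by (simp add: div_mod_mixed del: mult_Suc_right)
    qed
    define M where "M q = sys n k E (add w) (q div n div n) (q div n mod n) (q mod n)" for q
    define y2 where "y2 = array2 ?N ?C ?P ?S w []"
    have y2: "y2 = ((\<lambda>y. tab (\<lambda>q. eliminate R C (look3 y q))) ^^ C) (tab M)"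
      unfolding y2_def array2_def tab_def look3_def M_def n_def k_def E_def R_def C_def ..
    have look_y2: "look3 y2 q r c = (eliminate R C ^^ C) (M q) r c" if "q < ?Qn" "r < R" "c \<le> C" for q r c
    proof -
      have "look3 (((\<lambda>y. tab (\<lambda>q. eliminate R C (look3 y q))) ^^ t) (tab M)) q r c = (eliminate R C ^^ t) (M q) r c" for t
        using that
      proof (induction t arbitrary: r c)
        case (Suc t)
        then show ?case using eliminate_cong[OF Suc.IH[OF that(1)] Suc.prems(2,3)] by (simp add: look3)
      qed (simp add: look3)
      then show ?thesis unfolding y2 .
    qed
    obtain t where t: "polymorphism n k E t" "\<And>x y. x < n \<Longrightarrow> y < n \<Longrightarrow> add w x y = t x 0 y"
      "\<And>x y. x < n \<Longrightarrow> y < n \<Longrightarrow> t x 0 y = t y 0 x" "\<And>x. x < n \<Longrightarrow> t x 0 0 = x" "\<And>x. x < n \<Longrightarrow> t x 0 x = 0"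
      "\<And>x y z. x < n \<Longrightarrow> y < n \<Longrightarrow> z < n \<Longrightarrow> t (t x 0 y) 0 z = t x 0 (t y 0 z)"
      using aff[OF w n_def k_def E_def] by blast
    have lt: "t x 0 y < n" if "x < n" "y < n" for x y using t(1) d(1) that by (simp add: polymorphism_def)
    have "(\<forall>r<R. \<not> look3 y2 ((m * n + b) * n + c) r C) \<longleftrightarrow> extends n k E m b c" if m: "m < k" "b < n" "c < n" for m b c
    proof -
      let ?q = "(m * n + b) * n + c"
      have q: "?q < ?Qn" using m by (intro mixed_radix_less)
      have "extends n k E m b c \<longleftrightarrow> solvable R C (sys n k E (add w) m b c)" unfolding R_def C_def
        by (rule extends_iff_solvable[OF d(1,2) t(1,2) _ _ _ _ m]) (use t d(1) lt in simp_all)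
      also have "sys n k E (add w) m b c = M ?q" using m by (simp add: M_def div_mod_mixed)
      finally show ?thesis using gauss[of R C "M ?q"] look_y2[OF q] by simp
    qed
    then have "verdict n k E (\<lambda>q. \<forall>r<R. \<not> look3 y2 q r C) \<longleftrightarrow> CR n k E"
      by (rule verdict_CR[OF d(2,1)])
    moreover have "array1 (\<lambda>_. 0) (\<lambda>_. 0) (\<lambda>_ _. True) (\<lambda>_ _ _. True) w = []" by (simp add: array1_def)
    ultimately show ?thesis
      using d(3) by (simp add: Let_def y2_def n_def k_def E_def R_def C_def look3_def)
  qed
  ultimately show ?thesis unfolding in_class_def by blast
qed

section \<open>Terms in the generated variety\<close>

text \<open>Substitution of terms for the variables of a term\<close>

fun tsubst :: "(nat \<Rightarrow> trm) \<Rightarrow> trm \<Rightarrow> trm" where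
  "tsubst \<sigma> (Var v) = \<sigma> v"
| "tsubst \<sigma> (Fn f ts) = Fn f (map (tsubst \<sigma>) ts)"

lemma eval_tsubst: "eval_term B \<rho> (tsubst \<sigma> t) = eval_term B (\<lambda>i. eval_term B \<rho> (\<sigma> i)) t"
  by (induction t) (auto cong: map_cong simp: comp_def)

lemma is_term_tsubst: "is_term L m t \<Longrightarrow> (\<And>i. i < m \<Longrightarrow> is_term L n (\<sigma> i)) \<Longrightarrow> is_term L n (tsubst \<sigma> t)"
  by (induction t) auto

lemma is_term_mono: "is_term L m t \<Longrightarrow> m \<le> n \<Longrightarrow> is_term L n t"
  by (induction t) auto

lemma eval_cong: "is_term L m t \<Longrightarrow> (\<And>i. i < m \<Longrightarrow> \<rho> i = \<rho>' i) \<Longrightarrow> eval_term B \<rho> t = eval_term B \<rho>' t"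
  by (induction t) (auto cong: map_cong)

lemma eval_univ:
  "is_algebra L B \<Longrightarrow> is_term L m t \<Longrightarrow> (\<And>i. i < m \<Longrightarrow> \<rho> i \<in> univ B) \<Longrightarrow> eval_term B \<rho> t \<in> univ B"
proof (induction t)
  case (Fn f ts)
  then have "set (map (eval_term B \<rho>) ts) \<subseteq> univ B" by auto
  then show ?case using Fn.prems by (simp add: is_algebra_def)
qed simp

lemma eval_congruence:
  "is_congruence L B \<theta> \<Longrightarrow> is_term L m t \<Longrightarrow> (\<And>i. i < m \<Longrightarrow> (\<rho> i, \<rho>' i) \<in> \<theta>) \<Longrightarrow>
    (eval_term B \<rho> t, eval_term B \<rho>' t) \<in> \<theta>"
proof (induction t)
  case (Fn f ts)
  have "list_all2 (\<lambda>x y. (x, y) \<in> \<theta>) (map (eval_term B \<rho>) ts) (map (eval_term B \<rho>') ts)"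
    using Fn by (simp add: list_all2_conv_all_nth)
  then show ?case using Fn.prems by (simp add: is_congruence_def)
qed simp

lemma generated_variety_identity:
  assumes "is_algebra L A" "univ A = UNIV" "B \<in> generated_variety L A" "is_term L m s" "is_term L m t"
    and "\<And>\<rho>. eval_term A \<rho> s = eval_term A \<rho> t" "range \<rho> \<subseteq> univ B"
  shows "eval_term B \<rho> s = eval_term B \<rho> t"
proof -
  have "(s, t) \<in> identities L" "satisfies A s t" using assms by (auto simp: identities_def satisfies_def)
  then have "satisfies B s t" using assms(1,3) by (auto simp: generated_variety_iff)
  then show ?thesis using assms(7) by (simp add: satisfies_def)
qed

text \<open>The ternary operation given by a term, and the composition of ternary terms\<close>

definition ternary :: "'a algebra \<Rightarrow> trm \<Rightarrow> 'a \<Rightarrow> 'a \<Rightarrow> 'a \<Rightarrow> 'a" where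
  "ternary B t x y z = eval_term B (\<lambda>i. if i = 0 then x else if i = 1 then y else z) t"

definition compose3 :: "trm \<Rightarrow> trm \<Rightarrow> trm \<Rightarrow> trm \<Rightarrow> trm" where
  "compose3 t r s u = tsubst (\<lambda>i. if i = 0 then r else if i = 1 then s else u) t"

lemma eval_compose3 [simp]:
  "eval_term B \<rho> (compose3 t r s u) = ternary B t (eval_term B \<rho> r) (eval_term B \<rho> s) (eval_term B \<rho> u)"
  unfolding compose3_def eval_tsubst ternary_def by (rule arg_cong2[where f = "eval_term B"]) auto

lemma is_term_compose3: "is_term L 3 t \<Longrightarrow> is_term L m r \<Longrightarrow> is_term L m s \<Longrightarrow> is_term L m u \<Longrightarrow> is_term L m (compose3 t r s u)"
  unfolding compose3_def by (rule is_term_tsubst) auto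

text \<open>The value of a term, computed from the code of an algebra\<close>

fun code_eval :: "language \<Rightarrow> bits \<Rightarrow> (nat \<Rightarrow> nat) \<Rightarrow> trm \<Rightarrow> nat" where
  "code_eval L w \<rho> (Var v) = \<rho> v"
| "code_eval L w \<rho> (Fn f ts) = code_oper L w f (foldr (\<lambda>d q. d + code_size w * q) (map (code_eval L w \<rho>) ts) 0)"

lemma digits:
  fixes n :: nat
  assumes "\<And>d. d \<in> set ds \<Longrightarrow> d < n"
  shows "foldr (\<lambda>d q. d + n * q) ds 0 < n ^ length ds"
    "map (\<lambda>i. foldr (\<lambda>d q. d + n * q) ds 0 div n ^ i mod n) [0..<length ds] = ds"
proof -
  have "foldr (\<lambda>d q. d + n * q) ds 0 < n ^ length ds \<and>
    (\<forall>i<length ds. foldr (\<lambda>d q. d + n * q) ds 0 div n ^ i mod n = ds ! i)"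
    using assms
  proof (induction ds)
    case (Cons d ds)
    let ?q = "foldr (\<lambda>d q. d + n * q) ds 0"
    have IH: "?q < n ^ length ds" "\<And>i. i < length ds \<Longrightarrow> ?q div n ^ i mod n = ds ! i" and d: "d < n" using Cons by auto
    have "?q * n + d < n ^ length ds * n" using IH(1) d by (rule mixed_radix_less)
    moreover have "(d + n * ?q) div n ^ i mod n = (d # ds) ! i" if "i < Suc (length ds)" for i
    proof (cases i)
      case (Suc i')
      have "(d + n * ?q) div n ^ i = (d + n * ?q) div n div n ^ i'" using Suc by (simp add: div_mult2_eq)
      also have "(d + n * ?q) div n = ?q" using d by simp
      finally show ?thesis using IH(2)[of i'] Suc that by simp
    qed (use d in simp)
    ultimately show ?case by (simp add: algebra_simps)
  qed simp
  then show "foldr (\<lambda>d q. d + n * q) ds 0 < n ^ length ds"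
    "map (\<lambda>i. foldr (\<lambda>d q. d + n * q) ds 0 div n ^ i mod n) [0..<length ds] = ds"
    by (auto intro: nth_equalityI)
qed

lemma code_eval:
  assumes "univ B = {..<n}" "w = code_instance (L, B, \<theta>s)" "is_algebra L B"
  shows "is_term L m t \<Longrightarrow> (\<And>i. i < m \<Longrightarrow> \<rho> i < n) \<Longrightarrow> code_eval L w \<rho> t = eval_term B \<rho> t"
proof (induction t)
  case (Fn f ts)
  let ?ds = "map (eval_term B \<rho>) ts"
  have ds: "d < n" if "d \<in> set ?ds" for d
    using that eval_univ[OF assms(3), of m _ \<rho>] Fn.prems assms(1) by auto
  have "map (code_eval L w \<rho>) ts = ?ds" using Fn by simp
  then have "code_eval L w \<rho> (Fn f ts) = code_oper L w f (foldr (\<lambda>d q. d + n * q) ?ds 0)"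
    by (simp only: code_eval.simps decode_instance(1)[OF assms(1,2)])
  also have "\<dots> = oper B f ?ds"
    using decode_instance(4)[OF assms(1,2), of f "foldr (\<lambda>d q. d + n * q) ?ds 0"] digits[of ?ds n, OF ds] Fn.prems by simp
  finally show ?case by simp
qed simp

lemma Def_code_eval:
  assumes "\<And>i. Def (\<rho>' i)"
  shows "Def (\<lambda>R \<rho>. code_eval L (R 0) (\<lambda>i. \<rho>' i R \<rho>) t)"
proof (induction t)
  case (Fn f ts)
  have "Def (\<lambda>R \<rho>. foldr (\<lambda>d q. d + code_size (R 0) * q) (map (code_eval L (R 0) (\<lambda>i. \<rho>' i R \<rho>)) ts) 0)"
    using Fn
  proof (induction ts)
    case (Cons t ts)
    then show ?case by (auto intro!: Def_intros Def_code_size)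
  qed (simp add: Def_const)
  then show ?case using Def_code_oper[of 0 "\<lambda>R \<rho>. foldr (\<lambda>d q. d + code_size (R 0) * q) (map (code_eval L (R 0) (\<lambda>i. \<rho>' i R \<rho>)) ts) 0"]
    by simp
qed (simp add: assms)

context
  fixes L :: language and A :: "bool algebra" and t :: trm and g :: "bool list \<Rightarrow> bool"
  assumes A: "is_algebra L A" "univ A = UNIV" and t: "is_term L 3 t"
    and g: "\<And>xs. length xs = 3 \<Longrightarrow> eval_term A (\<lambda>i. xs ! i) t = g xs"
begin

lemma ternary_generator: "ternary A t x y z = g [x, y, z]"
proof -
  have "ternary A t x y z = eval_term A (\<lambda>i. [x, y, z] ! i) t"
    unfolding ternary_def by (rule eval_cong[OF t]) (auto simp: less_Suc_eq numeral_3_eq_3)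
  then show ?thesis by (simp add: g)
qed

lemma term_polymorphism:
  assumes w: "w \<in> fst (CRT_restricted L (generated_variety L A))"
    and n: "n = code_size w" and k: "k = code_count L w" and E: "E = coded_rel L w"
  obtains B where "B \<in> generated_variety L A" "univ B = {..<n}" "polymorphism n k E (ternary B t)" "0 < n"
    "\<And>x y z. x < n \<Longrightarrow> y < n \<Longrightarrow> z < n \<Longrightarrow> code_eval L w (\<lambda>i. if i = 0 then x else if i = 1 then y else z) t = ternary B t x y z"
proof -
  obtain B \<theta>s where B: "(L, B, \<theta>s) \<in> CRT_instances" "B \<in> generated_variety L A" "w = code_instance (L, B, \<theta>s)"
    "univ B = {..<n}" "0 < n" "k = length \<theta>s"
    and rel: "\<And>i a b. i < k \<Longrightarrow> a < n \<Longrightarrow> b < n \<Longrightarrow> E i a b \<longleftrightarrow> (a, b) \<in> \<theta>s ! i"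
    using w unfolding n k E by (elim CRT_restricted_decode) metis
  have alg: "is_algebra L B" and cong: "\<And>\<theta>. \<theta> \<in> set \<theta>s \<Longrightarrow> is_congruence L B \<theta>"
    using B(1) by (auto simp: CRT_instances_def)
  have lt: "ternary B t x y z < n" if "x < n" "y < n" "z < n" for x y z
    using eval_univ[OF alg t, of "\<lambda>i. if i = 0 then x else if i = 1 then y else z"] that B(4) by (simp add: ternary_def)
  have "polymorphism n k E (ternary B t)" unfolding polymorphism_def
  proof (intro conjI allI impI lt)
    fix i x x' y y' z z'
    assume a: "i < k" "x < n" "x' < n" "y < n" "y' < n" "z < n" "z' < n" "E i x x'" "E i y y'" "E i z z'"
    then have "is_congruence L B (\<theta>s ! i)" using cong B(6) by simp
    from eval_congruence[OF this t, of "\<lambda>i. if i = 0 then x else if i = 1 then y else z"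
        "\<lambda>i. if i = 0 then x' else if i = 1 then y' else z'"] a rel
    have "(ternary B t x y z, ternary B t x' y' z') \<in> \<theta>s ! i" by (simp add: ternary_def)
    then show "E i (ternary B t x y z) (ternary B t x' y' z')" using rel a lt by simp
  qed
  moreover have "code_eval L w (\<lambda>i. if i = 0 then x else if i = 1 then y else z) t = ternary B t x y z"
    if "x < n" "y < n" "z < n" for x y z
    unfolding ternary_def by (rule code_eval[OF B(4,3) alg t]) (use that in auto)
  ultimately show ?thesis using that B by blast
qed

lemma ternary_identity:
  assumes B: "B \<in> generated_variety L A" and r: "is_term L 4 r" "is_term L 4 s"
    and "\<And>\<rho>. eval_term A \<rho> r = eval_term A \<rho> s"
    and "x \<in> univ B" "y \<in> univ B" "z \<in> univ B" "u \<in> univ B"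
  shows "eval_term B (\<lambda>i. if i = 0 then x else if i = 1 then y else if i = 2 then z else u) r =
    eval_term B (\<lambda>i. if i = 0 then x else if i = 1 then y else if i = 2 then z else u) s"
  by (rule generated_variety_identity[OF A B r assms(4)]) (use assms in auto)

lemmas term4 = is_term_compose3[OF t, of 4]

lemma semilattice_in_P:
  assumes sl: "\<And>x. g [x, x, x] = x" "\<And>x y. g [x, x, y] = g [y, y, x]"
    "\<And>x y z. g [g [x, x, y], g [x, x, y], z] = g [x, x, g [y, y, z]]"
  shows "in_class (CRT_restricted L (generated_variety L A)) class_P"
proof (rule CRT_path_consistency_in_P)
  fix w n k E
  assume a: "w \<in> fst (CRT_restricted L (generated_variety L A))" "n = code_size w" "k = code_count L w" "E = coded_rel L w"
    and k: "0 < k"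
  obtain B where B: "B \<in> generated_variety L A" "univ B = {..<n}" "polymorphism n k E (ternary B t)"
    using term_polymorphism[OF a] by metis
  let ?g = "ternary B t" and ?v = "trm.Var"
  have idem: "?g x x x = x" if "x < n" for x
    using ternary_identity[OF B(1), of "compose3 t (?v 0) (?v 0) (?v 0)" "?v 0" x x x x] that B(2) sl
    by (simp add: term4 ternary_generator)
  have comm: "?g x x y = ?g y y x" if "x < n" "y < n" for x y
    using ternary_identity[OF B(1), of "compose3 t (?v 0) (?v 0) (?v 1)" "compose3 t (?v 1) (?v 1) (?v 0)" x y x x] that B(2) sl
    by (simp add: term4 ternary_generator)
  have assoc: "?g (?g x x y) (?g x x y) z = ?g x x (?g y y z)" if "x < n" "y < n" "z < n" for x y z
    using ternary_identity[OF B(1), of "compose3 t (compose3 t (?v 0) (?v 0) (?v 1)) (compose3 t (?v 0) (?v 0) (?v 1)) (?v 2)"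
        "compose3 t (?v 0) (?v 0) (compose3 t (?v 1) (?v 1) (?v 2))" x y z x] that B(2) sl
    by (simp add: term4 ternary_generator)
  show "\<exists>g. polymorphism n k E g \<and> (\<forall>x<n. g x x x = x) \<and>
      (\<forall>D a0. path_consistent n k D \<longrightarrow> closed_family k g D \<longrightarrow> D 0 0 a0 a0 \<longrightarrow> (\<exists>x. \<forall>i<k. \<forall>j<k. D i j (x i) (x j)))"
  proof (intro exI[of _ ?g] conjI allI impI)
    fix D a0 assume D: "path_consistent n k D" "closed_family k ?g D" "D 0 0 a0 a0"
    have "?g x x y < n" if "x < n" "y < n" for x y using B(3) that by (simp add: polymorphism_def)
    then show "\<exists>x. \<forall>i<k. \<forall>j<k. D i j (x i) (x j)"
      by (rule semilattice_solution[OF D(1,2) k D(3) _ idem comm assoc])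
  qed (use B idem in auto)
qed

lemma majority_in_P:
  assumes maj: "\<And>x y. g [x, x, y] = x \<and> g [x, y, x] = x \<and> g [y, x, x] = x"
  shows "in_class (CRT_restricted L (generated_variety L A)) class_P"
proof (rule CRT_path_consistency_in_P)
  fix w n k E
  assume a: "w \<in> fst (CRT_restricted L (generated_variety L A))" "n = code_size w" "k = code_count L w" "E = coded_rel L w"
    and k: "0 < k"
  obtain B where B: "B \<in> generated_variety L A" "univ B = {..<n}" "polymorphism n k E (ternary B t)"
    using term_polymorphism[OF a] by metis
  let ?g = "ternary B t" and ?v = "trm.Var"
  have maj': "?g x x y = x \<and> ?g x y x = x \<and> ?g y x x = x" if "x < n" "y < n" for x y
    using ternary_identity[OF B(1), of "compose3 t (?v 0) (?v 0) (?v 1)" "?v 0" x y x x]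
      ternary_identity[OF B(1), of "compose3 t (?v 0) (?v 1) (?v 0)" "?v 0" x y x x]
      ternary_identity[OF B(1), of "compose3 t (?v 1) (?v 0) (?v 0)" "?v 0" x y x x] that B(2) maj
    by (simp add: term4 ternary_generator)
  show "\<exists>g. polymorphism n k E g \<and> (\<forall>x<n. g x x x = x) \<and>
      (\<forall>D a0. path_consistent n k D \<longrightarrow> closed_family k g D \<longrightarrow> D 0 0 a0 a0 \<longrightarrow> (\<exists>x. \<forall>i<k. \<forall>j<k. D i j (x i) (x j)))"
  proof (intro exI[of _ ?g] conjI allI impI)
    fix D a0 assume "path_consistent n k D" "closed_family k ?g D" "D 0 0 a0 a0"
    then show "\<exists>x. \<forall>i<k. \<forall>j<k. D i j (x i) (x j)" using majority_solution[OF _ _ k _ maj'] by blast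
  qed (use B maj' in auto)
qed

lemma affine_in_P:
  assumes aff: "g = op_s"
  shows "in_class (CRT_restricted L (generated_variety L A)) class_P"
proof (rule CRT_affine_in_P[where add = "\<lambda>w x y. code_eval L w (\<lambda>i. if i = 0 then x else if i = 1 then 0 else y) t"])
  show "Def (\<lambda>R \<rho>. code_eval L (R 0) (\<lambda>i. if i = 0 then \<rho> 0 else if i = 1 then 0 else \<rho> 1) t)"
    by (rule Def_code_eval) (intro Def_intros)
next
  fix w n k E
  assume a: "w \<in> fst (CRT_restricted L (generated_variety L A))" "n = code_size w" "k = code_count L w" "E = coded_rel L w"
  obtain B where B: "B \<in> generated_variety L A" "univ B = {..<n}" "polymorphism n k E (ternary B t)" and n: "0 < n"
    and ev: "\<And>x y z. x < n \<Longrightarrow> y < n \<Longrightarrow> z < n \<Longrightarrow>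
      code_eval L w (\<lambda>i. if i = 0 then x else if i = 1 then y else z) t = ternary B t x y z"
    using term_polymorphism[OF a] by blast
  let ?g = "ternary B t" and ?v = "trm.Var"
  have comm: "?g x 0 y = ?g y 0 x" if "x < n" "y < n" for x y
    using ternary_identity[OF B(1), of "compose3 t (?v 0) (?v 3) (?v 1)" "compose3 t (?v 1) (?v 3) (?v 0)" x y x 0] that B(2) n
    by (simp add: term4 ternary_generator aff op_s_def) blast
  have zero: "?g x 0 0 = x" if "x < n" for x
    using ternary_identity[OF B(1), of "compose3 t (?v 0) (?v 3) (?v 3)" "?v 0" x x x 0] that B(2) n
    by (simp add: term4 ternary_generator aff op_s_def) blast
  have self: "?g x 0 x = 0" if "x < n" for x
    using ternary_identity[OF B(1), of "compose3 t (?v 0) (?v 3) (?v 0)" "?v 3" x x x 0] that B(2) n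
    by (simp add: term4 ternary_generator aff op_s_def) blast
  have assoc: "?g (?g x 0 y) 0 z = ?g x 0 (?g y 0 z)" if "x < n" "y < n" "z < n" for x y z
    using ternary_identity[OF B(1), of "compose3 t (compose3 t (?v 0) (?v 3) (?v 1)) (?v 3) (?v 2)"
        "compose3 t (?v 0) (?v 3) (compose3 t (?v 1) (?v 3) (?v 2))" x y z 0] that B(2) n
    by (simp add: term4 ternary_generator aff op_s_def) blast
  show "\<exists>t'. polymorphism n k E t' \<and> (\<forall>x<n. \<forall>y<n. code_eval L w (\<lambda>i. if i = 0 then x else if i = 1 then 0 else y) t = t' x 0 y \<and>
      t' x 0 y = t' y 0 x \<and> t' x 0 0 = x \<and> t' x 0 x = 0 \<and> (\<forall>z<n. t' (t' x 0 y) 0 z = t' x 0 (t' y 0 z)))"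
    using B(3) ev n comm zero self assoc by (intro exI[of _ ?g]) simp
qed

end

text \<open>\<open>op_n\<close> and its dual yield semilattice operations by identification of variables.\<close>

theorem CRT_in_P:
  assumes A: "is_algebra L A" "univ A = UNIV"
    and "is_term_operation L A 3 op_s \<or> is_term_operation L A 3 op_n \<or> is_term_operation L A 3 (dual_op op_n) \<or>
      is_term_operation L A 3 op_m"
  shows "in_class (CRT_restricted L (generated_variety L A)) class_P"
proof -
  have T: "\<exists>t. is_term L 3 t \<and> (\<forall>xs. length xs = 3 \<longrightarrow> eval_term A (\<lambda>i. xs ! i) t = g xs)"
    if "is_term_operation L A 3 g" for g using that A(2) by (simp add: is_term_operation_def)
  consider "is_term_operation L A 3 op_s" | "is_term_operation L A 3 op_n" | "is_term_operation L A 3 (dual_op op_n)"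
    | "is_term_operation L A 3 op_m" using assms(3) by blast
  then show ?thesis
  proof cases
    case 1
    then show ?thesis using T[of op_s] affine_in_P[OF A] by blast
  next
    case 2
    then obtain t where t: "is_term L 3 t" "\<And>xs. length xs = 3 \<Longrightarrow> eval_term A (\<lambda>i. xs ! i) t = op_n xs" using T by blast
    show ?thesis by (rule semilattice_in_P[OF A t]) (auto simp: op_n_def)
  next
    case 3
    then obtain t where t: "is_term L 3 t" "\<And>xs. length xs = 3 \<Longrightarrow> eval_term A (\<lambda>i. xs ! i) t = dual_op op_n xs" using T by blast
    show ?thesis by (rule semilattice_in_P[OF A t]) (auto simp: op_n_def dual_op_def)
  next
    case 4
    then obtain t where t: "is_term L 3 t" "\<And>xs. length xs = 3 \<Longrightarrow> eval_term A (\<lambda>i. xs ! i) t = op_m xs" using T by blast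
    show ?thesis by (rule majority_in_P[OF A t]) (auto simp: op_m_def)
  qed
qed

section \<open>Clones of Boolean functions\<close>

text \<open>An \<open>n\<close>-ary function takes its arguments from the first \<open>n\<close> values of a valuation of the variables.\<close>

definition clone :: "language \<Rightarrow> 'a algebra \<Rightarrow> nat \<Rightarrow> ((nat \<Rightarrow> 'a) \<Rightarrow> 'a) \<Rightarrow> bool" where
  "clone L A n h \<longleftrightarrow> (\<exists>t. is_term L n t \<and> (\<forall>\<rho>. eval_term A \<rho> t = h \<rho>))"

lemma clone_var: "i < n \<Longrightarrow> clone L A n (\<lambda>\<rho>. \<rho> i)"
  unfolding clone_def by (rule exI[of _ "trm.Var i"]) simp

lemma clone_cong: "clone L A n h \<Longrightarrow> (\<And>i. i < n \<Longrightarrow> \<rho> i = \<rho>' i) \<Longrightarrow> h \<rho> = h \<rho>'"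
  unfolding clone_def using eval_cong by metis

lemma clone_comp:
  assumes "clone L A m h" "\<And>i. i < m \<Longrightarrow> clone L A n (g i)"
  shows "clone L A n (\<lambda>\<rho>. h (\<lambda>i. g i \<rho>))"
proof -
  obtain t where t: "is_term L m t" "\<And>\<rho>. eval_term A \<rho> t = h \<rho>" using assms(1) by (auto simp: clone_def)
  obtain s where s: "\<And>i. i < m \<Longrightarrow> is_term L n (s i) \<and> (\<forall>\<rho>. eval_term A \<rho> (s i) = g i \<rho>)"
    using assms(2) unfolding clone_def by metis
  have "eval_term A \<rho> (tsubst s t) = h (\<lambda>i. g i \<rho>)" for \<rho>
    unfolding eval_tsubst t(2) by (rule clone_cong[OF assms(1)]) (use s in simp)
  moreover have "is_term L n (tsubst s t)" using t s by (blast intro: is_term_tsubst)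
  ultimately show ?thesis unfolding clone_def by blast
qed

lemma clone_oper: "f < length L \<Longrightarrow> clone L A (L ! f) (\<lambda>\<rho>. oper A f (map \<rho> [0..<L ! f]))"
  unfolding clone_def by (intro exI[of _ "Fn f (map trm.Var [0..<L ! f])"]) (simp add: comp_def)

text \<open>The ternary members, in curried form\<close>

definition clone3 :: "language \<Rightarrow> 'a algebra \<Rightarrow> ('a \<Rightarrow> 'a \<Rightarrow> 'a \<Rightarrow> 'a) \<Rightarrow> bool" where
  "clone3 L A F \<longleftrightarrow> clone L A 3 (\<lambda>\<rho>. F (\<rho> 0) (\<rho> 1) (\<rho> 2))"

lemma clone3_var: "clone3 L A (\<lambda>x y z. x)" "clone3 L A (\<lambda>x y z. y)" "clone3 L A (\<lambda>x y z. z)"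
  unfolding clone3_def by (rule clone_var; simp)+

text \<open>Minors of a function: its arguments are replaced by ternary functions.\<close>

lemma clone3_minor:
  assumes "clone L A n h" "\<And>i. clone3 L A (G i)"
  shows "clone3 L A (\<lambda>x y z. h (\<lambda>i. G i x y z))"
  using clone_comp[OF assms(1), of 3 "\<lambda>i \<rho>. G i (\<rho> 0) (\<rho> 1) (\<rho> 2)"] assms(2) unfolding clone3_def by blast

lemma clone3_comp:
  assumes "clone3 L A F" "clone3 L A G" "clone3 L A H" "clone3 L A K"
  shows "clone3 L A (\<lambda>x y z. F (G x y z) (H x y z) (K x y z))"
  using clone3_minor[OF assms(1)[unfolded clone3_def], of "\<lambda>i. if i = 0 then G else if i = 1 then H else K"] assms
  by simp

lemma clone3_blocks: "clone L A n h \<Longrightarrow> clone3 L A (\<lambda>x y z. h (\<lambda>i. if i \<in> P then x else if i \<in> Q then y else z))"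
proof -
  assume h: "clone L A n h"
  have "clone3 L A (\<lambda>x y z. if i \<in> P then x else if i \<in> Q then y else z)" for i
    using clone3_var by (cases "i \<in> P"; cases "i \<in> Q") simp_all
  then show ?thesis by (rule clone3_minor[OF h])
qed

lemma clone3_is_term_operation:
  assumes "clone3 L A F" "\<And>x y z. F x y z = g [x, y, z]"
  shows "is_term_operation L A 3 g"
proof -
  obtain t where t: "is_term L 3 t" "\<And>\<rho>. eval_term A \<rho> t = F (\<rho> 0) (\<rho> 1) (\<rho> 2)"
    using assms(1) by (auto simp: clone3_def clone_def)
  have "xs = [xs ! 0, xs ! 1, xs ! 2]" if "length xs = 3" for xs :: "'a list"
    using that by (intro nth_equalityI) (auto simp: less_Suc_eq numeral_3_eq_3 numeral_2_eq_2)
  then show ?thesis unfolding is_term_operation_def using t assms(2) by (metis (no_types, lifting))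
qed

text \<open>Constant functions count as essentially unary.\<close>

definition unary3 :: "(bool \<Rightarrow> bool \<Rightarrow> bool \<Rightarrow> bool) \<Rightarrow> bool" where
  "unary3 F \<longleftrightarrow> (\<exists>c. (\<forall>x y z. F x y z = c) \<or> (\<forall>x y z. F x y z = (x \<noteq> c)) \<or> (\<forall>x y z. F x y z = (y \<noteq> c)) \<or>
    (\<forall>x y z. F x y z = (z \<noteq> c)))"

lemma unary3D:
  "unary3 F \<Longrightarrow> F True True False \<noteq> F False False False \<Longrightarrow> F False True False = F False False False \<Longrightarrow>
    F True False False \<noteq> F False False False"
  "unary3 F \<Longrightarrow> F True False False \<noteq> F False False False \<Longrightarrow> F x True False = (x \<noteq> F False False False)"
  unfolding unary3_def by (elim exE disjE; simp; fail)+

lemma unary3_binary: "unary3 (\<lambda>x y z. f x y) \<longleftrightarrow>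
    f False False = f False True \<and> f True False = f True True \<or> f False False = f True False \<and> f False True = f True True"
proof
  assume "f False False = f False True \<and> f True False = f True True \<or> f False False = f True False \<and> f False True = f True True"
  then show "unary3 (\<lambda>x y z. f x y)" unfolding unary3_def
    by (cases "f False False"; cases "f False True"; cases "f True False"; cases "f True True"; simp add: all_bool_eq ex_bool_eq)
qed (auto simp: unary3_def all_bool_eq)

lemma not_unary3:
  assumes "\<not> unary3 F"
  shows "F \<noteq> (\<lambda>x y z. False)" "F \<noteq> (\<lambda>x y z. True)" "F \<noteq> (\<lambda>x y z. x)" "F \<noteq> (\<lambda>x y z. y)" "F \<noteq> (\<lambda>x y z. z)"
  using assms unfolding unary3_def by auto

text \<open>A function all of whose minors with three blocks of variables are essentially unary is itself essentially unary: the
  value at the indicator of a minimal set at which it differs from the value at 0 shows that this set has one element.\<close>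

lemma essentially_unary:
  fixes h :: "(nat \<Rightarrow> bool) \<Rightarrow> bool"
  assumes cong: "\<And>\<rho> \<rho>'. (\<And>i. i < n \<Longrightarrow> \<rho> i = \<rho>' i) \<Longrightarrow> h \<rho> = h \<rho>'"
    and minors: "\<And>P Q. unary3 (\<lambda>x y z. h (\<lambda>i. if i \<in> P then x else if i \<in> Q then y else z))"
  shows "(\<exists>c. \<forall>\<rho>. h \<rho> = c) \<or> (\<exists>i<n. \<exists>c. \<forall>\<rho>. h \<rho> = (\<rho> i \<noteq> c))"
proof (cases "\<exists>\<rho>. h \<rho> \<noteq> h (\<lambda>_. False)")
  case True
  let ?\<phi> = "\<lambda>S. h (\<lambda>i. i \<in> S) \<noteq> h (\<lambda>_. False)"
  obtain \<rho> where \<rho>: "h \<rho> \<noteq> h (\<lambda>_. False)" using True by blast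
  have "h (\<lambda>i. i \<in> {i. i < n \<and> \<rho> i}) = h \<rho>" by (rule cong) simp
  then have "finite {i. i < n \<and> \<rho> i} \<and> ?\<phi> {i. i < n \<and> \<rho> i}" using \<rho> by simp
  then obtain S where S: "finite S" "?\<phi> S" "\<And>S'. finite S' \<Longrightarrow> ?\<phi> S' \<Longrightarrow> card S \<le> card S'"
    using ex_has_least_nat[of "\<lambda>S. finite S \<and> ?\<phi> S" "{i. i < n \<and> \<rho> i}" card] by blast
  have "S \<noteq> {}" using S(2) by auto
  then obtain p where p: "p \<in> S" by blast
  let ?F = "\<lambda>Q x y z. h (\<lambda>i. if i \<in> {p} then x else if i \<in> Q then y else z)"
  have ind: "(\<lambda>i. if i \<in> {p} then True else if i \<in> S - {p} then True else False) = (\<lambda>i. i \<in> S)"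
    "(\<lambda>i. if i \<in> {p} then False else if i \<in> S - {p} then True else False) = (\<lambda>i. i \<in> S - {p})"
    "(\<lambda>i. if i \<in> {p} then False else if i \<in> Q then False else False) = (\<lambda>i. False)"
    "(\<lambda>i. if i \<in> {p} then True else if i \<in> Q then False else False) = (\<lambda>i. i = p)" for Q
    using p by auto
  have "card (S - {p}) < card S" using p S(1) by (meson card_Diff1_less)
  then have "\<not> ?\<phi> (S - {p})" using S(3)[of "S - {p}"] S(1) by auto
  then have "?F (S - {p}) True True False \<noteq> ?F (S - {p}) False False False"
    "?F (S - {p}) False True False = ?F (S - {p}) False False False"
    unfolding ind using S(2) by simp_all
  then have "?F (S - {p}) True False False \<noteq> ?F (S - {p}) False False False"
    by (rule unary3D(1)[OF minors[of "{p}" "S - {p}"]])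
  then have F: "?F Q True False False \<noteq> ?F Q False False False" for Q unfolding ind .
  have pn: "p < n"
  proof (rule ccontr)
    assume "\<not> p < n"
    then have "?F {} True False False = ?F {} False False False" by (intro cong) auto
    then show False using F by blast
  qed
  \<comment> \<open>the minor that separates \<open>p\<close> from the other arguments at which \<open>\<rho>\<close> is true\<close>
  have "h \<rho> = (\<rho> p \<noteq> h (\<lambda>_. False))" for \<rho>
  proof -
    have "h \<rho> = ?F {i. \<rho> i} (\<rho> p) True False" by (rule arg_cong[where f = h]) auto
    also have "\<dots> = (\<rho> p \<noteq> ?F {i. \<rho> i} False False False)"
      by (rule unary3D(2)[OF minors[of "{p}" "{i. \<rho> i}"] F])
    finally show ?thesis unfolding ind .
  qed
  then show ?thesis using pn by blast
qed blast

lemma ternary_ext: "F = G \<longleftrightarrow> F False False False = G False False False \<and> F False False True = G False False True \<and>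
    F False True False = G False True False \<and> F False True True = G False True True \<and>
    F True False False = G True False False \<and> F True False True = G True False True \<and>
    F True True False = G True True False \<and> F True True True = G True True True"
  by (simp add: fun_eq_iff all_bool_eq) blast

text \<open>A binary function that depends on both arguments yields \<open>\<and>\<close>, \<open>\<or>\<close> or \<open>op_s\<close>.\<close>

lemma binary_clone:
  assumes F: "clone3 L A (\<lambda>x y z. f x y)" and dep: "\<not> unary3 (\<lambda>x y z. f x y)"
  shows "clone3 L A (\<lambda>x y z. x \<and> y) \<or> clone3 L A (\<lambda>x y z. x \<or> y) \<or> clone3 L A (\<lambda>x y z. (x \<noteq> y) \<noteq> z)"
proof -
  note v = clone3_var
  have fc: "clone3 L A (\<lambda>x y z. f (G x y z) (H x y z))" if "clone3 L A G" "clone3 L A H" for G H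
    using clone3_comp[OF F that v(1)] .
  have c: "clone3 L A (\<lambda>x y z. f (f x y) (f x y))" "clone3 L A (\<lambda>x y z. f x (f x y))" "clone3 L A (\<lambda>x y z. f (f x y) x)"
    "clone3 L A (\<lambda>x y z. f y (f y x))" "clone3 L A (\<lambda>x y z. f (f y x) y)" "clone3 L A (\<lambda>x y z. f (f x y) z)"
    "clone3 L A (\<lambda>x y z. f x y)"
    by (intro fc v F)+
  have "(\<lambda>x y z :: bool. x \<and> y) \<in> {\<lambda>x y z. f (f x y) (f x y), \<lambda>x y z. f x (f x y), \<lambda>x y z. f (f y x) y, \<lambda>x y z. f x y,
        \<lambda>x y z. f (f x y) y} \<or>
      (\<lambda>x y z :: bool. x \<or> y) \<in> {\<lambda>x y z. f (f x y) (f x y), \<lambda>x y z. f x (f x y), \<lambda>x y z. f (f y x) y, \<lambda>x y z. f x y,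
        \<lambda>x y z. f (f x y) y} \<or>
      (\<lambda>x y z. (x \<noteq> y) \<noteq> z) = (\<lambda>x y z. f (f x y) z)"
    using dep unfolding unary3_binary ternary_ext insert_iff empty_iff
    by (cases "f False False"; cases "f False True"; cases "f True False"; cases "f True True"; simp)
  then show ?thesis using c fc[OF c(7) v(2)] by (elim disjE insertE emptyE) simp_all
qed

text \<open>A ternary function that is not essentially unary but all of whose binary minors are is, up to negation, the majority
  function, the minority function or, up to the order of the arguments, the discriminator, which yields the majority function.\<close>

lemma ternary_clone:
  assumes F: "clone3 L A F" and dep: "\<not> unary3 F"
  shows "clone3 L A (\<lambda>x y z. x \<and> y) \<or> clone3 L A (\<lambda>x y z. x \<or> y) \<or> clone3 L A (\<lambda>x y z. (x \<noteq> y) \<noteq> z) \<or>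
    clone3 L A (\<lambda>x y z. x \<and> y \<or> x \<and> z \<or> y \<and> z)"
proof -
  note v = clone3_var
  have main: ?thesis if F: "clone3 L A F" and dep: "\<not> unary3 F" and bin: "unary3 (\<lambda>x y z. F x x y)" "unary3 (\<lambda>x y z. F x y x)"
      "unary3 (\<lambda>x y z. F y x x)" and F0: "\<not> F False False False" for F
  proof -
    have fc: "clone3 L A (\<lambda>x y z. F (G x y z) (H x y z) (K x y z))" if "clone3 L A G" "clone3 L A H" "clone3 L A K" for G H K
      using clone3_comp[OF F that] .
    have c: "clone3 L A (\<lambda>x y z. F x (F x y z) z)" "clone3 L A (\<lambda>x y z. F x y (F x y z))" "clone3 L A (\<lambda>x y z. F (F x y z) y z)"
      by (intro fc v)+
    note b = not_unary3[OF dep] bin[unfolded unary3_binary[of "\<lambda>x y. F x x y"] unary3_binary[of "\<lambda>x y. F x y x"]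
        unary3_binary[of "\<lambda>x y. F y x x"]] F0
    have T: "F True True True"
      using b unfolding ternary_ext by argo
    have "F True True False = (\<not> F False False True)" "F True False True = (\<not> F False True False)"
      "F False True True = (\<not> F True False False)" using b T by argo+
    then have "F = (\<lambda>x y z. (x \<noteq> y) \<noteq> z) \<or>
      (\<lambda>x y z. x \<and> y \<or> x \<and> z \<or> y \<and> z) \<in> {F, \<lambda>x y z. F x (F x y z) z, \<lambda>x y z. F x y (F x y z), \<lambda>x y z. F (F x y z) y z}"
      using b(3-5) F0 T unfolding ternary_ext insert_iff empty_iff
      by (cases "F False False True"; cases "F False True False"; cases "F True False False"; simp)
    then show ?thesis using c F by (elim disjE insertE emptyE) simp_all
  qed
  consider "\<not> unary3 (\<lambda>x y z. F x x y)" | "\<not> unary3 (\<lambda>x y z. F x y x)" | "\<not> unary3 (\<lambda>x y z. F y x x)"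
    | "unary3 (\<lambda>x y z. F x x y)" "unary3 (\<lambda>x y z. F x y x)" "unary3 (\<lambda>x y z. F y x x)" by blast
  then show ?thesis
  proof cases
    case 1
    then show ?thesis using binary_clone[of L A "\<lambda>x y. F x x y"] clone3_comp[OF F v(1,1,2)] by blast
  next
    case 2
    then show ?thesis using binary_clone[of L A "\<lambda>x y. F x y x"] clone3_comp[OF F v(1,2,1)] by blast
  next
    case 3
    then show ?thesis using binary_clone[of L A "\<lambda>x y. F y x x"] clone3_comp[OF F v(2,1,1)] by blast
  next
    case 4
    show ?thesis
    proof (cases "F False False False")
      case False
      then show ?thesis using main F dep 4 by blast
    next
      case True
      then have T: "\<not> F True True True"
        using not_unary3[OF dep] 4 unfolding unary3_binary[of "\<lambda>x y. F x x y"] unary3_binary[of "\<lambda>x y. F x y x"]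
          unary3_binary[of "\<lambda>x y. F y x x"] ternary_ext
        by (cases "F False False True"; cases "F False True False"; cases "F False True True"; cases "F True False False";
            cases "F True False True"; cases "F True True False"; simp)
      let ?G = "\<lambda>x y z. F (F x y z) (F x y z) (F x y z)"
      have G: "?G = (\<lambda>x y z. \<not> F x y z)"
        using True T by (intro ext) (metis (full_types))
      have neg1: "unary3 (\<lambda>x y z. \<not> H x y z)" if "unary3 H" for H
        using that unfolding unary3_def by (elim exE, rule_tac x = "\<not> c" in exI, elim disjE) simp_all
      have neg: "unary3 (\<lambda>x y z. \<not> H x y z) = unary3 H" for H
        using neg1[of H] neg1[of "\<lambda>x y z. \<not> H x y z"] by auto
      have "clone3 L A (\<lambda>x y z. \<not> F x y z)" using clone3_comp[OF F F F F] unfolding G .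
      then show ?thesis
        by (rule main[of "\<lambda>x y z. \<not> F x y z"]) (use neg 4 dep True in auto)
    qed
  qed
qed

text \<open>In the presence of \<open>\<or>\<close>, a function that is neither constant nor a join of variables yields \<open>op_n\<close>.\<close>

lemma join_clone:
  assumes join: "clone3 L A (\<lambda>x y z. x \<or> y)" and n: "\<not> clone3 L A (\<lambda>x y z. x \<and> y \<or> z)" and h: "clone L A r h"
  shows "(\<exists>c. \<forall>\<rho>. h \<rho> = c) \<or> (\<exists>J. J \<noteq> {} \<and> J \<subseteq> {..<r} \<and> (\<forall>\<rho>. h \<rho> = (\<exists>j\<in>J. \<rho> j)))"
proof -
  note v = clone3_var
  have or: "clone3 L A (\<lambda>x y z. G x y z \<or> H x y z)" if "clone3 L A G" "clone3 L A H" for G H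
    using clone3_comp[OF join that v(1)] .
  have mono: "h \<rho>'" if le: "\<And>i. \<rho> i \<Longrightarrow> \<rho>' i" and "h \<rho>" for \<rho> \<rho>'
  proof (rule ccontr)
    assume h': "\<not> h \<rho>'"
    define H where "H x y z = h (\<lambda>i. if i \<in> {i. \<not> \<rho>' i} then x else if i \<in> {i. \<not> \<rho> i} then y else z)" for x y z
    have H: "clone3 L A H" unfolding H_def by (rule clone3_blocks[OF h])
    have "(\<lambda>i. if i \<in> {i. \<not> \<rho>' i} then False else if i \<in> {i. \<not> \<rho> i} then False else True) = \<rho>"
      "(\<lambda>i. if i \<in> {i. \<not> \<rho>' i} then False else if i \<in> {i. \<not> \<rho> i} then True else True) = \<rho>'"
      using le by (auto simp: fun_eq_iff)
    then have H1: "H False False True" "\<not> H False True True" unfolding H_def using that(2) h' by (simp_all only: not_False_eq_True)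
    define q where "q x y z = (x \<or> H x (x \<or> y) ((x \<or> y) \<or> z))" for x y z
    have "clone3 L A q" unfolding q_def using clone3_comp[OF H v(1) or[OF v(1,2)] or[OF or[OF v(1,2)] v(3)]]
      by (intro or v)
    then have qc: "clone3 L A (\<lambda>x y z. q (G x y z) (G' x y z) (G'' x y z))" if "clone3 L A G" "clone3 L A G'" "clone3 L A G''"
      for G G' G'' using clone3_comp that by blast
    show False
    proof (cases "H False False False")
      case True
      then have q: "q x y z = (x \<or> \<not> y)" for x y z using H1 by (cases x; cases y; cases z) (simp_all add: q_def)
      have "clone3 L A (\<lambda>x y z. q z (q (q z y y) x x) x)" by (intro qc v)
      moreover have "(\<lambda>x y z. q z (q (q z y y) x x) x) = (\<lambda>x y z. x \<and> y \<or> z)" by (auto simp: q fun_eq_iff)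
      ultimately show False using n by simp
    next
      case False
      then have q: "q x y z = (x \<or> \<not> y \<and> z)" for x y z using H1 by (cases x; cases y; cases z) (simp_all add: q_def)
      have "clone3 L A (\<lambda>x y z. q z (q z x y) y)" by (intro qc v)
      moreover have "(\<lambda>x y z. q z (q z x y) y) = (\<lambda>x y z. x \<and> y \<or> z)" by (auto simp: q fun_eq_iff)
      ultimately show False using n by simp
    qed
  qed
  define J where "J = {j. j < r \<and> h (\<lambda>i. i = j)}"
  show ?thesis
  proof (cases "h (\<lambda>_. False)")
    case True
    then have "h \<rho>" for \<rho> using mono[of "\<lambda>_. False"] by blast
    then show ?thesis by blast
  next
    case h0: False
    have "\<exists>j\<in>J. \<rho> j" if \<rho>: "h \<rho>" for \<rho>
    proof (rule ccontr)
      assume nJ: "\<not> (\<exists>j\<in>J. \<rho> j)"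
      let ?\<phi> = "\<lambda>S. S \<subseteq> {i. i < r \<and> \<rho> i} \<and> h (\<lambda>i. i \<in> S)"
      have "h (\<lambda>i. i \<in> {i. i < r \<and> \<rho> i}) = h \<rho>" by (rule clone_cong[OF h]) simp
      then have "?\<phi> {i. i < r \<and> \<rho> i}" using \<rho> by simp
      then obtain S where S: "?\<phi> S" "\<And>S'. ?\<phi> S' \<Longrightarrow> card S \<le> card S'"
        using ex_has_least_nat[of ?\<phi> "{i. i < r \<and> \<rho> i}" card] by blast
      have fin: "finite S" by (rule finite_subset[of _ "{..<r}"]) (use S(1) in auto)
      have "S \<noteq> {}" using S(1) h0 by auto
      then obtain p where p: "p \<in> S" by blast
      define H where "H x y z = h (\<lambda>i. if i \<in> {p} then x else if i \<in> S - {p} then y else z)" for x y z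
      have ind: "(\<lambda>i. if i \<in> {p} then True else if i \<in> S - {p} then True else False) = (\<lambda>i. i \<in> S)"
        "(\<lambda>i. if i \<in> {p} then False else if i \<in> S - {p} then True else False) = (\<lambda>i. i \<in> S - {p})"
        "(\<lambda>i. if i \<in> {p} then False else if i \<in> S - {p} then False else False) = (\<lambda>i. False)"
        "(\<lambda>i. if i \<in> {p} then True else if i \<in> S - {p} then False else False) = (\<lambda>i. i = p)"
        using p by auto
      have "card (S - {p}) < card S" using p fin by (meson card_Diff1_less)
      then have "\<not> h (\<lambda>i. i \<in> S - {p})" using S(1) S(2)[of "S - {p}"] by auto
      moreover have "\<not> h (\<lambda>i. i = p)" using nJ p S(1) by (auto simp: J_def)
      ultimately have H: "H True True False" "\<not> H False True False" "\<not> H False False False" "\<not> H True False False"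
        unfolding H_def ind using S(1) h0 by simp_all
      have "(\<lambda>x y z. z \<or> H x y z) = (\<lambda>x y z. x \<and> y \<or> z)"
      proof (intro ext)
        fix x y z show "(z \<or> H x y z) = (x \<and> y \<or> z)" using H by (cases x; cases y; cases z) simp_all
      qed
      then show False using n or[OF v(3) clone3_blocks[OF h, of "{p}" "S - {p}", folded H_def]] by simp
    qed
    moreover have "h \<rho>" if "j \<in> J" "\<rho> j" for j \<rho> using mono[of "\<lambda>i. i = j" \<rho>] that by (auto simp: J_def)
    ultimately have J: "\<forall>\<rho>. h \<rho> = (\<exists>j\<in>J. \<rho> j)" by (intro allI iffI) (blast, erule bexE)
    moreover have "J \<subseteq> {..<r}" by (auto simp: J_def)
    moreover have "\<forall>\<rho>. h \<rho> = False" if "J = {}" using J that by simp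
    ultimately show ?thesis by blast
  qed
qed

section \<open>Interpretations between generated varieties\<close>

text \<open>Every operation of \<open>A\<close> is the term-operation of \<open>A'\<close> given by \<open>T\<close>.\<close>

definition expresses :: "language \<Rightarrow> bool algebra \<Rightarrow> language \<Rightarrow> bool algebra \<Rightarrow> (nat \<Rightarrow> trm) \<Rightarrow> bool" where
  "expresses L A L' A' T \<longleftrightarrow> (\<forall>f<length L. is_term L' (if L ! f = 0 then 1 else L ! f) (T f) \<and>
     (\<forall>\<rho>. eval_term A' \<rho> (T f) = oper A f (map \<rho> [0..<L ! f])))"

text \<open>The translation of terms along \<open>T\<close>. The variable 0 is put into the term for a constant, whose value does not depend on it.\<close>

fun translate :: "language \<Rightarrow> (nat \<Rightarrow> trm) \<Rightarrow> trm \<Rightarrow> trm" where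
  "translate L T (trm.Var v) = trm.Var v"
| "translate L T (Fn f ts) = tsubst (\<lambda>i. if L ! f = 0 then trm.Var 0 else map (translate L T) ts ! i) (T f)"

lemma is_term_translate:
  assumes T: "expresses L A L' A' T" and m: "0 < m"
  shows "is_term L m t \<Longrightarrow> is_term L' m (translate L T t)"
proof (induction t)
  case (Fn f ts)
  have "is_term L' (if L ! f = 0 then 1 else L ! f) (T f)" using T Fn.prems by (simp add: expresses_def)
  then show ?case unfolding translate.simps by (rule is_term_tsubst) (use Fn m in \<open>auto split: if_splits\<close>)
qed simp

text \<open>In \<open>A'\<close>, a translated term has the same value as the original one in \<open>A\<close>.\<close>

lemma translate_generator:
  assumes T: "expresses L A L' A' T"
  shows "is_term L m t \<Longrightarrow> eval_term A' \<rho> (translate L T t) = eval_term A \<rho> t"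
proof (induction t)
  case (Fn f ts)
  have IH: "map (\<lambda>i. eval_term A' \<rho> (map (translate L T) ts ! i)) [0..<L ! f] = map (eval_term A \<rho>) ts"
    using Fn by (intro nth_equalityI) auto
  have "eval_term A' \<rho> (translate L T (Fn f ts)) =
      oper A f (map (\<lambda>i. eval_term A' \<rho> (if L ! f = 0 then trm.Var 0 else map (translate L T) ts ! i)) [0..<L ! f])"
    using Fn.prems T by (simp add: eval_tsubst expresses_def)
  also have "\<dots> = oper A f (map (\<lambda>i. eval_term A' \<rho> (map (translate L T) ts ! i)) [0..<L ! f])"
    by (cases "L ! f = 0") simp_all
  finally show ?case unfolding IH by simp
qed simp

lemma interpreted_in_generated_variety:
  assumes A: "is_algebra L A" "univ A = UNIV" "is_algebra L' A'" "univ A' = UNIV" and T: "expresses L A L' A' T"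
    and B: "B \<in> generated_variety L' A'"
  shows constant_value: "f < length L \<Longrightarrow> L ! f = 0 \<Longrightarrow> x \<in> univ B \<Longrightarrow> y \<in> univ B \<Longrightarrow>
      eval_term B (\<lambda>_. x) (T f) = eval_term B (\<lambda>_. y) (T f)" (is "_ \<Longrightarrow> _ \<Longrightarrow> _ \<Longrightarrow> _ \<Longrightarrow> ?const f x y")
    and eval_translate: "is_term L m t \<Longrightarrow> range \<rho> \<subseteq> univ B \<Longrightarrow>
      eval_term (interpreted L T B) \<rho> t = eval_term B \<rho> (translate L T t)"
    and "interpreted L T B \<in> generated_variety L A"
proof -
  have algB: "is_algebra L' B" using B by (simp add: generated_variety_iff[OF A(3)])
  then obtain b where b: "b \<in> univ B" by (auto simp: is_algebra_def)
  have some: "(SOME x. x \<in> univ B) \<in> univ B" using b by (rule someI)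
  have Tt: "is_term L' (if L ! f = 0 then 1 else L ! f) (T f)"
    and Te: "eval_term A' \<rho> (T f) = oper A f (map \<rho> [0..<L ! f])" if "f < length L" for f \<rho>
    using T that by (auto simp: expresses_def)
  show const: "?const f x y" if f: "f < length L" "L ! f = 0" and xy: "x \<in> univ B" "y \<in> univ B" for f x y
  proof -
    have t: "is_term L' 1 (T f)" using Tt[OF f(1)] f(2) by simp
    let ?s = "\<lambda>v. tsubst (\<lambda>_. trm.Var v) (T f)"
    have "eval_term B (\<lambda>i. if i = 0 then x else y) (?s 0) = eval_term B (\<lambda>i. if i = 0 then x else y) (?s 1)"
    proof (rule generated_variety_identity[OF A(3,4) B])
      show "is_term L' 2 (?s 0)" "is_term L' 2 (?s 1)" by (rule is_term_tsubst[OF t], simp)+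
      show "eval_term A' \<rho> (?s 0) = eval_term A' \<rho> (?s 1)" for \<rho> using Te[OF f(1)] f(2) by (simp add: eval_tsubst)
    qed (use xy in auto)
    then show ?thesis by (simp add: eval_tsubst)
  qed
  show ev: "eval_term (interpreted L T B) \<rho> t = eval_term B \<rho> (translate L T t)"
    if "is_term L m t" "range \<rho> \<subseteq> univ B" for m t \<rho>
    using that(1)
  proof (induction t)
    case (Fn f ts)
    have IH: "map (eval_term (interpreted L T B) \<rho>) ts = map (eval_term B \<rho>) (map (translate L T) ts)"
      using Fn by simp
    show ?case
    proof (cases "L ! f = 0")
      case True
      then have "is_term L' 1 (T f)" using Tt[of f] Fn.prems by simp
      then have "eval_term B \<rho> (translate L T (Fn f ts)) = eval_term B (\<lambda>_. \<rho> 0) (T f)"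
        using True by (simp add: eval_tsubst)
      also have "\<dots> = eval_term B (\<lambda>_. SOME x. x \<in> univ B) (T f)"
        using const[of f "\<rho> 0" "SOME x. x \<in> univ B"] Fn.prems True some that(2) by auto
      finally show ?thesis using True by (simp add: interpreted_def)
    next
      case False
      then have "is_term L' (L ! f) (T f)" using Tt[of f] Fn.prems by simp
      then have "eval_term B (\<lambda>i. map (eval_term B \<rho>) (map (translate L T) ts) ! i) (T f) =
          eval_term B (\<lambda>i. eval_term B \<rho> (map (translate L T) ts ! i)) (T f)"
        by (rule eval_cong) (use Fn.prems in simp)
      then show ?thesis using False IH by (simp add: interpreted_def eval_tsubst del: map_map)
    qed
  qed simp
  show "interpreted L T B \<in> generated_variety L A"
    unfolding generated_variety_iff[OF A(1)]
  proof (intro conjI ballI, goal_cases)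
    case 1
    have "oper (interpreted L T B) f xs \<in> univ B" if f: "f < length L" "length xs = L ! f" "set xs \<subseteq> univ B" for f xs
      using eval_univ[OF algB Tt[OF f(1)], of "\<lambda>i. if L ! f = 0 then SOME x. x \<in> univ B else xs ! i"] f some
      by (cases "L ! f = 0") (auto simp: interpreted_def subset_iff)
    then show ?case using b by (auto simp: is_algebra_def interpreted_def)
  next
    case (2 st)
    obtain s t where st: "st = (s, t)" by (cases st)
    obtain m where m: "is_term L m s" "is_term L m t" using 2 st by (auto simp: identities_def)
    then have m': "is_term L (Suc m) s" "is_term L (Suc m) t" using is_term_mono by auto
    have "satisfies A s t \<longrightarrow> satisfies (interpreted L T B) s t"
    proof
      assume sat: "satisfies A s t"
      have "eval_term B \<rho> (translate L T s) = eval_term B \<rho> (translate L T t)" if "range \<rho> \<subseteq> univ B" for \<rho>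
        by (rule generated_variety_identity[OF A(3,4) B is_term_translate[OF T _ m'(1)] is_term_translate[OF T _ m'(2)]])
          (use that sat A(2) translate_generator[OF T] m in \<open>auto simp: satisfies_def\<close>)
      then show "satisfies (interpreted L T B) s t" using ev m by (simp add: satisfies_def interpreted_def)
    qed
    then show ?case by (simp add: st)
  qed
qed

lemma is_interpretation_expresses:
  assumes "is_algebra L A" "univ A = UNIV" "is_algebra L' A'" "univ A' = UNIV" "expresses L A L' A' T"
  shows "is_interpretation L (generated_variety L A) L' (generated_variety L' A') T"
  using interpreted_in_generated_variety(1,3)[OF assms] assms(5) unfolding is_interpretation_def expresses_def by auto

lemma round_trip:
  assumes A: "is_algebra L A" "univ A = UNIV" "is_algebra L' A'" "univ A' = UNIV"
    and T: "expresses L A L' A' T" and S: "expresses L' A' L A S" and B: "B \<in> generated_variety L' A'"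
  shows "alg_eq L' (interpreted L' S (interpreted L T B)) B"
  unfolding alg_eq_def
proof (intro conjI allI impI)
  let ?C = "interpreted L T B"
  have u: "univ ?C = univ B" by (simp add: interpreted_def)
  then show "univ (interpreted L' S ?C) = univ B" by (simp add: interpreted_def)
  have algB: "is_algebra L' B" using B by (simp add: generated_variety_iff[OF A(3)])
  then obtain b where b: "b \<in> univ B" by (auto simp: is_algebra_def)
  then have some: "(SOME x. x \<in> univ B) \<in> univ B" by (rule someI)
  fix f xs assume f: "f < length L'" and xs: "length xs = L' ! f \<and> set xs \<subseteq> univ (interpreted L' S ?C)"
  then have xs': "length xs = L' ! f" "set xs \<subseteq> univ B" by (auto simp: interpreted_def)
  let ?m = "if L' ! f = 0 then 1 else L' ! f"
  have Sf: "is_term L ?m (S f)" "\<And>\<rho>. eval_term A \<rho> (S f) = oper A' f (map \<rho> [0..<L' ! f])"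
    using S f by (auto simp: expresses_def)
  define \<rho> where "\<rho> i = (if i < length xs then xs ! i else SOME x. x \<in> univ B)" for i
  have \<rho>: "range \<rho> \<subseteq> univ B" using xs' some by (auto simp: \<rho>_def subset_iff)
  have "oper (interpreted L' S ?C) f xs = eval_term ?C \<rho> (S f)"
  proof (cases "L' ! f = 0")
    case True
    then have "\<rho> = (\<lambda>_. SOME x. x \<in> univ B)" using xs' by (auto simp: \<rho>_def)
    then show ?thesis using True by (simp add: interpreted_def[of L'] u)
  next
    case False
    then show ?thesis using eval_cong[OF Sf(1), of "\<lambda>i. xs ! i" \<rho> ?C] xs' by (simp add: interpreted_def[of L'] \<rho>_def)
  qed
  also have "\<dots> = eval_term B \<rho> (translate L T (S f))"
    by (rule eval_translate[OF A T B Sf(1) \<rho>])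
  also have "\<dots> = eval_term B \<rho> (Fn f (map trm.Var [0..<L' ! f]))"
  proof (rule generated_variety_identity[OF A(3,4) B _ _ _ \<rho>])
    show "is_term L' ?m (translate L T (S f))" by (rule is_term_translate[OF T _ Sf(1)]) simp
    show "is_term L' ?m (Fn f (map trm.Var [0..<L' ! f]))" using f by auto
    show "eval_term A' \<rho> (translate L T (S f)) = eval_term A' \<rho> (Fn f (map trm.Var [0..<L' ! f]))" for \<rho>
      using translate_generator[OF T Sf(1)] Sf(2) by (simp add: comp_def)
  qed
  also have "\<dots> = oper B f xs"
  proof -
    have "map \<rho> [0..<L' ! f] = xs" using xs' by (intro nth_equalityI) (auto simp: \<rho>_def)
    then show ?thesis by (simp add: comp_def)
  qed
  finally show "oper (interpreted L' S ?C) f xs = oper B f xs" .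
qed

lemma term_equivalent_expresses:
  assumes "is_algebra L A" "univ A = UNIV" "is_algebra L' A'" "univ A' = UNIV"
    and "expresses L A L' A' T" "expresses L' A' L A S"
  shows "term_equivalent L (generated_variety L A) L' (generated_variety L' A')"
  unfolding term_equivalent_def
  using is_interpretation_expresses[OF assms(1-5)] is_interpretation_expresses[OF assms(3,4,1,2,6)]
    round_trip[OF assms] round_trip[OF assms(3,4,1,2,6,5)] by blast

section \<open>Algebras with joins\<close>

text \<open>The algebra with the operation \<open>\<or>\<close> and the constants \<open>cs\<close>\<close>

definition join_language :: "bool list \<Rightarrow> language" where
  "join_language cs = 2 # replicate (length cs) 0"

definition join_algebra :: "bool list \<Rightarrow> bool algebra" where
  "join_algebra cs = alg2 (op_join # map (\<lambda>c _. c) cs)"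

lemma join_term:
  assumes "finite J" "J \<noteq> {}" "J \<subseteq> {..<r}"
  shows "\<exists>t. is_term (join_language cs) r t \<and> (\<forall>\<rho>. eval_term (join_algebra cs) \<rho> t = (\<exists>j\<in>J. \<rho> j))"
  using assms
proof (induction rule: finite_ne_induct)
  case (singleton j)
  then show ?case by (intro exI[of _ "trm.Var j"]) simp
next
  case (insert j J)
  then obtain t where "is_term (join_language cs) r t" "\<forall>\<rho>. eval_term (join_algebra cs) \<rho> t = (\<exists>j\<in>J. \<rho> j)" by auto
  then show ?case using insert.prems
    by (intro exI[of _ "Fn 0 [trm.Var j, t]"]) (simp add: join_language_def join_algebra_def alg2_def)
qed

text \<open>The constants are those that occur as values of constant operations, which may have arguments.\<close>

lemma join_term_equivalent:
  assumes A: "is_algebra L A" "univ A = UNIV"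
    and join: "clone3 L A (\<lambda>x y z. x \<or> y)" and n: "\<not> clone3 L A (\<lambda>x y z. x \<and> y \<or> z)"
  obtains cs where "cs \<in> {[], [False], [True], [False, True]}"
    "term_equivalent L (generated_variety L A) (join_language cs) (generated_variety (join_language cs) (join_algebra cs))"
proof -
  let ?op = "\<lambda>f \<rho>. oper A f (map \<rho> [0..<L ! f])"
  define cs where "cs = filter (\<lambda>c. \<exists>f<length L. \<forall>\<rho>. ?op f \<rho> = c) [False, True]"
  have cs: "c \<in> set cs \<longleftrightarrow> (\<exists>f<length L. \<forall>\<rho>. ?op f \<rho> = c)" for c
    by (cases c) (auto simp: cs_def)
  let ?L = "join_language cs" and ?A = "join_algebra cs"
  have "\<exists>t. is_term ?L (if L ! f = 0 then 1 else L ! f) t \<and> (\<forall>\<rho>. eval_term ?A \<rho> t = ?op f \<rho>)" if f: "f < length L" for f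
    using join_clone[OF join n clone_oper[OF f]]
  proof (elim disjE exE conjE)
    fix c assume c: "\<forall>\<rho>. ?op f \<rho> = c"
    then have "c \<in> set cs" using cs f by blast
    then obtain i where "i < length cs" "cs ! i = c" by (auto simp: in_set_conv_nth)
    then show ?thesis using c
      by (intro exI[of _ "Fn (Suc i) []"]) (auto simp: join_language_def join_algebra_def alg2_def)
  next
    fix J assume J: "J \<noteq> {}" "J \<subseteq> {..<L ! f}" "\<forall>\<rho>. ?op f \<rho> = (\<exists>j\<in>J. \<rho> j)"
    have "finite J" by (rule finite_subset[OF J(2)]) simp
    moreover have "L ! f \<noteq> 0" using J(1,2) by auto
    ultimately show ?thesis using join_term[of J "L ! f" cs] J by auto
  qed
  then obtain T where T: "expresses L A ?L ?A T" unfolding expresses_def by metis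
  have "\<exists>t. is_term L (if ?L ! f = 0 then 1 else ?L ! f) t \<and> (\<forall>\<rho>. eval_term A \<rho> t = oper ?A f (map \<rho> [0..<?L ! f]))"
    if f: "f < length ?L" for f
  proof (cases f)
    case 0
    obtain t where t: "is_term L 3 t" "\<And>\<rho>. eval_term A \<rho> t = (\<rho> 0 \<or> \<rho> 1)"
      using join by (auto simp: clone3_def clone_def)
    have "is_term L 2 (tsubst (\<lambda>i. if i < 2 then trm.Var i else trm.Var 0) t)"
      by (rule is_term_tsubst[OF t(1)]) simp
    then show ?thesis using 0 t(2)
      by (intro exI[of _ "tsubst (\<lambda>i. if i < 2 then trm.Var i else trm.Var 0) t"])
        (simp add: eval_tsubst join_language_def join_algebra_def alg2_def numeral_2_eq_2)
  next
    case (Suc i)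
    then have i: "i < length cs" using f by (simp add: join_language_def)
    then obtain g where g: "g < length L" "\<And>\<rho>. ?op g \<rho> = cs ! i" using cs[of "cs ! i"] by auto
    have "oper A g (replicate (L ! g) x) = cs ! i" for x
      using g(2)[of "\<lambda>_. x"] by (simp add: map_replicate_const)
    then show ?thesis using Suc i g(1)
      by (intro exI[of _ "Fn g (replicate (L ! g) (trm.Var 0))"])
        (auto simp: join_language_def join_algebra_def alg2_def)
  qed
  then obtain S where S: "expresses ?L ?A L A S" unfolding expresses_def by metis
  have "is_algebra ?L ?A" "univ ?A = UNIV" by (simp_all add: join_algebra_def alg2_def is_algebra_def)
  then have "term_equivalent L (generated_variety L A) ?L (generated_variety ?L ?A)"
    using term_equivalent_expresses[OF A _ _ T S] by blast
  moreover have "cs \<in> {[], [False], [True], [False, True]}" by (auto simp: cs_def)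
  ultimately show ?thesis using that by blast
qed

text \<open>The exchange of 0 and 1 is an isomorphism onto the dual algebra, which therefore generates the same variety.\<close>

definition dual :: "bool algebra \<Rightarrow> bool algebra" where
  "dual A = \<lparr>univ = UNIV, oper = (\<lambda>f xs. \<not> oper A f (map Not xs))\<rparr>"

lemma eval_dual: "eval_term (dual A) \<rho> t = (\<not> eval_term A (\<lambda>i. \<not> \<rho> i) t)"
proof (induction t)
  case (Fn f ts)
  have "map Not (map (eval_term (dual A) \<rho>) ts) = map (eval_term A (\<lambda>i. \<not> \<rho> i)) ts" using Fn by simp
  then show ?case by (simp add: dual_def del: map_map)
qed simp

lemma generated_variety_dual:
  assumes A: "is_algebra L A" "univ A = UNIV"
  shows "is_algebra L (dual A)" "univ (dual A) = UNIV" "generated_variety L (dual A) = generated_variety L A"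
proof -
  show d: "is_algebra L (dual A)" "univ (dual A) = UNIV" by (simp_all add: is_algebra_def dual_def)
  have "satisfies (dual A) s t \<longleftrightarrow> satisfies A s t" for s t
  proof
    assume s: "satisfies (dual A) s t"
    have "eval_term A \<rho> s = eval_term A \<rho> t" for \<rho>
      using s[unfolded satisfies_def, rule_format, of "\<lambda>i. \<not> \<rho> i"] d(2) by (simp add: eval_dual)
    then show "satisfies A s t" by (simp add: satisfies_def)
  qed (use A(2) in \<open>simp add: satisfies_def eval_dual\<close>)
  then show "generated_variety L (dual A) = generated_variety L A"
    using generated_variety_iff[OF A(1)] generated_variety_iff[OF d(1)] by blast
qed

lemma clone3_dual: "clone3 L (dual A) F \<longleftrightarrow> clone3 L A (\<lambda>x y z. \<not> F (\<not> x) (\<not> y) (\<not> z))"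
proof -
  have "(\<forall>\<rho>. eval_term (dual A) \<rho> t = F (\<rho> 0) (\<rho> 1) (\<rho> 2)) \<longleftrightarrow>
      (\<forall>\<rho>. eval_term A \<rho> t = (\<not> F (\<not> \<rho> 0) (\<not> \<rho> 1) (\<not> \<rho> 2)))" for t
  proof
    assume a: "\<forall>\<rho>. eval_term (dual A) \<rho> t = F (\<rho> 0) (\<rho> 1) (\<rho> 2)"
    show "\<forall>\<rho>. eval_term A \<rho> t = (\<not> F (\<not> \<rho> 0) (\<not> \<rho> 1) (\<not> \<rho> 2))"
      using a eval_dual[of A "\<lambda>i. \<not> \<rho> i" t for \<rho>] by simp
  qed (simp add: eval_dual)
  then show ?thesis by (simp add: clone3_def clone_def)
qed

section \<open>The dichotomy\<close>

lemma not_join_generated: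
  fixes V :: "'u algebra set"
  assumes A: "is_algebra L A" "univ A = UNIV" and V: "V = generated_variety L A"
    and no: "\<not> term_equivalent L V lang_J var_J" "\<not> term_equivalent L V lang_J0 var_J0"
      "\<not> term_equivalent L V lang_J1 var_J1" "\<not> term_equivalent L V lang_J01 var_J01"
    and n: "\<not> clone3 L A (\<lambda>x y z. x \<and> y \<or> z)"
  shows "\<not> clone3 L A (\<lambda>x y z. x \<or> y)"
proof
  assume "clone3 L A (\<lambda>x y z. x \<or> y)"
  then obtain cs where "cs \<in> {[], [False], [True], [False, True]}"
    "term_equivalent L V (join_language cs) (generated_variety (join_language cs) (join_algebra cs))"
    using join_term_equivalent[OF A _ n] unfolding V by blast
  then show False
    using no unfolding var_J_def var_J0_def var_J1_def var_J01_def join_language_def join_algebra_def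
    by (auto simp: numeral_2_eq_2)
qed

lemma unary_operations:
  assumes A: "is_algebra L A" "univ A = UNIV"
    and un: "\<And>f. f < length L \<Longrightarrow> (\<exists>c. \<forall>\<rho>. oper A f (map \<rho> [0..<L ! f]) = c) \<or>
      (\<exists>i<L ! f. \<exists>c. \<forall>\<rho>. oper A f (map \<rho> [0..<L ! f]) = (\<rho> i \<noteq> c))"
  shows "\<exists>ch. unary_choice L A ch" and "interpretable L (generated_variety L A) lang_U var_U"
proof -
  have "\<exists>b. (case b of None \<Rightarrow> (\<exists>c. \<forall>xs. length xs = L ! f \<longrightarrow> oper A f xs = c)
   | Some i \<Rightarrow> i < L ! f \<and> (\<exists>c. \<forall>xs. length xs = L ! f \<longrightarrow> oper A f xs = (xs ! i \<noteq> c)))" if f: "f < length L" for f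
    using un[OF f]
  proof (elim disjE exE conjE)
    fix c assume c: "\<forall>\<rho>. oper A f (map \<rho> [0..<L ! f]) = c"
    have "oper A f xs = c" if "length xs = L ! f" for xs using c[rule_format, of "\<lambda>i. xs ! i"] map_nth[of xs] that by simp
    then show ?thesis by (intro exI[of _ None]) auto
  next
    fix i c assume i: "i < L ! f" and c: "\<forall>\<rho>. oper A f (map \<rho> [0..<L ! f]) = (\<rho> i \<noteq> c)"
    have "oper A f xs = (xs ! i \<noteq> c)" if "length xs = L ! f" for xs
      using c[rule_format, of "\<lambda>i. xs ! i"] map_nth[of xs] that by simp
    then show ?thesis using i by (intro exI[of _ "Some i"]) auto
  qed
  then show "\<exists>ch. unary_choice L A ch" unfolding unary_choice_def by (intro choice allI) blast
  let ?U = "alg2 [op_neg, op_zero, op_one]"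
  have "\<exists>t. is_term lang_U (if L ! f = 0 then 1 else L ! f) t \<and> (\<forall>\<rho>. eval_term ?U \<rho> t = oper A f (map \<rho> [0..<L ! f]))"
    if f: "f < length L" for f
    using un[OF f]
  proof (elim disjE exE conjE)
    fix c assume "\<forall>\<rho>. oper A f (map \<rho> [0..<L ! f]) = c"
    then show ?thesis by (intro exI[of _ "Fn (if c then 2 else 1) []"]) (simp add: alg2_def)
  next
    fix i c assume "i < L ! f" "\<forall>\<rho>. oper A f (map \<rho> [0..<L ! f]) = (\<rho> i \<noteq> c)"
    then show ?thesis by (intro exI[of _ "if c then Fn 0 [trm.Var i] else trm.Var i"]) (auto simp: alg2_def)
  qed
  then obtain T where T: "expresses L A lang_U ?U T" unfolding expresses_def by metis
  have "is_algebra lang_U ?U" "univ ?U = UNIV" by (simp_all add: alg2_def is_algebra_def)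
  from is_interpretation_expresses[OF A this T]
  show "interpretable L (generated_variety L A) lang_U var_U" unfolding interpretable_def var_U_def by blast
qed

theorem theorem5p6:
  fixes L :: language and A :: "bool algebra" and V :: "'u::infinite algebra set"
  assumes "is_algebra L A" and "univ A = UNIV"
    and "V = generated_variety L A"
    and "\<not> term_equivalent L V lang_J var_J"
    and "\<not> term_equivalent L V lang_J0 var_J0"
    and "\<not> term_equivalent L V lang_J1 var_J1"
    and "\<not> term_equivalent L V lang_J01 var_J01"
  shows "((is_term_operation L A 3 op_s \<or>
           is_term_operation L A 3 op_n \<or> is_term_operation L A 3 (dual_op op_n) \<or>
           is_term_operation L A 3 op_m) \<and>
          in_class (CRT_restricted L (generated_variety L A)) class_P)
       \<or> (interpretable L V lang_U var_U \<and>
          coNP_complete (CRT_restricted L (generated_variety L A)))"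
proof (cases "is_term_operation L A 3 op_s \<or> is_term_operation L A 3 op_n \<or> is_term_operation L A 3 (dual_op op_n) \<or>
    is_term_operation L A 3 op_m")
  case True
  then show ?thesis using CRT_in_P[OF assms(1,2)] by blast
next
  case False
  note clone = clone3_is_term_operation[where L = L and A = A]
  have no: "\<not> clone3 L A (\<lambda>x y z. (x \<noteq> y) \<noteq> z)" "\<not> clone3 L A (\<lambda>x y z. x \<and> y \<or> z)"
    "\<not> clone3 L A (\<lambda>x y z. (x \<or> y) \<and> z)" "\<not> clone3 L A (\<lambda>x y z. x \<and> y \<or> x \<and> z \<or> y \<and> z)"
    using False clone[of _ op_s] clone[of _ op_n] clone[of _ "dual_op op_n"] clone[of _ op_m]
    by (auto simp: op_s_def op_n_def op_m_def dual_op_def)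
  note d = generated_variety_dual[OF assms(1,2)]
  have join: "\<not> clone3 L A (\<lambda>x y z. x \<or> y)"
    by (rule not_join_generated[OF assms no(2)])
  have "V = generated_variety L (dual A)" unfolding d(3) by (rule assms(3))
  then have "\<not> clone3 L (dual A) (\<lambda>x y z. x \<or> y)"
    by (rule not_join_generated[OF d(1,2) _ assms(4-7)]) (use no(3) in \<open>simp add: clone3_dual\<close>)
  then have meet: "\<not> clone3 L A (\<lambda>x y z. x \<and> y)" by (simp add: clone3_dual)
  have "unary3 F" if "clone3 L A F" for F using ternary_clone[OF that] no(1,4) join meet by blast
  then have un: "(\<exists>c. \<forall>\<rho>. oper A f (map \<rho> [0..<L ! f]) = c) \<or>
      (\<exists>i<L ! f. \<exists>c. \<forall>\<rho>. oper A f (map \<rho> [0..<L ! f]) = (\<rho> i \<noteq> c))" if "f < length L" for f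
    using clone_cong[OF clone_oper[OF that, of A]] clone3_blocks[OF clone_oper[OF that, of A]]
    by (intro essentially_unary) blast+
  obtain ch where ch: "unary_choice L A ch" using unary_operations(1)[OF assms(1,2) un] by blast
  have "coNP_complete (CRT_restricted L (generated_variety L A))"
    unfolding coNP_complete_def using CRT_in_coNP CRT_coNP_hard[OF assms(1,2) ch] by blast
  then show ?thesis using unary_operations(2)[OF assms(1,2) un] assms(3) by blast
qed

end
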